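(* Let $(A,\mathbf{e})$ be a properly stratified Gorenstein algebra, $\mathbf{e}=\{e_1,\ldots,e_n\}$. Then the following hold for every $i\in\{1,\ldots,n\}$: (1) $\operatorname{End}_A(\Delta(i))$ is a Frobenius algebra. (2) $\operatorname{End}_A(\nabla(i))$ is a Frobenius algebra. (3) The quotient $(A/A(e_{i+1}+\cdots+e_n)A,\mathbf{e}^i)$ is a properly stratified Gorenstein algebra, where $\mathbf{e}^i=\{e_1^i,\ldots,e_i^i\}$ and $e_j^i$ denotes the image of $e_j$ in $A/A(e_{i+1}+\cdots+e_n)A$.
   Context: All algebras are finite dimensional over a field $K$; modules are finitely generated right modules; $\operatorname{mod} A$ is the category of such modules; $D=\operatorname{Hom}_K(-,K)$. $A$ is Gorenstein if the left and right injective dimensions of the regular module $A$ are both finite. An algebra $B$ is a Frobenius algebra if $D(B)\cong B$ as right $B$-modules. Stratification. Let $\mathbf{e}=\{e_1,\ldots,e_n\}$ be a linearly ordered complete set of primitive orthogonal idempotents of $A$ (so $e_1+\cdots+e_n=1$), the simple modules $S(i)=\operatorname{top}(e_iA)$ being pairwise non-isomorphic. Put $P(i)=e_iA$ and $\Delta(i)=P(i)/e_iA(e_{i+1}+\cdots+e_n)A$ (standard modules), i.e. the maximal quotient of $P(i)$ without composition factors $S(j)$, $j>i$. Let $\overline{\Delta}(i)$ (proper standard module) be the maximal quotient of $\Delta(i)$ having $S(i)$ only once as a composition factor. Let $\Delta_{op}(i)$ be the standard modules of $(A^{op},\mathbf{e})$, and put $\nabla(i)=D\Delta_{op}(i)$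 (costandard right $A$-modules). Write $\Delta,\overline{\Delta}$ for the sets of standard and proper standard modules. For a set $\Theta$ of modules, $\mathcal{F}(\Theta)$ is the full subcategory of $\operatorname{mod} A$ of modules having a finite filtration with subquotients isomorphic to modules in $\Theta$. $(A,\mathbf{e})$ is properly stratified if $A_A\in\mathcal{F}(\Delta)\cap\mathcal{F}(\overline{\Delta})$. *)

theory Defs
  imports "HOL-Algebra.QuotRing" "HOL-Algebra.Module"
begin

section \<open>Finite dimensional algebras\<close>

text \<open>The locale \<^locale>\<open>algebra\<close> of HOL-Algebra is restricted to commutative algebras;
  the algebras here are arbitrary unital associative ones.\<close>

locale fd_algebra = module K A + field K + ring A
  for K :: "'k ring" (structure) and A :: "('k, 'a) module" (structure) +
  assumes smult_mult_left:
      "\<lbrakk>k \<in> carrier K; x \<in> carrier A; y \<in> carrier A\<rbrakk> \<Longrightarrow>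
        (k \<odot>\<^bsub>A\<^esub> x) \<otimes>\<^bsub>A\<^esub> y = k \<odot>\<^bsub>A\<^esub> (x \<otimes>\<^bsub>A\<^esub> y)"
    and smult_mult_right:
      "\<lbrakk>k \<in> carrier K; x \<in> carrier A; y \<in> carrier A\<rbrakk> \<Longrightarrow>
        x \<otimes>\<^bsub>A\<^esub> (k \<odot>\<^bsub>A\<^esub> y) = k \<odot>\<^bsub>A\<^esub> (x \<otimes>\<^bsub>A\<^esub> y)"
    and finite_dim:
      "\<exists>B. finite B \<and> B \<subseteq> carrier A \<and>
        (\<forall>x\<in>carrier A. \<exists>c\<in>B \<rightarrow> carrier K. x = (\<Oplus>\<^bsub>A\<^esub>b\<in>B. c b \<odot>\<^bsub>A\<^esub> b))"

definition op_algebra :: "('k, 'a) module \<Rightarrow> ('k, 'a) module" where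
  "op_algebra A = A\<lparr>mult := \<lambda>x y. y \<otimes>\<^bsub>A\<^esub> x\<rparr>"

definition quot_algebra :: "('k, 'a) module \<Rightarrow> 'a set \<Rightarrow> ('k, 'a set) module" where
  "quot_algebra A I =
    \<lparr>carrier = carrier (A Quot I), mult = mult (A Quot I), one = one (A Quot I),
     zero = zero (A Quot I), add = add (A Quot I),
     smult = \<lambda>k X. \<Union>x\<in>X. I +>\<^bsub>A\<^esub> (k \<odot>\<^bsub>A\<^esub> x)\<rparr>"


section \<open>Right modules\<close>

text \<open>As for \<^typ>\<open>('a, 'm) module\<close> in HOL-Algebra, the additive group of a module is stored in
  a ring record, whose multiplicative fields carry no meaning. Left \<open>A\<close>-modules are right
  modules over \<^term>\<open>op_algebra A\<close>.\<close>

record ('a, 'm) right_mod = "'m ring" +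
  ract :: "['m, 'a] \<Rightarrow> 'm" (infixl \<open>\<bullet>\<index>\<close> 70)

locale right_module = A?: ring A + M?: abelian_group M
  for A (structure) and M :: "('a, 'm) right_mod" (structure) +
  assumes ract_closed:
      "\<lbrakk>x \<in> carrier M; a \<in> carrier A\<rbrakk> \<Longrightarrow> x \<bullet>\<^bsub>M\<^esub> a \<in> carrier M"
    and ract_add_left:
      "\<lbrakk>x \<in> carrier M; y \<in> carrier M; a \<in> carrier A\<rbrakk> \<Longrightarrow>
        (x \<oplus>\<^bsub>M\<^esub> y) \<bullet>\<^bsub>M\<^esub> a = x \<bullet>\<^bsub>M\<^esub> a \<oplus>\<^bsub>M\<^esub> y \<bullet>\<^bsub>M\<^esub> a"
    and ract_add_right:
      "\<lbrakk>x \<in> carrier M; a \<in> carrier A; b \<in> carrier A\<rbrakk> \<Longrightarrow>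
        x \<bullet>\<^bsub>M\<^esub> (a \<oplus>\<^bsub>A\<^esub> b) = x \<bullet>\<^bsub>M\<^esub> a \<oplus>\<^bsub>M\<^esub> x \<bullet>\<^bsub>M\<^esub> b"
    and ract_assoc:
      "\<lbrakk>x \<in> carrier M; a \<in> carrier A; b \<in> carrier A\<rbrakk> \<Longrightarrow>
        x \<bullet>\<^bsub>M\<^esub> (a \<otimes>\<^bsub>A\<^esub> b) = (x \<bullet>\<^bsub>M\<^esub> a) \<bullet>\<^bsub>M\<^esub> b"
    and ract_one:
      "x \<in> carrier M \<Longrightarrow> x \<bullet>\<^bsub>M\<^esub> \<one>\<^bsub>A\<^esub> = x"

definition regular :: "('k, 'a) module \<Rightarrow> ('a, 'a) right_mod" where
  "regular A = \<lparr>carrier = carrier A, mult = undefined, one = undefined,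
     zero = \<zero>\<^bsub>A\<^esub>, add = add A, ract = mult A\<rparr>"

definition right_submodule ::
  "('k, 'a) module \<Rightarrow> ('a, 'm) right_mod \<Rightarrow> 'm set \<Rightarrow> bool" where
  "right_submodule A M N \<longleftrightarrow>
     additive_subgroup N M \<and> (\<forall>x\<in>N. \<forall>a\<in>carrier A. x \<bullet>\<^bsub>M\<^esub> a \<in> N)"

definition quot_mod ::
  "('a, 'm) right_mod \<Rightarrow> 'm set \<Rightarrow> ('a, 'm set) right_mod" where
  "quot_mod M N = \<lparr>carrier = a_rcosets\<^bsub>M\<^esub> N, mult = undefined, one = undefined,
     zero = N, add = set_add M, ract = \<lambda>X a. \<Union>x\<in>X. N +>\<^bsub>M\<^esub> (x \<bullet>\<^bsub>M\<^esub> a)\<rparr>"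

definition finitely_generated ::
  "('k, 'a) module \<Rightarrow> ('a, 'm) right_mod \<Rightarrow> bool" where
  "finitely_generated A M \<longleftrightarrow>
     (\<exists>S. finite S \<and> S \<subseteq> carrier M \<and>
       (\<forall>N. right_submodule A M N \<longrightarrow> S \<subseteq> N \<longrightarrow> N = carrier M))"

definition fg_module :: "('k, 'a) module \<Rightarrow> ('a, 'm) right_mod \<Rightarrow> bool" where
  "fg_module A M \<longleftrightarrow> right_module A M \<and> finitely_generated A M"

definition mod_hom ::
  "('k, 'a) module \<Rightarrow> ('a, 'm) right_mod \<Rightarrow> ('a, 'l) right_mod \<Rightarrow> ('m \<Rightarrow> 'l) set" where
  "mod_hom A M N =
     {f \<in> carrier M \<rightarrow> carrier N.
        (\<forall>x\<in>carrier M. \<forall>y\<in>carrier M. f (x \<oplus>\<^bsub>M\<^esub> y) = f x \<oplus>\<^bsub>N\<^esub> f y) \<and>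
        (\<forall>x\<in>carrier M. \<forall>a\<in>carrier A. f (x \<bullet>\<^bsub>M\<^esub> a) = f x \<bullet>\<^bsub>N\<^esub> a)}"

definition mod_iso ::
  "('k, 'a) module \<Rightarrow> ('a, 'm) right_mod \<Rightarrow> ('a, 'l) right_mod \<Rightarrow> bool" where
  "mod_iso A M N \<longleftrightarrow> (\<exists>f\<in>mod_hom A M N. bij_betw f (carrier M) (carrier N))"

text \<open>The \<open>K\<close>-vector space structure of a right \<open>A\<close>-module: \<open>k x = x (k 1)\<close>.\<close>

definition kscale ::
  "('k, 'a) module \<Rightarrow> ('a, 'm) right_mod \<Rightarrow> 'k \<Rightarrow> 'm \<Rightarrow> 'm" where
  "kscale A M k x = x \<bullet>\<^bsub>M\<^esub> (k \<odot>\<^bsub>A\<^esub> \<one>\<^bsub>A\<^esub>)"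

text \<open>If \<open>M\<close> is a right module over \<^term>\<open>op_algebra A\<close>, i.e. a left \<open>A\<close>-module,
  then \<open>D(M)\<close> is a right \<open>A\<close>-module via \<open>(f a)(x) = f (a x)\<close>; here \<open>a x\<close> is
  \<^term>\<open>x \<bullet>\<^bsub>M\<^esub> a\<close>. Linear maps are normalised to \<^const>\<open>undefined\<close> off the carrier.\<close>

definition dual ::
  "'k ring \<Rightarrow> ('k, 'a) module \<Rightarrow> ('a, 'm) right_mod \<Rightarrow> ('a, 'm \<Rightarrow> 'k) right_mod" where
  "dual K A M =
    \<lparr>carrier = {f \<in> carrier M \<rightarrow>\<^sub>E carrier K.
        (\<forall>x\<in>carrier M. \<forall>y\<in>carrier M. f (x \<oplus>\<^bsub>M\<^esub> y) = f x \<oplus>\<^bsub>K\<^esub> f y) \<and>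
        (\<forall>k\<in>carrier K. \<forall>x\<in>carrier M. f (kscale A M k x) = k \<otimes>\<^bsub>K\<^esub> f x)},
     mult = undefined, one = undefined,
     zero = \<lambda>x\<in>carrier M. \<zero>\<^bsub>K\<^esub>,
     add = \<lambda>f g. \<lambda>x\<in>carrier M. f x \<oplus>\<^bsub>K\<^esub> g x,
     ract = \<lambda>f a. \<lambda>x\<in>carrier M. f (x \<bullet>\<^bsub>M\<^esub> a)\<rparr>"

definition end_algebra ::
  "('k, 'a) module \<Rightarrow> ('a, 'm) right_mod \<Rightarrow> ('k, 'm \<Rightarrow> 'm) module" where
  "end_algebra A M =
    \<lparr>carrier = mod_hom A M M \<inter> extensional (carrier M),
     mult = compose (carrier M),
     one = \<lambda>x\<in>carrier M. x,
     zero = \<lambda>x\<in>carrier M. \<zero>\<^bsub>M\<^esub>,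
     add = \<lambda>f g. \<lambda>x\<in>carrier M. f x \<oplus>\<^bsub>M\<^esub> g x,
     smult = \<lambda>k f. \<lambda>x\<in>carrier M. kscale A M k (f x)\<rparr>"

definition frobenius_algebra :: "'k ring \<Rightarrow> ('k, 'b) module \<Rightarrow> bool" where
  "frobenius_algebra K B \<longleftrightarrow>
     fd_algebra K B \<and> mod_iso B (dual K B (regular (op_algebra B))) (regular B)"


section \<open>Injective dimension and Gorenstein algebras\<close>

text \<open>A finitely generated module over a finite dimensional algebra is finite dimensional, hence
  isomorphic to one whose carrier is a subset of \<^typ>\<open>nat \<Rightarrow> 'k\<close>, with \<open>'k\<close> the type
  of scalars (\<open>K\<^sup>d\<close> as sequences vanishing from index \<open>d\<close> on). The modules on this type thus
  form a category equivalent to \<open>mod A\<close>, and it is enough to quantify over them.\<close>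

type_synonym ('k, 'a) small_mod = "('a, nat \<Rightarrow> 'k) right_mod"

definition injective_module ::
  "('k, 'a) module \<Rightarrow> ('a, 'm) right_mod \<Rightarrow> bool" where
  "injective_module A E \<longleftrightarrow> fg_module A E \<and>
     (\<forall>(X :: ('k, 'a) small_mod) (Y :: ('k, 'a) small_mod). \<forall>f\<in>mod_hom A X Y. \<forall>g\<in>mod_hom A X E.
        fg_module A X \<longrightarrow> fg_module A Y \<longrightarrow> inj_on f (carrier X) \<longrightarrow>
        (\<exists>h\<in>mod_hom A Y E. \<forall>x\<in>carrier X. h (f x) = g x))"

text \<open>There is an exact sequence \<open>0 \<rightarrow> M \<rightarrow> I 0 \<rightarrow> \<dots> \<rightarrow> I r \<rightarrow> 0\<close> with all \<open>I j\<close> injective;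
  it is continued by \<open>I j = 0\<close> for \<open>j > r\<close>.\<close>

definition inj_dim_le ::
  "('k, 'a) module \<Rightarrow> ('a, 'm) right_mod \<Rightarrow> nat \<Rightarrow> bool" where
  "inj_dim_le A M r \<longleftrightarrow>
     (\<exists>(I :: nat \<Rightarrow> ('k, 'a) small_mod) \<epsilon> d.
        (\<forall>j. injective_module A (I j)) \<and>
        (\<forall>j>r. carrier (I j) = {\<zero>\<^bsub>I j\<^esub>}) \<and>
        \<epsilon> \<in> mod_hom A M (I 0) \<and> (\<forall>j. d j \<in> mod_hom A (I j) (I (Suc j))) \<and>
        inj_on \<epsilon> (carrier M) \<and>
        \<epsilon> ` carrier M = a_kernel (I 0) (I 1) (d 0) \<and>
        (\<forall>j. d j ` carrier (I j) = a_kernel (I (Suc j)) (I (Suc (Suc j))) (d (Suc j))))"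

definition gorenstein :: "('k, 'a) module \<Rightarrow> bool" where
  "gorenstein A \<longleftrightarrow>
     (\<exists>r. inj_dim_le A (regular A) r) \<and>
     (\<exists>r. inj_dim_le (op_algebra A) (regular (op_algebra A)) r)"


section \<open>Filtrations and composition factors\<close>

definition subquotient ::
  "('a, 'm) right_mod \<Rightarrow> 'm set \<Rightarrow> 'm set \<Rightarrow> ('a, 'm set) right_mod" where
  "subquotient M N N' = quot_mod (M\<lparr>carrier := N'\<rparr>) N"

definition filtration ::
  "('k, 'a) module \<Rightarrow> ('a, 'm) right_mod \<Rightarrow> nat \<Rightarrow> (nat \<Rightarrow> 'm set) \<Rightarrow> bool" where
  "filtration A M t N \<longleftrightarrow>
     N 0 = {\<zero>\<^bsub>M\<^esub>} \<and> N t = carrier M \<and>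
     (\<forall>j\<le>t. right_submodule A M (N j)) \<and> (\<forall>j<t. N j \<subseteq> N (Suc j))"

text \<open>Membership in \<open>\<F>(\<Theta>)\<close>.\<close>

definition filtered_by ::
  "('k, 'a) module \<Rightarrow> ('a, 'l) right_mod set \<Rightarrow> ('a, 'm) right_mod \<Rightarrow> bool" where
  "filtered_by A \<Theta> M \<longleftrightarrow> fg_module A M \<and>
     (\<exists>t N. filtration A M t N \<and>
        (\<forall>j<t. \<exists>X\<in>\<Theta>. mod_iso A (subquotient M (N j) (N (Suc j))) X))"

definition simple_module :: "('k, 'a) module \<Rightarrow> ('a, 'm) right_mod \<Rightarrow> bool" where
  "simple_module A M \<longleftrightarrow> right_module A M \<and> carrier M \<noteq> {\<zero>\<^bsub>M\<^esub>} \<and>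
     (\<forall>N. right_submodule A M N \<longrightarrow> N = {\<zero>\<^bsub>M\<^esub>} \<or> N = carrier M)"

text \<open>\<open>S\<close> occurs exactly \<open>m\<close> times as a composition factor of \<open>M\<close>; by Jordan-Hoelder
  the choice of the composition series is irrelevant.\<close>

definition comp_multiplicity ::
  "('k, 'a) module \<Rightarrow> ('a, 'm) right_mod \<Rightarrow> ('a, 'l) right_mod \<Rightarrow> nat \<Rightarrow> bool" where
  "comp_multiplicity A M S m \<longleftrightarrow>
     (\<exists>t N. filtration A M t N \<and>
        (\<forall>j<t. simple_module A (subquotient M (N j) (N (Suc j)))) \<and>
        card {j. j < t \<and> mod_iso A (subquotient M (N j) (N (Suc j))) S} = m)"

definition maximal_submodule ::
  "('k, 'a) module \<Rightarrow> ('a, 'm) right_mod \<Rightarrow> 'm set \<Rightarrow> bool" where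
  "maximal_submodule A M N \<longleftrightarrow> right_submodule A M N \<and> N \<noteq> carrier M \<and>
     (\<forall>N'. right_submodule A M N' \<longrightarrow> N \<subseteq> N' \<longrightarrow> N' = N \<or> N' = carrier M)"

definition rad_mod :: "('k, 'a) module \<Rightarrow> ('a, 'm) right_mod \<Rightarrow> 'm set" where
  "rad_mod A M = carrier M \<inter> \<Inter>{N. maximal_submodule A M N}"

definition top_mod ::
  "('k, 'a) module \<Rightarrow> ('a, 'm) right_mod \<Rightarrow> ('a, 'm set) right_mod" where
  "top_mod A M = quot_mod M (rad_mod A M)"


section \<open>Stratification\<close>

definition proj_mod :: "('k, 'a) module \<Rightarrow> (nat \<Rightarrow> 'a) \<Rightarrow> nat \<Rightarrow> ('a, 'a) right_mod" where
  "proj_mod A e i = (regular A)\<lparr>carrier := (\<lambda>a. e i \<otimes>\<^bsub>A\<^esub> a) ` carrier A\<rparr>"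

definition simple_top :: "('k, 'a) module \<Rightarrow> (nat \<Rightarrow> 'a) \<Rightarrow> nat \<Rightarrow> ('a, 'a set) right_mod" where
  "simple_top A e i = top_mod A (proj_mod A e i)"

definition primitive_idempotent :: "('k, 'a) module \<Rightarrow> 'a \<Rightarrow> bool" where
  "primitive_idempotent A u \<longleftrightarrow>
     u \<in> carrier A \<and> u \<otimes>\<^bsub>A\<^esub> u = u \<and> u \<noteq> \<zero>\<^bsub>A\<^esub> \<and>
     (\<forall>f\<in>carrier A. \<forall>g\<in>carrier A.
        f \<otimes>\<^bsub>A\<^esub> f = f \<longrightarrow> g \<otimes>\<^bsub>A\<^esub> g = g \<longrightarrow> f \<otimes>\<^bsub>A\<^esub> g = \<zero>\<^bsub>A\<^esub> \<longrightarrow> g \<otimes>\<^bsub>A\<^esub> f = \<zero>\<^bsub>A\<^esub> \<longrightarrow>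
        u = f \<oplus>\<^bsub>A\<^esub> g \<longrightarrow> f = \<zero>\<^bsub>A\<^esub> \<or> g = \<zero>\<^bsub>A\<^esub>)"

text \<open>The idempotents are \<open>e 1, \<dots>, e n\<close>, ordered by their indices; the values of \<open>e\<close> at
  other indices are irrelevant.\<close>

definition idempotent_system :: "('k, 'a) module \<Rightarrow> nat \<Rightarrow> (nat \<Rightarrow> 'a) \<Rightarrow> bool" where
  "idempotent_system A n e \<longleftrightarrow>
     (\<forall>i\<in>{1..n}. primitive_idempotent A (e i)) \<and>
     (\<forall>i\<in>{1..n}. \<forall>j\<in>{1..n}. i \<noteq> j \<longrightarrow> e i \<otimes>\<^bsub>A\<^esub> e j = \<zero>\<^bsub>A\<^esub>) \<and>
     (\<Oplus>\<^bsub>A\<^esub>i\<in>{1..n}. e i) = \<one>\<^bsub>A\<^esub> \<and>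
     (\<forall>i\<in>{1..n}. \<forall>j\<in>{1..n}. i \<noteq> j \<longrightarrow> \<not> mod_iso A (simple_top A e i) (simple_top A e j))"

text \<open>As \<open>A\<close> is unital, \<open>A (e (i+1) + \<dots> + e n) A\<close> is the two-sided ideal generated by
  \<open>e (i+1) + \<dots> + e n\<close>; for \<open>i = n\<close> the sum is empty and the ideal is zero.\<close>

definition strat_ideal :: "('k, 'a) module \<Rightarrow> nat \<Rightarrow> (nat \<Rightarrow> 'a) \<Rightarrow> nat \<Rightarrow> 'a set" where
  "strat_ideal A n e i = Idl\<^bsub>A\<^esub> {\<Oplus>\<^bsub>A\<^esub>j\<in>{i<..n}. e j}"

definition standard_mod ::
  "('k, 'a) module \<Rightarrow> nat \<Rightarrow> (nat \<Rightarrow> 'a) \<Rightarrow> nat \<Rightarrow> ('a, 'a set) right_mod" where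
  "standard_mod A n e i =
     quot_mod (proj_mod A e i) ((\<lambda>a. e i \<otimes>\<^bsub>A\<^esub> a) ` strat_ideal A n e i)"

text \<open>The maximal quotient with a given property is the quotient by the least submodule (with
  respect to inclusion) for which the quotient has this property.\<close>

definition proper_standard_mod ::
  "('k, 'a) module \<Rightarrow> nat \<Rightarrow> (nat \<Rightarrow> 'a) \<Rightarrow> nat \<Rightarrow> ('a, 'a set set) right_mod" where
  "proper_standard_mod A n e i =
     quot_mod (standard_mod A n e i)
       (LEAST N. right_submodule A (standard_mod A n e i) N \<and>
          comp_multiplicity A (quot_mod (standard_mod A n e i) N) (simple_top A e i) 1)"

definition costandard_mod ::
  "'k ring \<Rightarrow> ('k, 'a) module \<Rightarrow> nat \<Rightarrow> (nat \<Rightarrow> 'a) \<Rightarrow> nat \<Rightarrow> ('a, 'a set \<Rightarrow> 'k) right_mod" where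
  "costandard_mod K A n e i = dual K A (standard_mod (op_algebra A) n e i)"

definition properly_stratified ::
  "'k ring \<Rightarrow> ('k, 'a) module \<Rightarrow> nat \<Rightarrow> (nat \<Rightarrow> 'a) \<Rightarrow> bool" where
  "properly_stratified K A n e \<longleftrightarrow>
     fd_algebra K A \<and> idempotent_system A n e \<and>
     filtered_by A (standard_mod A n e ` {1..n}) (regular A) \<and>
     filtered_by A (proper_standard_mod A n e ` {1..n}) (regular A)"

end

theory Submission
  imports Defs
begin

text \<open>Let \<open>e\<close> be the last idempotent and \<open>J = A e A\<close>. Comparing coefficients along the filtration of
  \<open>A\<close> by proper standard modules shows that \<open>e A\<close> is free over the local algebra \<open>e A e\<close> and that
  \<open>A e \<otimes> e A\<close> (over \<open>e A e\<close>) is \<open>J\<close>, so \<open>J\<close> is filtered by copies of \<open>A e\<close> as a left ideal. The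
  filtration of \<open>A\<close> by standard modules makes \<open>J\<close> filtered by copies of \<open>e A\<close> as a right ideal.
  Consequently \<open>A / J\<close> has finite injective dimension over \<open>A\<close>, and \<open>Hom(A / J, -)\<close> turns its
  injective resolution into one over \<open>A / J\<close>: the quotient is again Gorenstein, and it inherits both
  filtrations, since a step that is annihilated by \<open>e\<close> does not meet \<open>J\<close>. Moreover, homomorphisms on
  right ideals of \<open>e A e\<close> induce homomorphisms on right ideals of \<open>A\<close>, and these extend step by step
  along an injective resolution of \<open>A\<close>; thus \<open>e A e\<close> is self-injective on both sides, and being
  local it is Frobenius. By descending induction this applies to every
  \<open>A / A (e (i+1) + \<dots> + e n) A\<close>, whose corner at \<open>e i\<close> is the endomorphism algebra of both
  \<open>\<Delta> i\<close> and \<open>\<nabla> i\<close>.\<close>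

text \<open>The obstacle behind the Frobenius property is that the kernel of an epimorphism between
  injective modules need not be injective. As \<open>e A e\<close> is local, it has a nonzero socle
  element \<open>t\<close> such that an element of the target killed by the radical is a multiple
  \<open>c t\<close>; lifting \<open>c\<close> gives a preimage that is again killed by the radical.
  This is what lets injectivity pass backwards through a resolution of any finite length. The sides
  are crossed: right self-injectivity of \<open>e A e\<close> uses the filtration of
  \<open>J\<close> as a left ideal, and conversely. Freeness is obtained with elements: a minimal
  family of generators of \<open>e A\<close> over \<open>e A e\<close> is independent modulo the
  annihilator of the last proper standard module, and descending along the filtration makes it
  independent outright. The filtration by standard modules then reuses this family. The modules
  involved live on several carrier types. Both kinds of standard modules are therefore recorded by
  the annihilator of a cyclic generator, which turns filtrations into chains of right ideals, and
  quotient algebras are handled as targets of surjections.\<close>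

abbreviation (input) car :: "('m, 'z) partial_object_scheme => 'm set" where "car == carrier"

abbreviation (input) iff_ascii :: "bool => bool => bool" (infixr "<->" 25) where "iff_ascii == (=)"

abbreviation (input) mult_default :: "('m, 'z) monoid_scheme => 'm => 'm => 'm" (infixl "**\<index>" 70)
  where "mult_default == mult"

abbreviation (input) add_default :: "('m, 'z) ring_scheme => 'm => 'm => 'm" (infixl "+.\<index>" 65)
  where "add_default == add"

abbreviation (input) minus_default :: "('m, 'z) ring_scheme => 'm => 'm => 'm" (infixl "-.\<index>" 65)
  where "minus_default == a_minus"

abbreviation (input) mult_in :: "'m => ('m, 'z) monoid_scheme => 'm => 'm" ("_ **[_] _" [70, 0, 71] 70)
  where "x **[M] y == x \<otimes>\<^bsub>M\<^esub> y"

abbreviation (input) act_in :: "'m => ('a, 'm) right_mod => 'a => 'm" ("_ *[_] _" [70, 0, 71] 70)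
  where "x *[M] a == x \<bullet>\<^bsub>M\<^esub> a"

abbreviation (input) add_in :: "'m => ('m, 'z) ring_scheme => 'm => 'm" ("_ +[_] _" [65, 0, 66] 65)
  where "x +[M] y == x \<oplus>\<^bsub>M\<^esub> y"

abbreviation (input) zero_in :: "('m, 'z) ring_scheme => 'm" ("0[_]")
  where "0[M] == \<zero>\<^bsub>M\<^esub>"

abbreviation (input) one_in :: "('m, 'z) monoid_scheme => 'm" ("1[_]")
  where "1[M] == \<one>\<^bsub>M\<^esub>"

section \<open>Linear algebra over a field\<close>

lemma additive_subgroup_iff:
 assumes "abelian_group M"
 shows "additive_subgroup N M <-> N <= car M & 0[M]:N &
  (ALL x:N. ALL y:N. x +[M] y:N) & (ALL x:N. \<ominus>\<^bsub>M\<^esub> x:N)"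
proof -
 interpret abelian_group M by fact
 show ?thesis
  unfolding additive_subgroup_def subgroup_def by(auto simp: a_inv_def)
qed

context abelian_group
begin

lemma subgroup_add_cancel:
 assumes "additive_subgroup N G" "x:car G" "y:N" "x+.y:N"
 shows "x:N"
proof -
 have y: "y:car G" "\<ominus> y:N" and "(x+.y)+.\<ominus> y:N"
  using assms by(auto simp: additive_subgroup_iff[OF abelian_group_axioms])
 thus ?thesis using assms(2) by(simp add: a_assoc r_neg)
qed

lemma subgroup_add_cancel':
 assumes "additive_subgroup N G" "x:car G" "y:N" "y+.x:N"
 shows "x:N"
 using assms subgroup_add_cancel[of N x y]
 by(metis a_comm additive_subgroup.a_Hcarr)

lemma subgroup_diff:
 assumes "additive_subgroup N G" "x:N" "y:N"
 shows "x-.y:N"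
 using assms by(auto simp: additive_subgroup_iff[OF abelian_group_axioms] a_minus_def)

lemma diff_eq_iff:
 assumes "x:car G" "y:car G" "z:car G"
 shows "x-.y = z <-> x = z+.y"
 using assms by(auto simp: a_minus_def a_assoc l_neg r_neg)

lemma diff_add_cancel: "x:car G ==> y:car G ==> (x-.y)+.y = x"
 by(simp add: a_minus_def a_assoc l_neg)

lemma add_diff_cancel: "x:car G ==> y:car G ==> (x+.y)-.y = x"
 by(simp add: a_minus_def a_assoc r_neg)

lemma diff_self: "x:car G ==> x-.x = \<zero>"
 by(simp add: a_minus_def r_neg)

lemma diff_eq_zero_iff: "x:car G ==> y:car G ==> x-.y = \<zero> <-> x = y"
 by(simp add: diff_eq_iff)

lemma diff_add_diff:
 "[|x:car G; y:car G; z:car G; w:car G|] ==>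
  (x+.y)-.(z+.w) = (x-.z)+.(y-.w)"
 by(simp add: a_minus_def minus_add a_ac)

lemma a_inv_zero [simp]: "\<ominus> \<zero> = \<zero>"
 by(rule minus_equality) auto

lemma zero_additive_subgroup: "additive_subgroup {\<zero>} G"
 by(simp add: additive_subgroup_iff[OF abelian_group_axioms] a_inv_def)

lemma Int_additive_subgroup:
 "additive_subgroup N G ==> additive_subgroup N' G ==> additive_subgroup (N \<inter> N') G"
 by(auto simp: additive_subgroup_iff[OF abelian_group_axioms])

end

text \<open>The set of all \<open>f z 0 + \<dots> + f z (q - 1)\<close>, where \<open>z\<close> ranges over \<open>S\<close>
 independently in each summand.\<close>

primrec lin_comb ::
 "('m, 'x) ring_scheme => ('s => nat => 'm) => 's set => nat => 'm set" where
 "lin_comb M f S 0 = {0[M]}"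
| "lin_comb M f S (Suc q) = {u +[M] f z q | u z. u:lin_comb M f S q & z:S}"

lemma lin_comb_cong:
 "(!!z i. z:S ==> i < q ==> f z i = g z i) ==> lin_comb M f S q = lin_comb M g S q"
proof (induct q)
 case (Suc q)
 hence "lin_comb M f S q = lin_comb M g S q" "!!z. z:S ==> f z q = g z q" by auto
 thus ?case by simp metis
qed simp

locale vector_space_on = field K + V: abelian_group V
 for K :: "('k, 'x) ring_scheme" (structure) and V :: "('v, 'y) ring_scheme" (structure) +
 fixes sc :: "'k => 'v => 'v"
 assumes sc_closed [simp, intro]: "[|k:car K; x:car V|] ==> sc k x:car V"
  and sc_add_left: "[|k:car K; l:car K; x:car V|] ==>
   sc (k +[K] l) x = sc k x +[V] sc l x"
  and sc_add_right: "[|k:car K; x:car V; y:car V|] ==>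
   sc k (x +[V] y) = sc k x +[V] sc k y"
  and sc_assoc: "[|k:car K; l:car K; x:car V|] ==>
   sc (k **[K] l) x = sc k (sc l x)"
  and sc_one [simp]: "x:car V ==> sc 1[K] x = x"
begin

definition subspace :: "'v set => bool" where
 "subspace U <-> additive_subgroup U V & (ALL k:car K. ALL x:U. sc k x:U)"

abbreviation span :: "(nat => 'v) => nat => 'v set" where
 "span b == lin_comb V (%k i. sc k (b i)) (car K)"

text \<open>The spanning family is a total sequence cut off at \<open>d\<close>, so that inductions
  over the initial segments \<open>span b i\<close> can replace bases and dimensions.\<close>

definition fin_dim :: bool where
 "fin_dim <-> (EX b d. range b <= car V & car V = span b d)"

lemma sc_zero_left [simp]: "x:car V ==> sc 0[K] x = 0[V]"
proof -
 assume x: "x:car V"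
 have "sc 0[K] x +[V] sc 0[K] x = sc 0[K] x" using x sc_add_left[of "0[K]" "0[K]" x] by simp
 thus ?thesis using x V.add.r_cancel_one' by(metis sc_closed zero_closed)
qed

lemma sc_zero_right [simp]: "k:car K ==> sc k 0[V] = 0[V]"
proof -
 assume k: "k:car K"
 have "sc k 0[V] \<oplus>\<^bsub>V\<^esub> sc k 0[V] = sc k 0[V]"
  using k sc_add_right[of k "0[V]" "0[V]"] by simp
 thus ?thesis using k V.add.r_cancel_one' by(metis sc_closed V.zero_closed)
qed

lemma sc_minus: "[|k:car K; x:car V|] ==> sc k (\<ominus>\<^bsub>V\<^esub> x) = \<ominus>\<^bsub>V\<^esub> sc k x"
 by(metis V.a_inv_closed V.l_neg V.minus_equality sc_add_right sc_closed sc_zero_right)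

lemma sc_minus_left: "[|k:car K; x:car V|] ==> sc (\<ominus>\<^bsub>K\<^esub> k) x = \<ominus>\<^bsub>V\<^esub> sc k x"
 by(metis V.minus_equality a_inv_closed l_neg sc_add_left sc_closed sc_zero_left)

lemma subspaceI:
 assumes "U <= car V" "0[V]:U" "!!x y. x:U ==> y:U ==> x +[V] y:U"
  "!!k x. k:car K ==> x:U ==> sc k x:U"
 shows "subspace U"
proof -
 have "\<ominus>\<^bsub>V\<^esub> x:U" if "x:U" for x
  using assms(4)[of "\<ominus>\<^bsub>K\<^esub> 1[K]" x] that assms(1) sc_minus_left[of "1[K]" x] by auto
 thus ?thesis
  using assms unfolding subspace_def additive_subgroup_iff[OF V.abelian_group_axioms] by auto
qed

lemma subspaceD:
 assumes "subspace U"
 shows "U <= car V" "0[V]:U" "x:U ==> y:U ==> x +[V] y:U"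
  "k:car K ==> x:U ==> sc k x:U" "x:U ==> \<ominus>\<^bsub>V\<^esub> x:U"
  "x:U ==> y:U ==> x \<ominus>\<^bsub>V\<^esub> y:U"
 using assms unfolding subspace_def additive_subgroup_iff[OF V.abelian_group_axioms]
 by(auto simp: a_minus_def)

lemma subspace_carrier: "subspace (car V)"
 by(rule subspaceI) auto

lemma subspace_zero: "subspace {0[V]}"
 by(rule subspaceI) auto

lemma subspace_Int: "subspace U ==> subspace W ==> subspace (U \<inter> W)"
 using V.Int_additive_subgroup by(auto simp: subspace_def)

lemma subspace_insert:
 assumes U: "subspace U" and b: "b:car V"
 shows "subspace {u +[V] sc k b | u k. u:U & k:car K}" (is "subspace ?W")
proof (rule subspaceI)
 note UD = subspaceD[OF U]
 show "?W <= car V" using UD(1) b by auto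
 show "0[V]:?W" using UD(2) b by(force intro: exI[of _ "0[K]"])
 fix x y assume "x:?W" "y:?W"
 then obtain u k u' k' where *: "x = u +[V] sc k b" "y = u' +[V] sc k' b" "u:U" "u':U"
  "k:car K" "k':car K" by auto
 hence c: "u:car V" "u':car V" using UD(1) by auto
 have "x +[V] y = (u +[V] u') +[V] sc (k +[K] k') b"
  using * c b by(simp add: sc_add_left V.a_ac)
 thus "x +[V] y:?W" using * UD(3) by blast
next
 note UD = subspaceD[OF U]
 fix k x assume k: "k:car K" and "x:?W"
 then obtain u l where *: "x = u +[V] sc l b" "u:U" "l:car K" by auto
 hence c: "u:car V" using UD(1) by auto
 have "sc k x = sc k u +[V] sc (k **[K] l) b"
  using * k c b by(simp add: sc_add_right sc_assoc)
 thus "sc k x:?W" using * k UD(4) by blast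
qed

lemma subspace_span: "range b <= car V ==> subspace (span b d)"
proof (induct d)
 case 0 thus ?case by(simp add: subspace_zero)
next
 case (Suc d)
 hence "b d:car V" by auto
 thus ?case using subspace_insert[OF Suc(1)[OF Suc(2)], of "b d"] by simp
qed

lemma span_Suc: "range b <= car V ==> span b d <= span b (Suc d)"
proof
 fix x assume b: "range b <= car V" and x: "x:span b d"
 hence c: "x:car V" "b d:car V" using subspaceD(1)[OF subspace_span] by auto
 have "x = x +[V] sc 0[K] (b d)" using c by simp
 thus "x:span b (Suc d)" using x by(metis (mono_tags, lifting) lin_comb.simps(2) mem_Collect_eq zero_closed)
qed

lemma span_base: "range b <= car V ==> i < d ==> b i:span b d"
proof (induct d)
 case (Suc d)
 show ?case
 proof (cases "i = d")
  case True
  have "b d:car V" using Suc(2) by auto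
  hence "b i = 0[V] \<oplus>\<^bsub>V\<^esub> sc 1[K] (b d)" using True by simp
  thus ?thesis using subspaceD(2)[OF subspace_span[OF Suc(2)]] by fastforce
 next
  case False thus ?thesis using Suc span_Suc by(meson less_SucE subsetD)
 qed
qed simp

lemma span_subset:
 assumes "subspace U" "!!i. i < d ==> b i:U"
 shows "span b d <= U"
 using assms(2)
proof (induct d)
 case 0 thus ?case using subspaceD(2)[OF assms(1)] by simp
next
 case (Suc d)
 hence *: "span b d <= U" "b d:U" by auto
 show ?case
 proof
  fix x assume "x:span b (Suc d)"
  then obtain u k where x: "x = u +[V] sc k (b d)" "u:span b d" "k:car K" by auto
  thus "x:U" using * subspaceD(3)[OF assms(1), of u] subspaceD(4)[OF assms(1) x(3)] by auto
 qed
qed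

text \<open>This form has the shape of \<open>finitely_generated\<close>, with subspaces in place of
  submodules; the two notions are compared in \<open>fg_module_iff\<close>.\<close>

lemma fin_dim_iff_finite:
 "fin_dim <-> (EX S. finite S & S <= car V & (ALL U. subspace U --> S <= U --> U = car V))"
  (is "_ <-> (EX S. ?P S)")
proof
 assume fin_dim
 then obtain b d where b: "range b <= car V" "car V = span b d" by(auto simp: fin_dim_def)
 have "?P (b ` {..<d})"
 proof (intro conjI allI impI)
  show "b ` {..<d} <= car V" using b(1) by auto
  fix U assume U: "subspace U" "b ` {..<d} <= U"
  hence "span b d <= U" by(intro span_subset) auto
  thus "U = car V" using b(2) subspaceD(1)[OF U(1)] by auto
 qed simp
 thus "EX S. ?P S" by blast
next
 assume "EX S. ?P S"
 then obtain S where S: "?P S" by blast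
 then obtain f and d :: nat where f: "S = f ` {i. i < d}" using finite_imp_nat_seg_image_inj_on[of S] by auto
 define b where "b i = (if i < d then f i else 0[V])" for i
 have b: "range b <= car V" using S f by(auto simp: b_def)
 have "S <= span b d"
 proof
  fix x assume "x:S"
  then obtain i where "i < d" "x = b i" using f by(auto simp: b_def)
  thus "x:span b d" using span_base[OF b] by simp
 qed
 hence "span b d = car V" using S subspace_span[OF b] by blast
 thus fin_dim using b unfolding fin_dim_def by(intro exI[of _ b] exI[of _ d]) auto
qed

lemma subspace_finsum:
 assumes U: "subspace U" and "finite B" "!!i. i:B ==> f i:U"
 shows "finsum V f B:U"
 using assms(2,3)
proof (induct B rule: finite_induct)
 case empty thus ?case using subspaceD(2)[OF U] by simp
next
 case (insert i B)
 hence "f i:car V" "f:B \<rightarrow> car V" using subspaceD(1)[OF U] by auto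
 hence "finsum V f (insert i B) = f i +[V] finsum V f B" using insert by(simp add: V.finsum_insert)
 thus ?case using insert subspaceD(3)[OF U] by auto
qed

text \<open>The sums over a finite set are those in the axiom \<open>finite_dim\<close> of
  \<open>fd_algebra\<close>; algebras constructed later satisfy the axiom by this lemma.\<close>

lemma fin_dim_combination:
 assumes fin_dim
 shows "EX B. finite B & B <= car V &
  (ALL x:car V. EX c:B \<rightarrow> car K. x = (\<Oplus>\<^bsub>V\<^esub>b\<in>B. sc (c b) b))"
proof -
 obtain B where B: "finite B" "B <= car V" "!!U. subspace U ==> B <= U ==> U = car V"
  using assms fin_dim_iff_finite by auto
 let ?U = "{(\<Oplus>\<^bsub>V\<^esub>b\<in>B. sc (c b) b) | c. c:B \<rightarrow> car K}"
 have scB: "(%b. sc (c b) b):B \<rightarrow> car V" if "c:B \<rightarrow> car K" for c using that B(2) by auto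
 have "subspace ?U"
 proof (rule subspaceI)
  show "?U <= car V" using scB by auto
  have "(\<Oplus>\<^bsub>V\<^esub>b\<in>B. sc 0[K] b) = (\<Oplus>\<^bsub>V\<^esub>b\<in>B. 0[V])" using B(2) by(intro V.finsum_cong') auto
  hence "(\<Oplus>\<^bsub>V\<^esub>b\<in>B. sc 0[K] b) = 0[V]" using B(1) by(simp add: V.finsum_zero)
  thus "0[V]:?U" by(intro CollectI exI[of _ "%_. 0[K]"]) auto
 next
  fix x y assume "x:?U" "y:?U"
  then obtain c d where c: "x = (\<Oplus>\<^bsub>V\<^esub>b\<in>B. sc (c b) b)" "c:B \<rightarrow> car K"
   and d: "y = (\<Oplus>\<^bsub>V\<^esub>b\<in>B. sc (d b) b)" "d:B \<rightarrow> car K" by auto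
  have "x +[V] y = (\<Oplus>\<^bsub>V\<^esub>b\<in>B. sc (c b) b +[V] sc (d b) b)"
   unfolding c d by(rule V.finsum_addf[symmetric]) (use scB c d in auto)
  also have "\<dots> = (\<Oplus>\<^bsub>V\<^esub>b\<in>B. sc (c b +[K] d b) b)"
   by(rule V.finsum_cong') (use c d B(2) in \<open>auto simp: sc_add_left Pi_iff subset_iff\<close>)
  finally show "x +[V] y:?U" using c d by(intro CollectI exI[of _ "%b. c b +[K] d b"]) auto
 next
  fix k x assume k: "k:car K" and "x:?U"
  then obtain c where c: "x = (\<Oplus>\<^bsub>V\<^esub>b\<in>B. sc (c b) b)" "c:B \<rightarrow> car K" by auto
  have *: "sc k (\<Oplus>\<^bsub>V\<^esub>b\<in>C. sc (c b) b) = (\<Oplus>\<^bsub>V\<^esub>b\<in>C. sc (k **[K] c b) b)" if "C <= B" for C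
   using finite_subset[OF that B(1)] that
  proof (induct C rule: finite_induct)
   case empty thus ?case using k by simp
  next
   case (insert b C)
   hence bc: "c b:car K" "b:car V" "(%b. sc (c b) b):C \<rightarrow> car V"
    "(%b. sc (k **[K] c b) b):C \<rightarrow> car V" using c(2) B(2) k by(auto simp: Pi_iff subset_iff)
   thus ?case using insert k
    by(simp add: V.finsum_insert sc_add_right sc_assoc)
  qed
  thus "sc k x:?U" using c k by(intro CollectI exI[of _ "%b. k **[K] c b"]) auto
 qed
 moreover have "B <= ?U"
 proof
  fix b assume b: "b:B"
  let ?c = "%b'. if b' = b then 1[K] else 0[K]"
  have "(\<Oplus>\<^bsub>V\<^esub>b'\<in>B. sc (?c b') b') = (\<Oplus>\<^bsub>V\<^esub>b'\<in>B. if b = b' then b' else 0[V])"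
   using B(2) by(intro V.finsum_cong') auto
  also have "\<dots> = b" using V.finsum_singleton[OF b B(1), of "%x. x"] B(2) by auto
  finally show "b:?U" by(intro CollectI exI[of _ ?c]) auto
 qed
 ultimately have "?U = car V" using B(3) by blast
 thus ?thesis using B(1,2) by(intro exI[of _ B]) blast
qed

text \<open>Modulo \<open>span b i\<close> the space \<open>span b (Suc i)\<close> has dimension at
  most one, so a single vector outside the smaller one eliminates the last coordinate of any
  other.\<close>

lemma span_elim:
 assumes b: "range b <= car V" and w: "w:span b (Suc i)"
  and u: "u:span b (Suc i)" "u ~: span b i"
 shows "EX c:car K. w \<ominus>\<^bsub>V\<^esub> sc c u:span b i"
proof -
 note S = subspaceD[OF subspace_span[OF b, of i]]
 have bi: "b i:car V" using b by auto
 obtain w0 l where w0: "w = w0 +[V] sc l (b i)" "w0:span b i" "l:car K" using w by auto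
 obtain u0 k where u0: "u = u0 +[V] sc k (b i)" "u0:span b i" "k:car K" using u by auto
 have c: "w0:car V" "u0:car V" using S(1) w0 u0 by auto
 have k0: "k ~= 0[K]" using u u0 c bi by auto
 hence inv: "inv\<^bsub>K\<^esub> k:car K" "inv\<^bsub>K\<^esub> k **[K] k = 1[K]"
  using u0(3) field_Units by(auto simp: Units_l_inv)
 define c where "c = l **[K] inv\<^bsub>K\<^esub> k"
 have cK: "c:car K" using inv w0 by(simp add: c_def)
 have ck: "c **[K] k = l" using inv w0 u0 by(simp add: c_def m_assoc)
 have "sc c u = sc c u0 +[V] sc l (b i)"
  using u0 cK c bi ck by(simp add: sc_add_right flip: sc_assoc)
 hence "w \<ominus>\<^bsub>V\<^esub> sc c u = (w0 \<ominus>\<^bsub>V\<^esub> sc c u0) +[V] (sc l (b i) \<ominus>\<^bsub>V\<^esub> sc l (b i))"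
  using w0 c bi cK \<open>w0:car V\<close> \<open>u0:car V\<close> by(simp add: V.diff_add_diff)
 hence "w \<ominus>\<^bsub>V\<^esub> sc c u = w0 \<ominus>\<^bsub>V\<^esub> sc c u0"
  using \<open>w0:car V\<close> \<open>u0:car V\<close> bi cK w0(3) by(simp add: V.diff_self)
 thus ?thesis using S(4)[OF cK u0(2)] S(6)[OF w0(2)] cK by(intro bexI[of _ c]) auto
qed

lemma subspace_Int_span:
 assumes b: "range b <= car V" and U: "subspace U"
 shows "EX b' d'. range b' <= U & U \<inter> span b d = span b' d'"
proof (induct d)
 case 0
 show ?case using subspaceD(2)[OF U]
  by(intro exI[of _ "%_. 0[V]"] exI[of _ 0]) auto
next
 case (Suc d)
 then obtain b' d' where IH: "range b' <= U" "U \<inter> span b d = span b' d'" by auto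
 note UD = subspaceD[OF U]
 show ?case
 proof (cases "U \<inter> span b (Suc d) <= span b d")
  case True
  hence "U \<inter> span b (Suc d) = span b' d'" using span_Suc[OF b, of d] IH(2) by blast
  thus ?thesis using IH(1) by blast
 next
  case False
  \<comment> \<open>When the intersection grows, one new vector is enough: every other is reduced by
    a multiple of it to the previous intersection.\<close>
  then obtain w where w: "w:U" "w:span b (Suc d)" "w ~: span b d" by auto
  define b'' where "b'' = b'(d' := w)"
  have r: "range b'' <= U" using IH(1) w(1) by(auto simp: b''_def)
  have eq: "span b'' d' = U \<inter> span b d"
   unfolding IH(2) by(rule lin_comb_cong) (simp add: b''_def)
  have "U \<inter> span b (Suc d) = span b'' (Suc d')"
  proof
   show "U \<inter> span b (Suc d) <= span b'' (Suc d')"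
   proof
    fix y assume y: "y:U \<inter> span b (Suc d)"
    then obtain c where c: "c:car K" "y \<ominus>\<^bsub>V\<^esub> sc c w:span b d"
     using span_elim[OF b _ w(2,3)] by blast
    have "y \<ominus>\<^bsub>V\<^esub> sc c w:span b'' d'" using c y w UD by(simp add: eq)
    moreover have "y = (y \<ominus>\<^bsub>V\<^esub> sc c w) +[V] sc c (b'' d')"
     using y w(1) UD(1) c(1) by(simp add: b''_def V.diff_add_cancel subset_iff)
    ultimately show "y:span b'' (Suc d')" using c(1) by auto
   qed
   show "span b'' (Suc d') <= U \<inter> span b (Suc d)"
   proof
    fix y assume "y:span b'' (Suc d')"
    then obtain u k where y: "y = u +[V] sc k w" "u:U \<inter> span b d" "k:car K"
     using eq by(auto simp: b''_def)
    have sS: "subspace (U \<inter> span b (Suc d))"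
     using subspace_Int[OF U subspace_span[OF b]] .
    have "u:U \<inter> span b (Suc d)" using y(2) span_Suc[OF b, of d] by blast
    moreover have "sc k w:U \<inter> span b (Suc d)" using subspaceD(4)[OF sS y(3)] w by blast
    ultimately show "y:U \<inter> span b (Suc d)" unfolding y(1) using subspaceD(3)[OF sS] by blast
   qed
  qed
  moreover have "range b'' <= U" using r .
  ultimately show ?thesis by blast
 qed
qed

lemma subspace_span_ex:
 assumes fin_dim and U: "subspace U"
 shows "EX b d. range b <= U & U = span b d"
proof -
 obtain b d where b: "range b <= car V" "car V = span b d"
  using assms(1) by(auto simp: fin_dim_def)
 have "U \<inter> span b d = U" using b(2) subspaceD(1)[OF U] by auto
 thus ?thesis using subspace_Int_span[OF b(1) U, of d] by simp
qed

text \<open>A substitute for the dimension: \<open>ht U\<close> counts the indices at which the flag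
  \<open>span b i\<close> meets \<open>U\<close> in something new. Later arguments rely on its
  strict monotonicity and boundedness to choose extremal subspaces.\<close>

lemma height_ex:
 assumes fin_dim
 shows "EX (ht :: 'v set => nat) d. (ALL U. ht U <= d) &
  (ALL U W. subspace U --> subspace W --> U \<subset> W --> ht U < ht W)"
proof -
 obtain b d where b: "range b <= car V" "car V = span b d"
  using assms(1) by(auto simp: fin_dim_def)
 define jump where "jump U = {i. i < d & ~ U \<inter> span b (Suc i) <= span b i}" for U
 have fin: "finite (jump U)" for U by(simp add: jump_def)
 \<comment> \<open>Climbing the flag, a vector of \<open>W\<close> at a jump is reduced by a vector
   of \<open>U\<close> to one of lower index.\<close>
 have key: "W <= U" if U: "subspace U" and W: "subspace W" and UW: "U <= W" "jump W <= jump U" for U W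
 proof -
  have "W \<inter> span b i <= U" if "i <= d" for i using that
  proof (induct i)
   case 0 thus ?case using subspaceD(2)[OF U] by auto
  next
   case (Suc i)
   show ?case
   proof
    fix w assume w: "w:W \<inter> span b (Suc i)"
    show "w:U"
    proof (cases "w:span b i")
     case True thus ?thesis using w Suc by auto
    next
     case False
     hence "i:jump W" using w Suc(2) Suc_le_lessD unfolding jump_def by blast
     hence "i:jump U" using UW by blast
     then obtain u where u: "u:U" "u:span b (Suc i)" "u ~: span b i"
      unfolding jump_def by blast
     obtain c where c: "c:car K" "w \<ominus>\<^bsub>V\<^esub> sc c u:span b i"
      using span_elim[OF b(1) _ u(2,3)] w by blast
     have "sc c u:W" using subspaceD(4)[OF W c(1)] u(1) UW(1) by auto
     hence "w \<ominus>\<^bsub>V\<^esub> sc c u:W" using w subspaceD(6)[OF W] by auto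
     hence *: "w \<ominus>\<^bsub>V\<^esub> sc c u:U" using c Suc by auto
     have "sc c u:U" "w:car V" "u:car V"
      using c(1) u(1) subspaceD[OF U] w subspaceD(1)[OF W] by auto
     thus "w:U" using V.diff_add_cancel[of w "sc c u"] subspaceD(3)[OF U *, of "sc c u"] c(1)
      by simp
    qed
   qed
  qed
  from this[of d] show ?thesis using b(2) subspaceD(1)[OF W] by auto
 qed
 have "card (jump U) < card (jump W)" if "subspace U" "subspace W" "U \<subset> W" for U W
 proof -
  have "jump U <= jump W" using that by(auto simp: jump_def)
  moreover have "~ jump W <= jump U" using key[of U W] that by blast
  ultimately show ?thesis using fin[of W] by(intro psubset_card_mono) auto
 qed
 moreover have "card (jump U) <= d" for U
  using card_mono[of "{..<d}" "jump U"] by(auto simp: jump_def)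
 ultimately show ?thesis by(intro exI[of _ "%U. card (jump U)"] exI[of _ d]) auto
qed

text \<open>An injection is all that is asked for: \<open>transport_mod\<close> carries the module
  structure along it to the type of small modules.\<close>

lemma coordinates_ex:
 assumes fin_dim
 shows "EX f :: 'v => nat => 'k. inj_on f (car V)"
proof -
 obtain b d where b: "range b <= car V" "car V = span b d"
  using assms(1) by(auto simp: fin_dim_def)
 define val where "val c = rec_nat 0[V] (%i u. u +[V] sc (c i) (b i))" for c
 have "EX c. x = val c i" if "x:span b i" for x i using that
 proof (induct i arbitrary: x)
  case 0 thus ?case by(simp add: val_def)
 next
  case (Suc i)
  then obtain u k where u: "x = u +[V] sc k (b i)" "u:span b i" by auto
  then obtain c where c: "u = val c i" using Suc(1) by auto
  have "val (c(i := k)) j = val c j" if "j <= i" for j using that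
   by(induct j) (auto simp: val_def)
  hence "x = val (c(i := k)) (Suc i)" using u c by(simp add: val_def)
  thus ?case by blast
 qed
 hence "ALL x:car V. EX c. x = val c d" using b(2) by auto
 then obtain f where f: "ALL x:car V. x = val (f x) d" by(rule bchoice[THEN exE])
 have "inj_on f (car V)"
 proof (rule inj_onI)
  fix x y assume "x:car V" "y:car V" "f x = f y"
  thus "x = y" using f[rule_format, of x] f[rule_format, of y] by simp
 qed
 thus ?thesis by blast
qed

text \<open>Together with the minimal version below this replaces all chain conditions:
  \<open>P\<close> may single out submodules or one-sided ideals with a side condition.\<close>

lemma maximal_subspace_ex:
 assumes fin_dim "P U0" "!!U. P U ==> subspace U"
 shows "EX U. P U & (ALL W. P W --> ~ U \<subset> W)"
proof -
 obtain ht :: "'v set => nat" and d where ht: "ALL U. ht U <= d"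
  "ALL U W. subspace U --> subspace W --> U \<subset> W --> ht U < ht W" using height_ex assms(1) by blast
 obtain U where "P U" "ALL W. P W --> ht W <= ht U"
  using ex_has_greatest_nat[of P U0 ht "Suc d"] assms(2) ht(1) by(auto simp: less_Suc_eq_le)
 thus ?thesis using ht(2) assms(3) by(metis leD)
qed

lemma minimal_subspace_ex:
 assumes fin_dim "P U0" "!!U. P U ==> subspace U"
 shows "EX U. P U & (ALL W. P W --> ~ W \<subset> U)"
proof -
 obtain ht :: "'v set => nat" and d where ht: "ALL U. ht U <= d"
  "ALL U W. subspace U --> subspace W --> U \<subset> W --> ht U < ht W" using height_ex assms(1) by blast
 obtain U where "P U" "ALL W. P W --> ht U <= ht W"
  using ex_has_least_nat[of P U0 ht] assms(2) by auto
 thus ?thesis using ht(2) assms(3) by(metis leD)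
qed

text \<open>Take \<open>C\<close> maximal among the subspaces that meet \<open>U\<close> trivially;
  a vector outside \<open>U + C\<close> could be added to it.\<close>

lemma complement_ex:
 assumes fin_dim and U: "subspace U"
 shows "EX C. subspace C & U \<inter> C = {0[V]} & (ALL x:car V. EX u:U. EX c:C. x = u +[V] c)"
proof -
 note UD = subspaceD[OF U]
 define P where "P C <-> subspace C & U \<inter> C = {0[V]}" for C
 have "P {0[V]}" using subspace_zero UD(2) by(auto simp: P_def)
 from maximal_subspace_ex[of P, OF assms(1) this] obtain C
  where C: "P C" "ALL W. P W --> ~ C \<subset> W" by(auto simp: P_def)
 have sC: "subspace C" and UC: "U \<inter> C = {0[V]}" using C(1) by(auto simp: P_def)
 note CD = subspaceD[OF sC]
 have "EX u:U. EX c:C. x = u +[V] c" if x: "x:car V" for x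
 proof (rule ccontr)
  assume no: "~ ?thesis"
  let ?W = "{u +[V] sc k x | u k. u:C & k:car K}"
  have sW: "subspace ?W" by(rule subspace_insert[OF sC x])
  have "C <= ?W"
  proof
   fix c assume "c:C"
   hence "c = c +[V] sc 0[K] x" using x CD(1) by auto
   thus "c:?W" using \<open>c:C\<close> by blast
  qed
  moreover have "x:?W" using x CD(2) by(force intro: exI[of _ "1[K]"])
  moreover have "x ~: C"
   using no UD(2) x by(metis V.l_zero)
  moreover have "U \<inter> ?W = {0[V]}"
  proof -
   have "y = 0[V]" if y: "y:U" "y:?W" for y
   proof -
    obtain c k where ck: "y = c +[V] sc k x" "c:C" "k:car K" using y by auto
    have car: "c:car V" "y:car V" using ck CD(1) UD(1) y by auto
    show ?thesis
    proof (cases "k = 0[K]")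
     case True hence "y = c" using ck car x by simp
     thus ?thesis using y ck(2) UC by auto
    next
     case False
     hence inv: "inv\<^bsub>K\<^esub> k:car K" "inv\<^bsub>K\<^esub> k **[K] k = 1[K]"
      using ck(3) field_Units by(auto simp: Units_l_inv)
     have "sc k x = y \<ominus>\<^bsub>V\<^esub> c"
      using ck car x by(metis V.a_comm V.diff_eq_iff sc_closed)
     hence "sc (inv\<^bsub>K\<^esub> k) (sc k x) = sc (inv\<^bsub>K\<^esub> k) y +[V] sc (inv\<^bsub>K\<^esub> k) (\<ominus>\<^bsub>V\<^esub> c)"
      using car inv by(simp add: a_minus_def sc_add_right)
     moreover have "sc (inv\<^bsub>K\<^esub> k) (sc k x) = x" using inv ck x by(simp flip: sc_assoc)
     ultimately show ?thesis using no y(1) ck(2) inv UD(4) CD(4,5) by metis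
    qed
   qed
   moreover have "0[V]:?W" using subspaceD(2)[OF sW] .
   ultimately show ?thesis using UD(2) by blast
  qed
  ultimately show False using C(2) sW unfolding P_def by blast
 qed
 thus ?thesis using sC UC by blast
qed

lemma projection_ex:
 assumes fin_dim and U: "subspace U"
 shows "EX p. (ALL x:car V. p x:U) & (ALL x:U. p x = x) &
  (ALL x:car V. ALL y:car V. p (x +[V] y) = p x +[V] p y) &
  (ALL k:car K. ALL x:car V. p (sc k x) = sc k (p x))"
proof -
 obtain C where C: "subspace C" "U \<inter> C = {0[V]}"
  "!!x. x:car V ==> EX u:U. EX c:C. x = u +[V] c" using complement_ex[OF assms] by blast
 note UD = subspaceD[OF U] and CD = subspaceD[OF C(1)]
 define p where "p x = (SOME u. u:U & (EX c:C. x = u +[V] c))" for x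
 have p: "p x:U" "EX c:C. x = p x +[V] c" if "x:car V" for x
  unfolding p_def using someI_ex[of "%u. u:U & (EX c:C. x = u +[V] c)"] C(3)[OF that] by blast+
 have uniq: "p (u +[V] c) = u" if uc: "u:U" "c:C" for u c
 proof -
  have car: "u:car V" "c:car V" using uc UD(1) CD(1) by auto
  let ?x = "u +[V] c"
  obtain c' where c': "c':C" "?x = p ?x +[V] c'" using p[of ?x] car by auto
  have pc: "p ?x:U" "p ?x:car V" "c':car V" using p(1)[of ?x] car UD(1) c' CD(1) by auto
  have "0[V] = (u +[V] c) \<ominus>\<^bsub>V\<^esub> (p ?x +[V] c')" using c'(2) car by(simp add: V.diff_self)
  also have "\<dots> = (u \<ominus>\<^bsub>V\<^esub> p ?x) +[V] (c \<ominus>\<^bsub>V\<^esub> c')" using car pc by(simp add: V.diff_add_diff)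
  finally have "u \<ominus>\<^bsub>V\<^esub> p ?x = \<ominus>\<^bsub>V\<^esub> (c \<ominus>\<^bsub>V\<^esub> c')" using car pc
   by(metis V.minus_closed V.minus_equality)
  hence "u \<ominus>\<^bsub>V\<^esub> p ?x:U \<inter> C" using UD(6)[OF uc(1) pc(1)] CD(5)[OF CD(6)[OF uc(2) c'(1)]] by auto
  thus ?thesis using C(2) car pc V.diff_eq_zero_iff by auto
 qed
 show ?thesis
 proof (intro exI[of _ p] conjI ballI)
  fix x assume "x:U" thus "p x = x" using uniq[of x "0[V]"] CD(2) UD(1) by auto
 next
  fix x y assume x: "x:car V" and y: "y:car V"
  obtain c where c: "c:C" "x = p x +[V] c" using p[OF x] by auto
  obtain d where d: "d:C" "y = p y +[V] d" using p[OF y] by auto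
  have car: "p x:car V" "p y:car V" "c:car V" "d:car V"
   using p x y UD(1) CD(1) c d by auto
  have "x +[V] y = (p x +[V] c) +[V] (p y +[V] d)" using c(2) d(2) by simp
  also have "\<dots> = (p x +[V] p y) +[V] (c +[V] d)" using car by(simp add: V.a_ac)
  finally show "p (x +[V] y) = p x +[V] p y" using uniq UD(3) CD(3) p x y c d by auto
 next
  fix k x assume k: "k:car K" and x: "x:car V"
  obtain c where c: "c:C" "x = p x +[V] c" using p[OF x] by auto
  have car: "p x:car V" "c:car V" using p x UD(1) CD(1) c by auto
  have "sc k x = sc k (p x) +[V] sc k c" using c(2) car k by(metis sc_add_right)
  thus "p (sc k x) = sc k (p x)" using uniq UD(4) CD(4) p x c k by auto
 qed (use p in auto)
qed

section \<open>Linear functionals and finite dimensional duality\<close>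

definition functional :: "('v => 'k) => bool" where
 "functional f <-> f:car V \<rightarrow> car K &
  (ALL x:car V. ALL y:car V. f (x +[V] y) = f x +[K] f y) &
  (ALL k:car K. ALL x:car V. f (sc k x) = k **[K] f x)"

text \<open>A subspace \<open>H\<close> maximal among those that contain \<open>U\<close> and avoid
  \<open>x\<close> is a hyperplane; the functional reads off the coefficient of \<open>x\<close>
  modulo \<open>H\<close>.\<close>

lemma functional_separates:
 assumes fin_dim and U: "subspace U" and x: "x:car V" "x ~: U"
 shows "EX f. functional f & f x ~= 0[K] & (ALL u:U. f u = 0[K])"
proof -
 note UD = subspaceD[OF U]
 define P where "P W <-> subspace W & U <= W & x ~: W" for W
 have "P U" using U x by(auto simp: P_def)
 from maximal_subspace_ex[of P, OF assms(1) this] obtain H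
  where H: "P H" "ALL W. P W --> ~ H \<subset> W" by(auto simp: P_def)
 have sH: "subspace H" and UH: "U <= H" "x ~: H" using H(1) by(auto simp: P_def)
 note HD = subspaceD[OF sH]
 have ex: "EX k:car K. y \<ominus>\<^bsub>V\<^esub> sc k x:H" if y: "y:car V" for y
 proof (cases "y:H")
  case True thus ?thesis using x y by(auto simp: a_minus_def intro!: bexI[of _ "0[K]"])
 next
  case False
  let ?W = "{u +[V] sc k y | u k. u:H & k:car K}"
  have sW: "subspace ?W" by(rule subspace_insert[OF sH y])
  have HW: "H <= ?W"
  proof
   fix c assume "c:H"
   hence "c = c +[V] sc 0[K] y" using y HD(1) by auto
   thus "c:?W" using \<open>c:H\<close> by blast
  qed
  have "y = 0[V] \<oplus>\<^bsub>V\<^esub> sc 1[K] y" using y by simp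
  hence "y:?W" using HD(2) by blast
  hence "H \<subset> ?W" using HW False by auto
  \<comment> \<open>By maximality \<open>x\<close> lies in \<open>H + K y\<close>; dividing by the
    coefficient of \<open>y\<close> expresses \<open>y\<close> by \<open>x\<close> modulo
    \<open>H\<close>.\<close>
  hence "x:?W" using H(2) sW UH HW unfolding P_def by blast
  then obtain u k where uk: "x = u +[V] sc k y" "u:H" "k:car K" by auto
  have u: "u:car V" using uk HD(1) by auto
  have k0: "k ~= 0[K]" using uk UH y u by auto
  hence inv: "inv\<^bsub>K\<^esub> k:car K" "inv\<^bsub>K\<^esub> k **[K] k = 1[K]"
   using uk(3) field_Units by(auto simp: Units_l_inv)
  have "sc (inv\<^bsub>K\<^esub> k) x = sc (inv\<^bsub>K\<^esub> k) u +[V] y"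
   using uk inv y u by(simp add: sc_add_right flip: sc_assoc)
  hence "y \<ominus>\<^bsub>V\<^esub> sc (inv\<^bsub>K\<^esub> k) x = \<ominus>\<^bsub>V\<^esub> sc (inv\<^bsub>K\<^esub> k) u"
   using inv y u by(simp add: a_minus_def V.minus_add V.a_ac V.r_neg V.r_neg2)
  thus ?thesis using inv uk(2) HD by metis
 qed
 define f where "f y = (SOME k. k:car K & y \<ominus>\<^bsub>V\<^esub> sc k x:H)" for y
 have f: "f y:car K" "y \<ominus>\<^bsub>V\<^esub> sc (f y) x:H" if "y:car V" for y
  unfolding f_def using someI_ex[of "%k. k:car K & y \<ominus>\<^bsub>V\<^esub> sc k x:H"] ex[OF that] by blast+
 have uniq: "f y = k" if y: "y:car V" and k: "k:car K" "y \<ominus>\<^bsub>V\<^esub> sc k x:H" for y k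
 proof (rule ccontr)
  assume ne: "f y ~= k"
  define l where "l = f y \<ominus>\<^bsub>K\<^esub> k"
  have l: "l:car K" "l ~= 0[K]" using ne f[OF y] k by(auto simp: l_def diff_eq_zero_iff)
  have "sc l x = (y \<ominus>\<^bsub>V\<^esub> sc k x) \<ominus>\<^bsub>V\<^esub> (y \<ominus>\<^bsub>V\<^esub> sc (f y) x)"
   using f[OF y] y k x unfolding l_def
   by(simp add: a_minus_def sc_add_left sc_minus_left V.minus_add V.a_ac V.r_neg V.r_neg2 V.r_neg1)
  hence "sc l x:H" using HD(6)[OF k(2) f(2)[OF y]] by simp
  moreover have inv: "inv\<^bsub>K\<^esub> l:car K" "inv\<^bsub>K\<^esub> l **[K] l = 1[K]"
   using l field_Units by(auto simp: Units_l_inv)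
  ultimately have "sc (inv\<^bsub>K\<^esub> l) (sc l x):H" using HD(4) by auto
  thus False using UH(2) inv l x by(simp flip: sc_assoc)
 qed
 have "functional f"
  unfolding functional_def
 proof (intro conjI ballI)
  fix y z assume y: "y:car V" and z: "z:car V"
  have "(y +[V] z) \<ominus>\<^bsub>V\<^esub> sc (f y +[K] f z) x = (y \<ominus>\<^bsub>V\<^esub> sc (f y) x) +[V] (z \<ominus>\<^bsub>V\<^esub> sc (f z) x)"
   using f y z x by(simp add: sc_add_left V.diff_add_diff)
  thus "f (y +[V] z) = f y +[K] f z" using uniq f y z HD(3) by auto
 next
  fix k y assume k: "k:car K" and y: "y:car V"
  have "sc k y \<ominus>\<^bsub>V\<^esub> sc (k **[K] f y) x = sc k (y \<ominus>\<^bsub>V\<^esub> sc (f y) x)"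
   using f y k x by(simp add: sc_assoc a_minus_def sc_add_right sc_minus)
  thus "f (sc k y) = k **[K] f y" using uniq f k y HD(4) by auto
 qed (use f in auto)
 moreover have "f x = 1[K]" using uniq[of x "1[K]"] x HD(2) by(simp add: V.diff_self)
 moreover have "f u = 0[K]" if "u:U" for u
  using uniq[of u "0[K]"] that UH UD(1) x by(auto simp: a_minus_def)
 ultimately show ?thesis by(intro exI[of _ f]) auto
qed

text \<open>Subtracting \<open>g u\<close> times the last functional, for a vector \<open>u\<close>
  on which it is 1 and all earlier ones vanish, reduces their number by one. The closure of
  \<open>W\<close> is required only up to agreement on the carrier, so \<open>W\<close> may consist
  of functionals obtained from products in an algebra or of evaluations on a dual space.\<close>

lemma functional_in_dual_span:
 fixes q :: nat
 assumes W: "!!w. w:W ==> functional w"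
  and Wadd: "!!v w. v:W ==> w:W ==> EX u:W. ALL x:car V. u x = v x +[K] w x"
  and Wsc: "!!k w. k:car K ==> w:W ==> EX u:W. ALL x:car V. u x = k **[K] w x"
  and Wz: "EX u:W. ALL x:car V. u x = 0[K]"
  and fi: "!!i. i < q ==> f i:W"
  and g: "functional g" "!!x. x:car V ==> (!!i. i < q ==> f i x = 0[K]) ==> g x = 0[K]"
 shows "EX w:W. ALL x:car V. g x = w x"
 using fi g
proof (induction q arbitrary: g)
 case 0
 hence "!!x. x:car V ==> g x = 0[K]" by simp
 moreover obtain u where "u:W" "ALL x:car V. u x = 0[K]" using Wz by blast
 ultimately show ?case by(intro bexI[of _ u]) auto
next
 case (Suc q)
 show ?case
 proof (cases "ALL x:car V. (ALL i<q. f i x = 0[K]) --> f q x = 0[K]")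
  case True
  show ?thesis
  proof (rule Suc(1))
   show "f i:W" if "i < q" for i using Suc(2)[of i] that by simp
   show "functional g" by fact
   fix x assume x: "x:car V" "!!i. i < q ==> f i x = 0[K]"
   show "g x = 0[K]"
   proof (rule Suc(4)[OF x(1)])
    fix i assume "i < Suc q"
    thus "f i x = 0[K]" using True x by(cases "i = q") auto
   qed
  qed
 next
  case False
  then obtain u0 where u0: "u0:car V" "ALL i<q. f i u0 = 0[K]" "f q u0 ~= 0[K]" by auto
  have fq: "functional (f q)" "f q:W" using Suc(2) W by auto
  have fK: "f q x:car K" "g x:car K" if "x:car V" for x
   using fq Suc(3) that by(auto simp: functional_def)
  let ?i = "inv\<^bsub>K\<^esub> (f q u0)"
  have inv: "?i:car K" "?i **[K] f q u0 = 1[K]"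
   using u0 fK field_Units by(auto simp: Units_l_inv)
  define u where "u = sc ?i u0"
  have u: "u:car V" "f q u = 1[K]"
   using u0 inv fq by(auto simp: u_def functional_def)
  have u': "f i u = 0[K]" if "i < q" for i
  proof -
   have "functional (f i)" using that Suc(2) W by auto
   hence "f i u = ?i **[K] f i u0" using u0(1) inv(1) unfolding functional_def u_def by blast
   thus ?thesis using u0(2) that inv(1) by simp
  qed
  have gu: "g u:car K" using u fK by auto
  define c where "c = \<ominus>\<^bsub>K\<^esub> g u"
  have c: "c:car K" using gu by(simp add: c_def)
  define g' where "g' x = g x +[K] c **[K] f q x" for x
  have "functional g'"
   using fq(1) Suc(3) c unfolding functional_def g'_def
   by(auto simp: Pi_iff r_distr a_ac m_ac)
  moreover have "g' x = 0[K]" if x: "x:car V" "!!i. i < q ==> f i x = 0[K]" for x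
  proof -
   let ?l = "\<ominus>\<^bsub>K\<^esub> (f q x)"
   let ?y = "x +[V] sc ?l u"
   have l: "?l:car K" using fK x by auto
   have z: "f i ?y = 0[K]" if "i < Suc q" for i
   proof -
    have "functional (f i)" using that Suc(2) W by auto
    hence "f i ?y = f i x +[K] ?l **[K] f i u" using x u l unfolding functional_def by auto
    thus ?thesis using that x u u' fK l by(cases "i = q") (auto simp: r_neg)
   qed
   have "g ?y = 0[K]" by(rule Suc(4)) (use x u l z in auto)
   hence "g x +[K] ?l **[K] g u = 0[K]" using Suc(3) x u l unfolding functional_def by auto
   thus ?thesis using fK[OF x(1)] gu by(simp add: g'_def c_def l_minus r_minus m_comm[of _ "g u"])
  qed
  ultimately obtain w where w: "w:W" "ALL x:car V. g' x = w x"
   using Suc(1)[of g'] Suc(2) by auto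
  obtain v where v: "v:W" "ALL x:car V. v x = g u **[K] f q x" using Wsc[OF gu fq(2)] by auto
  obtain t where t: "t:W" "ALL x:car V. t x = w x +[K] v x" using Wadd[OF w(1) v(1)] by auto
  have "g x = t x" if x: "x:car V" for x
  proof -
   have "t x = g' x +[K] g u **[K] f q x" using t(2) v(2) w(2) x by simp
   thus ?thesis using fK[OF x] gu by(simp add: g'_def c_def l_minus a_assoc l_neg)
  qed
  thus ?thesis using t(1) by blast
 qed
qed

end

section \<open>Right modules\<close>

context right_module
begin

lemma ract_zero_left [simp]: "a:car A ==> 0[M] *[M] a = 0[M]"
proof -
 assume a: "a:car A"
 have "0[M] *[M] a +[M] 0[M] *[M] a = 0[M] *[M] a"
  using a ract_add_left[of "0[M]" "0[M]" a] by simp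
 thus ?thesis using a M.add.r_cancel_one' ract_closed by(metis M.zero_closed)
qed

lemma ract_zero_right [simp]: "x:car M ==> x *[M] 0[A] = 0[M]"
proof -
 assume x: "x:car M"
 have "x *[M] 0[A] \<oplus>\<^bsub>M\<^esub> x *[M] 0[A] = x *[M] 0[A]"
  using x ract_add_right[of x "0[A]" "0[A]"] by simp
 thus ?thesis using x M.add.r_cancel_one' ract_closed by(metis A.zero_closed)
qed

lemma ract_minus_left:
 "[|x:car M; a:car A|] ==> (\<ominus>\<^bsub>M\<^esub> x) *[M] a = \<ominus>\<^bsub>M\<^esub> (x *[M] a)"
 by(metis M.a_inv_closed M.l_neg M.minus_equality ract_add_left ract_closed ract_zero_left)

lemma ract_minus_right:
 "[|x:car M; a:car A|] ==> x *[M] (\<ominus>\<^bsub>A\<^esub> a) = \<ominus>\<^bsub>M\<^esub> (x *[M] a)"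
 by(metis A.a_inv_closed A.l_neg M.minus_equality ract_add_right ract_closed ract_zero_right)

lemma ract_diff_left:
 "[|x:car M; y:car M; a:car A|] ==>
  (x \<ominus>\<^bsub>M\<^esub> y) *[M] a = x *[M] a \<ominus>\<^bsub>M\<^esub> y *[M] a"
 by(simp add: a_minus_def ract_add_left ract_minus_left)

lemma ract_diff_right:
 "[|x:car M; a:car A; b:car A|] ==>
  x *[M] (a \<ominus>\<^bsub>A\<^esub> b) = x *[M] a \<ominus>\<^bsub>M\<^esub> x *[M] b"
 by(simp add: a_minus_def ract_add_right ract_minus_right)

end

lemma right_moduleI:
 assumes "ring A" "abelian_group M"
  "!!x a. [|x:car M; a:car A|] ==> x *[M] a:car M"
  "!!x y a. [|x:car M; y:car M; a:car A|] ==>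
    (x +[M] y) *[M] a = x *[M] a +[M] y *[M] a"
  "!!x a b. [|x:car M; a:car A; b:car A|] ==>
    x *[M] (a +[A] b) = x *[M] a +[M] x *[M] b"
  "!!x a b. [|x:car M; a:car A; b:car A|] ==>
    x *[M] (a **[A] b) = (x *[M] a) *[M] b"
  "!!x. x:car M ==> x *[M] 1[A] = x"
 shows "right_module A M"
 using assms by(intro right_module.intro right_module_axioms.intro) auto

lemma mod_homI:
 assumes "!!x. x:car M ==> f x:car N"
  "!!x y. [|x:car M; y:car M|] ==> f (x +[M] y) = f x +[N] f y"
  "!!x a. [|x:car M; a:car A|] ==> f (x *[M] a) = f x *[N] a"
 shows "f:mod_hom A M N"
 using assms unfolding mod_hom_def by auto

lemma mod_homD:
 assumes "f:mod_hom A M N"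
 shows "x:car M ==> f x:car N"
  "[|x:car M; y:car M|] ==> f (x +[M] y) = f x +[N] f y"
  "[|x:car M; a:car A|] ==> f (x *[M] a) = f x *[N] a"
 using assms unfolding mod_hom_def by auto

lemma mod_hom_zero:
 assumes M: "right_module A M" and N: "right_module A N" and f: "f:mod_hom A M N"
 shows "f 0[M] = 0[N]"
proof -
 interpret M: right_module A M by fact
 interpret N: right_module A N by fact
 have "f 0[M] \<oplus>\<^bsub>N\<^esub> f 0[M] = f 0[M]"
  using mod_homD(2)[OF f, of "0[M]" "0[M]"] by simp
 thus ?thesis using mod_homD(1)[OF f] N.M.add.r_cancel_one' by(metis M.M.zero_closed)
qed

lemma mod_hom_minus:
 assumes M: "right_module A M" and N: "right_module A N" and f: "f:mod_hom A M N"
  and x: "x:car M"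
 shows "f (\<ominus>\<^bsub>M\<^esub> x) = \<ominus>\<^bsub>N\<^esub> f x"
proof -
 interpret M: right_module A M by fact
 interpret N: right_module A N by fact
 have "f (\<ominus>\<^bsub>M\<^esub> x) +[N] f x = 0[N]"
  using mod_homD(2)[OF f, of "\<ominus>\<^bsub>M\<^esub> x" x] x mod_hom_zero[OF M N f] by(simp add: M.M.l_neg)
 thus ?thesis using N.M.minus_equality mod_homD(1)[OF f] x by(metis M.M.a_inv_closed)
qed

lemma mod_hom_diff:
 assumes M: "right_module A M" and N: "right_module A N" and f: "f:mod_hom A M N"
  and x: "x:car M" "y:car M"
 shows "f (x \<ominus>\<^bsub>M\<^esub> y) = f x \<ominus>\<^bsub>N\<^esub> f y"
proof -
 interpret M: right_module A M by fact
 show ?thesis unfolding a_minus_def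
  using mod_homD(2)[OF f] mod_hom_minus[OF M N f] x by simp
qed

lemma mod_hom_comp:
 "f:mod_hom A M N ==> g:mod_hom A N P ==> (%x. g (f x)):mod_hom A M P"
 by(rule mod_homI) (simp_all add: mod_homD)

lemma mod_hom_id: "(%x. x):mod_hom A M M"
 unfolding mod_hom_def by auto

lemma mod_hom_add:
 assumes N: "right_module A N" and M: "right_module A M"
  and f: "f:mod_hom A M N" and g: "g:mod_hom A M N"
 shows "(%x. f x +[N] g x):mod_hom A M N"
proof -
 interpret M: right_module A M by fact
 interpret N: right_module A N by fact
 show ?thesis
  by(rule mod_homI)
   (use mod_homD[OF f] mod_homD[OF g] in \<open>auto simp: N.ract_add_left N.M.a_ac\<close>)
qed

lemma mod_hom_sub:
 assumes N: "right_module A N" and M: "right_module A M"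
  and f: "f:mod_hom A M N" and g: "g:mod_hom A M N"
 shows "(%x. f x \<ominus>\<^bsub>N\<^esub> g x):mod_hom A M N"
proof -
 interpret M: right_module A M by fact
 interpret N: right_module A N by fact
 show ?thesis
  by(rule mod_homI)
   (use mod_homD[OF f] mod_homD[OF g] in \<open>auto simp: N.ract_diff_left N.M.diff_add_diff\<close>)
qed

lemma mod_hom_inv:
 assumes f: "f:mod_hom A M N" and b: "bij_betw f (car M) (car N)"
  and M: "right_module A M"
 shows "inv_into (car M) f:mod_hom A N M"
proof (rule mod_homI)
 interpret M: right_module A M by fact
 let ?g = "inv_into (car M) f"
 have g: "?g y:car M" "f (?g y) = y" if "y:car N" for y
  using that b by(auto simp: bij_betw_def inv_into_into f_inv_into_f)
 have gf: "?g (f x) = x" if "x:car M" for x using that b by(simp add: bij_betw_def)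
 show "?g y:car M" if "y:car N" for y using g that by auto
 show "?g (x +[N] y) = ?g x +[M] ?g y" if "x:car N" "y:car N" for x y
  using gf[of "?g x +[M] ?g y"] mod_homD(2)[OF f, of "?g x" "?g y"] g that by auto
 show "?g (x *[N] a) = ?g x *[M] a" if "x:car N" "a:car A" for x a
  using gf[of "?g x *[M] a"] mod_homD(3)[OF f, of "?g x" a] g that M.ract_closed by auto
qed

lemma mod_iso_sym: "right_module A M ==> mod_iso A M N ==> mod_iso A N M"
 unfolding mod_iso_def by(meson bij_betw_inv_into mod_hom_inv)

lemma mod_hom_inj_iff:
 assumes M: "right_module A M" and N: "right_module A N" and f: "f:mod_hom A M N"
 shows "inj_on f (car M) <-> (ALL x:car M. f x = 0[N] --> x = 0[M])"
proof -
 interpret M: right_module A M by fact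
 interpret N: right_module A N by fact
 show ?thesis
 proof
  show "inj_on f (car M) ==> ALL x:car M. f x = 0[N] --> x = 0[M]"
   using mod_hom_zero[OF M N f] by(metis M.M.zero_closed inj_onD)
  assume *: "ALL x:car M. f x = 0[N] --> x = 0[M]"
  show "inj_on f (car M)"
  proof (rule inj_onI)
   fix x y assume xy: "x:car M" "y:car M" "f x = f y"
   hence "f (x \<ominus>\<^bsub>M\<^esub> y) = 0[N]"
    using mod_hom_diff[OF M N f] N.M.diff_self mod_homD(1)[OF f] by simp
   thus "x = y" using * xy M.M.diff_eq_zero_iff by auto
  qed
 qed
qed

lemma right_submoduleI:
 assumes M: "right_module A M" "N <= car M" "0[M]:N"
  "!!x y. x:N ==> y:N ==> x +[M] y:N" "!!x a. x:N ==> a:car A ==> x *[M] a:N"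
 shows "right_submodule A M N"
proof -
 interpret M: right_module A M by fact
 have "\<ominus>\<^bsub>M\<^esub> x:N" if "x:N" for x
 proof -
  have "x *[M] (\<ominus>\<^bsub>A\<^esub> 1[A]):N" using assms(5)[OF that] by auto
  thus ?thesis using that M(2) by(auto simp: M.ract_minus_right M.ract_one subset_iff)
 qed
 thus ?thesis
  using assms unfolding right_submodule_def additive_subgroup_iff[OF M.M.abelian_group_axioms]
  by auto
qed

lemma right_submoduleD:
 assumes "right_module A M" "right_submodule A M N"
 shows "N <= car M" "0[M]:N"
  "!!x y. x:N ==> y:N ==> x +[M] y:N" "!!x a. x:N ==> a:car A ==> x *[M] a:N"
  "!!x. x:N ==> \<ominus>\<^bsub>M\<^esub> x:N" "!!x y. x:N ==> y:N ==> x \<ominus>\<^bsub>M\<^esub> y:N"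
  "additive_subgroup N M"
proof -
 interpret M: right_module A M by fact
 show "N <= car M" "0[M]:N"
  "!!x y. x:N ==> y:N ==> x +[M] y:N" "!!x a. x:N ==> a:car A ==> x *[M] a:N"
  "!!x. x:N ==> \<ominus>\<^bsub>M\<^esub> x:N" "!!x y. x:N ==> y:N ==> x \<ominus>\<^bsub>M\<^esub> y:N"
  "additive_subgroup N M"
  using assms(2) unfolding right_submodule_def additive_subgroup_iff[OF M.M.abelian_group_axioms]
  by(auto simp: a_minus_def)
qed

abbreviation sub_mod :: "('a, 'm) right_mod => 'm set => ('a, 'm) right_mod" where
 "sub_mod M N == M\<lparr>carrier := N\<rparr>"

lemma sub_mod_right_module:
 assumes M: "right_module A M" and N: "right_submodule A M N"
 shows "right_module A (sub_mod M N)"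
proof -
 interpret M: right_module A M by fact
 note ND = right_submoduleD[OF M N]
 have c: "x:N ==> x:car M" for x using ND(1) by auto
 have "abelian_group (sub_mod M N)"
 proof (rule abelian_groupI)
  fix x assume "x:car (sub_mod M N)"
  thus "EX y:car (sub_mod M N). y +[sub_mod M N] x = 0[sub_mod M N]"
   using ND(5)[of x] c M.M.l_neg by(intro bexI[of _ "\<ominus>\<^bsub>M\<^esub> x"]) auto
 qed (use ND c in \<open>auto simp: M.M.a_ac\<close>)
 thus ?thesis
  by(intro right_moduleI M.A.ring_axioms)
   (use ND c in \<open>auto simp: M.ract_add_left M.ract_add_right M.ract_assoc M.ract_one\<close>)
qed

lemma sub_mod_submodule_iff:
 assumes M: "right_module A M" and N: "right_submodule A M N"
 shows "right_submodule A (sub_mod M N) U <-> right_submodule A M U & U <= N"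
proof -
 note N' = sub_mod_right_module[OF M N] and ND = right_submoduleD[OF M N]
 show ?thesis
 proof safe
  assume U: "right_submodule A (sub_mod M N) U"
  show "right_submodule A M U"
   by(rule right_submoduleI[OF M]) (use right_submoduleD[OF N' U] ND in auto)
  show "x:N" if "x:U" for x using right_submoduleD(1)[OF N' U] that by auto
 next
  assume U: "right_submodule A M U" "U <= N"
  show "right_submodule A (sub_mod M N) U"
   by(rule right_submoduleI[OF N']) (use right_submoduleD[OF M U(1)] U(2) in auto)
 qed
qed

lemma submodule_carrier: "right_module A M ==> right_submodule A M (car M)"
proof -
 assume M: "right_module A M"
 interpret M: right_module A M by fact
 show ?thesis by(rule right_submoduleI[OF M]) (auto simp: M.ract_closed)
qed

lemma submodule_zero: "right_module A M ==> right_submodule A M {0[M]}"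
proof -
 assume M: "right_module A M"
 interpret M: right_module A M by fact
 show ?thesis by(rule right_submoduleI[OF M]) auto
qed

lemma submodule_Int:
 "right_module A M ==> right_submodule A M N ==> right_submodule A M N' ==> right_submodule A M (N \<inter> N')"
 using right_submoduleD by(intro right_submoduleI) (auto dest: right_submoduleD)

lemma submodule_image:
 assumes M: "right_module A M" and N: "right_module A N" and f: "f:mod_hom A M N"
  and U: "right_submodule A M U"
 shows "right_submodule A N (f ` U)"
proof -
 note UD = right_submoduleD[OF M U]
 have c: "x:U ==> x:car M" for x using UD(1) by auto
 show ?thesis
 proof (rule right_submoduleI[OF N])
  show "f ` U <= car N" using c mod_homD(1)[OF f] by auto
  show "0[N]:f ` U" using mod_hom_zero[OF M N f] UD(2) by(metis imageI)
  show "x +[N] y:f ` U" if xy: "x:f ` U" "y:f ` U" for x y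
  proof -
   obtain u v where "x = f u" "y = f v" "u:U" "v:U" using xy by auto
   thus ?thesis using mod_homD(2)[OF f, of u v] UD(3)[of u v] c by(metis imageI)
  qed
  show "x *[N] a:f ` U" if xy: "x:f ` U" "a:car A" for x a
  proof -
   obtain u where "x = f u" "u:U" using xy by auto
   thus ?thesis using mod_homD(3)[OF f, of u a] UD(4)[of u a] c xy(2) by(metis imageI)
  qed
 qed
qed

lemma submodule_vimage:
 assumes M: "right_module A M" and N: "right_module A N" and f: "f:mod_hom A M N"
  and U: "right_submodule A N U"
 shows "right_submodule A M {x:car M. f x:U}"
proof -
 interpret M: right_module A M by fact
 note UD = right_submoduleD[OF N U]
 show ?thesis
  by(rule right_submoduleI[OF M])
   (use UD mod_homD[OF f] mod_hom_zero[OF M N f] M.ract_closed in auto)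
qed

lemma mod_hom_factor:
 assumes M: "right_module A M" and N: "right_module A N" and P: "right_module A P"
  and f: "f:mod_hom A M N" "f ` car M = car N" and g: "g:mod_hom A M P"
  and ker: "!!x. x:car M ==> f x = 0[N] ==> g x = 0[P]"
 shows "EX h:mod_hom A N P. ALL x:car M. h (f x) = g x"
proof -
 interpret M: right_module A M by fact
 interpret N: right_module A N by fact
 interpret P: right_module A P by fact
 have eq: "g x = g y" if xy: "x:car M" "y:car M" "f x = f y" for x y
 proof -
  have "f (x \<ominus>\<^bsub>M\<^esub> y) = 0[N]"
   using mod_hom_diff[OF M N f(1)] N.M.diff_self mod_homD(1)[OF f(1)] xy by simp
  hence "g (x \<ominus>\<^bsub>M\<^esub> y) = 0[P]" using ker xy by simp
  hence "g x \<ominus>\<^bsub>P\<^esub> g y = 0[P]" using mod_hom_diff[OF M P g] xy by simp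
  thus ?thesis using P.M.diff_eq_zero_iff mod_homD(1)[OF g] xy by simp
 qed
 define h where "h y = g (SOME x. x:car M & f x = y)" for y
 have h: "h (f x) = g x" if "x:car M" for x
 proof -
  have "(SOME x'. x':car M & f x' = f x):car M & f (SOME x'. x':car M & f x' = f x) = f x"
   by(rule someI[where x = x]) (use that in auto)
  thus ?thesis unfolding h_def using eq that by blast
 qed
 have "h:mod_hom A N P"
 proof (rule mod_homI)
  fix y assume "y:car N"
  then obtain x where "x:car M" "y = f x" using f(2) by blast
  thus "h y:car P" using h mod_homD(1)[OF g] by simp
 next
  fix y y' assume "y:car N" "y':car N"
  then obtain x x' where x: "x:car M" "y = f x" "x':car M" "y' = f x'" using f(2) by blast
  hence "y +[N] y' = f (x +[M] x')" using mod_homD(2)[OF f(1)] by simp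
  thus "h (y +[N] y') = h y +[P] h y'" using x h mod_homD(2)[OF g] by simp
 next
  fix y a assume "y:car N" and a: "a:car A"
  then obtain x where x: "x:car M" "y = f x" using f(2) by blast
  hence "y *[N] a = f (x *[M] a)" using mod_homD(3)[OF f(1)] a by simp
  thus "h (y *[N] a) = h y *[P] a" using x h mod_homD(3)[OF g] a M.ract_closed by simp
 qed
 thus ?thesis using h by blast
qed

lemma quot_mod_facts:
 assumes M: "right_module A M" and N: "right_submodule A M N"
 shows "right_module A (quot_mod M N)"
  and "(%x. N +>\<^bsub>M\<^esub> x):mod_hom A M (quot_mod M N)"
  and "(%x. N +>\<^bsub>M\<^esub> x) ` car M = car (quot_mod M N)"
  and "x:car M ==> N +>\<^bsub>M\<^esub> x = 0[quot_mod M N] <-> x:N"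
proof -
 interpret M: right_module A M by fact
 note ND = right_submoduleD[OF M N]
 interpret N: abelian_subgroup N M
  using ND(7) M.M.abelian_group_axioms by(intro abelian_subgroupI3)
 let ?Q = "quot_mod M N"
 have car: "car ?Q = (%x. N +>\<^bsub>M\<^esub> x) ` car M"
  by(auto simp: quot_mod_def A_RCOSETS_def')
 have add: "(N +>\<^bsub>M\<^esub> x) +[?Q] (N +>\<^bsub>M\<^esub> y) = N +>\<^bsub>M\<^esub> (x +[M] y)"
  if "x:car M" "y:car M" for x y
  using that by(simp add: quot_mod_def N.a_rcos_sum)
 have zero: "0[?Q] = N +>\<^bsub>M\<^esub> 0[M]" using ND(1) by(simp add: quot_mod_def)
 have rc: "y:N +>\<^bsub>M\<^esub> x <-> y \<ominus>\<^bsub>M\<^esub> x:N" if "x:car M" "y:car M" for x y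
  using that N.a_rcos_module by(simp add: a_minus_def)
 have eqI: "N +>\<^bsub>M\<^esub> x = N +>\<^bsub>M\<^esub> y <-> x \<ominus>\<^bsub>M\<^esub> y:N" if "x:car M" "y:car M" for x y
  using that rc[of y x] N.a_rcos_self[of x] N.a_repr_independence'[of x y] by auto
 have act: "(N +>\<^bsub>M\<^esub> x) *[?Q] a = N +>\<^bsub>M\<^esub> (x *[M] a)" if x: "x:car M" and a: "a:car A" for x a
 proof -
  have st: "N +>\<^bsub>M\<^esub> (y *[M] a) = N +>\<^bsub>M\<^esub> (x *[M] a)" if y: "y:N +>\<^bsub>M\<^esub> x" for y
  proof -
   have yc: "y:car M" using y x N.a_elemrcos_carrier by blast
   hence "y \<ominus>\<^bsub>M\<^esub> x:N" using rc x y by blast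
   hence "(y \<ominus>\<^bsub>M\<^esub> x) *[M] a:N" using ND(4) a by blast
   thus ?thesis using eqI yc x a M.ract_closed by(simp add: M.ract_diff_left)
  qed
  have ne: "N +>\<^bsub>M\<^esub> x ~= {}" using N.a_rcos_self[OF x] by blast
  show ?thesis using SUP_eq_const[OF ne, of "%y. N +>\<^bsub>M\<^esub> (y *[M] a)" "N +>\<^bsub>M\<^esub> (x *[M] a)"] st
   by(simp add: quot_mod_def)
 qed
 have ab: "abelian_group ?Q"
 proof (rule abelian_groupI)
  fix X assume "X:car ?Q"
  then obtain x where x: "x:car M" "X = N +>\<^bsub>M\<^esub> x" unfolding car by auto
  thus "EX Y:car ?Q. Y +[?Q] X = 0[?Q]"
   by(intro bexI[of _ "N +>\<^bsub>M\<^esub> (\<ominus>\<^bsub>M\<^esub> x)"]) (auto simp: add zero car M.M.l_neg)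
 qed (auto simp: car add zero M.M.a_ac)
 show "right_module A ?Q"
  by(rule right_moduleI[OF M.A.ring_axioms ab])
   (auto simp: car act add M.ract_closed M.ract_add_left M.ract_add_right M.ract_assoc M.ract_one)
 show "(%x. N +>\<^bsub>M\<^esub> x):mod_hom A M ?Q"
  by(rule mod_homI) (auto simp: car add act)
 show "(%x. N +>\<^bsub>M\<^esub> x) ` car M = car ?Q" using car by simp
 show "N +>\<^bsub>M\<^esub> x = 0[?Q] <-> x:N" if "x:car M"
  using eqI[OF that, of "0[M]"] that by(simp add: zero a_minus_def)
qed

definition transport_mod :: "('m => 'l) => ('a, 'm) right_mod => ('a, 'l) right_mod" where
 "transport_mod f M = (let g = inv_into (car M) f in
  \<lparr>carrier = f ` car M, mult = undefined, one = undefined, zero = f 0[M],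
   add = %x y. f (g x +[M] g y), ract = %x a. f (g x *[M] a)\<rparr>)"

lemma transport_mod_facts:
 assumes M: "right_module A M" and f: "inj_on f (car M)"
 shows "right_module A (transport_mod f M)" "f:mod_hom A M (transport_mod f M)"
  "bij_betw f (car M) (car (transport_mod f M))"
proof -
 interpret M: right_module A M by fact
 let ?T = "transport_mod f M"
 have s: "car ?T = f ` car M" "0[?T] = f 0[M]"
  "!!x y. x:car M ==> y:car M ==> f x +[?T] f y = f (x +[M] y)"
  "!!x a. x:car M ==> f x *[?T] a = f (x *[M] a)"
  by(auto simp: transport_mod_def Let_def f)
 have "abelian_group ?T"
 proof (rule abelian_groupI)
  fix X assume "X:car ?T"
  then obtain x where "x:car M" "X = f x" using s by auto
  thus "EX Y:car ?T. Y +[?T] X = 0[?T]"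
   by(intro bexI[of _ "f (\<ominus>\<^bsub>M\<^esub> x)"]) (auto simp: s M.M.l_neg)
 qed (auto simp: s M.M.a_ac)
 thus "right_module A ?T"
  by(rule right_moduleI[OF M.A.ring_axioms])
   (auto simp: s M.ract_closed M.ract_add_left M.ract_add_right M.ract_assoc M.ract_one)
 show "f:mod_hom A M ?T" by(rule mod_homI) (auto simp: s)
 show "bij_betw f (car M) (car ?T)" using f s by(simp add: bij_betw_def)
qed

text \<open>The same assumption as \<open>fd_algebra\<close>, with the operations of
  \<open>K\<close> and of \<open>A\<close> under separate prefixes.\<close>

locale fd_alg = F: field K + A: ring A
 for K :: "'k ring" and A :: "('k, 'a) module" (structure) +
 assumes fd: "fd_algebra K A"
begin

lemma module_KA: "module K A"
 by(rule fd_algebra.axioms(1)[OF fd])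

lemmas smult_closed [simp, intro] = module.smult_closed[OF module_KA]
 and smult_l_distr = module.smult_l_distr[OF module_KA]
 and smult_r_distr = module.smult_r_distr[OF module_KA]
 and smult_assoc1 = module.smult_assoc1[OF module_KA]
 and smult_one [simp] = module.smult_one[OF module_KA]

lemma smult_mult:
 "[|k:car K; x:car A; y:car A|] ==>
  (k \<odot> x)**y = k \<odot> (x**y)"
 "[|k:car K; x:car A; y:car A|] ==>
  x**(k \<odot> y) = k \<odot> (x**y)"
 by(rule fd_algebra.smult_mult_left[OF fd] fd_algebra.smult_mult_right[OF fd]; assumption)+

sublocale vsA: vector_space_on K A "smult A"
 by unfold_locales
  (auto simp: smult_l_distr smult_r_distr smult_assoc1)

lemma smult_eq_mult:
 "[|k:car K; x:car A|] ==> k \<odot> x = x**(k \<odot> \<one>)"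
 "[|k:car K; x:car A|] ==> k \<odot> x = (k \<odot> \<one>)**x"
 by(simp_all add: smult_mult)

lemma fin_dim_A: "vsA.fin_dim"
proof -
 obtain B where B: "finite B" "B <= car A"
  "!!x. x:car A ==> EX c:B \<rightarrow> car K. x = (\<Oplus>b\<in>B. c b \<odot> b)"
  using fd_algebra.finite_dim[OF fd] by blast
 have "U = car A" if U: "vsA.subspace U" "B <= U" for U
 proof
  show "U <= car A" using vsA.subspaceD(1)[OF U(1)] .
  show "car A <= U"
  proof
   fix x assume "x:car A"
   then obtain c where c: "c:B \<rightarrow> car K" "x = (\<Oplus>b\<in>B. c b \<odot> b)" using B(3) by blast
   show "x:U" unfolding c(2)
    by(rule vsA.subspace_finsum[OF U(1) B(1)]) (use vsA.subspaceD(4)[OF U(1)] c(1) U(2) in auto)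
  qed
 qed
 thus ?thesis using B(1,2) vsA.fin_dim_iff_finite by blast
qed

lemma vs_module:
 assumes M: "right_module A M"
 shows "vector_space_on K M (kscale A M)"
proof -
 interpret M: right_module A M by fact
 show ?thesis
 proof (unfold_locales, goal_cases)
  case (4 k l x)
  have "(k **[K] l) \<odot> \<one> = (l \<odot> \<one>)**(k \<odot> \<one>)"
   using 4 by(simp add: smult_mult smult_assoc1)
  thus ?case using 4 by(simp add: kscale_def M.ract_assoc)
 qed (auto simp: kscale_def M.ract_closed M.ract_add_left M.ract_add_right M.ract_one
   smult_l_distr)
qed

lemma kscale_ract:
 assumes M: "right_module A M" and "k:car K" "x:car M" "a:car A"
 shows "kscale A M k (x *[M] a) = kscale A M k x *[M] a" "kscale A M k (x *[M] a) = x *[M] (k \<odot> a)"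
proof -
 interpret M: right_module A M by fact
 show "kscale A M k (x *[M] a) = kscale A M k x *[M] a" "kscale A M k (x *[M] a) = x *[M] (k \<odot> a)"
  using assms by(simp_all add: kscale_def smult_mult flip: M.ract_assoc)
qed

lemma submodule_subspace:
 assumes M: "right_module A M" and N: "right_submodule A M N"
 shows "vector_space_on.subspace K M (kscale A M) N"
proof -
 interpret V: vector_space_on K M "kscale A M" by(rule vs_module[OF M])
 show ?thesis
  by(rule V.subspaceI) (use right_submoduleD[OF M N] in \<open>auto simp: kscale_def\<close>)
qed

abbreviation fdim :: "('a, 'm) right_mod => bool" where
 "fdim M == vector_space_on.fin_dim K M (kscale A M)"

text \<open>Products of module generators with a spanning set of \<open>A\<close> span the module;
  conversely a spanning set generates, because submodules are subspaces.\<close>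

lemma fg_module_iff: "fg_module A M <-> right_module A M & fdim M"
proof -
 have "finitely_generated A M <-> fdim M" if M: "right_module A M"
 proof -
  interpret M: right_module A M by fact
  interpret V: vector_space_on K M "kscale A M" by(rule vs_module[OF M])
  show ?thesis
  proof
   assume fdim: "fdim M"
   then obtain S where S: "finite S" "S <= car M" "!!U. V.subspace U ==> S <= U ==> U = car M"
    using V.fin_dim_iff_finite by blast
   thus "finitely_generated A M"
    unfolding finitely_generated_def using submodule_subspace[OF M] by blast
  next
   assume "finitely_generated A M"
   then obtain S where S: "finite S" "S <= car M"
    "!!N. right_submodule A M N ==> S <= N ==> N = car M"
    unfolding finitely_generated_def by blast
   obtain B where B: "finite B" "B <= car A" "!!U. vsA.subspace U ==> B <= U ==> U = car A"
    using fin_dim_A vsA.fin_dim_iff_finite by blast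
   define T where "T = (%(s, b). s *[M] b) ` (S \<times> B)"
   have T: "finite T" "T <= car M"
    using S(1,2) B(1,2) by(auto simp: T_def intro!: M.ract_closed)
   have "U = car M" if U: "V.subspace U" "T <= U" for U
   proof -
    note UD = V.subspaceD[OF U(1)]
    have sA: "s *[M] a:U" if s: "s:S" and a: "a:car A" for s a
    proof -
     have sM: "s:car M" using s S by auto
     let ?W = "{a:car A. s *[M] a:U}"
     have "vsA.subspace ?W"
     proof (rule vsA.subspaceI)
      fix k x assume k: "k:car K" and x: "x:?W"
      hence "s *[M] (k \<odot> x) = kscale A M k (s *[M] x)" using kscale_ract(2)[OF M k sM] by simp
      thus "k \<odot> x:?W" using k x UD(4) by auto
     qed (use sM UD in \<open>auto simp: M.ract_add_right\<close>)
     moreover have "B <= ?W" using U(2) B(2) s by(auto simp: T_def)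
     ultimately show ?thesis using B(3) a by blast
    qed
    \<comment> \<open>The largest submodule inside the subspace \<open>U\<close>; the hypothesis on
      generators speaks about submodules only.\<close>
    let ?N = "{x:U. ALL a:car A. x *[M] a:U}"
    have "right_submodule A M ?N"
    proof (rule right_submoduleI[OF M])
     show "?N <= car M" using UD(1) by auto
     show "0[M]:?N" using UD(2) by auto
     show "x +[M] y:?N" if "x:?N" "y:?N" for x y
      using that UD(1,3) by(auto simp: M.ract_add_left subset_iff)
     show "x *[M] a:?N" if "x:?N" "a:car A" for x a
      using that UD(1) by(auto simp: subset_iff simp flip: M.ract_assoc)
    qed
    moreover have "S <= ?N"
    proof
     fix s assume s: "s:S"
     hence "s *[M] \<one>:U" using sA by simp
     moreover have "s *[M] \<one> = s" using s S(2) M.ract_one by auto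
     ultimately show "s:?N" using sA s by auto
    qed
    ultimately have "?N = car M" using S(3) by blast
    thus ?thesis using UD(1) by blast
   qed
   thus "fdim M" using T V.fin_dim_iff_finite by blast
  qed
 qed
 thus ?thesis by(auto simp: fg_module_def)
qed

lemma fg_right_module: "fg_module A M ==> right_module A M"
 by(simp add: fg_module_def)

lemma fg_image:
 assumes M: "fg_module A M" and N: "right_module A N" and f: "f:mod_hom A M N"
  "f ` car M = car N"
 shows "fg_module A N"
proof -
 have rM: "right_module A M" using M by(rule fg_right_module)
 obtain S where S: "finite S" "S <= car M"
  "!!N. right_submodule A M N ==> S <= N ==> N = car M"
  using M unfolding fg_module_def finitely_generated_def by blast
 have "U = car N" if U: "right_submodule A N U" "f ` S <= U" for U
 proof -
  have "{x:car M. f x:U} = car M"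
   using S(3)[OF submodule_vimage[OF rM N f(1) U(1)]] U(2) S(2) by auto
  hence "f ` car M <= U" by auto
  thus ?thesis using f(2) right_submoduleD(1)[OF N U(1)] by auto
 qed
 thus ?thesis
  using N S(1) S(2) f(2) unfolding fg_module_def finitely_generated_def
  by(intro conjI exI[of _ "f ` S"]) (auto intro!: mod_homD(1)[OF f(1)])
qed

text \<open>Finite dimensionality passes to subspaces, whereas an argument with module generators
  would call for a chain condition.\<close>

lemma fg_sub:
 assumes M: "fg_module A M" and N: "right_submodule A M N"
 shows "fg_module A (sub_mod M N)"
proof -
 have rM: "right_module A M" using M by(rule fg_right_module)
 interpret V: vector_space_on K M "kscale A M" by(rule vs_module[OF rM])
 have sN: "V.subspace N" by(rule submodule_subspace[OF rM N])
 have fM: "V.fin_dim" using M fg_module_iff by blast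
 obtain b d where b: "range b <= N" "N = V.span b d"
  using V.subspace_span_ex[OF fM sN] by blast
 have rN: "right_module A (sub_mod M N)" by(rule sub_mod_right_module[OF rM N])
 interpret W: vector_space_on K "sub_mod M N" "kscale A (sub_mod M N)" by(rule vs_module[OF rN])
 have "W.span b i = V.span b i" for i by(induct i) (auto simp: kscale_def)
 hence "W.fin_dim" unfolding W.fin_dim_def using b by(intro exI[of _ b] exI[of _ d]) auto
 thus ?thesis using fg_module_iff rN by blast
qed

lemma fg_quot:
 assumes M: "fg_module A M" and N: "right_submodule A M N"
 shows "fg_module A (quot_mod M N)"
 using fg_image[OF M] quot_mod_facts[OF fg_right_module[OF M] N] by blast

lemma fg_iso:
 "fg_module A M ==> right_module A N ==> f:mod_hom A M N ==>
  bij_betw f (car M) (car N) ==> fg_module A N"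
 using fg_image by(auto simp: bij_betw_def)

text \<open>Injectivity and injective dimension quantify over modules on \<open>nat => 'k\<close>; a
  finitely generated module is moved there whenever it has to enter such a quantifier.\<close>

lemma small_copy:
 assumes M: "fg_module A M"
 obtains X :: "('k, 'a) small_mod" and f where
  "fg_module A X" "f:mod_hom A M X" "bij_betw f (car M) (car X)"
proof -
 have rM: "right_module A M" using M by(rule fg_right_module)
 interpret V: vector_space_on K M "kscale A M" by(rule vs_module[OF rM])
 obtain f :: "_ => nat => 'k" where f: "inj_on f (car M)"
  using V.coordinates_ex M fg_module_iff by blast
 note T = transport_mod_facts[OF rM f]
 show ?thesis
  by(rule that[of "transport_mod f M" f]) (use T fg_iso[OF M T(1)] in auto)
qed

lemma regular_right_module: "right_module A (regular A)"
proof -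
 have "abelian_group (regular A)"
  by(rule abelian_groupI)
   (auto simp: regular_def A.a_ac intro: bexI[of _ "\<ominus> _"] A.l_neg)
 thus ?thesis
  by(rule right_moduleI[OF A.ring_axioms])
   (auto simp: regular_def A.l_distr A.r_distr A.m_assoc)
qed

lemma regular_fg: "fg_module A (regular A)"
proof -
 have "N = car (regular A)" if N: "right_submodule A (regular A) N" "{\<one>} <= N" for N
 proof
  show "N <= car (regular A)" using right_submoduleD(1)[OF regular_right_module N(1)] .
  show "car (regular A) <= N"
  proof
   fix a assume "a:car (regular A)"
   thus "a:N" using right_submoduleD(4)[OF regular_right_module N(1), of "\<one>" a] N(2)
    by(simp add: regular_def)
  qed
 qed
 thus ?thesis
  using regular_right_module unfolding fg_module_def finitely_generated_def
  by(intro conjI exI[of _ "{\<one>}"]) (auto simp: regular_def)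
qed

end

lemma fd_algI: "fd_algebra K A ==> fd_alg K A"
 unfolding fd_alg_def fd_alg_axioms_def fd_algebra_def by auto

section \<open>Injective modules and injective dimension\<close>

definition dsum :: "('a, 'm) right_mod => ('a, 'l) right_mod => ('a, 'm \<times> 'l) right_mod" where
 "dsum M N = \<lparr>carrier = car M \<times> car N, mult = undefined, one = undefined,
   zero = (0[M], 0[N]),
   add = %x y. (fst x +[M] fst y, snd x +[N] snd y),
   ract = %x a. (fst x *[M] a, snd x *[N] a)\<rparr>"

lemma dsum_simps [simp]:
 "car (dsum M N) = car M \<times> car N"
 "0[dsum M N] = (0[M], 0[N])"
 "(x, y) +[dsum M N] (x', y') = (x +[M] x', y +[N] y')"
 "(x, y) *[dsum M N] a = (x *[M] a, y *[N] a)"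
 by(simp_all add: dsum_def)

lemma dsum_right_module:
 assumes M: "right_module A M" and N: "right_module A N"
 shows "right_module A (dsum M N)"
proof -
 interpret M: right_module A M by fact
 interpret N: right_module A N by fact
 have "abelian_group (dsum M N)"
 proof (rule abelian_groupI)
  fix x assume "x:car (dsum M N)"
  thus "EX y:car (dsum M N). y +[dsum M N] x = 0[dsum M N]"
   by(intro bexI[of _ "(\<ominus>\<^bsub>M\<^esub> fst x, \<ominus>\<^bsub>N\<^esub> snd x)"]) (auto simp: M.M.l_neg N.M.l_neg)
 qed (auto simp: M.M.a_ac N.M.a_ac)
 thus ?thesis
  by(intro right_moduleI M.A.ring_axioms)
   (auto simp: M.ract_closed N.ract_closed M.ract_add_left N.ract_add_left
    M.ract_add_right N.ract_add_right M.ract_assoc N.ract_assoc M.ract_one N.ract_one)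
qed

lemma dsum_homs:
 assumes M: "right_module A M" and N: "right_module A N"
 shows "fst:mod_hom A (dsum M N) M" "snd:mod_hom A (dsum M N) N"
  "(%x. (x, 0[N])):mod_hom A M (dsum M N)" "(%y. (0[M], y)):mod_hom A N (dsum M N)"
proof -
 interpret M: right_module A M by fact
 interpret N: right_module A N by fact
 show "fst:mod_hom A (dsum M N) M" "snd:mod_hom A (dsum M N) N"
  "(%x. (x, 0[N])):mod_hom A M (dsum M N)" "(%y. (0[M], y)):mod_hom A N (dsum M N)"
  by(rule mod_homI; auto)+
qed

lemma dsum_pair_hom:
 "f:mod_hom A P M ==> g:mod_hom A P N ==> (%x. (f x, g x)):mod_hom A P (dsum M N)"
 by(rule mod_homI) (auto simp: mod_homD)

definition ses :: "('k, 'a) module => ('a, 'm) right_mod => ('m => 'l) => ('a, 'l) right_mod =>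
  ('l => 'p) => ('a, 'p) right_mod => bool" where
 "ses A M i E p C <-> i:mod_hom A M E & inj_on i (car M) & p:mod_hom A E C &
   p ` car E = car C & (ALL x:car E. p x = 0[C] <-> x:i ` car M)"

lemma sesD:
 assumes "ses A M i E p C"
 shows "i:mod_hom A M E" "inj_on i (car M)" "p:mod_hom A E C" "p ` car E = car C"
  "x:car E ==> p x = 0[C] <-> x:i ` car M"
  "m:car M ==> p (i m) = 0[C]"
 using assms unfolding ses_def by(auto simp: mod_homD)

text \<open>Replacing modules by small copies changes the types in a sequence, so its maps are
  conjugated by the isomorphisms.\<close>

lemma ses_iso:
 assumes s: "ses A M i E p C" and M: "right_module A M'" "right_module A M" and E: "right_module A E" "right_module A C"
  "right_module A C'"
  and a: "a:mod_hom A M' M" "bij_betw a (car M') (car M)"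
  and b: "b:mod_hom A E E'" "bij_betw b (car E) (car E')"
  and c: "c:mod_hom A C C'" "bij_betw c (car C) (car C')"
 shows "ses A M' (%x. b (i (a x))) E' (%y. c (p (inv_into (car E) b y))) C'"
proof -
 note S = sesD[OF s]
 let ?b' = "inv_into (car E) b"
 have b': "?b':mod_hom A E' E" "bij_betw ?b' (car E') (car E)"
  using mod_hom_inv[OF b E(1)] bij_betw_inv_into[OF b(2)] by auto
 have bb: "b (?b' y) = y" if "y:car E'" for y
  using that b(2) by(simp add: bij_betw_inv_into_right)
 have bb': "?b' (b x) = x" if "x:car E" for x
  using that b(2) by(simp add: bij_betw_inv_into_left)
 have cz: "c x = 0[C'] <-> x = 0[C]" if "x:car C" for x
  using that mod_hom_inj_iff[OF E(2,3) c(1)] c(2) mod_hom_zero[OF E(2,3) c(1)]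
  by(auto simp: bij_betw_def)
 have "b ` i ` a ` car M' = b ` i ` car M" using a(2) by(simp add: bij_betw_def)
 hence im: "(%x. b (i (a x))) ` car M' = b ` i ` car M" by(simp add: image_image)
 have iE: "i ` car M <= car E" using mod_homD(1)[OF S(1)] by auto
 show ?thesis unfolding ses_def
 proof (intro conjI ballI)
  show "(%x. b (i (a x))):mod_hom A M' E'"
   using mod_hom_comp[OF mod_hom_comp[OF a(1) S(1)] b(1)] .
  show "inj_on (%x. b (i (a x))) (car M')"
  proof (rule inj_onI)
   fix x y assume xy: "x:car M'" "y:car M'" "b (i (a x)) = b (i (a y))"
   hence "i (a x) = i (a y)" using b(2) mod_homD(1)[OF S(1)] mod_homD(1)[OF a(1)]
    by(meson bij_betw_imp_inj_on inj_onD)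
   hence "a x = a y" using S(2) xy mod_homD(1)[OF a(1)] by(meson inj_onD)
   thus "x = y" using a(2) xy by(meson bij_betw_imp_inj_on inj_onD)
  qed
  show "(%y. c (p (?b' y))):mod_hom A E' C'"
   using mod_hom_comp[OF mod_hom_comp[OF b'(1) S(3)] c(1)] .
  have "c ` p ` ?b' ` car E' = car C'" using b'(2) S(4) c(2) by(simp add: bij_betw_def)
  thus "(%y. c (p (?b' y))) ` car E' = car C'" by(simp add: image_image)
  fix y assume y: "y:car E'"
  hence y': "?b' y:car E" using mod_homD(1)[OF b'(1)] by auto
  have "c (p (?b' y)) = 0[C'] <-> ?b' y:i ` car M"
   using cz mod_homD(1)[OF S(3) y'] S(5)[OF y'] by simp
  also have "\<dots> <-> y:b ` i ` car M"
   using bb[OF y] bb' iE by(metis image_iff subsetD)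
  finally show "c (p (?b' y)) = 0[C'] <-> y:(%x. b (i (a x))) ` car M'" using im by simp
 qed
qed

context fd_alg
begin

lemma dsum_fg:
 assumes "fg_module A M" "fg_module A N"
 shows "fg_module A (dsum M N)"
proof -
 note M = fg_right_module[OF assms(1)] and N = fg_right_module[OF assms(2)]
 note MN = dsum_right_module[OF M N] and H = dsum_homs[OF M N]
 interpret M: right_module A M by fact
 interpret N: right_module A N by fact
 obtain S where S: "finite S" "S <= car M"
  "!!U. right_submodule A M U ==> S <= U ==> U = car M"
  using assms(1) unfolding fg_module_def finitely_generated_def by blast
 obtain T where T: "finite T" "T <= car N"
  "!!U. right_submodule A N U ==> T <= U ==> U = car N"
  using assms(2) unfolding fg_module_def finitely_generated_def by blast
 let ?S = "(%x. (x, 0[N])) ` S \<union> (%y. (0[M], y)) ` T"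
 have "U = car (dsum M N)" if U: "right_submodule A (dsum M N) U" "?S <= U" for U
 proof -
  note UD = right_submoduleD[OF MN U(1)]
  have "{x:car M. (x, 0[N]):U} = car M"
   by(rule S(3)[OF submodule_vimage[OF M MN H(3) U(1)]]) (use U(2) S in auto)
  moreover have "{y:car N. (0[M], y):U} = car N"
   by(rule T(3)[OF submodule_vimage[OF N MN H(4) U(1)]]) (use U(2) T in auto)
  ultimately have "(x, y):U" if "x:car M" "y:car N" for x y
   using UD(3)[of "(x, 0[N])" "(0[M], y)"] that by auto
  thus ?thesis using UD(1) by auto
 qed
 moreover have "finite ?S" "?S <= car (dsum M N)" using S T by auto
 ultimately show ?thesis using MN unfolding fg_module_def finitely_generated_def by blast
qed

lemma injective_fg: "injective_module A E ==> fg_module A E"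
 by(simp add: injective_module_def)

text \<open>Frees the extension property from the carrier type in \<open>injective_module\<close>:
  the problem is copied to small modules and its solution pulled back.\<close>

lemma injective_extend:
 assumes E: "injective_module A E" and X: "fg_module A X" and Y: "fg_module A Y"
  and f: "f:mod_hom A X Y" "inj_on f (car X)" and g: "g:mod_hom A X E"
 shows "EX h:mod_hom A Y E. ALL x:car X. h (f x) = g x"
proof -
 obtain X' :: "('k, 'a) small_mod" and a where a: "fg_module A X'" "a:mod_hom A X X'"
  "bij_betw a (car X) (car X')" using small_copy[OF X] .
 obtain Y' :: "('k, 'a) small_mod" and b where b: "fg_module A Y'" "b:mod_hom A Y Y'"
  "bij_betw b (car Y) (car Y')" using small_copy[OF Y] .
 let ?a' = "inv_into (car X) a"
 have a': "?a':mod_hom A X' X" using mod_hom_inv[OF a(2,3) fg_right_module[OF X]] .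
 have bij: "bij_betw ?a' (car X') (car X)" using bij_betw_inv_into[OF a(3)] .
 have inj: "inj_on (%x. b (f (?a' x))) (car X')"
 proof (rule inj_onI)
  fix x y assume xy: "x:car X'" "y:car X'" "b (f (?a' x)) = b (f (?a' y))"
  have c: "?a' x:car X" "?a' y:car X" using mod_homD(1)[OF a'] xy by auto
  hence "f (?a' x) = f (?a' y)" using b(3) xy(3) mod_homD(1)[OF f(1)]
   by(meson bij_betw_imp_inj_on inj_onD)
  hence "?a' x = ?a' y" using c f(2) by(meson inj_onD)
  thus "x = y" using bij xy by(meson bij_betw_imp_inj_on inj_onD)
 qed
 have "EX h:mod_hom A Y' E. ALL x:car X'. h (b (f (?a' x))) = g (?a' x)"
 proof -
  have ext: "ALL (X :: ('k, 'a) small_mod) (Y :: ('k, 'a) small_mod). ALL f:mod_hom A X Y. ALL g:mod_hom A X E.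
    fg_module A X --> fg_module A Y --> inj_on f (car X) -->
    (EX h:mod_hom A Y E. ALL x:car X. h (f x) = g x)"
   using E by(simp add: injective_module_def)
  show ?thesis
   by(rule ext[rule_format]; fact a(1) b(1) inj mod_hom_comp[OF mod_hom_comp[OF a' f(1)] b(2)]
    mod_hom_comp[OF a' g])
 qed
 then obtain h where h: "h:mod_hom A Y' E" "!!x. x:car X' ==> h (b (f (?a' x))) = g (?a' x)" by blast
 have "h (b (f x)) = g x" if "x:car X" for x
  using h(2)[of "a x"] that a(3) mod_homD(1)[OF a(2)] by(simp add: bij_betw_inv_into_left)
 thus ?thesis using mod_hom_comp[OF b(2) h(1)] by(intro bexI[of _ "%x. h (b x)"]) auto
qed

lemma injective_retract:
 assumes E: "injective_module A E" and F: "fg_module A F"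
  and i: "i:mod_hom A F E" and p: "p:mod_hom A E F" and pi: "!!x. x:car F ==> p (i x) = x"
 shows "injective_module A F"
 unfolding injective_module_def
proof (intro conjI allI ballI impI F)
 fix X Y :: "('k, 'a) small_mod" and f g
 assume f: "f:mod_hom A X Y" "inj_on f (car X)" and g: "g:mod_hom A X F"
  and XY: "fg_module A X" "fg_module A Y"
 obtain h where h: "h:mod_hom A Y E" "!!x. x:car X ==> h (f x) = i (g x)"
  using injective_extend[OF E XY f mod_hom_comp[OF g i]] by blast
 have "p (h (f x)) = g x" if "x:car X" for x
  using h(2)[OF that] pi mod_homD(1)[OF g that] by simp
 thus "EX h:mod_hom A Y F. ALL x:car X. h (f x) = g x"
  using mod_hom_comp[OF h(1) p] by(intro bexI[of _ "%x. p (h x)"]) auto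
qed

lemma injective_iso:
 assumes E: "injective_module A E" and F: "right_module A F"
  and f: "f:mod_hom A E F" "bij_betw f (car E) (car F)"
 shows "injective_module A F"
proof -
 have rE: "right_module A E" using E injective_fg fg_right_module by blast
 show ?thesis
  by(rule injective_retract[OF E fg_iso[OF injective_fg[OF E] F f] mod_hom_inv[OF f rE] f(1)])
   (use f(2) in \<open>simp add: bij_betw_inv_into_right\<close>)
qed

lemma injective_dsum:
 assumes E: "injective_module A E" and F: "injective_module A F"
 shows "injective_module A (dsum E F)"
 unfolding injective_module_def
proof (intro conjI allI ballI impI)
 show "fg_module A (dsum E F)" by(intro dsum_fg injective_fg E F)
 fix X Y :: "('k, 'a) small_mod" and f g
 assume f: "f:mod_hom A X Y" "inj_on f (car X)" and g: "g:mod_hom A X (dsum E F)"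
  and XY: "fg_module A X" "fg_module A Y"
 note H = dsum_homs[OF fg_right_module[OF injective_fg[OF E]] fg_right_module[OF injective_fg[OF F]]]
 obtain h where h: "h:mod_hom A Y E" "!!x. x:car X ==> h (f x) = fst (g x)"
  using injective_extend[OF E XY f mod_hom_comp[OF g H(1)]] by blast
 obtain k where k: "k:mod_hom A Y F" "!!x. x:car X ==> k (f x) = snd (g x)"
  using injective_extend[OF F XY f mod_hom_comp[OF g H(2)]] by blast
 show "EX h:mod_hom A Y (dsum E F). ALL x:car X. h (f x) = g x"
  using dsum_pair_hom[OF h(1) k(1)] h(2) k(2) by(intro bexI[of _ "%x. (h x, k x)"]) auto
qed

lemma injective_small_copy:
 assumes E: "injective_module A E"
 obtains X :: "('k, 'a) small_mod" and f where
  "injective_module A X" "f:mod_hom A E X" "bij_betw f (car E) (car X)"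
proof -
 obtain X :: "('k, 'a) small_mod" and f where f: "fg_module A X" "f:mod_hom A E X"
  "bij_betw f (car E) (car X)" using small_copy[OF injective_fg[OF E]] .
 thus ?thesis using that injective_iso[OF E] fg_right_module by blast
qed

lemma cokernel_ex:
 assumes E: "fg_module A E" and M: "right_module A M" and i: "i:mod_hom A M E" "inj_on i (car M)"
 obtains C :: "('k, 'a) small_mod" and p where "fg_module A C" "ses A M i E p C"
proof -
 note rE = fg_right_module[OF E]
 have N: "right_submodule A E (i ` car M)"
  using submodule_image[OF M rE i(1) submodule_carrier[OF M]] .
 note Q = quot_mod_facts[OF rE N] and Qf = fg_quot[OF E N]
 obtain C :: "('k, 'a) small_mod" and c where c: "fg_module A C" "c:mod_hom A (quot_mod E (i ` car M)) C"
  "bij_betw c (car (quot_mod E (i ` car M))) (car C)" using small_copy[OF Qf] .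
 let ?p = "%x. i ` car M +>\<^bsub>E\<^esub> x"
 have s: "ses A M i E ?p (quot_mod E (i ` car M))" unfolding ses_def using i Q by auto
 have "ses A M (%x. (%x. x) (i ((%x. x) x))) E (%y. c (?p (inv_into (car E) (%x. x) y))) C"
  by(rule ses_iso[OF s M M rE Q(1) fg_right_module[OF c(1)] mod_hom_id _ mod_hom_id _ c(2,3)])
   (auto simp: bij_betw_def)
 thus ?thesis using that c(1) by blast
qed

text \<open>This is \<open>Hom_K(A, M)\<close> with \<open>(f a)(x) = f (a x)\<close>. It supplies
  enough injectives without injective hulls. The maps are normalised outside \<open>car A\<close>,
  so that equality can be tested on \<open>car A\<close>.\<close>

definition coind :: "('a, 'm) right_mod => ('a, 'a => 'm) right_mod" where
 "coind M = \<lparr>carrier = {f:car A \<rightarrow>\<^sub>E car M.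
    (ALL x:car A. ALL y:car A. f (x+.y) = f x +[M] f y) &
    (ALL k:car K. ALL x:car A. f (k \<odot> x) = kscale A M k (f x))},
   mult = undefined, one = undefined, zero = \<lambda>x\<in>car A. 0[M],
   add = %f g. \<lambda>x\<in>car A. f x +[M] g x,
   ract = %f a. \<lambda>x\<in>car A. f (a**x)\<rparr>"

lemma coind_carrierD:
 assumes "f:car (coind M)"
 shows "x:car A ==> f x:car M"
  "x:car A ==> y:car A ==> f (x+.y) = f x +[M] f y"
  "k:car K ==> x:car A ==> f (k \<odot> x) = kscale A M k (f x)"
  "f:extensional (car A)"
 using assms by(auto simp: coind_def PiE_def)

lemma coind_carrierI:
 assumes "!!x. x:car A ==> f x:car M"
  "!!x y. x:car A ==> y:car A ==> f (x+.y) = f x +[M] f y"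
  "!!k x. k:car K ==> x:car A ==> f (k \<odot> x) = kscale A M k (f x)"
 shows "restrict f (car A):car (coind M)"
 using assms by(auto simp: coind_def)

lemma coind_eqI:
 "f:car (coind M) ==> g:car (coind M) ==> (!!x. x:car A ==> f x = g x) ==> f = g"
 by(meson coind_carrierD(4) extensionalityI)

lemma coind_right_module:
 assumes M: "right_module A M"
 shows "right_module A (coind M)"
proof -
 interpret M: right_module A M by fact
 interpret V: vector_space_on K M "kscale A M" by(rule vs_module[OF M])
 let ?C = "coind M"
 have ops: "0[?C] = (\<lambda>x\<in>car A. 0[M])" "f +[?C] g = (\<lambda>x\<in>car A. f x +[M] g x)"
  "f *[?C] a = (\<lambda>x\<in>car A. f (a**x))" for f g a
  by(simp_all add: coind_def)
 note D = coind_carrierD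
 have add: "f +[?C] g:car ?C" if "f:car ?C" "g:car ?C" for f g
  unfolding ops using D[OF that(1)] D[OF that(2)]
  by(intro coind_carrierI) (auto simp: M.M.a_ac V.sc_add_right)
 have zero: "0[?C]:car ?C" unfolding ops by(intro coind_carrierI) auto
 have neg: "(\<lambda>x\<in>car A. \<ominus>\<^bsub>M\<^esub> f x):car ?C" if "f:car ?C" for f
  using D[OF that] by(intro coind_carrierI) (auto simp: M.M.minus_add V.sc_minus)
 have act: "f *[?C] a:car ?C" if "f:car ?C" "a:car A" for f a
  unfolding ops using D[OF that(1)] that(2)
  by(intro coind_carrierI) (auto simp: A.r_distr smult_mult)
 have "abelian_group ?C"
 proof (rule abelian_groupI)
  fix f assume f: "f:car ?C"
  show "EX g:car ?C. g +[?C] f = 0[?C]"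
   by(rule bexI[OF _ neg[OF f]]) (use D(1)[OF f] in \<open>auto simp: ops M.M.l_neg\<close>)
 next
  fix f assume f: "f:car ?C"
  show "0[?C] \<oplus>\<^bsub>?C\<^esub> f = f"
   by(rule coind_eqI[OF add[OF zero f] f]) (use D(1)[OF f] in \<open>auto simp: ops\<close>)
 next
  fix f g h assume *: "f:car ?C" "g:car ?C" "h:car ?C"
  show "f +[?C] g +[?C] h = f +[?C] (g +[?C] h)"
   by(rule coind_eqI) (use * D(1)[OF *(1)] D(1)[OF *(2)] D(1)[OF *(3)] in \<open>auto intro!: add, auto simp: ops M.M.a_assoc\<close>)
 next
  fix f g assume *: "f:car ?C" "g:car ?C"
  show "f +[?C] g = g +[?C] f"
   by(rule coind_eqI) (use * D(1)[OF *(1)] D(1)[OF *(2)] in \<open>auto intro!: add, auto simp: ops M.M.a_comm\<close>)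
 qed (rule add zero; assumption)+
 thus ?thesis
 proof (rule right_moduleI[OF A.ring_axioms])
  fix f assume f: "f:car ?C"
  show "f *[?C] \<one> = f"
   by(rule coind_eqI[OF act[OF f] f]) (use D(1)[OF f] in \<open>auto simp: ops\<close>)
 next
  fix f g a assume *: "f:car ?C" "g:car ?C" "a:car A"
  show "(f +[?C] g) *[?C] a = f *[?C] a +[?C] g *[?C] a"
   by(rule coind_eqI) (use * in \<open>auto intro!: add act, auto simp: ops\<close>)
 next
  fix f a b assume *: "f:car ?C" "a:car A" "b:car A"
  show "f *[?C] (a+.b) = f *[?C] a +[?C] f *[?C] b"
   by(rule coind_eqI) (use * D(2)[OF *(1)] in \<open>auto intro!: add act, auto simp: ops A.l_distr\<close>)
  show "f *[?C] (a**b) = f *[?C] a *[?C] b"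
   by(rule coind_eqI) (use * in \<open>auto intro!: act, auto simp: ops A.m_assoc\<close>)
 qed (rule act; assumption)+
qed

lemma kscale_coind:
 assumes "f:car (coind M)" "k:car K" "x:car A"
 shows "kscale A (coind M) k f x = kscale A M k (f x)"
 using assms coind_carrierD(3)[OF assms(1)] by(simp add: kscale_def coind_def smult_mult)

text \<open>Evaluating at the members of a spanning family of \<open>A\<close>, one at a time, bounds the
  dimension of the coinduced module.\<close>

lemma coind_fg:
 assumes M: "fg_module A M"
 shows "fg_module A (coind M)"
proof -
 have rM: "right_module A M" using M by(rule fg_right_module)
 note rC = coind_right_module[OF rM]
 interpret M: right_module A M by fact
 interpret V: vector_space_on K M "kscale A M" by(rule vs_module[OF rM])
 interpret C: right_module A "coind M" by fact
 interpret W: vector_space_on K "coind M" "kscale A (coind M)" by(rule vs_module[OF rC])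
 have fM: "V.fin_dim" using M fg_module_iff by blast
 obtain b d where b: "range b <= car A" "car A = vsA.span b d"
  using fin_dim_A by(auto simp: vsA.fin_dim_def)
 have bA: "b i:car A" for i using b by auto
 have ops: "0[coind M] x = 0[M]" "(f +[coind M] g) x = f x +[M] g x" if "x:car A" for f g x
  using that by(simp_all add: coind_def)
 have negC: "(\<ominus>\<^bsub>coind M\<^esub> f) x = \<ominus>\<^bsub>M\<^esub> f x" if "f:car (coind M)" "x:car A" for f x
 proof -
  have "(\<ominus>\<^bsub>coind M\<^esub> f +[coind M] f) x = 0[M]" using that ops by(simp add: C.M.l_neg)
  hence "(\<ominus>\<^bsub>coind M\<^esub> f) x +[M] f x = 0[M]" using that ops by simp
  thus ?thesis using that coind_carrierD(1) M.M.minus_equality C.M.a_inv_closed by metis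
 qed
 \<comment> \<open>A descending flag from the whole module to zero; evaluation at \<open>b i\<close>
   controls each of its steps.\<close>
 define Fi where "Fi i = {f:car (coind M). ALL j<i. f (b j) = 0[M]}" for i
 have sF: "W.subspace (Fi i)" for i
  by(rule W.subspaceI) (auto simp: Fi_def ops bA kscale_coind)
 have "EX S. finite S & S <= Fi i & (ALL U. W.subspace U --> S <= U --> Fi i <= U)" if "i <= d" for i
  using that
 proof (induct i rule: inc_induct)
  case base
  have "Fi d <= {0[coind M]}"
  proof
   fix f assume f: "f:Fi d"
   hence fc: "f:car (coind M)" by(simp add: Fi_def)
   note D = coind_carrierD[OF fc]
   have "f \<zero> = 0[M]" using D(3)[of "0[K]" "\<zero>"] D(1) by simp
   hence "vsA.subspace {x:car A. f x = 0[M]}"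
    by(intro vsA.subspaceI) (auto simp: D)
   hence "vsA.span b d <= {x:car A. f x = 0[M]}"
    by(rule vsA.span_subset) (use f bA in \<open>auto simp: Fi_def\<close>)
   hence "f x = 0[M]" if "x:car A" for x using that b(2) by auto
   thus "f:{0[coind M]}" using coind_eqI[OF fc C.M.zero_closed] ops by simp
  qed
  thus ?case using W.subspaceD(2) by(intro exI[of _ "{}"]) auto
 next
  case (step i)
  then obtain S where S: "finite S" "S <= Fi (Suc i)"
   "!!U. W.subspace U ==> S <= U ==> Fi (Suc i) <= U" by blast
  have ev: "V.subspace ((%f. f (b i)) ` G)" if G: "W.subspace G" for G
  proof (rule V.subspaceI)
   note GD = W.subspaceD[OF G]
   show "(%f. f (b i)) ` G <= car M" using GD(1) coind_carrierD(1) bA by blast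
   show "0[M]:(%f. f (b i)) ` G" using GD(2) ops(1)[OF bA] by(metis imageI)
   show "x +[M] y:(%f. f (b i)) ` G" if xy: "x:(%f. f (b i)) ` G" "y:(%f. f (b i)) ` G" for x y
   proof -
    obtain f g where "x = f (b i)" "y = g (b i)" "f:G" "g:G" using xy by auto
    thus ?thesis using GD(3)[of f g] ops(2)[OF bA, of f g]
     by(intro image_eqI[of _ _ "f +[coind M] g"]) simp_all
   qed
   show "kscale A M k x:(%f. f (b i)) ` G" if xk: "k:car K" "x:(%f. f (b i)) ` G" for k x
   proof -
    obtain f where f: "x = f (b i)" "f:G" using xk by auto
    have "f:car (coind M)" using f(2) GD(1) by auto
    thus ?thesis using f GD(4)[OF xk(1) f(2)] kscale_coind[OF _ xk(1) bA, of f]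
     by(intro image_eqI[of _ _ "kscale A (coind M) k f"]) simp_all
   qed
  qed
  obtain c q where c: "range c <= (%f. f (b i)) ` Fi i" "(%f. f (b i)) ` Fi i = V.span c q"
   using V.subspace_span_ex[OF fM ev[OF sF]] by blast
  have "EX f. f:Fi i & f (b i) = c j" for j
  proof -
   have "c j:(%f. f (b i)) ` Fi i" using c(1) by blast
   thus ?thesis by auto
  qed
  then obtain s where s: "!!j. s j:Fi i" "!!j. s j (b i) = c j" by metis
  have FiSuc: "Fi (Suc i) <= Fi i" by(auto simp: Fi_def)
  have "Fi i <= U" if U: "W.subspace U" "S \<union> s ` {..<q} <= U" for U
  proof
   fix f assume f: "f:Fi i"
   have le: "V.span c q <= (%f. f (b i)) ` (U \<inter> Fi i)"
   proof (rule V.span_subset[OF ev[OF W.subspace_Int[OF U(1) sF]]])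
    fix j assume "j < q"
    hence "s j:U \<inter> Fi i" using U(2) s(1) by auto
    thus "c j:(%f. f (b i)) ` (U \<inter> Fi i)" using s(2) by(metis imageI)
   qed
   have "f (b i):V.span c q" using imageI[OF f, of "%f. f (b i)"] c(2) by simp
   hence "f (b i):(%f. f (b i)) ` (U \<inter> Fi i)" by(rule subsetD[OF le])
   then obtain u where u: "u:U" "u:Fi i" "u (b i) = f (b i)" by auto
   have car: "u:car (coind M)" "f:car (coind M)" using u f by(auto simp: Fi_def)
   have "f \<ominus>\<^bsub>coind M\<^esub> u:Fi i" using W.subspaceD(6)[OF sF f u(2)] .
   moreover have "(f \<ominus>\<^bsub>coind M\<^esub> u) (b i) = 0[M]"
    using ops(2)[OF bA] negC[OF car(1) bA] u(3) coind_carrierD(1)[OF car(2) bA]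
    by(simp add: a_minus_def M.M.r_neg)
   ultimately have "f \<ominus>\<^bsub>coind M\<^esub> u:Fi (Suc i)" by(auto simp: Fi_def less_Suc_eq)
   hence *: "f \<ominus>\<^bsub>coind M\<^esub> u:U" using S(3)[OF U(1)] U(2) by auto
   have "f = (f \<ominus>\<^bsub>coind M\<^esub> u) +[coind M] u" using car by(simp add: C.M.diff_add_cancel)
   thus "f:U" using W.subspaceD(3)[OF U(1) * u(1)] by simp
  qed
  thus ?case using S s FiSuc by(intro exI[of _ "S \<union> s ` {..<q}"]) auto
 qed
 from this[of 0] obtain S where "finite S" "S <= Fi 0" "!!U. W.subspace U ==> S <= U ==> Fi 0 <= U"
  by auto
 hence "W.fin_dim" unfolding W.fin_dim_iff_finite
  using W.subspaceD(1) by(intro exI[of _ S]) (auto simp: Fi_def)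
 thus ?thesis using fg_module_iff rC by blast
qed

text \<open>Homomorphisms into \<open>coind M\<close> correspond to linear maps into
  \<open>M\<close> by evaluation at 1, and a linear map extends along any inclusion by means of a
  linear projection onto the image.\<close>

lemma coind_injective:
 assumes M: "fg_module A M"
 shows "injective_module A (coind M)"
 unfolding injective_module_def
proof (intro conjI allI ballI impI coind_fg[OF M])
 fix X Y :: "('k, 'a) small_mod" and f g
 assume f: "f:mod_hom A X Y" "inj_on f (car X)" and g: "g:mod_hom A X (coind M)"
  and XY: "fg_module A X" "fg_module A Y"
 note rX = fg_right_module[OF XY(1)] and rY = fg_right_module[OF XY(2)] and rM = fg_right_module[OF M]
 interpret X: right_module A X by fact
 interpret Y: right_module A Y by fact
 interpret V: vector_space_on K Y "kscale A Y" by(rule vs_module[OF rY])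
 have im: "right_submodule A Y (f ` car X)"
  using submodule_image[OF rX rY f(1) submodule_carrier[OF rX]] .
 have fY: "V.fin_dim" using XY(2) by(simp add: fg_module_iff)
 obtain p where p: "!!y. y:car Y ==> p y:f ` car X" "!!y. y:f ` car X ==> p y = y"
  "!!x y. x:car Y ==> y:car Y ==> p (x +[Y] y) = p x +[Y] p y"
  "!!k x. k:car K ==> x:car Y ==> p (kscale A Y k x) = kscale A Y k (p x)"
  using V.projection_ex[OF fY submodule_subspace[OF rY im]] by blast
 have bf: "bij_betw f (car X) (car (sub_mod Y (f ` car X)))" using f(2) by(simp add: bij_betw_def)
 have f': "f:mod_hom A X (sub_mod Y (f ` car X))"
  using mod_homD[OF f(1)] by(intro mod_homI) auto
 define fi where "fi = inv_into (car X) f"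
 note fi = mod_hom_inv[OF f' bf rX, folded fi_def]
 have fif: "fi (f x) = x" if "x:car X" for x using that f(2) by(simp add: fi_def)
 \<comment> \<open>The linear map that corresponds to \<open>g\<close>, extended to \<open>Y\<close>
   by the projection \<open>p\<close>.\<close>
 define u where "u y = g (fi (p y)) \<one>" for y
 have fip: "fi (p y):car X" if "y:car Y" for y using mod_homD(1)[OF fi] p(1)[OF that] by simp
 have gC: "g x:car (coind M)" if "x:car X" for x using mod_homD(1)[OF g that] .
 have u1: "u y:car M" if "y:car Y" for y
  unfolding u_def using coind_carrierD(1)[OF gC[OF fip[OF that]]] by simp
 have u2: "u (x +[Y] y) = u x +[M] u y" if "x:car Y" "y:car Y" for x y
 proof -
  have "fi (p (x +[Y] y)) = fi (p x) +[X] fi (p y)"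
   using mod_homD(2)[OF fi, of "p x" "p y"] p(1)[OF that(1)] p(1)[OF that(2)] p(3)[OF that] by simp
  thus ?thesis unfolding u_def using mod_homD(2)[OF g fip[OF that(1)] fip[OF that(2)]]
   by(simp add: coind_def)
 qed
 have u3: "u (kscale A Y k y) = kscale A M k (u y)" if k: "k:car K" and y: "y:car Y" for k y
 proof -
  have "fi (p (kscale A Y k y)) = kscale A X k (fi (p y))"
   using mod_homD(3)[OF fi, of "p y" "k \<odot> \<one>"] p(1)[OF y] p(4)[OF k y] k by(simp add: kscale_def)
  hence "g (fi (p (kscale A Y k y))) = kscale A (coind M) k (g (fi (p y)))"
   using mod_homD(3)[OF g fip[OF y], of "k \<odot> \<one>"] k by(simp add: kscale_def)
  thus ?thesis unfolding u_def using kscale_coind[OF gC[OF fip[OF y]] k] by simp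
 qed
 have u4: "u (f x *[Y] a) = g x a" if x: "x:car X" and a: "a:car A" for x a
 proof -
  have xa: "x *[X] a:car X" using x a X.ract_closed by simp
  have "f x *[Y] a = f (x *[X] a)" using mod_homD(3)[OF f(1) x a] by simp
  hence "u (f x *[Y] a) = g (x *[X] a) \<one>" unfolding u_def using p(2) xa fif by simp
  also have "\<dots> = g x a" using mod_homD(3)[OF g x a] a by(simp add: coind_def)
  finally show ?thesis .
 qed
 define h where "h y = (\<lambda>a\<in>car A. u (y *[Y] a))" for y
 have hC: "h y:car (coind M)" if y: "y:car Y" for y unfolding h_def
 proof (rule coind_carrierI)
  fix k x assume "k:car K" "x:car A"
  thus "u (y *[Y] (k \<odot> x)) = kscale A M k (u (y *[Y] x))"
   using u3 kscale_ract(2)[OF rY _ y] Y.ract_closed[OF y] by metis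
 qed (use y u1 u2 Y.ract_closed Y.ract_add_right in auto)
 have "h:mod_hom A Y (coind M)"
 proof (rule mod_homI)
  fix x y assume xy: "x:car Y" "y:car Y"
  show "h (x +[Y] y) = h x +[coind M] h y"
   using xy u2 by(auto simp: h_def coind_def Y.ract_add_left Y.ract_closed intro!: restrict_ext)
 next
  fix x a assume xa: "x:car Y" "a:car A"
  show "h (x *[Y] a) = h x *[coind M] a"
   using xa by(auto simp: h_def coind_def Y.ract_assoc intro!: restrict_ext)
 qed (rule hC)
 moreover have "h (f x) = g x" if x: "x:car X" for x
  by(rule coind_eqI[OF hC gC[OF x]]) (use x u4 mod_homD(1)[OF f(1)] in \<open>auto simp: h_def\<close>)
 ultimately show "EX h:mod_hom A Y (coind M). ALL x:car X. h (f x) = g x" by blast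
qed

text \<open>\<open>M\<close> embeds into \<open>coind M\<close> by sending \<open>m\<close> to the
  map taking \<open>a\<close> to \<open>m a\<close>; evaluation at 1 recovers
  \<open>m\<close>.\<close>

lemma enough_injectives:
 assumes M: "fg_module A M"
 obtains E :: "('k, 'a) small_mod" and i where
  "injective_module A E" "i:mod_hom A M E" "inj_on i (car M)"
proof -
 note rM = fg_right_module[OF M]
 interpret M: right_module A M by fact
 obtain E :: "('k, 'a) small_mod" and f where f: "injective_module A E" "f:mod_hom A (coind M) E"
  "bij_betw f (car (coind M)) (car E)" using injective_small_copy[OF coind_injective[OF M]] .
 define j where "j m = (\<lambda>a\<in>car A. m *[M] a)" for m
 have jC: "j m:car (coind M)" if "m:car M" for m
  unfolding j_def using that
  by(intro coind_carrierI) (auto simp: M.ract_closed M.ract_add_right kscale_ract(2)[OF rM])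
 have j: "j:mod_hom A M (coind M)"
  by(rule mod_homI)
   (auto simp: jC, auto simp: j_def coind_def M.ract_add_left M.ract_assoc intro!: restrict_ext)
 have inj: "inj_on j (car M)"
 proof (rule inj_onI)
  fix x y assume xy: "x:car M" "y:car M" "j x = j y"
  hence "j x \<one> = j y \<one>" by simp
  thus "x = y" using xy by(simp add: j_def M.ract_one)
 qed
 have "inj_on (%x. f (j x)) (car M)"
  using inj f(3) jC by(auto simp: inj_on_def bij_betw_def)
 thus ?thesis using that f(1) mod_hom_comp[OF j f(2)] by blast
qed

end

text \<open>Injective dimension at most \<open>r\<close> as a recursion over cosyzygies. A
  resolution is chosen one step at a time, which makes proofs inductions over \<open>r\<close>;
  \<open>idp_of_inj_dim_le\<close> and \<open>inj_dim_le_of_idp\<close> translate to whole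
  resolutions and back.\<close>

primrec idp :: "('k, 'a) module => nat => ('k, 'a) small_mod => bool" where
 "idp A 0 M = injective_module A M"
| "idp A (Suc r) M = (fg_module A M & (EX (E :: ('k, 'a) small_mod) (C :: ('k, 'a) small_mod) i p.
   injective_module A E & fg_module A C &
   ses A M i E p C & idp A r C))"

section \<open>Dimension shifting\<close>

context fd_alg
begin

lemma idp_fg: "idp A r M ==> fg_module A M"
 by(cases r) (auto simp: injective_fg)

lemma idp_SucE:
 assumes "idp A (Suc r) M"
 obtains E C :: "('k, 'a) small_mod" and i p
 where "injective_module A E" "fg_module A C" "ses A M i E p C" "idp A r C"
 using assms by auto

text \<open>A variant of Schanuel's lemma for a retract \<open>M\<close> of \<open>M'\<close>.\<close>

lemma retract_cokernel:
 assumes M: "fg_module A M" "fg_module A M'" and C: "fg_module A C" "fg_module A C'"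
  and i: "i:mod_hom A M M'" and q: "q:mod_hom A M' M" and qi: "!!x. x:car M ==> q (i x) = x"
  and s: "ses A M j E p C" and s': "ses A M' j' E' p' C'"
  and E: "injective_module A E" "injective_module A E'"
 shows "EX a:mod_hom A C C'. EX b:mod_hom A C E. EX c:mod_hom A C' C. EX d:mod_hom A E C.
  ALL x:car C. c (a x) +[C] d (b x) = x"
proof -
 note S = sesD[OF s] and S' = sesD[OF s']
 note fE = injective_fg[OF E(1)] injective_fg[OF E(2)]
 note rE = fE[THEN fg_right_module] and rM = M[THEN fg_right_module] and rC = C[THEN fg_right_module]
 interpret E: right_module A E by(rule rE)
 interpret C: right_module A C by(rule rC)
 obtain \<alpha> where \<alpha>: "\<alpha>:mod_hom A E E'" "!!x. x:car M ==> \<alpha> (j x) = j' (i x)"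
  using injective_extend[OF E(2) M(1) fE(1) S(1,2) mod_hom_comp[OF i S'(1)]] by blast
 obtain \<beta> where \<beta>: "\<beta>:mod_hom A E' E" "!!x. x:car M' ==> \<beta> (j' x) = j (q x)"
  using injective_extend[OF E(1) M(2) fE(2) S'(1,2) mod_hom_comp[OF q S(1)]] by blast
 have im: "EX m:car M. x = j m" if "x:car E" "p x = 0[C]" for x
  using S(5)[OF that(1)] that(2) by auto
 have im': "EX m:car M'. x = j' m" if "x:car E'" "p' x = 0[C']" for x
  using S'(5)[OF that(1)] that(2) by auto
 have "EX a:mod_hom A C C'. ALL x:car E. a (p x) = p' (\<alpha> x)"
 proof (rule mod_hom_factor[OF rE(1) rC(1) rC(2) S(3,4) mod_hom_comp[OF \<alpha>(1) S'(3)]])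
  fix x assume "x:car E" "p x = 0[C]"
  then obtain m where "m:car M" "x = j m" using im by blast
  thus "p' (\<alpha> x) = 0[C']" using \<alpha>(2) S'(6) mod_homD(1)[OF i] by simp
 qed
 then obtain a where a: "a:mod_hom A C C'" "!!x. x:car E ==> a (p x) = p' (\<alpha> x)" by blast
 \<comment> \<open>The difference between the identity and the composite of \<alpha> and \<beta>
   vanishes on the image of \<open>M\<close>, because \<open>q i\<close> is the identity there; so
   it factors through \<open>C\<close>.\<close>
 have "EX b:mod_hom A C E. ALL x:car E. b (p x) = x \<ominus>\<^bsub>E\<^esub> \<beta> (\<alpha> x)"
 proof (rule mod_hom_factor[OF rE(1) rC(1) rE(1) S(3,4)
   mod_hom_sub[OF rE(1) rE(1) mod_hom_id mod_hom_comp[OF \<alpha>(1) \<beta>(1)]]])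
  fix x assume "x:car E" "p x = 0[C]"
  then obtain m where "m:car M" "x = j m" using im by blast
  thus "x \<ominus>\<^bsub>E\<^esub> \<beta> (\<alpha> x) = 0[E]"
   using \<alpha>(2) \<beta>(2) mod_homD(1)[OF i] mod_homD(1)[OF S(1)] qi by(simp add: E.M.diff_self)
 qed
 then obtain b where b: "b:mod_hom A C E" "!!x. x:car E ==> b (p x) = x \<ominus>\<^bsub>E\<^esub> \<beta> (\<alpha> x)" by blast
 have "EX c:mod_hom A C' C. ALL x:car E'. c (p' x) = p (\<beta> x)"
 proof (rule mod_hom_factor[OF rE(2) rC(2) rC(1) S'(3,4) mod_hom_comp[OF \<beta>(1) S(3)]])
  fix x assume "x:car E'" "p' x = 0[C']"
  then obtain m where "m:car M'" "x = j' m" using im' by blast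
  thus "p (\<beta> x) = 0[C]" using \<beta>(2) S(6) mod_homD(1)[OF q] by simp
 qed
 then obtain c where c: "c:mod_hom A C' C" "!!x. x:car E' ==> c (p' x) = p (\<beta> x)" by blast
 have "c (a x) +[C] p (b x) = x" if x: "x:car C" for x
 proof -
  obtain y where y: "y:car E" "x = p y" using x S(4) by blast
  have ay: "\<alpha> y:car E'" and bay: "\<beta> (\<alpha> y):car E"
   using mod_homD(1)[OF \<alpha>(1) y(1)] mod_homD(1)[OF \<beta>(1)] by auto
  have "c (a x) +[C] p (b x) = p (\<beta> (\<alpha> y)) +[C] p (y \<ominus>\<^bsub>E\<^esub> \<beta> (\<alpha> y))"
   using y a(2) c(2) b(2) ay by simp
  also have "\<dots> = p (\<beta> (\<alpha> y) +[E] (y \<ominus>\<^bsub>E\<^esub> \<beta> (\<alpha> y)))" using mod_homD(2)[OF S(3)] y bay by simp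
  also have "\<beta> (\<alpha> y) +[E] (y \<ominus>\<^bsub>E\<^esub> \<beta> (\<alpha> y)) = y"
   using E.M.diff_add_cancel[OF y(1) bay] E.M.a_comm bay y(1) by simp
  finally show ?thesis using y by simp
 qed
 thus ?thesis using a(1) b(1) c(1) S(3) by(intro bexI[of _ a] bexI[of _ b] bexI[of _ c] bexI[of _ p]) auto
qed

lemma ses_dsum:
 assumes C: "right_module A C" "right_module A F" "right_module A E" "right_module A D" and s: "ses A C j F p D"
 shows "ses A (dsum C E) (%z. (j (fst z), snd z)) (dsum F E) (%z. p (fst z)) D"
proof -
 note S = sesD[OF s] and H = dsum_homs[OF C(1,3)] dsum_homs[OF C(2,3)]
 interpret E: right_module A E by(rule C)
 interpret F: right_module A F by(rule C)
 show ?thesis unfolding ses_def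
 proof (intro conjI ballI)
  show "(%z. (j (fst z), snd z)):mod_hom A (dsum C E) (dsum F E)"
   by(rule dsum_pair_hom[OF mod_hom_comp[OF H(1) S(1)] H(2)])
  show "inj_on (%z. (j (fst z), snd z)) (car (dsum C E))"
   using S(2) by(auto simp: inj_on_def)
  show "(%z. p (fst z)):mod_hom A (dsum F E) D" by(rule mod_hom_comp[OF H(5) S(3)])
  show "(%z. p (fst z)) ` car (dsum F E) = car D"
  proof
   show "(%z. p (fst z)) ` car (dsum F E) <= car D" using mod_homD(1)[OF S(3)] by auto
   show "car D <= (%z. p (fst z)) ` car (dsum F E)"
   proof
    fix d assume "d:car D"
    then obtain x where "x:car F" "d = p x" using S(4) by blast
    thus "d:(%z. p (fst z)) ` car (dsum F E)"
     by(intro image_eqI[of _ _ "(x, 0[E])"]) auto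
   qed
  qed
  fix z assume z: "z:car (dsum F E)"
  thus "p (fst z) = 0[D] <-> z:(%z. (j (fst z), snd z)) ` car (dsum C E)"
   using S(5)[of "fst z"] by(cases z) (auto simp: image_iff)
 qed
qed

text \<open>An injective summand is absorbed by the first term of a resolution and leaves the
  cokernel unchanged.\<close>

lemma idp_dsum_injective:
 assumes C: "idp A r C" and E: "injective_module A E" and Z: "fg_module A Z"
  and phi: "phi:mod_hom A Z (dsum C E)" "bij_betw phi (car Z) (car (dsum C E))"
 shows "idp A r Z"
proof (cases r)
 case 0
 have "injective_module A (dsum C E)" using C E 0 by(simp add: injective_dsum)
 thus ?thesis
  using injective_iso[OF _ fg_right_module[OF Z] mod_hom_inv[OF phi fg_right_module[OF Z]] bij_betw_inv_into[OF phi(2)]] 0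
  by simp
next
 case (Suc r')
 obtain F :: "('k, 'a) small_mod" and D j p where F: "injective_module A F" and D: "fg_module A D" and s: "ses A C j F p D"
  and idD: "idp A r' D" using C[unfolded Suc] by(rule idp_SucE)
 note rC = fg_right_module[OF idp_fg[OF C]] and rF = fg_right_module[OF injective_fg[OF F]]
  and rE = fg_right_module[OF injective_fg[OF E]] and rD = fg_right_module[OF D]
  and rZ = fg_right_module[OF Z]
 obtain G :: "('k, 'a) small_mod" and \<gamma> where G: "injective_module A G" "\<gamma>:mod_hom A (dsum F E) G"
  "bij_betw \<gamma> (car (dsum F E)) (car G)" using injective_small_copy[OF injective_dsum[OF F E]] .
 have "EX u v. ses A Z u G v D"
  using ses_iso[OF ses_dsum[OF rC rF rE rD s] rZ dsum_right_module[OF rC rE] dsum_right_module[OF rF rE] rD rD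
   phi G(2,3) mod_hom_id] by(auto simp: bij_betw_def)
 thus ?thesis using Suc Z G(1) D idD by auto
qed

text \<open>The relation between the four maps makes \<open>C\<close> a retract of the direct sum of
  \<open>C'\<close> and \<open>E\<close>, which is replaced by a small copy so that
  \<open>idp\<close> applies to it.\<close>

lemma sum_retract:
 assumes C': "idp A r C'" and E: "injective_module A E" and C: "fg_module A C"
  and a: "a:mod_hom A C C'" and b: "b:mod_hom A C E"
  and c: "c:mod_hom A C' C" and d: "d:mod_hom A E C"
  and eq: "!!x. x:car C ==> c (a x) +[C] d (b x) = x"
 obtains Z i q where "idp A r Z" "i:mod_hom A C Z" "q:mod_hom A Z C" "!!x. x:car C ==> q (i x) = x"
proof -
 note rC' = fg_right_module[OF idp_fg[OF C']] and rE = fg_right_module[OF injective_fg[OF E]]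
  and rC = fg_right_module[OF C]
 note rS = dsum_right_module[OF rC' rE] and H = dsum_homs[OF rC' rE]
 obtain Z :: "('k, 'a) small_mod" and \<zeta> where Z: "fg_module A Z" "\<zeta>:mod_hom A (dsum C' E) Z"
  "bij_betw \<zeta> (car (dsum C' E)) (car Z)" using small_copy[OF dsum_fg[OF idp_fg[OF C'] injective_fg[OF E]]] .
 let ?\<zeta>' = "inv_into (car (dsum C' E)) \<zeta>"
 note \<zeta>' = mod_hom_inv[OF Z(2,3) rS] and bz = bij_betw_inv_into[OF Z(3)]
 have "idp A r Z" by(rule idp_dsum_injective[OF C' E Z(1) \<zeta>' bz])
 moreover have "(%x. \<zeta> (a x, b x)):mod_hom A C Z"
  using mod_hom_comp[OF dsum_pair_hom[OF a b] Z(2)] .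
 moreover have "(%z. c (fst (?\<zeta>' z)) +[C] d (snd (?\<zeta>' z))):mod_hom A Z C"
  using mod_hom_comp[OF \<zeta>' mod_hom_add[OF rC rS mod_hom_comp[OF H(1) c] mod_hom_comp[OF H(2) d]]] .
 moreover have "c (fst (?\<zeta>' (\<zeta> (a x, b x)))) +[C] d (snd (?\<zeta>' (\<zeta> (a x, b x)))) = x" if "x:car C" for x
 proof -
  have "?\<zeta>' (\<zeta> (a x, b x)) = (a x, b x)"
   using that mod_homD(1)[OF a] mod_homD(1)[OF b] by(intro bij_betw_inv_into_left[OF Z(3)]) auto
  thus ?thesis using eq that by simp
 qed
 ultimately show ?thesis using that by blast
qed

text \<open>If \<open>M\<close> is embedded through \<open>M'\<close> into the same injective
  module, its cokernel is a retract of the cokernel of \<open>M'\<close> plus an injective module,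
  and the induction hypothesis applies.\<close>

lemma idp_retract:
 assumes "idp A r M'" "fg_module A M" "i:mod_hom A M M'" "q:mod_hom A M' M"
  "!!x. x:car M ==> q (i x) = x"
 shows "idp A r M"
 using assms
proof (induction r arbitrary: M M' i q)
 case 0
 thus ?case using injective_retract[of M' M i q] by simp
next
 case (Suc r)
 obtain E :: "('k, 'a) small_mod" and C' j p where E: "injective_module A E" and C': "fg_module A C'" and s: "ses A M' j E p C'"
  and idC: "idp A r C'" using Suc.prems(1) by(rule idp_SucE)
 note S = sesD[OF s]
 have inj: "inj_on (%x. j (i x)) (car M)"
 proof (rule inj_onI)
  fix x y assume xy: "x:car M" "y:car M" "j (i x) = j (i y)"
  hence "i x = i y" using S(2) mod_homD(1)[OF Suc.prems(3)] by(meson inj_onD)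
  thus "x = y" using Suc.prems(5) xy(1,2) by metis
 qed
 note hom = mod_hom_comp[OF Suc.prems(3) S(1)]
 obtain C :: "('k, 'a) small_mod" and p' where C: "fg_module A C" "ses A M (%x. j (i x)) E p' C"
  using cokernel_ex[OF injective_fg[OF E] fg_right_module[OF Suc.prems(2)] hom inj] .
 obtain a b c d where abcd: "a:mod_hom A C C'" "b:mod_hom A C E" "c:mod_hom A C' C" "d:mod_hom A E C"
  "!!x. x:car C ==> c (a x) +[C] d (b x) = x"
  using retract_cokernel[OF Suc.prems(2) idp_fg[OF Suc.prems(1)] C(1) C' Suc.prems(3-5) C(2) s E E] by blast
 obtain Z i' q' where Z: "idp A r Z" "i':mod_hom A C Z" "q':mod_hom A Z C"
  "!!x. x:car C ==> q' (i' x) = x" using sum_retract[where a = a and b = b and c = c and d = d, OF idC E C(1) abcd] by blast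
 have "idp A r C" by(rule Suc.IH[OF Z(1) C(1) Z(2-4)])
 thus ?case using Suc.prems(2) E C by auto
qed

text \<open>Dimension shifting must not depend on the chosen embedding:
  \<open>retract_cokernel\<close> with identity maps compares the given sequence with the one that
  \<open>idp\<close> provides.\<close>

lemma idp_cokernel:
 assumes M: "idp A (Suc r) M" and s: "ses A M j E p C" and E: "injective_module A E" and C: "fg_module A C"
 shows "idp A r C"
proof -
 obtain E' :: "('k, 'a) small_mod" and C' j' p' where E': "injective_module A E'" and C': "fg_module A C'" and s': "ses A M j' E' p' C'"
  and idC: "idp A r C'" using M by(rule idp_SucE)
 note fM = idp_fg[OF M]
 obtain a b c d where abcd: "a:mod_hom A C C'" "b:mod_hom A C E" "c:mod_hom A C' C" "d:mod_hom A E C"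
  "!!x. x:car C ==> c (a x) +[C] d (b x) = x"
  using retract_cokernel[OF fM fM C C' mod_hom_id mod_hom_id _ s s' E E'] by blast
 obtain Z i' q' where Z: "idp A r Z" "i':mod_hom A C Z" "q':mod_hom A Z C"
  "!!x. x:car C ==> q' (i' x) = x" using sum_retract[where a = a and b = b and c = c and d = d, OF idC E C abcd] by blast
 show ?thesis by(rule idp_retract[OF Z(1) C Z(2-4)])
qed

text \<open>A horseshoe argument. If \<open>X\<close> is injective, the sequence splits and
  \<open>Z\<close> is a retract of \<open>Y\<close>. Otherwise the three modules are embedded
  compatibly, and the cokernels form a sequence of the same kind with a smaller bound.\<close>

lemma idp_quotient:
 assumes "ses A X \<alpha> Y \<gamma> Z" "idp A r X" "idp A r Y" "fg_module A Z"
 shows "idp A r Z"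
 using assms
proof (induction r arbitrary: X Y Z \<alpha> \<gamma>)
 case (0 X Y Z \<alpha> \<gamma>)
 note S = sesD[OF 0(1)]
 have X: "injective_module A X" and Y: "injective_module A Y" using 0 by auto
 note fX = injective_fg[OF X] and fY = injective_fg[OF Y]
 note rX = fg_right_module[OF fX] and rY = fg_right_module[OF fY] and rZ = fg_right_module[OF 0(4)]
 interpret X: right_module A X by(rule rX)
 interpret Y: right_module A Y by(rule rY)
 interpret Z: right_module A Z by(rule rZ)
 obtain \<rho> where \<rho>: "\<rho>:mod_hom A Y X" "!!x. x:car X ==> \<rho> (\<alpha> x) = x"
  using injective_extend[OF X fX fY S(1,2) mod_hom_id] by blast
 have "EX s:mod_hom A Z Y. ALL y:car Y. s (\<gamma> y) = y \<ominus>\<^bsub>Y\<^esub> \<alpha> (\<rho> y)"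
 proof (rule mod_hom_factor[OF rY rZ rY S(3,4) mod_hom_sub[OF rY rY mod_hom_id mod_hom_comp[OF \<rho>(1) S(1)]]])
  fix y assume y: "y:car Y" "\<gamma> y = 0[Z]"
  then obtain x where x: "x:car X" "y = \<alpha> x" using S(5)[OF y(1)] by auto
  thus "y \<ominus>\<^bsub>Y\<^esub> \<alpha> (\<rho> y) = 0[Y]" using \<rho>(2) y(1) by(simp add: Y.M.diff_self)
 qed
 then obtain s where s: "s:mod_hom A Z Y" "!!y. y:car Y ==> s (\<gamma> y) = y \<ominus>\<^bsub>Y\<^esub> \<alpha> (\<rho> y)" by blast
 have "\<gamma> (s z) = z" if z: "z:car Z" for z
 proof -
  obtain y where y: "y:car Y" "z = \<gamma> y" using z S(4) by blast
  have ry: "\<rho> y:car X" "\<alpha> (\<rho> y):car Y" using mod_homD(1)[OF \<rho>(1) y(1)] mod_homD(1)[OF S(1)] by auto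
  have "\<gamma> (s z) = \<gamma> y \<ominus>\<^bsub>Z\<^esub> \<gamma> (\<alpha> (\<rho> y))" using s(2) y mod_hom_diff[OF rY rZ S(3) y(1) ry(2)] by simp
  thus ?thesis using S(6)[OF ry(1)] y z by(simp add: a_minus_def)
 qed
 thus ?case using injective_retract[OF Y 0(4) s(1) S(3)] by simp
next
 case (Suc r)
 note S = sesD[OF Suc.prems(1)]
 obtain E :: "('k, 'a) small_mod" and C \<iota> \<pi> where E: "injective_module A E" and C: "fg_module A C" and sX: "ses A X \<iota> E \<pi> C"
  and idC: "idp A r C" using Suc.prems(2) by(rule idp_SucE)
 note SX = sesD[OF sX]
 note fX = idp_fg[OF Suc.prems(2)] and fY = idp_fg[OF Suc.prems(3)] and fZ = Suc.prems(4)
 obtain G :: "('k, 'a) small_mod" and \<zeta> where G: "injective_module A G" "\<zeta>:mod_hom A Z G" "inj_on \<zeta> (car Z)"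
  using enough_injectives[OF fZ] .
 note rX = fg_right_module[OF fX] and rY = fg_right_module[OF fY] and rZ = fg_right_module[OF fZ]
  and rE = fg_right_module[OF injective_fg[OF E]] and rG = fg_right_module[OF injective_fg[OF G(1)]]
  and rC = fg_right_module[OF C]
 obtain Z1 :: "('k, 'a) small_mod" and \<omega> where Z1: "fg_module A Z1" "ses A Z \<zeta> G \<omega> Z1"
  using cokernel_ex[OF injective_fg[OF G(1)] rZ G(2,3)] .
 note SZ = sesD[OF Z1(2)] and rZ1 = fg_right_module[OF Z1(1)]
 obtain \<beta> where \<beta>: "\<beta>:mod_hom A Y E" "!!x. x:car X ==> \<beta> (\<alpha> x) = \<iota> x"
  using injective_extend[OF E fX fY S(1,2) SX(1)] by blast
 note rEG = dsum_right_module[OF rE rG] and H = dsum_homs[OF rE rG]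
 \<comment> \<open>The first component extends the embedding of \<open>X\<close> and the second
   comes from \<open>Z\<close>. This makes the map injective and its cokernel an extension of the
   cokernel of \<open>Z\<close> by that of \<open>X\<close>.\<close>
 define \<psi> where "\<psi> y = (\<beta> y, \<zeta> (\<gamma> y))" for y
 have \<psi>: "\<psi>:mod_hom A Y (dsum E G)"
  unfolding \<psi>_def by(rule dsum_pair_hom[OF \<beta>(1) mod_hom_comp[OF S(3) G(2)]])
 interpret E: right_module A E by(rule rE)
 interpret G: right_module A G by(rule rG)
 have zin: "z = 0[Z]" if "z:car Z" "\<zeta> z = 0[G]" for z
  using that G(3) mod_hom_inj_iff[OF rZ rG G(2)] by simp
 have iin: "x = 0[X]" if "x:car X" "\<iota> x = 0[E]" for x
  using that SX(2) mod_hom_inj_iff[OF rX rE SX(1)] by simp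
 have inj: "inj_on \<psi> (car Y)"
  unfolding mod_hom_inj_iff[OF rY rEG \<psi>]
 proof (intro ballI impI)
  fix y assume y: "y:car Y" and "\<psi> y = 0[dsum E G]"
  hence *: "\<beta> y = 0[E]" "\<zeta> (\<gamma> y) = 0[G]" by(auto simp: \<psi>_def)
  hence "\<gamma> y = 0[Z]" using zin mod_homD(1)[OF S(3) y] by simp
  then obtain x where x: "x:car X" "y = \<alpha> x" using S(5)[OF y] by auto
  hence "x = 0[X]" using *(1) \<beta>(2) iin by simp
  thus "y = 0[Y]" using x mod_hom_zero[OF rX rY S(1)] by simp
 qed
 have iEG: "injective_module A (dsum E G)" using injective_dsum[OF E G(1)] .
 obtain D :: "('k, 'a) small_mod" and \<delta> where D: "fg_module A D" "ses A Y \<psi> (dsum E G) \<delta> D"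
  using cokernel_ex[OF injective_fg[OF iEG] rY \<psi> inj] .
 note SD = sesD[OF D(2)] and rD = fg_right_module[OF D(1)]
 have idD: "idp A r D" by(rule idp_cokernel[OF Suc.prems(3) D(2) iEG D(1)])
 interpret D: right_module A D by(rule rD)
 have "EX kp:mod_hom A C D. ALL x:car E. kp (\<pi> x) = \<delta> (x, 0[G])"
 proof (rule mod_hom_factor[OF rE rC rD SX(3,4) mod_hom_comp[OF H(3) SD(3)]])
  fix x assume x: "x:car E" "\<pi> x = 0[C]"
  then obtain m where m: "m:car X" "x = \<iota> m" using SX(5)[OF x(1)] by auto
  hence "(x, 0[G]) = \<psi> (\<alpha> m)"
   using \<beta>(2) S(6) mod_hom_zero[OF rZ rG G(2)] by(simp add: \<psi>_def)
  thus "\<delta> (x, 0[G]) = 0[D]" using SD(6) mod_homD(1)[OF S(1) m(1)] by simp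
 qed
 then obtain kp where kp: "kp:mod_hom A C D" "!!x. x:car E ==> kp (\<pi> x) = \<delta> (x, 0[G])" by blast
 have "EX \<omega>':mod_hom A D Z1. ALL z:car (dsum E G). \<omega>' (\<delta> z) = \<omega> (snd z)"
 proof (rule mod_hom_factor[OF rEG rD rZ1 SD(3,4) mod_hom_comp[OF H(2) SZ(3)]])
  fix z assume z: "z:car (dsum E G)" "\<delta> z = 0[D]"
  then obtain y where y: "y:car Y" "z = \<psi> y" using SD(5)[OF z(1)] by auto
  thus "\<omega> (snd z) = 0[Z1]" using SZ(6) mod_homD(1)[OF S(3)] by(simp add: \<psi>_def)
 qed
 then obtain \<omega>' where \<omega>': "\<omega>':mod_hom A D Z1" "!!z. z:car (dsum E G) ==> \<omega>' (\<delta> z) = \<omega> (snd z)" by blast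
 have sC: "ses A C kp D \<omega>' Z1"
  unfolding ses_def
 proof (intro conjI ballI kp(1) \<omega>'(1))
  show "inj_on kp (car C)"
   unfolding mod_hom_inj_iff[OF rC rD kp(1)]
  proof (intro ballI impI)
   fix c assume c: "c:car C" "kp c = 0[D]"
   obtain x where x: "x:car E" "c = \<pi> x" using c(1) SX(4) by blast
   hence "\<delta> (x, 0[G]) = 0[D]" using kp(2) c(2) by simp
   moreover have "(x, 0[G]):car (dsum E G)" using x by simp
   ultimately obtain y where y: "y:car Y" "(x, 0[G]) = \<psi> y" using SD(5) by blast
   hence "\<gamma> y = 0[Z]" using zin mod_homD(1)[OF S(3) y(1)] by(simp add: \<psi>_def)
   then obtain m where m: "m:car X" "y = \<alpha> m" using S(5)[OF y(1)] by auto
   hence "x = \<iota> m" using y \<beta>(2) by(simp add: \<psi>_def)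
   thus "c = 0[C]" using x(2) SX(6)[OF m(1)] by simp
  qed
  show "\<omega>' ` car D = car Z1"
  proof
   show "\<omega>' ` car D <= car Z1" using mod_homD(1)[OF \<omega>'(1)] by auto
   show "car Z1 <= \<omega>' ` car D"
   proof
    fix z assume "z:car Z1"
    then obtain g where g: "g:car G" "z = \<omega> g" using SZ(4) by blast
    have c: "(0[E], g):car (dsum E G)" using g by simp
    hence "z = \<omega>' (\<delta> (0[E], g))" using \<omega>'(2) g by simp
    thus "z:\<omega>' ` car D" using mod_homD(1)[OF SD(3) c] by simp
   qed
  qed
  fix d assume "d:car D"
  hence "d:\<delta> ` car (dsum E G)" by(simp only: SD(4))
  then obtain x g where xg: "x:car E" "g:car G" "d = \<delta> (x, g)" by auto
  hence cg: "(x, g):car (dsum E G)" by simp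
  show "\<omega>' d = 0[Z1] <-> d:kp ` car C"
  proof
   assume "\<omega>' d = 0[Z1]"
   hence "\<omega> g = 0[Z1]" using \<omega>'(2)[OF cg] xg by simp
   then obtain z where z: "z:car Z" "g = \<zeta> z" using SZ(5)[OF xg(2)] by auto
   obtain y where y: "y:car Y" "z = \<gamma> y" using z(1) S(4) by blast
   have bE: "\<beta> y:car E" using mod_homD(1)[OF \<beta>(1) y(1)] .
   \<comment> \<open>Subtracting the image of \<open>y\<close> moves the representative into the
     summand \<open>E\<close> without changing its class.\<close>
   define x' where "x' = x \<ominus>\<^bsub>E\<^esub> \<beta> y"
   have x': "x':car E" using xg bE by(simp add: x'_def)
   have py: "\<psi> y:car (dsum E G)" using mod_homD(1)[OF \<psi> y(1)] .
   have "(x, g) = (x', 0[G]) +[dsum E G] \<psi> y"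
    using xg z y bE by(simp add: \<psi>_def x'_def E.M.diff_add_cancel)
   hence "d = \<delta> (x', 0[G]) +[D] \<delta> (\<psi> y)"
    using mod_homD(2)[OF SD(3) _ py, of "(x', 0[G])"] x' xg(3) by simp
   hence "d = kp (\<pi> x')" using SD(6)[OF y(1)] kp(2)[OF x'] x' mod_homD(1)[OF SD(3), of "(x', 0[G])"] by simp
   thus "d:kp ` car C" using mod_homD(1)[OF SX(3) x'] by simp
  next
   assume "d:kp ` car C"
   then obtain c where c: "c:car C" "d = kp c" by auto
   obtain x where x: "x:car E" "c = \<pi> x" using c(1) SX(4) by blast
   hence "d = \<delta> (x, 0[G])" using c kp(2) by simp
   hence "\<omega>' d = \<omega> 0[G]" using \<omega>'(2)[of "(x, 0[G])"] x by simp
   thus "\<omega>' d = 0[Z1]" using mod_hom_zero[OF rG rZ1 SZ(3)] by simp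
  qed
 qed
 have "idp A r Z1" by(rule Suc.IH[OF sC idC idD Z1(1)])
 thus ?case using fZ G(1) Z1 by auto
qed

text \<open>The resolution is cut at the kernels \<open>Z j\<close>. Descending from
  \<open>Z r\<close>, which is all of \<open>I r\<close> because \<open>I (Suc r)\<close> is zero,
  each kernel gains one step.\<close>

lemma idp_of_inj_dim_le:
 assumes M: "right_module A M" and d: "inj_dim_le A M r"
 obtains X f where "idp A r X" "f:mod_hom A M X" "bij_betw f (car M) (car X)"
proof -
 obtain I :: "nat => ('k, 'a) small_mod" and \<epsilon> d where I': "ALL j. injective_module A (I j)"
  "ALL j>r. car (I j) = {0[I j]}" "\<epsilon>:mod_hom A M (I 0)"
  "ALL j. d j:mod_hom A (I j) (I (Suc j))" "inj_on \<epsilon> (car M)"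
  "\<epsilon> ` car M = a_kernel (I 0) (I 1) (d 0)"
  "ALL j. d j ` car (I j) = a_kernel (I (Suc j)) (I (Suc (Suc j))) (d (Suc j))"
  using d unfolding inj_dim_le_def by(elim exE conjE)
 note I = I'[rule_format]
 define Z where "Z j = {x:car (I j). d j x = 0[I (Suc j)]}" for j
 have kerZ: "a_kernel (I j) (I (Suc j)) (d j) = Z j" for j by(simp add: Z_def a_kernel_def')
 note rI = fg_right_module[OF injective_fg[OF I(1)]]
 have sZ: "right_submodule A (I j) (Z j)" for j
  using submodule_vimage[OF rI rI I(4) submodule_zero[OF rI], of j] by(simp add: Z_def)
 have fZ: "fg_module A (sub_mod (I j) (Z j))" for j by(rule fg_sub[OF injective_fg[OF I(1)] sZ])
 have "idp A (r - j) (sub_mod (I j) (Z j))" if "j <= r" for j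
  using that
 proof (induct j rule: inc_induct)
  case base
  have "d r x = 0[I (Suc r)]" if "x:car (I r)" for x
   using mod_homD(1)[OF I(4) that] I(2)[of "Suc r"] by simp
  hence "Z r = car (I r)" by(auto simp: Z_def)
  hence "injective_module A (sub_mod (I r) (Z r))"
   by(intro injective_iso[OF I(1) fg_right_module[OF fZ], of "%x. x"] mod_homI) (auto simp: bij_betw_def)
  thus ?case by simp
 next
  case (step j)
  have "ses A (sub_mod (I j) (Z j)) (%x. x) (I j) (d j) (sub_mod (I (Suc j)) (Z (Suc j)))"
   unfolding ses_def
  proof (intro conjI ballI)
   have im: "d j ` car (I j) = Z (Suc j)" using I(7)[of j] kerZ[of "Suc j"] by simp
   thus "d j ` car (I j) = car (sub_mod (I (Suc j)) (Z (Suc j)))" by simp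
   show "d j:mod_hom A (I j) (sub_mod (I (Suc j)) (Z (Suc j)))"
    by(rule mod_homI) (use mod_homD[OF I(4)[of j]] im in auto)
  qed (auto simp: Z_def intro!: mod_homI)
  moreover have "r - j = Suc (r - Suc j)" using step by simp
  ultimately show ?case using fZ I(1) step(3) by(simp only: idp.simps) blast
 qed
 from this[of 0] have "idp A r (sub_mod (I 0) (Z 0))" by simp
 moreover have "\<epsilon>:mod_hom A M (sub_mod (I 0) (Z 0))"
  by(rule mod_homI) (use mod_homD[OF I(3)] I(6) kerZ[of 0] in auto)
 moreover have "bij_betw \<epsilon> (car M) (car (sub_mod (I 0) (Z 0)))"
  using I(5,6) kerZ[of 0] by(simp add: bij_betw_def)
 ultimately show ?thesis using that by blast
qed

lemma inj_dim_le_0: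
 fixes M :: "('k, 'a) small_mod"
 assumes M: "injective_module A M"
 shows "inj_dim_le A M 0"
proof -
 note rM = fg_right_module[OF injective_fg[OF M]]
 interpret M: right_module A M by(rule rM)
 \<comment> \<open>Terms are required in every degree, so an injective zero module on the small type
   has to be produced.\<close>
 define Z where "Z = sub_mod M {0[M]}"
 have fZ: "fg_module A Z" unfolding Z_def by(rule fg_sub[OF injective_fg[OF M] submodule_zero[OF rM]])
 have Z: "injective_module A Z"
  by(rule injective_retract[OF M fZ, of "%x. x" "%_. 0[M]"]) (auto simp: Z_def intro!: mod_homI)
 define I where "I j = (if j = 0 then M else Z)" for j :: nat
 have z: "(%_. 0[M]):mod_hom A (I j) (I (Suc j))" for j
  by(rule mod_homI) (auto simp: I_def Z_def)
 show ?thesis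
  unfolding inj_dim_le_def
 proof (intro exI[of _ I] exI[of _ "%x. x"] exI[of _ "%_ _. 0[M]"] conjI allI impI z)
  show "injective_module A (I j)" for j using M Z by(simp add: I_def)
  show "(%x. x):mod_hom A M (I 0)" by(simp add: I_def mod_hom_id)
 qed (auto simp: I_def Z_def a_kernel_def')
qed

text \<open>The new term is placed in front by \<open>case_nat\<close>; since \<open>p\<close> is
  onto, exactness at the old first term persists.\<close>

lemma inj_dim_le_Suc:
 assumes E: "injective_module A (E :: ('k, 'a) small_mod)" and C: "right_module A C"
  and s: "ses A M i E p C" and d: "inj_dim_le A C r"
 shows "inj_dim_le A M (Suc r)"
proof -
 obtain I :: "nat => ('k, 'a) small_mod" and \<epsilon> d where I': "ALL j. injective_module A (I j)"
  "ALL j>r. car (I j) = {0[I j]}" "\<epsilon>:mod_hom A C (I 0)"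
  "ALL j. d j:mod_hom A (I j) (I (Suc j))" "inj_on \<epsilon> (car C)"
  "\<epsilon> ` car C = a_kernel (I 0) (I 1) (d 0)"
  "ALL j. d j ` car (I j) = a_kernel (I (Suc j)) (I (Suc (Suc j))) (d (Suc j))"
  using d unfolding inj_dim_le_def by(elim exE conjE)
 note I = I'[rule_format]
 note S = sesD[OF s]
 note rI = fg_right_module[OF injective_fg[OF I(1)]]
 have ker: "\<epsilon> (p x) = 0[I 0] <-> x:i ` car M" if "x:car E" for x
  using S(5)[OF that] mod_hom_inj_iff[OF C rI I(3)] I(5) mod_homD(1)[OF S(3) that] mod_hom_zero[OF C rI I(3)]
  by auto
 have im: "(%x. \<epsilon> (p x)) ` car E = \<epsilon> ` car C" using S(4) by(metis image_image)
 show ?thesis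
  unfolding inj_dim_le_def
 proof (intro exI[of _ "case_nat E I"] exI[of _ i] exI[of _ "case_nat (%x. \<epsilon> (p x)) d"] conjI allI impI)
  show "injective_module A (case_nat E I j)" for j using E I(1) by(simp split: nat.split)
  show "car (case_nat E I j) = {0[case_nat E I j]}" if "j > Suc r" for j
   using that I(2) by(auto split: nat.split)
  show "i:mod_hom A M (case_nat E I 0)" using S(1) by simp
  show "case_nat (%x. \<epsilon> (p x)) d j:mod_hom A (case_nat E I j) (case_nat E I (Suc j))" for j
   using I(4) mod_hom_comp[OF S(3) I(3)] by(simp split: nat.split)
  show "inj_on i (car M)" by(rule S(2))
  show "i ` car M = a_kernel (case_nat E I 0) (case_nat E I 1) (case_nat (%x. \<epsilon> (p x)) d 0)"
   using ker mod_homD(1)[OF S(1)] by(auto simp: a_kernel_def')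
  show "case_nat (%x. \<epsilon> (p x)) d j ` car (case_nat E I j) =
   a_kernel (case_nat E I (Suc j)) (case_nat E I (Suc (Suc j))) (case_nat (%x. \<epsilon> (p x)) d (Suc j))" for j
   using I(6,7) im by(cases j) auto
 qed
qed

lemma inj_dim_le_iso:
 assumes f: "f:mod_hom A M N" "bij_betw f (car M) (car N)" and d: "inj_dim_le A N r"
 shows "inj_dim_le A M r"
proof -
 obtain I :: "nat => ('k, 'a) small_mod" and \<epsilon> d where I': "ALL j. injective_module A (I j)"
  "ALL j>r. car (I j) = {0[I j]}" "\<epsilon>:mod_hom A N (I 0)"
  "ALL j. d j:mod_hom A (I j) (I (Suc j))" "inj_on \<epsilon> (car N)"
  "\<epsilon> ` car N = a_kernel (I 0) (I 1) (d 0)"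
  "ALL j. d j ` car (I j) = a_kernel (I (Suc j)) (I (Suc (Suc j))) (d (Suc j))"
  using d unfolding inj_dim_le_def by(elim exE conjE)
 note I = I'[rule_format]
 have im: "(%x. \<epsilon> (f x)) ` car M = \<epsilon> ` car N" using f(2) by(metis bij_betw_def image_image)
 have "inj_on (%x. \<epsilon> (f x)) (car M)"
  using comp_inj_on[of f "car M" \<epsilon>] f(2) I(5) by(simp add: bij_betw_def comp_def)
 thus ?thesis
  unfolding inj_dim_le_def using I mod_hom_comp[OF f(1) I(3)] im
  by(intro exI[of _ I] exI[of _ "%x. \<epsilon> (f x)"] exI[of _ d]) auto
qed

lemma inj_dim_le_of_idp: "idp A r X ==> inj_dim_le A X r"
proof (induct r arbitrary: X)
 case 0 thus ?case by(simp add: inj_dim_le_0)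
next
 case (Suc r)
 then obtain E :: "('k, 'a) small_mod" and C i p where "injective_module A E" "fg_module A C" "ses A X i E p C" "idp A r C"
  by(auto elim: idp_SucE)
 thus ?case by(intro inj_dim_le_Suc[of E C X i p r] fg_right_module Suc(1))
qed

end

section \<open>Filtrations by copies of a projective module\<close>

definition right_ideal :: "('k, 'a) module => 'a set => bool" where
 "right_ideal A N <-> right_submodule A (regular A) N"

abbreviation eset :: "('k, 'a) module => 'a => 'a set" where
 "eset A e == (%a. e **[A] a) ` car A"

lemma regular_simps [simp]:
 "car (regular A) = car A" "x +[regular A] y = x +[A] y" "0[regular A] = 0[A]"
 "x *[regular A] a = x **[A] a"
 by(simp_all add: regular_def)

lemma additive_subgroup_regular: "additive_subgroup N (regular A) = additive_subgroup N A"
 unfolding additive_subgroup_def subgroup_def m_inv_def by(simp add: regular_def)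

text \<open>Right ideals with a finite filtration whose successive quotients are isomorphic to the
  projective module \<open>e A\<close>, the isomorphisms being induced by left multiplication.\<close>

inductive proj_chain :: "('k, 'a) module => 'a => 'a set => bool" for A e where
 zero: "proj_chain A e {0[A]}"
| step: "proj_chain A e N ==> v:car A ==> v **[A] e = v ==>
  (!!w. w:eset A e ==> v **[A] w:N ==> w = 0[A]) ==>
  proj_chain A e {u +[A] v **[A] w | u w. u:N & w:eset A e}"

context fd_alg
begin

lemmas rreg = regular_right_module

lemma right_idealI:
 assumes "N <= car A" "\<zero>:N" "!!x y. x:N ==> y:N ==> x+.y:N"
  "!!x a. x:N ==> a:car A ==> x**a:N"
 shows "right_ideal A N"
 unfolding right_ideal_def using assms by(intro right_submoduleI rreg) auto

lemma right_idealD: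
 assumes "right_ideal A N"
 shows "N <= car A" "\<zero>:N" "!!x y. x:N ==> y:N ==> x+.y:N"
  "!!x a. x:N ==> a:car A ==> x**a:N" "additive_subgroup N A"
  "!!x. x:N ==> \<ominus> x:N" "!!x y. x:N ==> y:N ==> x-.y:N"
  "right_submodule A (regular A) N"
proof -
 note D = right_submoduleD[OF rreg assms[unfolded right_ideal_def]]
 show "N <= car A" "\<zero>:N" "!!x y. x:N ==> y:N ==> x+.y:N"
  "!!x a. x:N ==> a:car A ==> x**a:N" and as: "additive_subgroup N A"
  using D by(auto simp: additive_subgroup_regular)
 show "!!x. x:N ==> \<ominus> x:N" "!!x y. x:N ==> y:N ==> x-.y:N"
  using as A.subgroup_diff unfolding additive_subgroup_iff[OF A.is_abelian_group] by blast+
 show "right_submodule A (regular A) N" using assms by(simp add: right_ideal_def)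
qed

lemma eset_iff: "e:car A ==> e**e = e ==> w:eset A e <-> w:car A & e**w = w"
 by(auto simp: image_iff simp flip: A.m_assoc) metis

lemma eset_right_ideal: "e:car A ==> right_ideal A (eset A e)"
proof (rule right_idealI)
 assume e: "e:car A"
 show "eset A e <= car A" using e by auto
 show "\<zero>:eset A e" using e by(intro image_eqI[of _ _ "\<zero>"]) auto
 show "x+.y:eset A e" if xy: "x:eset A e" "y:eset A e" for x y
 proof -
  obtain a b where "a:car A" "b:car A" "x = e**a" "y = e**b" using xy by auto
  thus ?thesis using e by(intro image_eqI[of _ _ "a+.b"]) (auto simp: A.r_distr)
 qed
 show "x**a:eset A e" if xy: "x:eset A e" "a:car A" for x a
 proof -
  obtain b where "b:car A" "x = e**b" using xy by auto
  thus ?thesis using e xy(2) by(intro image_eqI[of _ _ "b**a"]) (auto simp: A.m_assoc)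
 qed
qed

lemma right_ideal_add_mult:
 assumes N: "right_ideal A N" and U: "right_ideal A U" and v: "v:car A"
 shows "right_ideal A {u+.v**w | u w. u:N & w:U}" (is "right_ideal A ?W")
proof (rule right_idealI)
 note ND = right_idealD[OF N] and UD = right_idealD[OF U]
 have c: "x:N ==> x:car A" "x:U ==> x:car A" for x using ND(1) UD(1) by auto
 show "?W <= car A" using c v by auto
 show "\<zero>:?W" using ND(2) UD(2) v by force
 show "x+.y:?W" if xy: "x:?W" "y:?W" for x y
 proof -
  obtain u w u' w' where *: "x = u+.v**w" "u:N" "w:U" "y = u'+.v**w'" "u':N" "w':U"
   using xy by auto
  have "x+.y = (u+.u')+.v**(w+.w')"
   using * c v by(simp add: A.r_distr A.a_ac)
  thus ?thesis using ND(3)[OF *(2,5)] UD(3)[OF *(3,6)] by blast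
 qed
 show "x**a:?W" if xy: "x:?W" "a:car A" for x a
 proof -
  obtain u w where *: "x = u+.v**w" "u:N" "w:U" using xy by auto
  have "x**a = u**a+.v**(w**a)"
   using * c v xy(2) by(simp add: A.l_distr A.m_assoc)
  thus ?thesis using ND(4)[OF *(2) xy(2)] UD(4)[OF *(3) xy(2)] by blast
 qed
qed

lemma proj_chain_right_ideal:
 assumes e: "e:car A" and N: "proj_chain A e N"
 shows "right_ideal A N"
 using N
proof induct
 case zero show ?case by(rule right_idealI) auto
next
 case (step N v)
 thus ?case using right_ideal_add_mult[OF step(2) eset_right_ideal[OF e], of v] by simp
qed

text \<open>The three modules live on different types, so the sequence is first moved to small
  copies.\<close>

lemma idp_quotient':
 fixes X :: "('a, 'x) right_mod" and Y :: "('a, 'y) right_mod" and Z :: "('a, 'z) right_mod"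
 assumes s: "ses A X \<alpha> Y \<gamma> Z" and f: "fg_module A X" "fg_module A Y" "fg_module A Z"
  and X': "idp A r X'" "a:mod_hom A X X'" "bij_betw a (car X) (car X')"
  and Y': "idp A r Y'" "b:mod_hom A Y Y'" "bij_betw b (car Y) (car Y')"
 obtains Z' c where "idp A r Z'" "c:mod_hom A Z Z'" "bij_betw c (car Z) (car Z')"
proof -
 note r = f[THEN fg_right_module]
 obtain Z' :: "('k, 'a) small_mod" and c where c: "fg_module A Z'" "c:mod_hom A Z Z'"
  "bij_betw c (car Z) (car Z')" using small_copy[OF f(3)] .
 have s': "ses A X' (%x. b (\<alpha> (inv_into (car X) a x))) Y' (%y. c (\<gamma> (inv_into (car Y) b y))) Z'"
  by(rule ses_iso[OF s fg_right_module[OF idp_fg[OF X'(1)]] r(1-3) fg_right_module[OF c(1)]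
   mod_hom_inv[OF X'(2,3) r(1)] bij_betw_inv_into[OF X'(3)] Y'(2,3) c(2,3)])
 have "idp A r Z'" by(rule idp_quotient[OF s' X'(1) Y'(1) c(1)])
 thus ?thesis using that c(2,3) by blast
qed

text \<open>Each step of the chain yields an exact sequence consisting of \<open>e A\<close>,
  \<open>A / N\<close> and \<open>A / N'\<close>. As \<open>e A\<close> is a retract of
  \<open>A\<close>, the bound \<open>r\<close> is kept by \<open>idp_quotient\<close> and does not
  grow with the length of the chain.\<close>

lemma quot_proj_chain_idp:
 assumes e: "e:car A" "e**e = e" and N: "proj_chain A e N" and d: "inj_dim_le A (regular A) r"
 shows "EX X c. idp A r X & c:mod_hom A (quot_mod (regular A) N) X &
  bij_betw c (car (quot_mod (regular A) N)) (car X)"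
proof -
 note eI = eset_right_ideal[OF e(1)] and eD = right_idealD(8)[OF eset_right_ideal[OF e(1)]]
 define P where "P = sub_mod (regular A) (eset A e)"
 have fP: "fg_module A P" unfolding P_def by(rule fg_sub[OF regular_fg eD])
 note rP = fg_right_module[OF fP]
 obtain R f where R: "idp A r R" "f:mod_hom A (regular A) R" "bij_betw f (car (regular A)) (car R)"
  using idp_of_inj_dim_le[OF rreg d] .
 note rR = fg_right_module[OF idp_fg[OF R(1)]]
 obtain P' :: "('k, 'a) small_mod" and p where p: "fg_module A P'" "p:mod_hom A P P'"
  "bij_betw p (car P) (car P')" using small_copy[OF fP] .
 note p' = mod_hom_inv[OF p(2,3) rP] and f' = mod_hom_inv[OF R(2,3) rreg]
 have incl: "(%x. x):mod_hom A P (regular A)"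
  by(rule mod_homI) (use right_idealD(1)[OF eI] in \<open>auto simp: P_def\<close>)
 have em: "(%x. e**x):mod_hom A (regular A) P"
  by(rule mod_homI) (use e in \<open>auto simp: P_def A.r_distr A.m_assoc\<close>)
 have idP: "idp A r P'"
 proof (rule idp_retract[OF R(1) p(1)])
  show "(%x. f (inv_into (car P) p x)):mod_hom A P' R"
   using mod_hom_comp[OF mod_hom_comp[OF p' incl] R(2)] .
  show "(%x. p (e**(inv_into (car (regular A)) f x))):mod_hom A R P'"
   using mod_hom_comp[OF mod_hom_comp[OF f' em] p(2)] .
  fix x assume x: "x:car P'"
  let ?y = "inv_into (car P) p x"
  have y: "?y:car P" "p ?y = x"
   using mod_homD(1)[OF p' x] bij_betw_inv_into_right[OF p(3) x] by auto
  hence "?y:car A" "e**?y = ?y" using eset_iff[OF e, of ?y] by(auto simp: P_def)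
  thus "p (e**inv_into (car (regular A)) f (f ?y)) = x"
   using bij_betw_inv_into_left[OF R(3), of ?y] y(2) by simp
 qed
 show ?thesis using N
 proof induct
  case zero
  have zI: "right_submodule A (regular A) {\<zero>}" using submodule_zero[OF rreg] by simp
  note Q = quot_mod_facts[OF rreg zI]
  let ?Q = "quot_mod (regular A) {\<zero>}" and ?q = "%x. {\<zero>} +>\<^bsub>regular A\<^esub> x"
  have "inj_on ?q (car (regular A))"
   unfolding mod_hom_inj_iff[OF rreg Q(1,2)] using Q(4) by auto
  hence bq: "bij_betw ?q (car (regular A)) (car ?Q)" using Q(3) by(simp add: bij_betw_def)
  have h: "(%x. f (inv_into (car (regular A)) ?q x)):mod_hom A ?Q R"
   using mod_hom_comp[OF mod_hom_inv[OF Q(2) bq rreg] R(2)] .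
  moreover have "bij_betw (%x. f (inv_into (car (regular A)) ?q x)) (car ?Q) (car R)"
   using bij_betw_trans[OF bij_betw_inv_into[OF bq] R(3)] by(simp add: comp_def)
  ultimately show ?case using R(1) by(intro exI[of _ R]) auto
 next
  case (step N v)
  define N' where "N' = {u+.v**w | u w. u:N & w:eset A e}"
  have NI: "right_ideal A N" by(rule proj_chain_right_ideal[OF e(1) step(1)])
  have N'I: "right_ideal A N'" unfolding N'_def by(rule right_ideal_add_mult[OF NI eI step(3)])
  note ND = right_idealD[OF NI] and N'D = right_idealD[OF N'I]
  note Q = quot_mod_facts[OF rreg ND(8)] and Q' = quot_mod_facts[OF rreg N'D(8)]
  let ?Q = "quot_mod (regular A) N" and ?Q' = "quot_mod (regular A) N'"
  let ?q = "%x. N +>\<^bsub>regular A\<^esub> x" and ?q' = "%x. N' +>\<^bsub>regular A\<^esub> x"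
  have NN': "x:N'" if "x:N" for x
  proof -
   have "x = x+.v**\<zero>" using that ND(1) step(3) by auto
   thus ?thesis using that right_idealD(2)[OF eI] unfolding N'_def by blast
  qed
  have vN': "v**w:N'" if "w:eset A e" for w
  proof -
   have "v**w = \<zero> \<oplus> v**w" using that right_idealD(1)[OF eI] step(3) by auto
   thus ?thesis using that ND(2) unfolding N'_def by blast
  qed
  have vm: "(%w. v**w):mod_hom A P (regular A)"
   by(rule mod_homI) (use right_idealD(1)[OF eI] step(3) in \<open>auto simp: P_def A.r_distr A.m_assoc subset_iff\<close>)
  note \<alpha> = mod_hom_comp[OF vm Q(2)]
  have "EX \<gamma>:mod_hom A ?Q ?Q'. ALL x:car (regular A). \<gamma> (?q x) = ?q' x"
   by(rule mod_hom_factor[OF rreg Q(1) Q'(1) Q(2,3) Q'(2)]) (use Q(4) Q'(4) NN' in auto)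
  then obtain \<gamma> where \<gamma>: "\<gamma>:mod_hom A ?Q ?Q'" "!!x. x:car A ==> \<gamma> (?q x) = ?q' x" by auto
  have s: "ses A P (%w. ?q (v**w)) ?Q \<gamma> ?Q'"
   unfolding ses_def
  proof (intro conjI ballI \<alpha> \<gamma>(1))
   show "inj_on (%w. ?q (v**w)) (car P)"
    unfolding mod_hom_inj_iff[OF rP Q(1) \<alpha>]
   proof (intro ballI impI)
    fix w assume w: "w:car P" "?q (v**w) = 0[?Q]"
    hence we: "w:eset A e" by(simp add: P_def)
    hence "v**w:car A" using right_idealD(1)[OF eI] step(3) by auto
    hence "v**w:N" using Q(4)[of "v**w"] w(2) by simp
    thus "w = 0[P]" using step(5)[OF we] by(simp add: P_def)
   qed
   show "\<gamma> ` car ?Q = car ?Q'"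
   proof -
    have "\<gamma> ` car ?Q = \<gamma> ` ?q ` car A" using Q(3) by simp
    also have "\<dots> = ?q' ` car A" unfolding image_image using \<gamma>(2) by(rule image_cong[OF refl])
    finally show ?thesis using Q'(3) by simp
   qed
   fix x assume "x:car ?Q"
   hence "x:?q ` car A" using Q(3) by simp
   then obtain a where a: "a:car A" "x = ?q a" by auto
   show "\<gamma> x = 0[?Q'] <-> x:(%w. ?q (v**w)) ` car P"
   proof
    assume "\<gamma> x = 0[?Q']"
    hence "a:N'" using \<gamma>(2) a Q'(4)[of a] by simp
    then obtain u w where uw: "a = u+.v**w" "u:N" "w:eset A e" unfolding N'_def by auto
    have c: "u:car A" "v**w:car A" using uw ND(1) right_idealD(1)[OF eI] step(3) by auto
    interpret Q: right_module A ?Q by(rule Q(1))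
    have "?q a = ?q u +[?Q] ?q (v**w)" using mod_homD(2)[OF Q(2), of u "v**w"] c uw(1) by simp
    also have "?q u = 0[?Q]" using Q(4)[of u] c uw(2) by simp
    finally have "?q a = ?q (v**w)" using mod_homD(1)[OF Q(2), of "v**w"] c by simp
    thus "x:(%w. ?q (v**w)) ` car P" using a(2) uw(3) by(simp add: P_def)
   next
    assume "x:(%w. ?q (v**w)) ` car P"
    then obtain w where w: "w:eset A e" "x = ?q (v**w)" by(auto simp: P_def)
    hence c: "v**w:car A" using right_idealD(1)[OF eI] step(3) by auto
    show "\<gamma> x = 0[?Q']" using \<gamma>(2)[OF c] Q'(4)[of "v**w"] c vN'[OF w(1)] w(2) by simp
   qed
  qed
  obtain Y b where Y: "idp A r Y" "b:mod_hom A ?Q Y" "bij_betw b (car ?Q) (car Y)" using step(2) by auto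
  obtain Z c where "idp A r Z" "c:mod_hom A ?Q' Z" "bij_betw c (car ?Q') (car Z)"
   using idp_quotient'[OF s fP fg_quot[OF regular_fg ND(8)] fg_quot[OF regular_fg N'D(8)] idP p(2,3) Y] .
  thus ?case unfolding N'_def by blast
 qed
qed

text \<open>Every step splits off a direct summand isomorphic to \<open>e A\<close>, so the ideal is
  projective and a lift can be chosen summand by summand.\<close>

lemma proj_chain_lift:
 assumes e: "e:car A" "e**e = e" and N: "proj_chain A e N"
  and E: "right_module A E" and C: "right_module A C" and p: "p:mod_hom A E C" "p ` car E = car C"
  and f: "f:mod_hom A (sub_mod (regular A) N) C"
 shows "EX g:mod_hom A (sub_mod (regular A) N) E. ALL x:N. p (g x) = f x"
 using N f
proof induct
 case zero
 interpret E: right_module A E by fact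
 have r0: "right_module A (sub_mod (regular A) {\<zero>})"
  using sub_mod_right_module[OF rreg submodule_zero[OF rreg]] by simp
 have "f \<zero> = 0[C]" using mod_hom_zero[OF r0 C zero] by simp
 thus ?case using mod_hom_zero[OF E C p(1)]
  by(intro bexI[of _ "%_. 0[E]"] mod_homI) auto
next
 case (step N v)
 interpret E: right_module A E by fact
 interpret C: right_module A C by fact
 note eI = eset_right_ideal[OF e(1)]
 define N' where "N' = {u+.v**w | u w. u:N & w:eset A e}"
 have NI: "right_ideal A N" by(rule proj_chain_right_ideal[OF e(1) step(1)])
 note ND = right_idealD[OF NI] and eD = right_idealD[OF eI]
 have cN: "x:N ==> x:car A" and ce: "x:eset A e ==> x:car A" for x using ND(1) eD(1) by auto
 have f: "f:mod_hom A (sub_mod (regular A) N') C" using step(6) by(simp add: N'_def)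
 have N'I: "u+.v**w:N'" if "u:N" "w:eset A e" for u w using that unfolding N'_def by blast
 have NN': "x:N'" if "x:N" for x using N'I[OF that eD(2)] cN[OF that] step(3) by simp
 have vN': "v**w:N'" if "w:eset A e" for w using N'I[OF ND(2) that] ce[OF that] step(3) by simp
 have ee: "e:eset A e" using eset_iff[OF e] e by simp
 have vv: "v:N'" using vN'[OF ee] step(4) by simp
 have "f:mod_hom A (sub_mod (regular A) N) C" using mod_homD[OF f] NN' by(intro mod_homI) auto
 then obtain g where g: "g:mod_hom A (sub_mod (regular A) N) E" "!!x. x:N ==> p (g x) = f x"
  using step(2) by blast
 have "f v:car C" using mod_homD(1)[OF f] vv by simp
 \<comment> \<open>On the new summand the lift sends \<open>v w\<close> to \<open>x0 w\<close>, so
   any preimage of \<open>f v\<close> will do.\<close>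
 then obtain x0 where x0: "x0:car E" "p x0 = f v" using p(2) by(metis imageE)
 have dec: "u = u' & w = w'" if eq: "u+.v**w = u'+.v**w'"
  and u: "u:N" "u':N" and w: "w:eset A e" "w':eset A e" for u u' w w'
 proof -
  note c = cN[OF u(1)] cN[OF u(2)] ce[OF w(1)] ce[OF w(2)]
  have "\<zero> = (u+.v**w)-.(u'+.v**w')" using eq c step(3) by(simp add: A.diff_self)
  also have "\<dots> = (u-.u')+.(v**w-.v**w')" using c step(3) by(simp add: A.diff_add_diff)
  also have "v**w-.v**w' = v**(w-.w')"
   using c step(3) by(simp add: a_minus_def A.r_distr A.r_minus)
  finally have z: "(u-.u')+.v**(w-.w') = \<zero>" by simp
  have "v**(w-.w'):N"
   by(rule A.subgroup_add_cancel'[OF ND(5) _ ND(7)[OF u]]) (use c step(3) z ND(2) in auto)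
  hence "w-.w' = \<zero>" using step(5)[OF eD(7)[OF w]] by simp
  hence ww: "w = w'" using c A.diff_eq_zero_iff by simp
  have "u = u'" using eq c step(3) unfolding ww by(simp add: A.add.right_cancel)
  thus ?thesis using ww by simp
 qed
 define h where "h x = (THE y. EX u:N. EX w:eset A e. x = u+.v**w & y = g u +[E] x0 *[E] w)" for x
 have h: "h (u+.v**w) = g u +[E] x0 *[E] w" if "u:N" "w:eset A e" for u w
  unfolding h_def
 proof (rule the_equality)
  show "EX u':N. EX w':eset A e. u+.v**w = u'+.v**w' & g u +[E] x0 *[E] w = g u' +[E] x0 *[E] w'"
   using that by blast
  fix y assume "EX u':N. EX w':eset A e. u+.v**w = u'+.v**w' & y = g u' +[E] x0 *[E] w'"
  then obtain u' w' where "u':N" "w':eset A e" "u+.v**w = u'+.v**w'" "y = g u' +[E] x0 *[E] w'"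
   by blast
  thus "y = g u +[E] x0 *[E] w" using dec[of u w u' w'] that by simp
 qed
 have N'E: "EX u:N. EX w:eset A e. x = u+.v**w" if "x:N'" for x using that unfolding N'_def by blast
 have gE: "g u:car E" if "u:N" for u using mod_homD(1)[OF g(1)] that by simp
 have hhom: "h:mod_hom A (sub_mod (regular A) N') E"
 proof (rule mod_homI)
  fix x assume "x:car (sub_mod (regular A) N')"
  then obtain u w where "u:N" "w:eset A e" "x = u+.v**w" using N'E[of x] by auto
  thus "h x:car E" using h gE x0 ce E.ract_closed by simp
 next
  fix x y assume xy: "x:car (sub_mod (regular A) N')" "y:car (sub_mod (regular A) N')"
  obtain u w where 1: "u:N" "w:eset A e" "x = u+.v**w"
   using N'E[of x] xy by auto
  obtain u' w' where 2: "u':N" "w':eset A e" "y = u'+.v**w'"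
   using N'E[of y] xy by auto
  note * = 1 2
  note c = cN[OF *(1)] cN[OF *(4)] ce[OF *(2)] ce[OF *(5)]
  have "x+.y = (u+.u')+.v**(w+.w')"
   using *(3,6) c step(3) by(simp add: A.r_distr A.a_ac)
  hence "h (x+.y) = g (u+.u') +[E] x0 *[E] (w+.w')"
   using h ND(3)[OF *(1,4)] eD(3)[OF *(2,5)] by simp
  also have "g (u+.u') = g u +[E] g u'" using mod_homD(2)[OF g(1), of u u'] *(1,4) by simp
  finally show "h (x +[sub_mod (regular A) N'] y) = h x +[E] h y"
   using h * gE x0 c E.ract_closed by(simp add: E.ract_add_right E.M.a_ac)
 next
  fix x a assume "x:car (sub_mod (regular A) N')" and a: "a:car A"
  then obtain u w where *: "u:N" "w:eset A e" "x = u+.v**w" using N'E[of x] by auto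
  note c = cN[OF *(1)] ce[OF *(2)]
  have "x**a = u**a+.v**(w**a)" using *(3) c step(3) a by(simp add: A.l_distr A.m_assoc)
  hence "h (x**a) = g (u**a) +[E] x0 *[E] (w**a)"
   using h ND(4)[OF *(1) a] eD(4)[OF *(2) a] by simp
  also have "g (u**a) = g u *[E] a" using mod_homD(3)[OF g(1), of u a] *(1) a by simp
  finally show "h (x *[sub_mod (regular A) N'] a) = h x *[E] a"
   using h * gE x0 c a E.ract_closed by(simp add: E.ract_add_left E.ract_assoc)
 qed
 have "p (h x) = f x" if xN: "x:N'" for x
 proof -
  obtain u w where *: "u:N" "w:eset A e" "x = u+.v**w" using N'E[OF xN] by auto
  note c = cN[OF *(1)] ce[OF *(2)]
  have "p (h x) = p (g u) +[C] p x0 *[C] w"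
   using h * gE x0 c E.ract_closed mod_homD[OF p(1)] by simp
  also have "\<dots> = f u +[C] f v *[C] w" using g(2) * x0 by simp
  also have "f v *[C] w = f (v**w)" using mod_homD(3)[OF f, of v w] vv c by simp
  also have "f u +[C] f (v**w) = f x" using mod_homD(2)[OF f, of u "v**w"] NN'[OF *(1)] vN'[OF *(2)] *(3) by simp
  finally show ?thesis .
 qed
 thus ?case using hhom unfolding N'_def by blast
qed

end

section \<open>Injective dimension of quotient algebras\<close>

text \<open>A surjection instead of a literal quotient also covers the maps between successive
  quotients of one algebra and the passage to opposite algebras.\<close>

locale fd_quot = A: fd_alg K A + B: fd_alg K B
 for K :: "'k ring" and A :: "('k, 'a) module" (structure) and B :: "('k, 'b) module" +
 fixes phi :: "'a => 'b"
 assumes hom: "phi:ring_hom A B"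
  and surj: "phi ` car A = car B"
  and klin: "[|k:car K; x:car A|] ==> phi (k \<odot> x) = k \<odot>\<^bsub>B\<^esub> phi x"
begin

definition ker :: "'a set" where "ker = {a:car A. phi a = 0[B]}"

lemma phi_closed [simp, intro]: "a:car A ==> phi a:car B"
 using ring_hom_closed[OF hom] .

lemma phi_mult: "a:car A ==> b:car A ==> phi (a**b) = phi a **[B] phi b"
 using ring_hom_mult[OF hom] .

lemma phi_add: "a:car A ==> b:car A ==> phi (a+.b) = phi a +[B] phi b"
 using ring_hom_add[OF hom] .

lemma phi_one: "phi \<one> = 1[B]"
 using ring_hom_one[OF hom] .

lemma phi_zero: "phi \<zero> = 0[B]"
 using ring_hom_zero[OF hom A.A.ring_axioms B.A.ring_axioms] .

lemma phi_minus: "a:car A ==> phi (\<ominus> a) = \<ominus>\<^bsub>B\<^esub> phi a"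
 by(metis A.A.a_inv_closed A.A.l_neg B.A.minus_equality phi_add phi_closed phi_zero)

lemma phi_diff: "a:car A ==> b:car A ==> phi (a-.b) = phi a \<ominus>\<^bsub>B\<^esub> phi b"
 by(simp add: a_minus_def phi_add phi_minus)

lemma phi_eq_iff: "a:car A ==> b:car A ==> phi a = phi b <-> a-.b:ker"
 by(simp add: ker_def phi_diff B.A.diff_eq_zero_iff)

text \<open>A section of sets only, not a homomorphism; \<open>push_ract\<close> shows that the
  module structure built with it does not depend on the choice.\<close>

definition psi :: "'b => 'a" where "psi = inv_into (car A) phi"

lemma psi: "b:car B ==> psi b:car A" "b:car B ==> phi (psi b) = b"
 using surj by(auto simp: psi_def inv_into_into f_inv_into_f)

lemma ker_props:
 "ker <= car A" "right_ideal A ker" "a:car A ==> j:ker ==> a**j:ker"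
proof -
 show "ker <= car A" by(auto simp: ker_def)
 show "right_ideal A ker"
  by(rule A.right_idealI) (auto simp: ker_def phi_zero phi_add phi_mult)
 show "a:car A ==> j:ker ==> a**j:ker" by(auto simp: ker_def phi_mult)
qed

section \<open>Restriction of scalars along \<open>phi\<close> and its right adjoint\<close>

definition pull :: "('b, 'm) right_mod => ('a, 'm) right_mod" where
 "pull M = \<lparr>carrier = car M, mult = undefined, one = undefined, zero = 0[M],
   add = add M, ract = %x a. x *[M] phi a\<rparr>"

definition ann_part :: "('a, 'm) right_mod => 'm set" where
 "ann_part M = {x:car M. ALL j:ker. x *[M] j = 0[M]}"

text \<open>This is \<open>Hom_A(B, M)\<close>, realised as the part of \<open>M\<close> that is
  annihilated by \<open>ker\<close>.\<close>

definition push :: "('a, 'm) right_mod => ('b, 'm) right_mod" where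
 "push M = \<lparr>carrier = ann_part M, mult = undefined, one = undefined, zero = 0[M],
   add = add M, ract = %x b. x *[M] psi b\<rparr>"

lemma pull_right_module:
 assumes M: "right_module B M"
 shows "right_module A (pull M)"
proof -
 interpret M: right_module B M by fact
 have s: "car (pull M) = car M" "x +[pull M] y = x +[M] y" "0[pull M] = 0[M]"
  "x *[pull M] a = x *[M] phi a" for x y a by(simp_all add: pull_def)
 have "abelian_group (pull M)"
  by(rule abelian_groupI) (auto simp: s M.M.a_ac intro: bexI[of _ "\<ominus>\<^bsub>M\<^esub> _"] M.M.l_neg)
 thus ?thesis
  by(rule right_moduleI[OF A.A.ring_axioms])
   (auto simp: s M.ract_closed M.ract_add_left M.ract_add_right M.ract_assoc M.ract_one phi_add phi_mult phi_one)
qed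

lemma pull_submodule_iff:
 assumes M: "right_module B M"
 shows "right_submodule A (pull M) N <-> right_submodule B M N"
proof -
 note rP = pull_right_module[OF M]
 have s: "car (pull M) = car M" "x +[pull M] y = x +[M] y" "0[pull M] = 0[M]"
  "x *[pull M] a = x *[M] phi a" for x y a by(simp_all add: pull_def)
 show ?thesis
 proof
  assume N: "right_submodule A (pull M) N"
  note D = right_submoduleD[OF rP N]
  show "right_submodule B M N"
  proof (rule right_submoduleI[OF M])
   show "x *[M] b:N" if "x:N" "b:car B" for x b
    using D(4)[of x "psi b"] psi[of b] that by(simp add: s)
  qed (use D(1-3) in \<open>auto simp: s\<close>)
 next
  assume N: "right_submodule B M N"
  show "right_submodule A (pull M) N"
   by(rule right_submoduleI[OF rP]) (use right_submoduleD(1-4)[OF M N] in \<open>auto simp: s\<close>)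
 qed
qed

lemma pull_fg:
 assumes M: "fg_module B M"
 shows "fg_module A (pull M)"
proof -
 note rM = B.fg_right_module[OF M]
 have "car (pull M) = car M" by(simp add: pull_def)
 thus ?thesis
  using M pull_right_module[OF rM] pull_submodule_iff[OF rM]
  unfolding fg_module_def finitely_generated_def by simp
qed

lemma pull_hom: "f:mod_hom B M N ==> f:mod_hom A (pull M) (pull N)"
 by(rule mod_homI) (auto simp: pull_def mod_homD)

lemma ann_part_submodule:
 assumes M: "right_module A M"
 shows "right_submodule A M (ann_part M)"
proof -
 interpret M: right_module A M by fact
 have k: "j:car A" if "j:ker" for j using that ker_props(1) by auto
 show ?thesis
 proof (rule right_submoduleI[OF M])
  fix x a assume x: "x:ann_part M" and a: "a:car A"
  have "x *[M] a *[M] j = 0[M]" if j: "j:ker" for j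
   using x a k[OF j] ker_props(3)[OF a j] by(simp add: ann_part_def flip: M.ract_assoc)
  thus "x *[M] a:ann_part M" using x a by(simp add: ann_part_def M.ract_closed)
 qed (auto simp: ann_part_def k M.ract_add_left)
qed

text \<open>Two preimages of an element of \<open>B\<close> differ by an element of
  \<open>ker\<close>, which kills \<open>ann_part M\<close>.\<close>

lemma push_ract:
 assumes M: "right_module A M" and x: "x:ann_part M" and a: "a:car A"
 shows "x *[push M] phi a = x *[M] a"
proof -
 interpret M: right_module A M by fact
 have p: "psi (phi a):car A" "psi (phi a)-.a:ker"
  using psi[OF phi_closed[OF a]] phi_eq_iff[of "psi (phi a)" a] a by auto
 have xc: "x:car M" using x by(simp add: ann_part_def)
 have "x *[M] psi (phi a) \<ominus>\<^bsub>M\<^esub> x *[M] a = 0[M]"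
  using p x xc a by(simp add: ann_part_def flip: M.ract_diff_right)
 thus ?thesis using xc p(1) a by(simp add: push_def M.ract_closed M.M.diff_eq_zero_iff)
qed

lemma push_right_module:
 assumes M: "right_module A M"
 shows "right_module B (push M)"
proof -
 note sub = ann_part_submodule[OF M]
 note rS = sub_mod_right_module[OF M sub]
 interpret S: right_module A "sub_mod M (ann_part M)" by(rule rS)
 note D = right_submoduleD[OF M sub]
 have s: "car (push M) = ann_part M" "x +[push M] y = x +[M] y" "0[push M] = 0[M]" for x y
  by(simp_all add: push_def)
 interpret M: right_module A M by fact
 have c: "x:car M" if "x:ann_part M" for x using that by(simp add: ann_part_def)
 have "abelian_group (push M)"
 proof (rule abelian_groupI)
  fix x assume "x:car (push M)"
  thus "EX y:car (push M). y +[push M] x = 0[push M]"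
   using D(5)[of x] c M.M.l_neg by(intro bexI[of _ "\<ominus>\<^bsub>M\<^esub> x"]) (auto simp: s)
 qed (use D c in \<open>auto simp: s M.M.a_ac\<close>)
 thus ?thesis
 proof (rule right_moduleI[OF B.A.ring_axioms])
  fix x b assume x: "x:car (push M)" and b: "b:car B"
  obtain a where a: "a:car A" "b = phi a" using psi[OF b] by metis
  show "x *[push M] b:car (push M)" using push_ract[OF M _ a(1)] x a D(4) by(simp add: s)
  fix y assume y: "y:car (push M)"
  thus "(x +[push M] y) *[push M] b = x *[push M] b +[push M] y *[push M] b"
   using push_ract[OF M _ a(1)] x a D(3) S.ract_add_left by(simp add: s)
 next
  fix x b c assume x: "x:car (push M)" and b: "b:car B" and c: "c:car B"
  obtain a where a: "a:car A" "b = phi a" using psi[OF b] by metis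
  obtain d where d: "d:car A" "c = phi d" using psi[OF c] by metis
  have "x *[push M] phi (a+.d) = x *[push M] b +[push M] x *[push M] c"
   using push_ract[OF M] x a d S.ract_add_right by(simp add: s)
  thus "x *[push M] (b +[B] c) = x *[push M] b +[push M] x *[push M] c"
   using a d by(simp add: phi_add)
  have "x *[push M] phi (a**d) = x *[push M] b *[push M] c"
   using push_ract[OF M] x a d S.ract_assoc D(4) by(simp add: s)
  thus "x *[push M] (b **[B] c) = x *[push M] b *[push M] c"
   using a d by(simp add: phi_mult)
 next
  fix x assume x: "x:car (push M)"
  show "x *[push M] 1[B] = x"
   using push_ract[OF M, of x "\<one>"] x S.ract_one by(simp add: s phi_one)
 qed
qed

lemma push_fg:
 assumes M: "fg_module A M"
 shows "fg_module B (push M)"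
proof -
 note rM = A.fg_right_module[OF M]
 note sub = ann_part_submodule[OF rM]
 note rS = sub_mod_right_module[OF rM sub] and rP = push_right_module[OF rM]
 have "right_submodule A (sub_mod M (ann_part M)) N" if N: "right_submodule B (push M) N" for N
 proof -
  note D = right_submoduleD[OF rP N]
  have sN: "N <= ann_part M" using D(1) by(simp add: push_def)
  show ?thesis
  proof (rule right_submoduleI[OF rS])
   show "x *[sub_mod M (ann_part M)] a:N" if "x:N" "a:car A" for x a
    using D(4)[OF that(1) phi_closed[OF that(2)]] push_ract[OF rM _ that(2), of x] sN that by auto
  qed (use D(1-3) in \<open>auto simp: push_def\<close>)
 qed
 moreover have "car (push M) = car (sub_mod M (ann_part M))" by(simp add: push_def)
 ultimately show ?thesis
  using A.fg_sub[OF M sub] rP unfolding fg_module_def finitely_generated_def by(metis (no_types, lifting))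
qed

text \<open>A homomorphism from a \<open>B\<close>-module to \<open>E\<close> lands in the
  annihilated part by itself, so extension problems over \<open>B\<close> can be solved over
  \<open>A\<close>.\<close>

lemma push_injective:
 assumes E: "injective_module A E"
 shows "injective_module B (push E)"
 unfolding injective_module_def
proof (intro conjI allI ballI impI push_fg[OF A.injective_fg[OF E]])
 note rE = A.fg_right_module[OF A.injective_fg[OF E]]
 fix X Y :: "('k, 'b) small_mod" and f g
 assume f: "f:mod_hom B X Y" "inj_on f (car X)" and g: "g:mod_hom B X (push E)"
  and XY: "fg_module B X" "fg_module B Y"
 note rX = B.fg_right_module[OF XY(1)] and rY = B.fg_right_module[OF XY(2)]
 interpret Y: right_module B Y by(rule rY)
 have cX: "car (pull X) = car X" and cY: "car (pull Y) = car Y" by(simp_all add: pull_def)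
 have gA: "g:mod_hom A (pull X) E"
 proof (rule mod_homI)
  fix x assume "x:car (pull X)"
  thus "g x:car E" using mod_homD(1)[OF g] by(simp add: pull_def push_def ann_part_def)
 next
  fix x y assume "x:car (pull X)" "y:car (pull X)"
  thus "g (x +[pull X] y) = g x +[E] g y" using mod_homD(2)[OF g] by(simp add: pull_def push_def)
 next
  fix x a assume "x:car (pull X)" "a:car A"
  thus "g (x *[pull X] a) = g x *[E] a"
   using mod_homD(3)[OF g, of x "phi a"] mod_homD(1)[OF g, of x] push_ract[OF rE, of "g x" a]
   by(simp add: pull_def push_def)
 qed
 have "inj_on f (car (pull X))" using f(2) cX by simp
 from A.injective_extend[OF E pull_fg[OF XY(1)] pull_fg[OF XY(2)] pull_hom[OF f(1)] this gA, unfolded cX]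
 obtain h where h: "h:mod_hom A (pull Y) E" "!!x. x:car X ==> h (f x) = g x" by blast
 note rpY = pull_right_module[OF rY]
 have hz: "h 0[Y] = 0[E]" using mod_hom_zero[OF rpY rE h(1)] by(simp add: pull_def)
 have han: "h y:ann_part E" if y: "y:car Y" for y
 proof -
  have "h y *[E] j = 0[E]" if j: "j:ker" for j
  proof -
   have "h (y *[pull Y] j) = h y *[E] j" using mod_homD(3)[OF h(1), of y j] y j ker_props(1) cY by auto
   thus ?thesis using j y hz by(simp add: pull_def ker_def)
  qed
  thus ?thesis using mod_homD(1)[OF h(1)] y cY by(simp add: ann_part_def)
 qed
 have "h:mod_hom B Y (push E)"
 proof (rule mod_homI)
  fix y b assume y: "y:car Y" and b: "b:car B"
  have "h (y *[pull Y] psi b) = h y *[E] psi b" using mod_homD(3)[OF h(1), of y "psi b"] y psi[OF b] cY by simp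
  thus "h (y *[Y] b) = h y *[push E] b" using psi[OF b] by(simp add: pull_def push_def)
 next
  fix x y assume "x:car Y" "y:car Y"
  thus "h (x +[Y] y) = h x +[push E] h y" using mod_homD(2)[OF h(1), of x y] by(simp add: pull_def push_def)
 qed (simp add: han push_def)
 thus "EX h:mod_hom B Y (push E). ALL x:car X. h (f x) = g x" using h(2) by blast
qed

definition ker_mod :: "('a, 'a) right_mod" where "ker_mod = sub_mod (regular A) ker"

lemma ker_mod: "fg_module A ker_mod" "car ker_mod = ker"
 unfolding ker_mod_def using A.fg_sub[OF A.regular_fg A.right_idealD(8)[OF ker_props(2)]] by auto

text \<open>That is, \<open>Ext\<^sup>1(B, M) = 0\<close>.\<close>

definition acyclic :: "('a, 'm) right_mod => bool" where
 "acyclic M <-> (ALL f:mod_hom A ker_mod M. EX m:car M. ALL j:ker. f j = m *[M] j)"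

lemma acyclicD: "acyclic M ==> f:mod_hom A ker_mod M ==> EX m:car M. ALL j:ker. f j = m *[M] j"
 by(simp add: acyclic_def)

text \<open>The ideal \<open>ker\<close> is projective, so a homomorphism into the quotient
  \<open>C\<close> of \<open>E\<close> lifts to \<open>E\<close>. There it extends to
  \<open>A\<close> by injectivity and is given by the image of 1.\<close>

lemma acyclic_cokernel:
 assumes e: "e:car A" "e**e = e" and J: "proj_chain A e ker"
  and E: "injective_module A E" and C: "right_module A C" and p: "p:mod_hom A E C" "p ` car E = car C"
 shows "acyclic C"
 unfolding acyclic_def
proof
 note rE = A.fg_right_module[OF A.injective_fg[OF E]]
 fix f assume "f:mod_hom A ker_mod C"
 then obtain g where g: "g:mod_hom A ker_mod E" "!!x. x:ker ==> p (g x) = f x"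
  using A.proj_chain_lift[OF e J rE C p] unfolding ker_mod_def by blast
 have "(%x. x):mod_hom A ker_mod (regular A)"
  by(rule mod_homI) (use ker_props(1) in \<open>auto simp: ker_mod_def\<close>)
 then obtain h where h: "h:mod_hom A (regular A) E" "!!x. x:ker ==> h x = g x"
  using A.injective_extend[OF E ker_mod(1) A.regular_fg _ _ g(1), of "%x. x"] by(auto simp: ker_mod(2))
 have h1: "h \<one>:car E" using mod_homD(1)[OF h(1)] by simp
 show "EX m:car C. ALL j:ker. f j = m *[C] j"
 proof (intro bexI[of _ "p (h \<one>)"] ballI)
  fix j assume j: "j:ker"
  hence ja: "j:car A" using ker_props(1) by auto
  have "f j = p (h (\<one>**j))" using g(2) h(2) j ja by simp
  also have "h (\<one>**j) = h \<one> *[E] j" using mod_homD(3)[OF h(1), of "\<one>" j] ja by simp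
  finally show "f j = p (h \<one>) *[C] j" using mod_homD(3)[OF p(1) h1 ja] by simp
 qed (use mod_homD(1)[OF p(1) h1] in simp)
qed

text \<open>The sequence of \<open>M\<close>, \<open>E\<close> and \<open>C\<close> stays exact
  under \<open>push\<close> because \<open>M\<close> is acyclic, and \<open>C\<close> is acyclic
  again as a quotient of an injective module; so the whole resolution is carried over to
  \<open>B\<close>.\<close>

lemma push_idp:
 assumes e: "e:car A" "e**e = e" and J: "proj_chain A e ker"
 shows "idp A r M ==> acyclic M ==> idp B r (push M)"
proof (induct r arbitrary: M)
 case 0 thus ?case by(simp add: push_injective)
next
 case (Suc r)
 obtain E :: "('k, 'a) small_mod" and C i p where E: "injective_module A E" and C: "fg_module A C"
  and s: "ses A M i E p C" and idC: "idp A r C" using Suc(2) by(rule A.idp_SucE)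
 note S = sesD[OF s]
 note fM = A.idp_fg[OF Suc(2)]
 note rM = A.fg_right_module[OF fM] and rE = A.fg_right_module[OF A.injective_fg[OF E]] and rC = A.fg_right_module[OF C]
 interpret E: right_module A E by(rule rE)
 have "acyclic C" by(rule acyclic_cokernel[OF e J E rC S(3,4)])
 hence idp: "idp B r (push C)" using Suc(1) idC by blast
 have kc: "j:car A" if "j:ker" for j using that ker_props(1) by auto
 have ann: "f x:ann_part Q" if f: "f:mod_hom A P Q" "right_module A P" "right_module A Q" and x: "x:ann_part P"
  for f x and P Q :: "('k, 'a) small_mod"
  using x mod_homD(1)[OF f(1), of x] mod_homD(3)[OF f(1), of x] mod_hom_zero[OF f(2,3,1)] kc
  by(auto simp: ann_part_def) metis
 have push_hom: "f:mod_hom B (push P) (push Q)" if f: "f:mod_hom A P Q" "right_module A P" "right_module A Q"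
  for f and P Q :: "('k, 'a) small_mod"
 proof (rule mod_homI)
  fix x b assume x: "x:car (push P)" and b: "b:car B"
  thus "f (x *[push P] b) = f x *[push Q] b"
   using mod_homD(3)[OF f(1), of x "psi b"] psi[OF b] by(simp add: push_def ann_part_def)
 next
  fix x y assume "x:car (push P)" "y:car (push P)"
  thus "f (x +[push P] y) = f x +[push Q] f y"
   using mod_homD(2)[OF f(1), of x y] by(simp add: push_def ann_part_def)
 qed (use ann[OF f] in \<open>simp add: push_def\<close>)
 have sub: "ann_part P <= car P" for P :: "('k, 'a) small_mod" by(auto simp: ann_part_def)
 have "ses B (push M) i (push E) p (push C)"
  unfolding ses_def
 proof (intro conjI ballI push_hom[OF S(1) rM rE] push_hom[OF S(3) rE rC])
  show "inj_on i (car (push M))" using S(2) sub[of M] by(auto simp: push_def intro: inj_on_subset)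
  show "p ` car (push E) = car (push C)"
  proof
   show "p ` car (push E) <= car (push C)" using ann[OF S(3) rE rC] by(auto simp: push_def)
   show "car (push C) <= p ` car (push E)"
   proof
    fix c assume "c:car (push C)"
    hence c: "c:car C" "!!j. j:ker ==> c *[C] j = 0[C]" by(auto simp: push_def ann_part_def)
    obtain x where x: "x:car E" "c = p x" using c(1) S(4) by blast
    \<comment> \<open>Since \<open>c\<close> is killed by \<open>ker\<close>, the products
      \<open>x j\<close> come from \<open>M\<close>. Acyclicity provides one \<open>m\<close> with
      \<open>x j = (i m) j\<close> for all \<open>j\<close>, and \<open>x\<close> is corrected by
      \<open>i m\<close>.\<close>
    have xj: "EX m:car M. x *[E] j = i m" if j: "j:ker" for j
    proof -
     have "p (x *[E] j) = 0[C]" using mod_homD(3)[OF S(3) x(1) kc[OF j]] c(2)[OF j] x(2) by simp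
     thus ?thesis using S(5)[OF E.ract_closed[OF x(1) kc[OF j]]] by auto
    qed
    define ii where "ii = inv_into (car M) i"
    have ii: "ii (x *[E] j):car M" "i (ii (x *[E] j)) = x *[E] j" if "j:ker" for j
    proof -
     have "x *[E] j:i ` car M" using xj[OF that] by auto
     thus "ii (x *[E] j):car M" "i (ii (x *[E] j)) = x *[E] j"
      by(simp_all add: ii_def inv_into_into f_inv_into_f)
    qed
    have iim: "ii (i m) = m" if "m:car M" for m using that S(2) by(simp add: ii_def)
    interpret M: right_module A M by(rule rM)
    have "(%j. ii (x *[E] j)):mod_hom A ker_mod M"
    proof (rule mod_homI)
     fix j l assume "j:car ker_mod" "l:car ker_mod"
     hence j: "j:ker" "l:ker" by(simp_all add: ker_mod(2))
     have "x *[E] (j+.l) = i (ii (x *[E] j) +[M] ii (x *[E] l))"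
      using mod_homD(2)[OF S(1)] ii j x kc by(simp add: E.ract_add_right)
     thus "ii (x *[E] (j +[ker_mod] l)) = ii (x *[E] j) +[M] ii (x *[E] l)"
      using iim ii j by(simp add: ker_mod_def)
    next
     fix j a assume "j:car ker_mod" and a: "a:car A"
     hence j: "j:ker" by(simp add: ker_mod(2))
     have "x *[E] (j**a) = i (ii (x *[E] j) *[M] a)"
      using mod_homD(3)[OF S(1) _ a] ii j x kc a by(simp add: E.ract_assoc)
     thus "ii (x *[E] (j *[ker_mod] a)) = ii (x *[E] j) *[M] a"
      using iim ii j a M.ract_closed by(simp add: ker_mod_def)
    qed (use ii in \<open>simp add: ker_mod(2)\<close>)
    from acyclicD[OF Suc(3) this]
    obtain m where m: "m:car M" "!!j. j:ker ==> ii (x *[E] j) = m *[M] j"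
     by blast
    have im: "i m:car E" using mod_homD(1)[OF S(1) m(1)] .
    define y where "y = x \<ominus>\<^bsub>E\<^esub> i m"
    have y: "y:car E" using x im by(simp add: y_def)
    have "y *[E] j = 0[E]" if j: "j:ker" for j
    proof -
     have "i m *[E] j = x *[E] j" using mod_homD(3)[OF S(1) m(1) kc[OF j]] m(2)[OF j] ii(2)[OF j] by simp
     thus ?thesis using x im kc[OF j] E.ract_closed by(simp add: y_def E.ract_diff_left E.M.diff_self)
    qed
    hence "y:car (push E)" using y by(simp add: push_def ann_part_def)
    moreover have "p y = c"
    proof -
     interpret C: right_module A C by(rule rC)
     have "p y = p x \<ominus>\<^bsub>C\<^esub> p (i m)" unfolding y_def by(rule mod_hom_diff[OF rE rC S(3) x(1) im])
     thus ?thesis using S(6)[OF m(1)] x c(1) by(simp add: a_minus_def)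
    qed
    ultimately show "c:p ` car (push E)" by blast
   qed
  qed
  fix x assume x: "x:car (push E)"
  hence xc: "x:car E" by(simp add: push_def ann_part_def)
  show "p x = 0[push C] <-> x:i ` car (push M)"
  proof
   assume "p x = 0[push C]"
   then obtain m where m: "m:car M" "x = i m" using S(5)[OF xc] by(auto simp: push_def)
   have "m *[M] j = 0[M]" if j: "j:ker" for j
   proof -
    interpret M: right_module A M by(rule rM)
    have "i (m *[M] j) = 0[E]"
     using mod_homD(3)[OF S(1) m(1) kc[OF j]] x j m(2) by(simp add: push_def ann_part_def)
    thus ?thesis using S(2) mod_hom_inj_iff[OF rM rE S(1)] M.ract_closed[OF m(1) kc[OF j]] by blast
   qed
   thus "x:i ` car (push M)" using m by(auto simp: push_def ann_part_def)
  next
   assume "x:i ` car (push M)"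
   thus "p x = 0[push C]" using S(6) by(auto simp: push_def ann_part_def)
  qed
 qed
 thus ?case using idp push_injective[OF E] push_fg[OF fM] push_fg[OF C] by auto
qed

text \<open>As an \<open>A\<close>-module, \<open>A / ker\<close> has injective dimension at most
  \<open>r\<close>. It is acyclic since every homomorphism from \<open>ker\<close> to it is zero:
  the elements \<open>x\<close> of \<open>ker\<close> with \<open>x e = x\<close> generate, and
  their images are multiples by \<open>e\<close>, which lies in \<open>ker\<close>. Pushing this
  module to \<open>B\<close> gives the regular module.\<close>

lemma quotient_inj_dim:
 assumes e: "e:car A" "e**e = e" and J: "proj_chain A e ker"
  and gen: "!!N. right_ideal A N ==> {x:ker. x**e = x} <= N ==> ker <= N" and eJ: "e:ker"
  and d: "inj_dim_le A (regular A) r"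
 shows "inj_dim_le B (regular B) r"
proof -
 let ?Q = "quot_mod (regular A) ker" and ?q = "%x. ker +>\<^bsub>regular A\<^esub> x"
 note kD = A.right_idealD[OF ker_props(2)]
 note Q = quot_mod_facts[OF A.rreg kD(8)]
 obtain X c where X: "idp A r X" "c:mod_hom A ?Q X" "bij_betw c (car ?Q) (car X)"
  using A.quot_proj_chain_idp[OF e J d] by blast
 note rX = A.fg_right_module[OF A.idp_fg[OF X(1)]]
 interpret X: right_module A X by(rule rX)
 note f = mod_hom_comp[OF Q(2) X(2)]
 have fsurj: "(%x. c (?q x)) ` car A = car X"
  using Q(3) X(3) by(simp add: bij_betw_def flip: image_image)
 have f0: "c (?q a) = 0[X] <-> a:ker" if a: "a:car A" for a
 proof -
  have "c y = 0[X] <-> y = 0[?Q]" if "y:car ?Q" for y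
   using that X(3) mod_hom_inj_iff[OF Q(1) rX X(2)] mod_hom_zero[OF Q(1) rX X(2)] by(auto simp: bij_betw_def)
  thus ?thesis using mod_homD(1)[OF Q(2), of a] Q(4)[of a] a by simp
 qed
 have kA: "j:car A" if "j:ker" for j using that ker_props(1) by auto
 have annX: "x *[X] j = 0[X]" if x: "x:car X" and j: "j:ker" for x j
 proof -
  obtain a where a: "a:car A" "x = c (?q a)" using x fsurj by(metis (no_types, lifting) imageE)
  have "c (?q (a**j)) = x *[X] j" using mod_homD(3)[OF f, of a j] a kA[OF j] by simp
  thus ?thesis using f0[of "a**j"] ker_props(3)[OF a(1) j] kA by auto
 qed
 have "acyclic X"
  unfolding acyclic_def
 proof
  fix g assume g: "g:mod_hom A ker_mod X"
  note rk = A.fg_right_module[OF ker_mod(1)]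
  have "right_submodule A ker_mod {x:car ker_mod. g x:{0[X]}}"
   by(rule submodule_vimage[OF rk rX g submodule_zero[OF rX]])
  hence "right_ideal A {x:ker. g x = 0[X]}"
   using sub_mod_submodule_iff[OF A.rreg kD(8)] unfolding right_ideal_def
   by(simp add: ker_mod_def)
  moreover have "g x = 0[X]" if x: "x:ker" "x**e = x" for x
  proof -
   have "g (x *[ker_mod] e) = g x *[X] e" using mod_homD(3)[OF g, of x e] x e by(simp add: ker_mod(2))
   thus ?thesis using x annX[OF _ eJ, of "g x"] mod_homD(1)[OF g, of x] by(simp add: ker_mod_def)
  qed
  ultimately have "ker <= {x:ker. g x = 0[X]}" by(intro gen) auto
  thus "EX m:car X. ALL j:ker. g j = m *[X] j"
   using annX[of "0[X]"] by(intro bexI[of _ "0[X]"]) auto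
 qed
 hence idp: "idp B r (push X)" using push_idp[OF e J X(1)] by blast
 have annc: "ann_part X = car X" using annX by(auto simp: ann_part_def)
 define g where "g b = c (?q (psi b))" for b
 have g: "g (phi a) = c (?q a)" if a: "a:car A" for a
 proof -
  have p: "psi (phi a):car A" "psi (phi a)-.a:ker"
   using psi[OF phi_closed[OF a]] phi_eq_iff[of "psi (phi a)" a] a by auto
  have "c (?q (psi (phi a)-.a)) = 0[X]" using f0 p a by simp
  moreover have "psi (phi a) = (psi (phi a)-.a)+.a" using p a by(simp add: A.A.diff_add_cancel)
  ultimately have "c (?q (psi (phi a))) = 0[X] \<oplus>\<^bsub>X\<^esub> c (?q a)"
   using mod_homD(2)[OF f, of "psi (phi a)-.a" a] p a by simp
  thus ?thesis using mod_homD(1)[OF f, of a] a by(simp add: g_def)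
 qed
 have gh: "g:mod_hom B (regular B) (push X)"
 proof (rule mod_homI)
  fix x assume "x:car (regular B)"
  thus "g x:car (push X)" using mod_homD(1)[OF f, of "psi x"] psi by(simp add: g_def push_def annc)
 next
  fix x y assume "x:car (regular B)" "y:car (regular B)"
  then obtain a b where ab: "a:car A" "b:car A" "x = phi a" "y = phi b" using psi by(metis regular_simps(1))
  thus "g (x +[regular B] y) = g x +[push X] g y"
   using g[of "a+.b"] g mod_homD(2)[OF f, of a b] by(simp add: phi_add push_def)
 next
  fix x y assume "x:car (regular B)" "y:car B"
  then obtain a b where ab: "a:car A" "b:car A" "x = phi a" "y = phi b" using psi by(metis regular_simps(1))
  have "g x *[push X] y = g x *[X] b"
   using push_ract[OF rX _ ab(2), of "g x"] mod_homD(1)[OF f, of a] g ab annc by simp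
  thus "g (x *[regular B] y) = g x *[push X] y"
   using ab g[of "a**b"] g mod_homD(3)[OF f, of a b] by(simp add: phi_mult)
 qed
 have "bij_betw g (car (regular B)) (car (push X))"
 proof (rule bij_betw_imageI)
  note rPX = push_right_module[OF rX]
  show "inj_on g (car (regular B))"
   unfolding mod_hom_inj_iff[OF B.rreg rPX gh]
  proof (intro ballI impI)
   fix x assume x: "x:car (regular B)" "g x = 0[push X]"
   then obtain a where a: "a:car A" "x = phi a" using psi by(metis regular_simps(1))
   hence "a:ker" using x g f0 by(simp add: push_def)
   thus "x = 0[regular B]" using a by(simp add: ker_def)
  qed
  have "g ` car B = g ` phi ` car A" using surj by simp
  also have "\<dots> = (%x. c (?q x)) ` car A" unfolding image_image using g by(rule image_cong[OF refl])
  finally show "g ` car (regular B) = car (push X)" using fsurj by(simp add: push_def annc)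
 qed
 thus ?thesis using B.inj_dim_le_iso[OF gh _ B.inj_dim_le_of_idp[OF idp]] by blast
qed

end

section \<open>Local corner algebras\<close>

definition corner :: "('k, 'a) module => 'a => 'a set" where
 "corner A e = {x:car A. e **[A] x = x & x **[A] e = x}"

definition nilpotent_elt :: "('k, 'a) module => 'a => bool" where
 "nilpotent_elt A x <-> (EX m::nat. x [^]\<^bsub>A\<^esub> m = 0[A])"

definition corner_unit :: "('k, 'a) module => 'a => 'a => bool" where
 "corner_unit A e x <-> (EX y:corner A e. x **[A] y = e & y **[A] x = e)"

text \<open>For a local idempotent this is the radical of \<open>e A e\<close>.\<close>

definition corner_rad :: "('k, 'a) module => 'a => 'a set" where
 "corner_rad A e = {x:corner A e. ~ corner_unit A e x}"

text \<open>Locality of \<open>e A e\<close> in the form that Fitting's argument delivers; it passes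
  directly to opposite algebras and to nonzero images in quotients.\<close>

definition local_idempotent :: "('k, 'a) module => 'a => bool" where
 "local_idempotent A e <-> e:car A & e **[A] e = e & e ~= 0[A] &
   (ALL x:corner A e. nilpotent_elt A x \<or> corner_unit A e x)"

lemma op_simps [simp]:
 "car (op_algebra A) = car A" "x **[op_algebra A] y = y **[A] x"
 "1[op_algebra A] = 1[A]" "0[op_algebra A] = 0[A]" "x +[op_algebra A] y = x +[A] y"
 "k \<odot>\<^bsub>op_algebra A\<^esub> x = k \<odot>\<^bsub>A\<^esub> x" "op_algebra (op_algebra A) = A"
 by(simp_all add: op_algebra_def)

lemma op_fd_algebra:
 assumes "fd_algebra K A"
 shows "fd_algebra K (op_algebra A)"
proof -
 interpret fd_alg K A using assms by(rule fd_algI)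
 have ab: "abelian_group (op_algebra A)"
  by(rule abelian_groupI) (auto simp: A.a_ac intro: bexI[of _ "\<ominus>\<^bsub>A\<^esub> _"] A.l_neg)
 have ri: "ring (op_algebra A)"
  by(rule ringI[OF ab monoidI]) (auto simp: A.m_assoc A.l_distr A.r_distr)
 have mo: "module K (op_algebra A)"
  by(rule moduleI[OF F.cring_axioms ab]) (auto simp: smult_l_distr smult_r_distr smult_assoc1)
 have eq: "finsum (op_algebra A) f B = finsum A f B" for f :: "'c => 'b" and B
  by(simp add: finsum_def op_algebra_def)
 show ?thesis
  unfolding fd_algebra_def fd_algebra_axioms_def
  using mo F.field_axioms ri fd_algebra.finite_dim[OF assms] by(auto simp: smult_mult eq)
qed

lemma op_corner [simp]: "corner (op_algebra A) e = corner A e"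
 by(auto simp: corner_def)

lemma op_pow: "ring A ==> x:car A ==> x [^]\<^bsub>op_algebra A\<^esub> (m::nat) = x [^]\<^bsub>A\<^esub> m"
proof (induct m)
 case (Suc m)
 interpret ring A by fact
 have "x [^]\<^bsub>op_algebra A\<^esub> Suc m = x **[A] x [^]\<^bsub>op_algebra A\<^esub> m" by(simp add: nat_pow_def)
 also have "\<dots> = x **[A] x [^]\<^bsub>A\<^esub> m" using Suc by simp
 also have "\<dots> = x [^]\<^bsub>A\<^esub> Suc m" using Suc(3) by(rule nat_pow_Suc2[symmetric])
 finally show ?case .
qed (simp add: nat_pow_def)

lemma op_local_idempotent:
 assumes "ring A" "local_idempotent A e"
 shows "local_idempotent (op_algebra A) e"
 using assms(2) unfolding local_idempotent_def
 by(auto simp: corner_unit_def nilpotent_elt_def op_pow[OF assms(1)] corner_def)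

locale corner_alg = fd_alg K A for K :: "'k ring" and A :: "('k, 'a) module" (structure) +
 fixes e :: 'a
 assumes loc: "local_idempotent A e"
begin

abbreviation Gam :: "'a set" where "Gam == corner A e"

abbreviation R :: "'a set" where "R == corner_rad A e"

lemma e: "e:car A" "e**e = e" "e ~= \<zero>" "e:Gam"
 using loc by(auto simp: local_idempotent_def corner_def)

lemma G_carrier: "x:Gam ==> x:car A"
 and G_e: "x:Gam ==> e**x = x" "x:Gam ==> x**e = x"
 by(auto simp: corner_def)

lemma G_mult: "x:Gam ==> y:Gam ==> x**y:Gam"
proof -
 assume x: "x:Gam" and y: "y:Gam"
 have "e**(x**y) = x**y"
  using G_carrier[OF x] G_carrier[OF y] e(1) G_e(1)[OF x] by(simp flip: A.m_assoc)
 moreover have "(x**y)**e = x**y"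
  using G_carrier[OF x] G_carrier[OF y] e(1) G_e(2)[OF y] by(simp add: A.m_assoc)
 ultimately show ?thesis using x y by(simp add: corner_def)
qed

lemma G_corner: "a:car A ==> e**a**e:Gam"
proof -
 assume a: "a:car A"
 have "e**(e**a**e) = e**a**e" using a e by(simp flip: A.m_assoc)
 moreover have "(e**a**e)**e = e**a**e" using a e by(simp add: A.m_assoc)
 ultimately show ?thesis using a e by(simp add: corner_def)
qed

lemma G_add: "x:Gam ==> y:Gam ==> x+.y:Gam"
 and G_zero: "\<zero>:Gam"
 and G_smult: "k:car K ==> x:Gam ==> k \<odot> x:Gam"
 using e by(auto simp: corner_def A.l_distr A.r_distr smult_mult)

lemma G_subspace: "vsA.subspace Gam"
 by(rule vsA.subspaceI) (auto simp: G_carrier G_add G_zero G_smult)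

lemmas G_diff = vsA.subspaceD(6)[OF G_subspace] and G_minus = vsA.subspaceD(5)[OF G_subspace]

lemma unit_or_nilpotent: "x:Gam ==> x ~: R ==> corner_unit A e x"
 and R_nilpotent: "x:R ==> nilpotent_elt A x"
 and R_G: "x:R ==> x:Gam"
 using loc by(auto simp: local_idempotent_def corner_rad_def)

text \<open>A right invertible \<open>x\<close> is not nilpotent, because \<open>y\<close> cancels
  one factor of a power of \<open>x\<close> at a time; by the dichotomy it is a unit.\<close>

lemma inverse_two_sided:
 assumes x: "x:Gam" and y: "y:Gam" and xy: "x**y = e"
 shows "y**x = e" "x ~: R" "y ~: R"
proof -
 note c = G_carrier[OF x] G_carrier[OF y]
 have "x [^] m**e ~= \<zero>" for m :: nat
 proof (induct m)
  case 0 thus ?case using e by simp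
 next
  case (Suc m)
  have p: "x [^] m:car A" using c by simp
  have "x [^] Suc m**e**y = x [^] m**e"
   using p c e G_e(2)[OF x] xy by(simp add: A.m_assoc G_e(1)[OF y])
  thus ?case using Suc c by(metis A.l_null)
 qed
 hence "~ nilpotent_elt A x" unfolding nilpotent_elt_def using e by(metis A.l_null)
 thus xR: "x ~: R" using R_nilpotent by blast
 then obtain x' where x': "x':Gam" "x**x' = e" "x'**x = e"
  using unit_or_nilpotent[OF x] by(auto simp: corner_unit_def)
 have "x' = x'**(x**y)" using xy G_e(2)[OF x'(1)] by simp
 also have "\<dots> = y" using x'(3) G_e(1)[OF y] G_carrier[OF x'(1)] c by(simp flip: A.m_assoc)
 finally show yx: "y**x = e" using x' by simp
 thus "y ~: R" using x xy by(auto simp: corner_rad_def corner_unit_def)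
qed

lemma R_mult: "x:R ==> y:Gam ==> x**y:R" "x:R ==> y:Gam ==> y**x:R"
proof -
 show "x**y:R" if x: "x:R" and y: "y:Gam"
 proof (rule ccontr)
  assume "x**y ~: R"
  then obtain z where z: "z:Gam" "x**y**z = e"
   using unit_or_nilpotent[OF G_mult[OF R_G[OF x] y]] by(auto simp: corner_unit_def)
  thus False
   using inverse_two_sided(2)[OF R_G[OF x] G_mult[OF y z(1)]] x R_G[OF x] y by(simp add: G_carrier A.m_assoc)
 qed
 show "y**x:R" if x: "x:R" and y: "y:Gam"
 proof (rule ccontr)
  assume "y**x ~: R"
  then obtain z where z: "z:Gam" "z**(y**x) = e"
   using unit_or_nilpotent[OF G_mult[OF y R_G[OF x]]] by(auto simp: corner_unit_def)
  thus False
   using inverse_two_sided(3)[OF G_mult[OF z(1) y] R_G[OF x]] x R_G[OF x] y by(simp add: G_carrier A.m_assoc)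
 qed
qed

text \<open>Geometric series of a nilpotent element.\<close>

lemma one_minus_R:
 assumes x: "x:R"
 shows "corner_unit A e (e-.x)"
proof -
 note xG = R_G[OF x]
 note c = G_carrier[OF xG] e(1)
 \<comment> \<open>The factor \<open>e\<close> turns the zeroth power, which is the identity of
   \<open>A\<close>, into the identity of the corner.\<close>
 have step: "EX y:Gam. (e-.x)**y = e-.x [^] m**e & x [^] m**e:Gam" for m :: nat
 proof (induct m)
  case 0
  show ?case using e c by(intro bexI[of _ "\<zero>"]) (auto simp: G_zero A.diff_self)
 next
  case (Suc m)
  then obtain y where y: "y:Gam" "(e-.x)**y = e-.x [^] m**e" "x [^] m**e:Gam" by auto
  define p where "p = x [^] m**e"
  have p: "p:Gam" "p:car A" "e**p = p" using y(3) G_carrier G_e by(auto simp: p_def)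
  have yc: "y:car A" using y G_carrier by auto
  have xp: "x [^] Suc m**e = x**p" unfolding p_def A.nat_pow_Suc2[OF c(1)] using c by(simp add: A.m_assoc)
  have "(e-.x)**(y+.p) = (e-.p)+.(p-.x**p)"
   using y(2) p yc c by(simp add: A.r_distr flip: p_def) (simp add: a_minus_def A.l_distr A.l_minus)
  also have "\<dots> = e-.x**p" using p c by(simp add: a_minus_def A.a_assoc A.r_neg1)
  finally show ?case unfolding xp using G_add[OF y(1) p(1)] G_mult[OF xG p(1)] by blast
 qed
 obtain m :: nat where m: "x [^] m = \<zero>" using R_nilpotent[OF x] by(auto simp: nilpotent_elt_def)
 obtain y where "y:Gam" "(e-.x)**y = e" using step[of m] m c by(auto simp: a_minus_def)
 thus ?thesis using inverse_two_sided(2)[OF G_diff[OF e(4) xG]] unit_or_nilpotent[OF G_diff[OF e(4) xG]] by blast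
qed

text \<open>If \<open>(x + y) u = e\<close>, then \<open>y u = e - x u\<close> would be a
  unit.\<close>

lemma R_add: "x:R ==> y:R ==> x+.y:R"
proof (rule ccontr)
 assume x: "x:R" and y: "y:R" and n: "x+.y ~: R"
 note xG = R_G[OF x] and yG = R_G[OF y]
 obtain u where u: "u:Gam" "(x+.y)**u = e"
  using unit_or_nilpotent[OF G_add[OF xG yG] n] by(auto simp: corner_unit_def)
 note c = G_carrier[OF xG] G_carrier[OF yG] G_carrier[OF u(1)] e(1)
 have "y**u = e-.x**u"
  using u(2) c by(metis A.a_comm A.diff_eq_iff A.l_distr A.m_closed)
 hence "corner_unit A e (y**u)" using one_minus_R[OF R_mult(1)[OF x u(1)]] by simp
 thus False using R_mult(1)[OF y u(1)] by(simp add: corner_rad_def)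
qed

lemma R_zero: "\<zero>:R"
 using G_zero e(1,3) by(auto simp: corner_rad_def corner_unit_def corner_def)

text \<open>Right ideals of the corner ring \<open>e A e\<close>, and homomorphisms from these to \<open>M e\<close>.\<close>

definition cideal :: "'a set => bool" where
 "cideal H <-> additive_subgroup H A & H <= Gam & (ALL x:H. ALL y:Gam. x**y:H)"

lemma cidealI:
 assumes "H <= Gam" "\<zero>:H" "!!x y. x:H ==> y:H ==> x+.y:H"
  "!!x y. x:H ==> y:Gam ==> x**y:H"
 shows "cideal H"
proof -
 have "\<ominus> x:H" if "x:H" for x
 proof -
  have xG: "x:Gam" using that assms(1) by auto
  have "x**(\<ominus> e) = \<ominus> x" using G_carrier[OF xG] e G_e(2)[OF xG] by(simp add: A.r_minus)
  thus ?thesis using assms(4)[OF that G_minus[OF e(4)]] by simp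
 qed
 thus ?thesis using assms G_carrier unfolding cideal_def additive_subgroup_iff[OF A.is_abelian_group] by auto
qed

lemma cidealD:
 assumes "cideal H"
 shows "x:H ==> x:Gam" "\<zero>:H" "x:H ==> y:H ==> x+.y:H"
  "x:H ==> y:Gam ==> x**y:H" "additive_subgroup H A" "x:H ==> y:H ==> x-.y:H"
 using assms A.subgroup_diff unfolding cideal_def additive_subgroup_iff[OF A.is_abelian_group] by auto

lemma cideal_subspace: "cideal H ==> vsA.subspace H"
proof -
 assume H: "cideal H"
 show ?thesis
 proof (rule vsA.subspaceI)
  fix k x assume k: "k:car K" and x: "x:H"
  have "k \<odot> x = x**(k \<odot> e)"
   using k x cidealD(1)[OF H x] e by(simp add: smult_mult G_carrier G_e)
  thus "k \<odot> x:H" using cidealD(4)[OF H x G_smult[OF k e(4)]] by simp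
 qed (use cidealD[OF H] G_carrier in auto)
qed

lemma cideal_R: "cideal R"
 by(rule cidealI) (auto simp: R_G R_zero R_add R_mult)

lemma cideal_G: "cideal Gam"
 by(rule cidealI) (auto simp: G_zero G_add G_mult)

lemma cideal_add_mult:
 assumes H: "cideal H" and y: "y:Gam" and L: "cideal L"
 shows "cideal {u+.y**w | u w. u:H & w:L}" (is "cideal ?W")
proof (rule cidealI)
 note HD = cidealD[OF H] and LD = cidealD[OF L]
 have c: "x:H ==> x:car A" "x:L ==> x:car A" for x using HD(1) LD(1) G_carrier by auto
 note yc = G_carrier[OF y]
 show "?W <= Gam" using HD(1) LD(1) y by(auto intro!: G_add G_mult)
 show "\<zero>:?W" using HD(2) LD(2) yc by force
 show "s+.t:?W" if st: "s:?W" "t:?W" for s t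
 proof -
  obtain u w u' w' where *: "s = u+.y**w" "u:H" "w:L" "t = u'+.y**w'" "u':H" "w':L"
   using st by auto
  have "s+.t = (u+.u')+.y**(w+.w')"
   using * c yc by(simp add: A.r_distr A.a_ac)
  thus ?thesis using HD(3)[OF *(2,5)] LD(3)[OF *(3,6)] by blast
 qed
 show "s**a:?W" if st: "s:?W" "a:Gam" for s a
 proof -
  obtain u w where *: "s = u+.y**w" "u:H" "w:L" using st by auto
  have "s**a = u**a+.y**(w**a)"
   using * c yc G_carrier[OF st(2)] by(simp add: A.l_distr A.m_assoc)
  thus ?thesis using HD(4)[OF *(2) st(2)] LD(4)[OF *(3) st(2)] by blast
 qed
qed

lemma cideal_principal: "y:Gam ==> cideal {y**w | w. w:Gam}"
proof -
 assume y: "y:Gam"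
 have z: "cideal {\<zero>}" by(rule cidealI) (auto simp: G_zero G_carrier)
 have "{u+.y**w | u w. u:{\<zero>} & w:Gam} = {y**w | w. w:Gam}"
 proof (intro Set.set_eqI iffI)
  fix x assume "x:{u+.y**w | u w. u:{\<zero>} & w:Gam}"
  then obtain w where "w:Gam" "x = \<zero> \<oplus> y**w" by auto
  thus "x:{y**w | w. w:Gam}" using G_carrier G_mult[OF y] by auto
 next
  fix x assume "x:{y**w | w. w:Gam}"
  then obtain w where w: "w:Gam" "x = y**w" by auto
  hence "x = \<zero> \<oplus> y**w" using G_carrier G_mult[OF y] by simp
  thus "x:{u+.y**w | u w. u:{\<zero>} & w:Gam}" using w by blast
 qed
 thus ?thesis using cideal_add_mult[OF z y cideal_G] by simp
qed

definition chom :: "('a, 'm) right_mod => 'a set => ('a => 'm) => bool" where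
 "chom M H h <-> (ALL x:H. h x:car M & h x *[M] e = h x) &
   (ALL x:H. ALL y:H. h (x+.y) = h x +[M] h y) &
   (ALL x:H. ALL y:Gam. h (x**y) = h x *[M] y)"

lemma chomI:
 assumes "!!x. x:H ==> h x:car M" "!!x. x:H ==> h x *[M] e = h x"
  "!!x y. x:H ==> y:H ==> h (x+.y) = h x +[M] h y"
  "!!x y. x:H ==> y:Gam ==> h (x**y) = h x *[M] y"
 shows "chom M H h"
 using assms by(simp add: chom_def)

lemma chomD:
 assumes "chom M H h"
 shows "x:H ==> h x:car M" "x:H ==> h x *[M] e = h x"
  "x:H ==> y:H ==> h (x+.y) = h x +[M] h y"
  "x:H ==> y:Gam ==> h (x**y) = h x *[M] y"
 using assms by(simp_all add: chom_def)

definition extends :: "('a, 'm) right_mod => 'a set => ('a => 'm) => bool" where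
 "extends M H h <-> (EX z:car M. z *[M] e = z & (ALL x:H. h x = z *[M] x))"

text \<open>Injectivity of the right \<open>e A e\<close>-module \<open>M e\<close>, in the form of
  Baer's criterion. It is phrased for \<open>A\<close>-modules because the terms of a resolution are
  such.\<close>

definition cinj :: "('a, 'm) right_mod => bool" where
 "cinj M <-> (ALL H h. cideal H --> chom M H h --> extends M H h)"

text \<open>The value \<open>h u + x0 w\<close> does not depend on the representation
  \<open>u + y w\<close>, since two representations differ by an element \<open>y w\<close> of
  \<open>H\<close>, where \<open>compat\<close> applies.\<close>

lemma chom_extend_step:
 assumes M: "right_module A M" and H: "cideal H" and h: "chom M H h" and y: "y:Gam" and L: "cideal L"
  and x0: "x0:car M" "x0 *[M] e = x0"
  and compat: "!!w. w:L ==> y**w:H ==> h (y**w) = x0 *[M] w"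
 shows "EX h'. chom M {u+.y**w | u w. u:H & w:L} h' &
  (ALL u:H. ALL w:L. h' (u+.y**w) = h u +[M] x0 *[M] w)"
proof -
 interpret M: right_module A M by fact
 note HD = cidealD[OF H] and LD = cidealD[OF L] and hD = chomD[OF h]
 have c: "x:H ==> x:car A" "x:L ==> x:car A" for x using HD(1) LD(1) G_carrier by auto
 note yc = G_carrier[OF y]
 have hc: "u:H ==> h u:car M" and xc: "w:L ==> x0 *[M] w:car M" for u w
  using hD(1) x0 c M.ract_closed by auto
 have wd: "h u +[M] x0 *[M] w = h u' +[M] x0 *[M] w'"
  if eq: "u+.y**w = u'+.y**w'" and u: "u:H" "u':H" and w: "w:L" "w':L" for u u' w w'
 proof -
  note cc = c(1)[OF u(1)] c(1)[OF u(2)] c(2)[OF w(1)] c(2)[OF w(2)]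
  have d: "w-.w':L" using LD(6) w by auto
  have "\<zero> = (u+.y**w)-.(u'+.y**w')" using eq cc yc by(simp add: A.diff_self)
  also have "\<dots> = (u-.u')+.(y**w-.y**w')" using cc yc by(simp add: A.diff_add_diff)
  also have "y**w-.y**w' = y**(w-.w')"
   using cc yc by(simp add: a_minus_def A.r_distr A.r_minus)
  finally have z: "(u-.u')+.y**(w-.w') = \<zero>" by simp
  have inH: "y**(w-.w'):H"
   by(rule A.subgroup_add_cancel'[OF HD(5) _ HD(6)[OF u]]) (use cc yc z HD(2) in auto)
  have "u' = u+.y**(w-.w')"
  proof -
   have "u' = (u+.y**w)-.y**w'" using cc yc eq by(simp add: A.add_diff_cancel)
   thus ?thesis using cc yc by(simp add: a_minus_def A.r_distr A.r_minus A.a_assoc)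
  qed
  hence "h u' = h u +[M] x0 *[M] (w-.w')" using hD(3)[OF u(1) inH] compat[OF d inH] by simp
  hence "h u' +[M] x0 *[M] w' = h u +[M] (x0 *[M] (w-.w') +[M] x0 *[M] w')"
   using hc u cc x0 M.ract_closed by(simp add: M.M.a_assoc)
  also have "x0 *[M] (w-.w') +[M] x0 *[M] w' = x0 *[M] w"
   using cc x0 M.ract_closed by(simp add: M.ract_diff_right M.M.diff_add_cancel)
  finally show ?thesis by simp
 qed
 let ?W = "{u+.y**w | u w. u:H & w:L}"
 define h' where "h' x = (THE z. EX u:H. EX w:L. x = u+.y**w & z = h u +[M] x0 *[M] w)" for x
 have h': "h' (u+.y**w) = h u +[M] x0 *[M] w" if "u:H" "w:L" for u w
  unfolding h'_def
 proof (rule the_equality)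
  show "EX u':H. EX w':L. u+.y**w = u'+.y**w' & h u +[M] x0 *[M] w = h u' +[M] x0 *[M] w'"
   using that by blast
  fix z assume "EX u':H. EX w':L. u+.y**w = u'+.y**w' & z = h u' +[M] x0 *[M] w'"
  then obtain u' w' where "u':H" "w':L" "u+.y**w = u'+.y**w'" "z = h u' +[M] x0 *[M] w'"
   by blast
  thus "z = h u +[M] x0 *[M] w" using wd[of u w u' w'] that by simp
 qed
 have "chom M ?W h'"
 proof (rule chomI)
  fix x assume "x:?W"
  then obtain u w where uw: "x = u+.y**w" "u:H" "w:L" by auto
  show "h' x:car M" using h' uw hc xc by simp
  have "x0 *[M] w *[M] e = x0 *[M] w"
   using x0 c uw e G_e(2)[OF LD(1)[OF uw(3)]] by(simp flip: M.ract_assoc)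
  thus "h' x *[M] e = h' x" using h' uw hc xc hD(2) e(1) by(simp add: M.ract_add_left)
 next
  fix s t assume st: "s:?W" "t:?W"
  obtain u w where 1: "s = u+.y**w" "u:H" "w:L" using st(1) by auto
  obtain u' w' where 2: "t = u'+.y**w'" "u':H" "w':L" using st(2) by auto
  have "s+.t = (u+.u')+.y**(w+.w')"
   using 1 2 c yc by(simp add: A.r_distr A.a_ac)
  hence "h' (s+.t) = h (u+.u') +[M] x0 *[M] (w+.w')"
   using h' HD(3)[OF 1(2) 2(2)] LD(3)[OF 1(3) 2(3)] by simp
  thus "h' (s+.t) = h' s +[M] h' t"
   using h' 1 2 hD(3) hc xc x0 c by(simp add: M.ract_add_right M.M.a_ac)
 next
  fix s a assume s: "s:?W" and a: "a:Gam"
  obtain u w where 1: "s = u+.y**w" "u:H" "w:L" using s by auto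
  note ac = G_carrier[OF a]
  have "s**a = u**a+.y**(w**a)" using 1 c yc ac by(simp add: A.l_distr A.m_assoc)
  hence "h' (s**a) = h (u**a) +[M] x0 *[M] (w**a)"
   using h' HD(4)[OF 1(2) a] LD(4)[OF 1(3) a] by simp
  thus "h' (s**a) = h' s *[M] a"
   using h' 1 hD(4)[OF 1(2) a] hc xc x0 c ac by(simp add: M.ract_add_left M.ract_assoc)
 qed
 thus ?thesis using h' by blast
qed

text \<open>Baer's criterion: as \<open>R\<close> is the only maximal right ideal of \<open>e A e\<close>, it is the only one that has
  to be tested.\<close>

lemma cinjI:
 assumes M: "right_module A M" and RM: "!!h. chom M R h ==> extends M R h"
 shows "cinj M"
 unfolding cinj_def
proof (intro allI impI)
 interpret M: right_module A M by fact
 fix H h assume H: "cideal H" and h: "chom M H h"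
 define P where "P H' <-> cideal H' & H <= H' & (EX h'. chom M H' h' & (ALL x:H. h' x = h x))" for H'
 have "P H" using H h by(auto simp: P_def)
 moreover have "vsA.subspace U" if "P U" for U using that cideal_subspace by(simp add: P_def)
 ultimately obtain H' where H': "P H'" and max: "ALL W. P W --> ~ H' \<subset> W"
  using vsA.maximal_subspace_ex[OF fin_dim_A, of P H] by auto
 then obtain h' where cH': "cideal H'" and HH': "H <= H'" and h': "chom M H' h'" "ALL x:H. h' x = h x" by(auto simp: P_def)
 note D = cidealD[OF cH'] and hD = chomD[OF h'(1)]
 show "extends M H h"
 proof (cases "e:H'")
  case True
  have "h x = h' e *[M] x" if x: "x:H" for x
  proof -
   have xG: "x:Gam" using x HH' D(1) by auto
   show ?thesis using hD(4)[OF True xG] G_e(1)[OF xG] h'(2) x by simp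
  qed
  thus ?thesis unfolding extends_def using hD(1,2)[OF True] by(intro bexI[of _ "h' e"]) auto
 next
  case False
  \<comment> \<open>A right ideal \<open>L\<close> minimal above \<open>H'\<close> is chosen. For
    \<open>y\<close> in \<open>L\<close> outside \<open>H'\<close>, a Nakayama argument puts
    \<open>y R\<close> into \<open>H'\<close>, so that \<open>w\<close> taken to
    \<open>h' (y w)\<close> is a homomorphism on \<open>R\<close>, to which the hypothesis
    applies.\<close>
  define S where "S L <-> cideal L & H' \<subset> L" for L
  have "S Gam" using D(1) False e(4) cideal_G by(auto simp: S_def)
  moreover have "vsA.subspace U" if "S U" for U using that cideal_subspace by(simp add: S_def)
  ultimately obtain L where L: "S L" and min: "ALL W. S W --> ~ W \<subset> L"
   using vsA.minimal_subspace_ex[OF fin_dim_A, of S Gam] by auto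
  have cL: "cideal L" using L by(simp add: S_def)
  obtain y where y: "y:L" "y ~: H'" using L by(auto simp: S_def)
  note LD = cidealD[OF cL]
  note yG = LD(1)[OF y(1)]
  note yc = G_carrier[OF yG]
  have inH: "y**u ~: H'" if u: "u:Gam" "u ~: R" for u
  proof
   assume a: "y**u:H'"
   obtain v where v: "v:Gam" "u**v = e" using unit_or_nilpotent[OF u] by(auto simp: corner_unit_def)
   have "y**u**v = y" using yc u v G_carrier G_e(2)[OF yG] by(simp add: A.m_assoc)
   thus False using D(4)[OF a v(1)] y(2) by simp
  qed
  let ?W = "{u+.y**w | u w. u:H' & w:R}"
  have cW: "cideal ?W" by(rule cideal_add_mult[OF cH' yG cideal_R])
  have HW: "H' <= ?W"
  proof
   fix u assume u: "u:H'"
   hence "u = u+.y**\<zero>" using yc D(1) G_carrier by simp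
   thus "u:?W" using u R_zero by blast
  qed
  have WL: "?W <= L" using L LD(3,4) y(1) R_G by(auto simp: S_def)
  have "y ~: ?W"
  proof
   assume "y:?W"
   then obtain u w where uw: "y = u+.y**w" "u:H'" "w:R" by auto
   have c: "u:car A" "w:car A" using uw D(1) R_G G_carrier by auto
   have "u = y-.y**w"
    using A.add_diff_cancel[of u "y**w"] uw(1) c yc by(metis A.m_closed)
   also have "\<dots> = y**(e-.w)" using yc c e(1) G_e(2)[OF yG] by(simp add: a_minus_def A.r_distr A.r_minus)
   finally have "y**(e-.w):H'" using uw(2) by simp
   thus False using inH[OF G_diff[OF e(4) R_G[OF uw(3)]]] one_minus_R[OF uw(3)] by(simp add: corner_rad_def)
  qed
  hence "?W \<subset> L" using WL y(1) by auto
  hence "~ S ?W" using min by blast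
  hence WH: "?W = H'" using HW cW by(auto simp: S_def)
  have yR: "y**w:H'" if w: "w:R" for w
  proof -
   have "y**w = \<zero> \<oplus> y**w" using w R_G G_carrier yc by simp
   hence "y**w:?W" using w D(2) by blast
   thus ?thesis using WH by simp
  qed
  have "chom M R (%w. h' (y**w))"
  proof (rule chomI)
   fix w v assume "w:R" "v:R"
   thus "h' (y**(w+.v)) = h' (y**w) +[M] h' (y**v)"
    using hD(3)[OF yR yR] yc R_G G_carrier by(simp add: A.r_distr)
  next
   fix w v assume "w:R" "v:Gam"
   thus "h' (y**(w**v)) = h' (y**w) *[M] v"
    using hD(4)[OF yR] yc R_G G_carrier by(simp flip: A.m_assoc)
  qed (use hD yR in auto)
  then obtain x0 where x0: "x0:car M" "x0 *[M] e = x0" "ALL w:R. h' (y**w) = x0 *[M] w"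
   using RM unfolding extends_def by blast
  let ?V = "{u+.y**w | u w. u:H' & w:Gam}"
  \<comment> \<open>By \<open>inH\<close>, an element \<open>w\<close> with \<open>y w\<close> in
    \<open>H'\<close> lies in \<open>R\<close>, and on \<open>R\<close> the element
    \<open>x0\<close> was chosen to fit.\<close>
  have "EX h''. chom M ?V h'' & (ALL u:H'. ALL w:Gam. h'' (u+.y**w) = h' u +[M] x0 *[M] w)"
   by(rule chom_extend_step[OF M cH' h'(1) yG cideal_G x0(1,2)]) (use inH x0(3) in blast)
  then obtain h'' where h'': "chom M ?V h''" "!!u w. u:H' ==> w:Gam ==> h'' (u+.y**w) = h' u +[M] x0 *[M] w"
   by blast
  have ez: "u = u+.y**\<zero>" if "u:H'" for u using that yc D(1) G_carrier by simp
  have sub: "H' <= ?V" using ez G_zero by blast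
  have "h'' x = h x" if x: "x:H" for x
  proof -
   have xH: "x:H'" using x HH' by auto
   have "h'' (x+.y**\<zero>) = h' x" using h''(2)[OF xH G_zero] hD(1)[OF xH] x0(1) by simp
   thus ?thesis using ez[OF xH] h'(2) x by simp
  qed
  hence "P ?V" unfolding P_def using cideal_add_mult[OF cH' yG cideal_G] sub HH' h''(1) by blast
  moreover have "y:?V"
  proof -
   have "y = \<zero> \<oplus> y**e" using yc G_e(2)[OF yG] by simp
   thus ?thesis using D(2) e(4) by blast
  qed
  ultimately show ?thesis using max sub y(2) by blast
 qed
qed

text \<open>The right socle of \<open>e A e\<close>.\<close>

definition rsoc :: "'a set" where "rsoc = {x:Gam. ALL w:R. x**w = \<zero>}"

text \<open>In a minimal nonzero right ideal, \<open>s w\<close> nonzero with \<open>w\<close> in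
  \<open>R\<close> would give \<open>s = s w v\<close>; but \<open>e - w v\<close> is a unit, so
  \<open>s\<close> would vanish.\<close>

lemma rsoc_ex:
 assumes H: "cideal H" and ne: "H ~= {\<zero>}"
 shows "EX s:H. s ~= \<zero> & s:rsoc"
proof -
 define P where "P L <-> cideal L & L ~= {\<zero>} & L <= H" for L
 have "P H" using assms by(simp add: P_def)
 moreover have "vsA.subspace U" if "P U" for U using that cideal_subspace by(simp add: P_def)
 ultimately obtain L where L: "P L" and min: "ALL W. P W --> ~ W \<subset> L"
  using vsA.minimal_subspace_ex[OF fin_dim_A, of P H] by auto
 have cL: "cideal L" and LH: "L <= H" using L by(auto simp: P_def)
 note D = cidealD[OF cL]
 obtain s where s: "s:L" "s ~= \<zero>" using L D(2) by(auto simp: P_def)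
 note sG = D(1)[OF s(1)]
 note sc = G_carrier[OF sG]
 have "s**w = \<zero>" if w: "w:R" for w
 proof (rule ccontr)
  assume n: "s**w ~= \<zero>"
  note wG = R_G[OF w]
  note swG = G_mult[OF sG wG]
  let ?W = "{s**w**v | v. v:Gam}"
  have "s**w = s**w**e" using G_e(2)[OF swG] by simp
  hence "s**w:?W" using e(4) by blast
  hence "?W ~= {\<zero>}" using n by blast
  moreover have WL: "?W <= L" using D(4)[OF D(4)[OF s(1) wG]] by auto
  ultimately have "P ?W" using cideal_principal[OF swG] LH by(auto simp: P_def)
  hence "?W = L" using min WL by blast
  then obtain v where v: "v:Gam" "s = s**w**v" using s(1) by auto
  have wvR: "w**v:R" by(rule R_mult(1)[OF w v(1)])
  have wvc: "w**v:car A" using R_G[OF wvR] G_carrier by simp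
  have sv: "s**(w**v) = s" using v sc G_carrier[OF wG] G_carrier[OF v(1)] by(simp add: A.m_assoc)
  have z: "s**(e-.w**v) = \<zero>"
   using sc wvc e(1) sv G_e(2)[OF sG] by(simp add: a_minus_def A.r_distr A.r_minus A.r_neg)
  obtain u where u: "u:Gam" "(e-.w**v)**u = e" using one_minus_R[OF wvR] by(auto simp: corner_unit_def)
  have "s = s**(e-.w**v)**u"
   using u sc wvc e(1) G_carrier[OF u(1)] G_e(2)[OF sG] by(simp add: A.m_assoc)
  hence "s = \<zero>" unfolding z using G_carrier[OF u(1)] by simp
  thus False using s(2) by simp
 qed
 thus ?thesis using s LH sG by(auto simp: rsoc_def)
qed

lemma zero_of_mult_unit:
 assumes "s:Gam" "u:Gam" "u ~: R"
 shows "s**u = \<zero> ==> s = \<zero>" "u**s = \<zero> ==> s = \<zero>"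
proof -
 obtain v where v: "v:Gam" "u**v = e" "v**u = e" using unit_or_nilpotent assms by(auto simp: corner_unit_def)
 note c = G_carrier[OF assms(1)] G_carrier[OF assms(2)] G_carrier[OF v(1)]
 show "s = \<zero>" if "s**u = \<zero>"
 proof -
  have "s = s**u**v" using c v G_e(2)[OF assms(1)] by(simp add: A.m_assoc)
  thus ?thesis using that c by simp
 qed
 show "s = \<zero>" if "u**s = \<zero>"
 proof -
  have "s = v**(u**s)" using c v G_e(1)[OF assms(1)] by(simp flip: A.m_assoc)
  thus ?thesis using that c by simp
 qed
qed

text \<open>Multiplication by a socle element factors through \<open>e A e / R\<close>, so it is injective modulo \<open>R\<close>.\<close>

lemma cinj_socle:
 assumes M: "right_module A M" and cM: "cinj M" and s: "s:rsoc" "s ~= \<zero>"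
  and c: "c:car M" "c *[M] e = c" "!!w. w:R ==> c *[M] w = 0[M]"
 shows "EX z:car M. z *[M] e = z & c = z *[M] s"
proof -
 interpret M: right_module A M by fact
 have sG: "s:Gam" using s(1) by(simp add: rsoc_def)
 note sc = G_carrier[OF sG]
 have z: "cideal {\<zero>}" by(rule cidealI) (auto simp: G_zero G_carrier)
 have hz: "chom M {\<zero>} (%_. 0[M])" by(rule chomI) (auto simp: e G_carrier)
 let ?V = "{u+.s**w | u w. u:{\<zero>} & w:Gam}"
 have "EX h. chom M ?V h & (ALL u:{\<zero>}. ALL w:Gam. h (u+.s**w) = 0[M] \<oplus>\<^bsub>M\<^esub> c *[M] w)"
 proof (rule chom_extend_step[OF M z hz sG cideal_G c(1,2)])
  fix w assume w: "w:Gam" "s**w:{\<zero>}"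
  hence "w:R" using zero_of_mult_unit(1)[OF sG w(1)] s(2) by auto
  thus "0[M] = c *[M] w" using c(3) by simp
 qed
 then obtain h where h: "chom M ?V h" "!!w. w:Gam ==> h (\<zero> \<oplus> s**w) = 0[M] \<oplus>\<^bsub>M\<^esub> c *[M] w" by blast
 have hs: "h s = c" using h(2)[OF e(4)] c sc G_e(2)[OF sG] by simp
 have sV: "s:?V"
 proof -
  have "s = \<zero> \<oplus> s**e" using sc G_e(2)[OF sG] by simp
  thus ?thesis using e(4) by blast
 qed
 have "extends M ?V h" using cM cideal_add_mult[OF z sG cideal_G] h(1) unfolding cinj_def by blast
 thus ?thesis using hs sV unfolding extends_def by auto
qed

end

section \<open>Self-injectivity of the corner algebra\<close>

context corner_alg
begin

lemma op_corner_alg: "corner_alg K (op_algebra A) e"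
 using fd_algI[OF op_fd_algebra[OF fd]] op_local_idempotent[OF A.ring_axioms loc]
 by(simp add: corner_alg_def corner_alg_axioms_def)

text \<open>As \<open>J\<close> is filtered by copies of \<open>A e\<close>, the left \<open>e A e\<close>-module \<open>e J\<close> is free. Hence a
  homomorphism \<open>h\<close> on a right ideal \<open>H\<close> of \<open>e A e\<close> induces \<open>\<gamma> w \<mapsto> h(\<gamma>) w\<close> on \<open>H J\<close>.\<close>

lemma chom_induced:
 assumes M: "right_module A M" and H: "cideal H" and h: "chom M H h"
  and N: "proj_chain (op_algebra A) e N"
 shows "EX S g. additive_subgroup S A & S <= N & (ALL c:H. ALL w:N. c**w:S) &
  (ALL x:S. g x:car M) & (ALL x:S. ALL y:S. g (x+.y) = g x +[M] g y) &
  (ALL c:H. ALL w:N. g (c**w) = h c *[M] w) &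
  (ALL T. additive_subgroup T A --> (ALL c:H. ALL w:N. c**w:T) --> S <= T)"
 using N
proof induct
 case zero
 interpret M: right_module A M by fact
 have "h c *[M] \<zero> = 0[M]" if "c:H" for c using chomD(1)[OF h that] by simp
 moreover have "c**\<zero> = \<zero>" if "c:H" for c using that cidealD(1)[OF H] G_carrier by simp
 ultimately show ?case
  using A.zero_additive_subgroup additive_subgroup.zero_closed
  by(intro exI[of _ "{\<zero>}"] exI[of _ "%_. 0[M]"]) auto
next
 case (step N v)
 interpret M: right_module A M by fact
 interpret O: fd_alg K "op_algebra A" by(rule fd_algI[OF op_fd_algebra[OF fd]])
 have "right_ideal (op_algebra A) N" using O.proj_chain_right_ideal[OF _ step(1)] e(1) by simp
 note ND = O.right_idealD[OF this, unfolded op_simps]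
 note HD = cidealD[OF H] and hD = chomD[OF h]
 obtain S g where SS: "additive_subgroup S A" "S <= N" "ALL c:H. ALL w:N. c**w:S"
  and gg: "ALL x:S. g x:car M" "ALL x:S. ALL y:S. g (x+.y) = g x +[M] g y"
  "ALL c:H. ALL w:N. g (c**w) = h c *[M] w"
  and ll: "ALL T. additive_subgroup T A --> (ALL c:H. ALL w:N. c**w:T) --> S <= T"
  using step(2) by(elim exE conjE)
 note S = SS[rule_format] and g = gg[rule_format]
 have least: "S <= T" if "additive_subgroup T A" "!!c w. c:H ==> w:N ==> c**w:T" for T
  using ll that by simp
 have v: "v:car A" "e**v = v" using step(3,4) by auto
 \<comment> \<open>The condition of the chain, read in \<open>A\<close>: right multiplication by
   \<open>v\<close> is injective on \<open>A e\<close> modulo \<open>N\<close>.\<close>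
 have free: "w = \<zero>" if "w:car A" "w**e = w" "w**v:N" for w
 proof -
  have "w:eset (op_algebra A) e" using that by(intro image_eqI[of _ _ w]) auto
  thus ?thesis using step(5)[of w] that(3) by simp
 qed
 have N': "x:{u +[op_algebra A] v **[op_algebra A] w | u w. u:N & w:eset (op_algebra A) e} <->
   (EX u:N. EX w:car A. w**e = w & x = u+.w**v)" (is "x:?N' <-> ?R x") for x
 proof
  assume "x:?N'"
  then obtain u a where ua: "u:N" "a:car A" "x = u+.(a**e)**v" by auto
  have "(a**e)**e = a**e" using ua e by(simp add: A.m_assoc)
  thus "?R x" using ua e(1) by(intro bexI[of _ u] bexI[of _ "a**e"]) auto
 next
  assume "?R x"
  then obtain u w where uw: "u:N" "w:car A" "w**e = w" "x = u+.w**v" by auto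
  have "w:eset (op_algebra A) e" using uw by(auto intro!: image_eqI[of _ _ w])
  thus "x:?N'" using uw by auto
 qed
 have Sc: "x:S ==> x:car A" and Hc: "x:H ==> x:car A" for x
  using S(2) ND(1) HD(1) G_carrier by auto
 note SA = S(1)[unfolded additive_subgroup_iff[OF A.is_abelian_group]]
 have dec: "s = s' & c = c'" if eq: "s+.c**v = s'+.c'**v"
  and s: "s:S" "s':S" and c: "c:H" "c':H" for s s' c c'
 proof -
  note cc = Sc[OF s(1)] Sc[OF s(2)] Hc[OF c(1)] Hc[OF c(2)]
  have "\<zero> = (s+.c**v)-.(s'+.c'**v)" using eq cc v by(simp add: A.diff_self)
  also have "\<dots> = (s-.s')+.(c**v-.c'**v)" using cc v by(simp add: A.diff_add_diff)
  also have "c**v-.c'**v = (c-.c')**v"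
   using cc v by(simp add: a_minus_def A.l_distr A.l_minus)
  finally have z: "(s-.s')+.(c-.c')**v = \<zero>" by simp
  have "(c-.c')**v:S"
   by(rule A.subgroup_add_cancel'[OF S(1) _ A.subgroup_diff[OF S(1) s]]) (use cc v z SA in auto)
  moreover have "c-.c':Gam" using HD(1)[OF HD(6)[OF c]] .
  ultimately have "c-.c' = \<zero>" using free[of "c-.c'"] S(2) G_carrier G_e(2) by auto
  hence c1: "c = c'" using cc A.diff_eq_zero_iff by simp
  have "s = s'" using eq cc v unfolding c1 by(simp add: A.add.right_cancel)
  thus ?thesis using c1 by simp
 qed
 let ?S' = "{s+.c**v | s c. s:S & c:H}"
 define g' where "g' x = (THE y. EX s:S. EX c:H. x = s+.c**v & y = g s +[M] h c *[M] v)" for x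
 have g': "g' (s+.c**v) = g s +[M] h c *[M] v" if "s:S" "c:H" for s c
  unfolding g'_def
 proof (rule the_equality)
  show "EX s':S. EX c':H. s+.c**v = s'+.c'**v & g s +[M] h c *[M] v = g s' +[M] h c' *[M] v"
   using that by blast
  fix y assume "EX s':S. EX c':H. s+.c**v = s'+.c'**v & y = g s' +[M] h c' *[M] v"
  then obtain s' c' where "s':S" "c':H" "s+.c**v = s'+.c'**v" "y = g s' +[M] h c' *[M] v" by blast
  thus "y = g s +[M] h c *[M] v" using dec[of s c s' c'] that by simp
 qed
 have hvM: "h c *[M] v:car M" if "c:H" for c using hD(1)[OF that] v M.ract_closed by simp
 have add': "(s+.c**v)+.(s'+.c'**v) = (s+.s')+.(c+.c')**v"
  if "s:S" "s':S" "c:H" "c':H" for s s' c c'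
  using that Sc Hc v by(simp add: A.l_distr A.a_ac)
 have asS': "additive_subgroup ?S' A"
  unfolding additive_subgroup_iff[OF A.is_abelian_group]
 proof (intro conjI ballI)
  show "?S' <= car A" using Sc Hc v by auto
  show "\<zero>:?S'" using SA HD(2) v by force
  fix x y assume "x:?S'" "y:?S'"
  then obtain s c s' c' where *: "s:S" "s':S" "c:H" "c':H"
   "x = s+.c**v" "y = s'+.c'**v" by auto
  hence "s+.s':S" "c+.c':H" using SA HD(3) by auto
  thus "x+.y:?S'" unfolding *(5,6) add'[OF *(1-4)] by blast
 next
  fix x assume "x:?S'"
  then obtain s c where *: "s:S" "c:H" "x = s+.c**v" by auto
  have "\<ominus> x = \<ominus> s+.(\<ominus> c)**v"
   using * Sc Hc v by(simp add: A.minus_add A.l_minus)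
  moreover have "\<ominus> s:S" using SA * by auto
  moreover have "\<ominus> c:H" using HD(5) *(2) unfolding additive_subgroup_iff[OF A.is_abelian_group] by auto
  ultimately show "\<ominus> x:?S'" by blast
 qed
 \<comment> \<open>As \<open>c = c e\<close>, the coefficient \<open>w\<close> of \<open>v\<close>
   may be replaced by \<open>e w\<close>; this lies in the corner, so \<open>c (e w)\<close> is
   again in \<open>H\<close>.\<close>
 have cw: "c**(u+.w**v) = c**u+.(c**(e**w))**v & e**w:Gam &
   c**u:S & c**(e**w):H"
  if c: "c:H" and u: "u:N" and w: "w:car A" "w**e = w" for c u w
 proof -
  have uc: "u:car A" using u ND(1) by auto
  have "c**(e**w) = c**w" using Hc[OF c] w e(1) G_e(2)[OF HD(1)[OF c]] by(simp flip: A.m_assoc)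
  moreover have ew: "e**w:Gam" using G_corner[OF w(1)] w e(1) by(simp add: A.m_assoc)
  ultimately show ?thesis using S(3)[OF c u] HD(4)[OF c ew] Hc[OF c] uc w v by(simp add: A.r_distr A.m_assoc)
 qed
 have S'N': "?S' <= ?N'"
 proof
  fix x assume "x:?S'"
  then obtain s c where *: "s:S" "c:H" "x = s+.c**v" by auto
  hence "s:N" "c:car A" "c**e = c" using S(2) Hc HD(1) G_e(2) by auto
  thus "x:?N'" unfolding N' using *(3) by blast
 qed
 have in': "c**x:?S' & g' (c**x) = h c *[M] x" if c: "c:H" and x: "x:?N'" for c x
 proof -
  obtain u w where uw: "u:N" "w:car A" "w**e = w" "x = u+.w**v" using x unfolding N' by auto
  note k = cw[OF c uw(1-3)]
  have uc: "u:car A" using uw ND(1) by auto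
  have "c**x = c**u+.(c**(e**w))**v" using k uw(4) by simp
  hence 1: "c**x:?S'" and 2: "g' (c**x) = g (c**u) +[M] h (c**(e**w)) *[M] v"
   using k g' by auto
  have "h (c**(e**w)) = h c *[M] e *[M] w"
   using hD(4)[OF c, of "e**w"] k hD(1)[OF c] e(1) uw(2) by(simp add: M.ract_assoc)
  hence "h (c**(e**w)) *[M] v = h c *[M] (w**v)"
   using hD(1,2)[OF c] uw(2) v by(simp add: M.ract_assoc)
  hence "g' (c**x) = h c *[M] x"
   using 2 g(3)[OF c uw(1)] uw(4) hD(1)[OF c] uc uw(2) v by(simp add: M.ract_add_right)
  thus ?thesis using 1 by simp
 qed
 have least': "?S' <= T" if T: "additive_subgroup T A" and Tw: "!!c w. c:H ==> w:?N' ==> c**w:T" for T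
 proof
  have NN': "u:?N'" if "u:N" for u
  proof -
   have "u = u+.\<zero>**v" using that ND(1) v by auto
   thus ?thesis unfolding N' using that e(1) by(intro bexI[of _ u] bexI[of _ "\<zero>"]) auto
  qed
  have vN': "v:?N'"
   unfolding N' using ND(2) v e by(intro bexI[of _ "\<zero>"] bexI[of _ e]) auto
  have ST: "S <= T" using least[OF T] Tw NN' by blast
  fix x assume "x:?S'"
  then obtain s c where *: "s:S" "c:H" "x = s+.c**v" by auto
  thus "x:T" using ST Tw[OF *(2) vN'] T unfolding additive_subgroup_iff[OF A.is_abelian_group] by auto
 qed
 show ?case
 proof (intro exI[of _ ?S'] exI[of _ g'] conjI ballI allI impI)
  show "additive_subgroup ?S' A" by(rule asS')
  show "?S' <= ?N'" by(rule S'N')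
  show "c**w:?S'" "g' (c**w) = h c *[M] w" if "c:H" "w:?N'" for c w using in'[OF that] by auto
  show "?S' <= T" if "additive_subgroup T A" "ALL c:H. ALL w:?N'. c**w:T" for T
   using least'[OF that(1)] that(2) by blast
 next
  fix x assume "x:?S'"
  then obtain s c where *: "s:S" "c:H" "x = s+.c**v" by auto
  thus "g' x:car M" using g' g(1) hvM by simp
 next
  fix x y assume "x:?S'" "y:?S'"
  then obtain s c s' c' where *: "s:S" "s':S" "c:H" "c':H"
   "x = s+.c**v" "y = s'+.c'**v" by auto
  have sc: "s+.s':S" "c+.c':H" using SA HD(3) * by auto
  show "g' (x+.y) = g' x +[M] g' y"
   unfolding *(5,6) add'[OF *(1-4)] g'[OF sc] g'[OF *(1,3)] g'[OF *(2,4)]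
   using g(1,2) hD(1,3) hvM * v by(simp add: M.ract_add_left M.M.a_ac)
 qed
qed

text \<open>The induced map on \<open>H J\<close> is a homomorphism on a right ideal of
  \<open>A\<close> and extends to \<open>A\<close> by injectivity. Because \<open>e\<close> lies in
  \<open>J\<close>, the image of \<open>e\<close> represents \<open>h\<close>.\<close>

lemma injective_cinj:
 assumes I: "injective_module A I" and J: "proj_chain (op_algebra A) e J" "e:J" "right_ideal A J"
 shows "cinj I"
 unfolding cinj_def
proof (intro allI impI)
 note rI = fg_right_module[OF injective_fg[OF I]]
 interpret I: right_module A I by(rule rI)
 note JD = right_idealD[OF J(3)]
 fix H h assume H: "cideal H" and h: "chom I H h"
 note HD = cidealD[OF H] and hD = chomD[OF h]
 obtain S g where SS: "additive_subgroup S A" "S <= J" "ALL c:H. ALL w:J. c**w:S"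
  and gg: "ALL x:S. g x:car I" "ALL x:S. ALL y:S. g (x+.y) = g x +[I] g y"
  "ALL c:H. ALL w:J. g (c**w) = h c *[I] w"
  and ll: "ALL T. additive_subgroup T A --> (ALL c:H. ALL w:J. c**w:T) --> S <= T"
  using chom_induced[OF rI H h J(1)] by(elim exE conjE)
 note S = SS[rule_format] and g = gg[rule_format]
 have least: "S <= T" if "additive_subgroup T A" "!!c w. c:H ==> w:J ==> c**w:T" for T
  using ll that by simp
 note SA = S(1)[unfolded additive_subgroup_iff[OF A.is_abelian_group]]
 have Sc: "x:S ==> x:car A" for x using SA by auto
 have g0: "g \<zero> = 0[I]"
 proof -
  have z: "\<zero>:S" using SA by simp
  have "g \<zero> \<oplus>\<^bsub>I\<^esub> g \<zero> = g \<zero>" using g(2)[OF z z] by simp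
  thus ?thesis using I.M.add.r_cancel_one' g(1)[OF z] by metis
 qed
 have gm: "g (\<ominus> x) = \<ominus>\<^bsub>I\<^esub> g x" if x: "x:S" for x
 proof -
  have m: "\<ominus> x:S" using SA x by simp
  have "g (\<ominus> x) +[I] g x = 0[I]" using g(2)[OF m x] g0 Sc[OF x] by(simp add: A.l_neg)
  thus ?thesis using I.M.minus_equality g(1)[OF m] g(1)[OF x] by metis
 qed
 \<comment> \<open>The elements at which \<open>g\<close> is \<open>A\<close>-linear. They form a
   subgroup that contains all products, hence all of \<open>S\<close> by minimality of
   \<open>S\<close>.\<close>
 define T where "T = {x:S. ALL a:car A. x**a:S & g (x**a) = g x *[I] a}"
 have "additive_subgroup T A"
  unfolding additive_subgroup_iff[OF A.is_abelian_group]
 proof (intro conjI ballI)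
  show "T <= car A" using Sc by(auto simp: T_def)
  show "\<zero>:T" using SA g0 by(simp add: T_def)
  show "x+.y:T" if "x:T" "y:T" for x y
   using that SA g Sc by(simp add: T_def A.l_distr I.ract_add_left)
  show "\<ominus> x:T" if "x:T" for x
   using that SA g gm Sc by(simp add: T_def A.l_minus I.ract_minus_left)
 qed
 moreover have "c**w:T" if c: "c:H" and w: "w:J" for c w
 proof -
  have cc: "c:car A" "w:car A" using HD(1)[OF c] G_carrier w JD(1) by auto
  have "c**w**a:S & g (c**w**a) = g (c**w) *[I] a" if a: "a:car A" for a
   using S(3)[OF c JD(4)[OF w a]] g(3)[OF c JD(4)[OF w a]] g(3)[OF c w] hD(1)[OF c] cc a
   by(simp add: A.m_assoc I.ract_assoc)
  thus ?thesis using S(3)[OF c w] by(simp add: T_def)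
 qed
 ultimately have ST: "S <= T" by(rule least)
 have SI: "right_ideal A S"
  by(rule right_idealI) (use SA ST in \<open>auto simp: T_def\<close>)
 note SD = right_idealD(8)[OF SI]
 have "g:mod_hom A (sub_mod (regular A) S) I"
  by(rule mod_homI) (use g ST in \<open>auto simp: T_def\<close>)
 moreover have "(%x. x):mod_hom A (sub_mod (regular A) S) (regular A)"
  by(rule mod_homI) (use Sc in auto)
 ultimately obtain k where k: "k:mod_hom A (regular A) I" "!!x. x:S ==> k x = g x"
  using injective_extend[OF I fg_sub[OF regular_fg SD] regular_fg, of "%x. x" g] by auto
 have k1: "k \<one>:car I" and ke: "k e = k \<one> *[I] e"
  using mod_homD(1)[OF k(1)] mod_homD(3)[OF k(1), of "\<one>" e] e by auto
 have kc: "k e:car I" "k e *[I] e = k e"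
  using mod_homD(1)[OF k(1)] mod_homD(3)[OF k(1), of e e] e by auto
 have "h c = k e *[I] c" if c: "c:H" for c
 proof -
  note cG = HD(1)[OF c]
  have "c:S" using S(3)[OF c J(2)] G_e(2)[OF cG] by simp
  hence "k c = g c" by(rule k(2))
  also have "g c = h c" using g(3)[OF c J(2)] G_e(2)[OF cG] hD(2)[OF c] by simp
  finally show ?thesis using mod_homD(3)[OF k(1), of e c] G_e(1)[OF cG] G_carrier[OF cG] e by simp
 qed
 thus "extends I H h" unfolding extends_def using kc by(intro bexI[of _ "k e"]) auto
qed

text \<open>By Baer's criterion it is enough to treat a homomorphism \<open>h\<close> on
  \<open>R\<close>. Into \<open>E\<close> it is multiplication by some \<open>z\<close>, and
  \<open>p z\<close> is killed by \<open>R\<close>. By the induction hypothesis for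
  \<open>C\<close>, \<open>p z = c' t\<close> with a socle element \<open>t\<close>. A lift
  \<open>x0\<close> of \<open>c'\<close> yields \<open>x = x0 t\<close>, which has the same image as
  \<open>z\<close> and is killed by \<open>R\<close>. Hence \<open>z - x\<close> comes from
  \<open>M\<close> and still represents \<open>h\<close>.\<close>

lemma idp_cinj:
 assumes J: "proj_chain (op_algebra A) e J" "e:J" "right_ideal A J"
 shows "idp A r M ==> cinj M"
proof (induct r arbitrary: M)
 case 0 thus ?case using injective_cinj[OF _ J] by simp
next
 case (Suc r)
 obtain E :: "('k, 'a) small_mod" and C i p where E: "injective_module A E" and C: "fg_module A C"
  and s: "ses A M i E p C" and idC: "idp A r C" using Suc(2) by(rule idp_SucE)
 note S = sesD[OF s]
 note rM = fg_right_module[OF idp_fg[OF Suc(2)]] and rE = fg_right_module[OF injective_fg[OF E]] and rC = fg_right_module[OF C]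
 interpret M: right_module A M by(rule rM)
 interpret E: right_module A E by(rule rE)
 interpret C: right_module A C by(rule rC)
 have cC: "cinj C" using Suc(1)[OF idC] .
 have cE: "cinj E" using injective_cinj[OF E J] .
 obtain t where t: "t:rsoc" "t ~= \<zero>" using rsoc_ex[OF cideal_G] e(3,4) by blast
 have tG: "t:Gam" using t(1) by(simp add: rsoc_def)
 note tc = G_carrier[OF tG]
 show ?case
 proof (rule cinjI[OF rM])
  fix h assume h: "chom M R h"
  note hD = chomD[OF h]
  have Rc: "w:car A" if "w:R" for w using that R_G G_carrier by simp
  have "chom E R (%w. i (h w))"
  proof (rule chomI)
   fix x assume x: "x:R"
   show "i (h x):car E" using mod_homD(1)[OF S(1) hD(1)[OF x]] .
   show "i (h x) *[E] e = i (h x)" using mod_homD(3)[OF S(1) hD(1)[OF x] e(1)] hD(2)[OF x] by simp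
   fix y assume y: "y:R"
   show "i (h (x+.y)) = i (h x) +[E] i (h y)"
    using mod_homD(2)[OF S(1) hD(1)[OF x] hD(1)[OF y]] hD(3)[OF x y] by simp
  next
   fix x y assume x: "x:R" and y: "y:Gam"
   show "i (h (x**y)) = i (h x) *[E] y"
    using mod_homD(3)[OF S(1) hD(1)[OF x] G_carrier[OF y]] hD(4)[OF x y] by simp
  qed
  then obtain z where z: "z:car E" "z *[E] e = z" "!!w. w:R ==> i (h w) = z *[E] w"
   using cE cideal_R unfolding cinj_def extends_def by blast
  have pz: "p z:car C" "p z *[C] e = p z"
   using mod_homD(1)[OF S(3) z(1)] mod_homD(3)[OF S(3) z(1) e(1)] z(2) by auto
  have pzR: "p z *[C] w = 0[C]" if w: "w:R" for w
  proof -
   have "p z *[C] w = p (i (h w))" using mod_homD(3)[OF S(3) z(1) Rc[OF w]] z(3)[OF w] by simp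
   thus ?thesis using S(6)[OF hD(1)[OF w]] by simp
  qed
  obtain c' where c': "c':car C" "c' *[C] e = c'" "p z = c' *[C] t"
   using cinj_socle[OF rC cC t pz pzR] by blast
  obtain x0 where x0: "x0:car E" "c' = p x0" using c'(1) S(4) by blast
  define x where "x = x0 *[E] t"
  have x: "x:car E" "x *[E] e = x"
   using x0 tc e(1) G_e(2)[OF tG] E.ract_closed by(auto simp: x_def simp flip: E.ract_assoc)
  have px: "p x = p z" using mod_homD(3)[OF S(3) x0(1) tc] x0(2) c'(3) by(simp add: x_def)
  have xR: "x *[E] w = 0[E]" if w: "w:R" for w
  proof -
   have "t**w = \<zero>" using t(1) w by(simp add: rsoc_def)
   thus ?thesis using x0(1) tc Rc[OF w] by(simp add: x_def flip: E.ract_assoc)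
  qed
  define y where "y = z \<ominus>\<^bsub>E\<^esub> x"
  have y: "y:car E" "y *[E] e = y" using z x e(1) by(auto simp: y_def E.ract_diff_left)
  have "p y = 0[C]" unfolding y_def using mod_hom_diff[OF rE rC S(3) z(1) x(1)] px pz(1) by(simp add: C.M.diff_self)
  then obtain m where m: "m:car M" "y = i m" using S(5)[OF y(1)] by auto
  have inj: "a = b" if "a:car M" "b:car M" "i a = i b" for a b using that S(2) by(meson inj_onD)
  have me: "m *[M] e = m"
   by(rule inj) (use m y mod_homD(3)[OF S(1) m(1) e(1)] M.ract_closed e(1) in auto)
  have "h w = m *[M] w" if w: "w:R" for w
  proof (rule inj[OF hD(1)[OF w] M.ract_closed[OF m(1) Rc[OF w]]])
   have "i (m *[M] w) = y *[E] w" using mod_homD(3)[OF S(1) m(1) Rc[OF w]] m(2) by simp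
   also have "\<dots> = z *[E] w"
    using z x Rc[OF w] xR[OF w] E.ract_closed by(simp add: y_def E.ract_diff_left) (simp add: a_minus_def)
   finally show "i (h w) = i (m *[M] w)" using z(3)[OF w] by simp
  qed
  thus "extends M R h" unfolding extends_def using m me by(intro bexI[of _ m]) auto
 qed
qed

lemma regular_cinj:
 assumes J: "proj_chain (op_algebra A) e J" "e:J" "right_ideal A J" and d: "inj_dim_le A (regular A) r"
 shows "cinj (regular A)"
 unfolding cinj_def
proof (intro allI impI)
 fix H h assume H: "cideal H" and h: "chom (regular A) H h"
 note hD = chomD[OF h]
 obtain X f where X: "idp A r X" "f:mod_hom A (regular A) X" "bij_betw f (car (regular A)) (car X)"
  using idp_of_inj_dim_le[OF rreg d] .
 let ?g = "inv_into (car (regular A)) f"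
 note g = mod_hom_inv[OF X(2,3) rreg]
 have gf: "?g (f a) = a" if "a:car A" for a using bij_betw_inv_into_left[OF X(3)] that by simp
 have "chom X H (%x. f (h x))"
  by(rule chomI)
   (use hD mod_homD[OF X(2)] cidealD(1)[OF H] e(1) G_carrier in \<open>auto simp flip: mod_homD(3)[OF X(2)]\<close>)
 hence "extends X H (%x. f (h x))" using idp_cinj[OF J X(1)] H unfolding cinj_def by blast
 then obtain z where z: "z:car X" "z *[X] e = z" "!!x. x:H ==> f (h x) = z *[X] x"
  unfolding extends_def by blast
 have "?g z:car A" "?g z**e = ?g z"
  using mod_homD(1)[OF g z(1)] mod_homD(3)[OF g z(1) e(1)] z(2) by auto
 moreover have "h x = ?g z**x" if x: "x:H" for x
 proof -
  have xc: "x:car A" using x cidealD(1)[OF H] G_carrier by simp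
  have "h x = ?g (f (h x))" using gf hD(1)[OF x] by simp
  also have "\<dots> = ?g (z *[X] x)" using z(3)[OF x] by simp
  also have "\<dots> = ?g z**x" using mod_homD(3)[OF g z(1) xc] by simp
  finally show ?thesis .
 qed
 ultimately show "extends (regular A) H h" unfolding extends_def by(intro bexI[of _ "?g z"]) auto
qed

text \<open>The case of the regular module in \<open>cinj_socle\<close>; multiplication by
  \<open>e\<close> from the left moves the factor into the corner.\<close>

lemma rsoc_mult:
 assumes cA: "cinj (regular A)" and s: "s:rsoc" "s ~= \<zero>" and c: "c:rsoc"
 shows "EX z:Gam. c = z**s"
proof -
 have G: "s:Gam" "c:Gam" "!!w. w:R ==> c**w = \<zero>" using s c by(auto simp: rsoc_def)
 obtain z where z: "z:car A" "z**e = z" "c = z**s"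
  using cinj_socle[OF rreg cA s, of c] G(2,3) G_carrier[OF G(2)] G_e(2)[OF G(2)] by auto
 have "e**z:Gam" using G_corner[OF z(1)] z e(1) by(simp add: A.m_assoc)
 moreover have "c = (e**z)**s"
  using G_e(1)[OF G(2)] z e(1) G_carrier[OF G(1)] by(simp add: A.m_assoc)
 ultimately show ?thesis by blast
qed

text \<open>If \<open>w s\<close> were nonzero, it would be a right socle element too, so
  \<open>s = z w s\<close> for some \<open>z\<close>; then the unit \<open>e - z w\<close> would
  kill \<open>s\<close>.\<close>

lemma rsoc_left:
 assumes cA: "cinj (regular A)" and s: "s:rsoc" and w: "w:R"
 shows "w**s = \<zero>"
proof (rule ccontr)
 assume n: "w**s ~= \<zero>"
 have sG: "s:Gam" and sR: "!!v. v:R ==> s**v = \<zero>" using s by(auto simp: rsoc_def)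
 note wG = R_G[OF w]
 note c = G_carrier[OF sG] G_carrier[OF wG]
 define t where "t = w**s"
 have tG: "t:Gam" using G_mult[OF wG sG] by(simp add: t_def)
 have "t**v = \<zero>" if "v:R" for v
  using sR[OF that] c G_carrier[OF R_G[OF that]] by(simp add: t_def A.m_assoc)
 hence tr: "t:rsoc" using tG by(simp add: rsoc_def)
 obtain z where z: "z:Gam" "s = z**t" using rsoc_mult[OF cA tr _ s] n by(auto simp: t_def)
 have zw: "z**w:R" by(rule R_mult(2)[OF w z(1)])
 note zc = G_carrier[OF z(1)]
 have "(e-.z**w)**s = s-.z**t"
  using c zc e(1) G_e(1)[OF sG] by(simp add: t_def a_minus_def A.l_distr A.l_minus A.m_assoc)
 also have "\<dots> = \<zero>" using z(2) c by(simp add: A.diff_self)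
 finally have "s = \<zero>"
  using zero_of_mult_unit(2)[OF sG G_diff[OF e(4) R_G[OF zw]]] one_minus_R[OF zw] by(simp add: corner_rad_def)
 thus False using n c by(simp add: t_def)
qed

text \<open>The bilinear form on \<open>e A e\<close> with values \<open>l (b x)\<close> is
  associative and nondegenerate. The functional is taken on all of \<open>A\<close>, where the
  linear algebra is available; only its values on the corner matter.\<close>

definition frobenius_form :: "('a => 'k) => bool" where
 "frobenius_form l <-> vsA.functional l &
   (ALL b:Gam. (ALL x:Gam. l (b**x) = 0[K]) --> b = \<zero>) &
   (ALL b:Gam. (ALL x:Gam. l (x**b) = 0[K]) --> b = \<zero>)"

text \<open>The right ideal generated by a nonzero \<open>b\<close> contains a nonzero socle element
  and hence, by \<open>L\<close>, the element \<open>s\<close>, at which \<open>l\<close> does not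
  vanish.\<close>

lemma right_nondegenerate:
 assumes L: "!!t. t:rsoc ==> t ~= \<zero> ==> EX z:Gam. s = t**z" and l: "l s ~= 0[K]"
  and b: "b:Gam" "!!x. x:Gam ==> l (b**x) = 0[K]"
 shows "b = \<zero>"
proof (rule ccontr)
 assume n: "b ~= \<zero>"
 have "b**e:{b**w | w. w:Gam}" using e(4) by blast
 hence "{b**w | w. w:Gam} ~= {\<zero>}" using n G_e(2)[OF b(1)] by auto
 then obtain w where w: "w:Gam" "b**w ~= \<zero>" "b**w:rsoc"
  using rsoc_ex[OF cideal_principal[OF b(1)]] by blast
 obtain z where z: "z:Gam" "s = b**w**z" using L[OF w(3,2)] by blast
 hence "s = b**(w**z)" using w b G_carrier by(simp add: A.m_assoc)
 thus False using b(2)[OF G_mult[OF w(1) z(1)]] l by simp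
qed

text \<open>Self-injectivity on both sides makes the two socles equal and generated, from either
  side, by each of their nonzero elements. So any functional that does not vanish at a chosen socle
  element is nondegenerate.\<close>

lemma frobenius_form_ex:
 assumes right: "cinj (regular A)"
  and left: "corner_alg.cinj (op_algebra A) e (regular (op_algebra A))"
 shows "EX l. frobenius_form l"
proof -
 interpret L: corner_alg K "op_algebra A" e by(rule op_corner_alg)
 have RL: "L.R = R" unfolding corner_rad_def by(auto simp: corner_unit_def)
 have Lsoc: "x:L.rsoc <-> x:Gam & (ALL w:R. w**x = \<zero>)" for x by(simp add: L.rsoc_def RL)
 have soc: "x:rsoc <-> x:L.rsoc" for x
 proof
  assume x: "x:rsoc"
  thus "x:L.rsoc" unfolding Lsoc using rsoc_left[OF right x] by(auto simp: rsoc_def)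
 next
  assume x: "x:L.rsoc"
  thus "x:rsoc" using L.rsoc_left[OF left x] Lsoc by(auto simp: rsoc_def RL)
 qed
 obtain s where s: "s:rsoc" "s ~= \<zero>" using rsoc_ex[OF cideal_G] e(3,4) by blast
 have sc: "s:car A" using s(1) G_carrier by(auto simp: rsoc_def)
 obtain l where l: "vsA.functional l" "l s ~= 0[K]"
  using vsA.functional_separates[OF fin_dim_A vsA.subspace_zero sc] s(2) by auto
 have "b = \<zero>" if "b:Gam" "!!x. x:Gam ==> l (b**x) = 0[K]" for b
 proof (rule right_nondegenerate[of s l, OF _ l(2) that])
  fix t assume "t:rsoc" "t ~= \<zero>"
  thus "EX z:Gam. s = t**z" using L.rsoc_mult[OF left, of t s] soc s(1) by simp
 qed
 moreover have "b = \<zero>" if "b:Gam" "!!x. x:Gam ==> l (x**b) = 0[K]" for b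
 proof -
  have "b = 0[op_algebra A]"
  proof (rule L.right_nondegenerate[of s l])
   fix t assume "t:L.rsoc" "t ~= 0[op_algebra A]"
   thus "EX z:corner (op_algebra A) e. s = t **[op_algebra A] z" using rsoc_mult[OF right, of t s] soc s(1) by simp
  qed (use that l(2) in auto)
  thus ?thesis by simp
 qed
 ultimately show ?thesis using l(1) unfolding frobenius_form_def by blast
qed

end

section \<open>Primitive idempotents and standard modules\<close>

context fd_alg
begin

text \<open>Fitting's lemma: when the powers of \<open>x\<close> stabilise, some power
  \<open>y\<close> of \<open>x\<close> has an idempotent \<open>f\<close> in the corner with
  \<open>y f = y\<close>. Primitivity leaves \<open>f = 0\<close>, and \<open>x\<close> is
  nilpotent, or \<open>f = u\<close>, and \<open>x\<close> is a unit.\<close>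

lemma primitive_local:
 assumes p: "primitive_idempotent A u"
 shows "local_idempotent A u"
proof -
 have u: "u:car A" "u**u = u" "u ~= \<zero>"
  and prim: "!!f g. [|f:car A; g:car A; f**f = f; g**g = g; f**g = \<zero>;
   g**f = \<zero>; u = f+.g|] ==> f = \<zero> \<or> g = \<zero>"
  using p by(auto simp: primitive_idempotent_def)
 obtain ht :: "'a set => nat" and d where ht:
  "ALL U W. vsA.subspace U --> vsA.subspace W --> U \<subset> W --> ht U < ht W"
  using vsA.height_ex[OF fin_dim_A] by blast
 have "nilpotent_elt A x \<or> corner_unit A u x" if x: "x:corner A u" for x
 proof -
  have xc: "x:car A" and ux: "u**x = x" and xu: "x**u = x" using x by(auto simp: corner_def)
  have pc: "x [^] (m::nat):car A" for m using xc by simp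
  define P where "P m = (%a. x [^] m**a) ` car A" for m :: nat
  define Q where "Q m = (%a. a**x [^] m) ` car A" for m :: nat
  have sP: "vsA.subspace (P m)" for m
  proof (rule vsA.subspaceI)
   show "P m <= car A" using pc by(auto simp: P_def)
   show "\<zero>:P m" unfolding P_def using pc by(intro image_eqI[of _ _ "\<zero>"]) auto
   fix y z assume "y:P m" "z:P m"
   then obtain a b where "a:car A" "b:car A" "y = x [^] m**a" "z = x [^] m**b"
    by(auto simp: P_def)
   thus "y+.z:P m" unfolding P_def using pc
    by(intro image_eqI[of _ _ "a+.b"]) (auto simp: A.r_distr)
  next
   fix k y assume k: "k:car K" and "y:P m"
   then obtain a where "a:car A" "y = x [^] m**a" by(auto simp: P_def)
   thus "k \<odot> y:P m" unfolding P_def using pc k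
    by(intro image_eqI[of _ _ "k \<odot> a"]) (auto simp: smult_mult)
  qed
  have sQ: "vsA.subspace (Q m)" for m
  proof (rule vsA.subspaceI)
   show "Q m <= car A" using pc by(auto simp: Q_def)
   show "\<zero>:Q m" unfolding Q_def using pc by(intro image_eqI[of _ _ "\<zero>"]) auto
   fix y z assume "y:Q m" "z:Q m"
   then obtain a b where "a:car A" "b:car A" "y = a**x [^] m" "z = b**x [^] m"
    by(auto simp: Q_def)
   thus "y+.z:Q m" unfolding Q_def using pc
    by(intro image_eqI[of _ _ "a+.b"]) (auto simp: A.l_distr)
  next
   fix k y assume k: "k:car K" and "y:Q m"
   then obtain a where "a:car A" "y = a**x [^] m" by(auto simp: Q_def)
   thus "k \<odot> y:Q m" unfolding Q_def using pc k
    by(intro image_eqI[of _ _ "k \<odot> a"]) (auto simp: smult_mult)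
  qed
  have pm: "x [^] (m + l) = x [^] m**x [^] l" for m l :: nat
   using A.nat_pow_mult[OF xc, of m l] by simp
  have PP: "P (m + l) <= P m" for m l
   unfolding P_def pm using pc by(auto simp: A.m_assoc)
  have QQ: "Q (m + l) <= Q l" for m l
   unfolding Q_def pm using pc by(auto simp flip: A.m_assoc)
  \<comment> \<open>Minimising the sum of both heights stops the two chains at the same exponent.
    The exponent is positive because the zeroth power is the identity of \<open>A\<close> and not of
    the corner.\<close>
  obtain m where m: "ALL l. ht (P (Suc m)) + ht (Q (Suc m)) <= ht (P (Suc l)) + ht (Q (Suc l))"
   using ex_has_least_nat[of "%_. True" 0 "%l. ht (P (Suc l)) + ht (Q (Suc l))"] by auto
  define y where "y = x [^] Suc m"
  have yc: "y:car A" using xc by(simp add: y_def)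
  have yy: "x [^] (Suc m + Suc m) = y**y" unfolding y_def by(rule pm)
  have le: "ht (P (Suc m)) + ht (Q (Suc m)) <= ht (P (Suc m + Suc m)) + ht (Q (Suc m + Suc m))"
   using m[rule_format, of "m + Suc m"] by simp
  have mono: "ht U <= ht W" if "vsA.subspace U" "vsA.subspace W" "U <= W" for U W
  proof (cases "U = W")
   case False
   hence "U \<subset> W" using that(3) by auto
   thus ?thesis using ht[rule_format, OF that(1,2)] by simp
  qed simp
  have "~ P (Suc m + Suc m) \<subset> P (Suc m)" "~ Q (Suc m + Suc m) \<subset> Q (Suc m)"
   using le mono[OF sP sP PP[of "Suc m" "Suc m"]] mono[OF sQ sQ QQ[of "Suc m" "Suc m"]] ht sP sQ
   by(metis add_less_le_mono add_le_less_mono leD)+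
  hence eqs: "P (Suc m + Suc m) = P (Suc m)" "Q (Suc m + Suc m) = Q (Suc m)"
   using PP[of "Suc m" "Suc m"] QQ[of "Suc m" "Suc m"] by auto
  have "y:P (Suc m)" "y:Q (Suc m)" using yc
   by(auto simp: P_def Q_def y_def intro!: image_eqI[of _ _ "\<one>"] simp del: A.nat_pow_Suc)
  hence "y:P (Suc m + Suc m)" "y:Q (Suc m + Suc m)" using eqs by auto
  then obtain b0 c where b0: "b0:car A" "y = y**y**b0" and c: "c:car A" "y = c**(y**y)"
   unfolding P_def Q_def yy by auto
  have uy: "u**y = y" unfolding y_def A.nat_pow_Suc2[OF xc] using u(1) xc ux pc by(simp flip: A.m_assoc)
  have yu: "y**u = y" unfolding y_def using u(1) xc xu pc by(simp add: A.m_assoc)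
  define b where "b = b0**u"
  have b: "b:car A" "y = y**y**b" "b**u = b"
  proof -
   show "b:car A" using b0 u by(simp add: b_def)
   have "y = y**y**b0**u" using b0(2) yu by simp
   thus "y = y**y**b" unfolding b_def using b0(1) yc u(1) by(simp add: A.m_assoc)
   show "b**u = b" unfolding b_def using b0(1) u by(simp add: A.m_assoc)
  qed
  \<comment> \<open>From \<open>y = y y b\<close> and \<open>y = c y y\<close> follows
    \<open>y b = c y\<close>, and this element is idempotent.\<close>
  define f where "f = y**b"
  have fc: "f:car A" using yc b by(simp add: f_def)
  have f': "f = c**y"
  proof -
   have "f = c**(y**y)**b" using c(2) by(simp add: f_def)
   also have "\<dots> = c**(y**y**b)" using c(1) yc b(1) by(simp add: A.m_assoc)
   finally show ?thesis using b(2) by simp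
  qed
  have yf: "y**f = y" using b(2) yc b(1) by(simp add: f_def A.m_assoc)
  have ff: "f**f = f"
  proof -
   have "f**f = c**(y**f)" using f' c(1) yc fc by(simp add: A.m_assoc)
   thus ?thesis using yf f' by simp
  qed
  have uf: "u**f = f" unfolding f_def using uy u(1) yc b(1) by(simp flip: A.m_assoc)
  have fu: "f**u = f" unfolding f_def using b u(1) yc by(simp add: A.m_assoc)
  have "f = \<zero> \<or> u-.f = \<zero>"
  proof (rule prim)
   show "(u-.f)**(u-.f) = u-.f" "f**(u-.f) = \<zero>" "(u-.f)**f = \<zero>"
    using u fc ff uf fu
    by(simp_all add: a_minus_def A.l_distr A.r_distr A.l_minus A.r_minus A.r_neg A.l_neg A.r_neg1 A.r_neg2 A.a_ac)
   show "u = f+.(u-.f)"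
    using A.diff_add_cancel[of u f] u(1) fc by(simp add: A.a_comm)
  qed (use u fc ff in auto)
  thus ?thesis
  proof
   assume "f = \<zero>"
   hence "y = \<zero>" using yf yc by simp
   thus ?thesis unfolding nilpotent_elt_def y_def by blast
  next
   assume "u-.f = \<zero>"
   hence f: "f = u" using A.diff_eq_zero_iff[OF u(1) fc] by simp
   \<comment> \<open>One factor \<open>x\<close> is split off from \<open>y\<close> on either side,
     which gives a right and a left inverse of \<open>x\<close>.\<close>
   define r where "r = u**x [^] m**b"
   define l where "l = u**c**x [^] m**u"
   have rc: "r:car A" and lc: "l:car A" using u pc b c by(auto simp: r_def l_def)
   have xr: "x**r = u"
   proof -
    have "x**r = (x**u)**x [^] m**b" using xc u(1) pc b(1) by(simp add: r_def A.m_assoc)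
    also have "\<dots> = y**b" unfolding xu y_def A.nat_pow_Suc2[OF xc] ..
    finally show ?thesis using f by(simp add: f_def)
   qed
   have lx: "l**x = u"
   proof -
    have "l**x = u**(c**(x [^] m**x))" using xc u(1) pc c(1) ux by(simp add: l_def A.m_assoc)
    also have "x [^] m**x = y" by(simp add: y_def)
    finally show ?thesis using f f' u(2) by simp
   qed
   have ur: "u**r = r" "r**u = r" using u pc b by(simp_all add: r_def A.m_assoc) (simp flip: A.m_assoc)
   have "l = l**(x**r)" using u pc c xr by(simp add: l_def A.m_assoc)
   also have "\<dots> = r" using lc xc rc lx ur by(simp flip: A.m_assoc)
   finally have "r**x = u" using lx by simp
   thus ?thesis unfolding corner_unit_def using ur xr rc by(auto simp: corner_def)
  qed
 qed
 thus ?thesis using u by(simp add: local_idempotent_def)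
qed

text \<open>An isomorphism of \<open>Q\<close> with \<open>A / L\<close> that takes \<open>v\<close>
  to the class of 1. Modules on different carrier types are compared through the annihilator
  \<open>L\<close> of a generator alone.\<close>

definition cyclic_gen :: "('a, 'm) right_mod => 'm => 'a set => bool" where
 "cyclic_gen Q v L <-> v:car Q & (ALL q:car Q. EX a:car A. q = v *[Q] a) &
   (ALL a:car A. v *[Q] a = 0[Q] <-> a:L)"

lemma cyclic_gen_map:
 assumes Q: "right_module A Q" and v: "v:car Q"
 shows "(%a. v *[Q] a):mod_hom A (regular A) Q"
proof -
 interpret Q: right_module A Q by fact
 show ?thesis by(rule mod_homI) (use v in \<open>auto simp: Q.ract_closed Q.ract_add_right Q.ract_assoc\<close>)
qed

lemma cyclic_gen_iso:
 assumes Q: "right_module A Q" "right_module A Q'" and v: "cyclic_gen Q v L" and v': "cyclic_gen Q' v' L"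
 shows "mod_iso A Q Q'"
proof -
 interpret Q: right_module A Q by(rule Q)
 interpret Q': right_module A Q' by(rule Q)
 have vc: "v:car Q" "v':car Q'" using v v' by(auto simp: cyclic_gen_def)
 have im: "(%a. v *[Q] a) ` car (regular A) = car Q"
  using v vc Q.ract_closed by(auto simp: cyclic_gen_def)
 have "EX h:mod_hom A Q Q'. ALL a:car (regular A). h (v *[Q] a) = v' *[Q'] a"
  by(rule mod_hom_factor[OF rreg Q cyclic_gen_map[OF Q(1) vc(1)] im cyclic_gen_map[OF Q(2) vc(2)]])
   (use v v' in \<open>auto simp: cyclic_gen_def\<close>)
 then obtain h where h: "h:mod_hom A Q Q'" "!!a. a:car A ==> h (v *[Q] a) = v' *[Q'] a" by auto
 have "inj_on h (car Q)" unfolding mod_hom_inj_iff[OF Q h(1)]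
 proof (intro ballI impI)
  fix q assume q: "q:car Q" "h q = 0[Q']"
  then obtain a where a: "a:car A" "q = v *[Q] a" using v by(auto simp: cyclic_gen_def)
  hence "a:L" using q h(2) v' by(simp add: cyclic_gen_def)
  thus "q = 0[Q]" using a v by(simp add: cyclic_gen_def)
 qed
 moreover have "h ` car Q = car Q'"
 proof
  show "h ` car Q <= car Q'" using mod_homD(1)[OF h(1)] by auto
  show "car Q' <= h ` car Q"
  proof
   fix q assume "q:car Q'"
   then obtain a where a: "a:car A" "q = v' *[Q'] a" using v' by(auto simp: cyclic_gen_def)
   thus "q:h ` car Q" using h(2) Q.ract_closed[OF vc(1)] by(intro image_eqI[of _ _ "v *[Q] a"]) auto
  qed
 qed
 ultimately show ?thesis unfolding mod_iso_def bij_betw_def using h(1) by blast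
qed

lemma cyclic_gen_transfer:
 assumes Q: "right_module A Q" "right_module A Q'" and iso: "mod_iso A Q Q'" and v: "cyclic_gen Q v L"
 shows "EX v'. cyclic_gen Q' v' L"
proof -
 obtain h where h: "h:mod_hom A Q Q'" "bij_betw h (car Q) (car Q')" using iso by(auto simp: mod_iso_def)
 interpret Q: right_module A Q by(rule Q)
 have vc: "v:car Q" using v by(simp add: cyclic_gen_def)
 have hv: "h v *[Q'] a = h (v *[Q] a)" if "a:car A" for a using mod_homD(3)[OF h(1) vc that] by simp
 have h0: "h x = 0[Q'] <-> x = 0[Q]" if "x:car Q" for x
  using that h(2) mod_hom_inj_iff[OF Q h(1)] mod_hom_zero[OF Q h(1)] by(auto simp: bij_betw_def)
 have "cyclic_gen Q' (h v) L"
  unfolding cyclic_gen_def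
 proof (intro conjI ballI)
  show "h v:car Q'" using mod_homD(1)[OF h(1) vc] .
  fix q assume "q:car Q'"
  then obtain x where x: "x:car Q" "q = h x" using h(2) by(auto simp: bij_betw_def)
  then obtain a where "a:car A" "x = v *[Q] a" using v by(auto simp: cyclic_gen_def)
  thus "EX a:car A. q = h v *[Q'] a" using x hv by auto
 next
  fix a assume a: "a:car A"
  thus "h v *[Q'] a = 0[Q'] <-> a:L" using hv h0[OF Q.ract_closed[OF vc a]] v by(simp add: cyclic_gen_def)
 qed
 thus ?thesis by blast
qed

lemma cyclic_gen_quot:
 assumes Q: "right_module A Q" and v: "cyclic_gen Q v L" and N: "right_submodule A Q N"
 shows "cyclic_gen (quot_mod Q N) (N +>\<^bsub>Q\<^esub> v) {a:car A. v *[Q] a:N}"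
proof -
 note F = quot_mod_facts[OF Q N]
 interpret Q: right_module A Q by(rule Q)
 have vc: "v:car Q" using v by(simp add: cyclic_gen_def)
 have act: "(N +>\<^bsub>Q\<^esub> v) *[quot_mod Q N] a = N +>\<^bsub>Q\<^esub> (v *[Q] a)" if "a:car A" for a
  using mod_homD(3)[OF F(2) vc that] by simp
 show ?thesis
  unfolding cyclic_gen_def
 proof (intro conjI ballI)
  show "N +>\<^bsub>Q\<^esub> v:car (quot_mod Q N)" using mod_homD(1)[OF F(2) vc] .
  fix q assume "q:car (quot_mod Q N)"
  hence "q:(%x. N +>\<^bsub>Q\<^esub> x) ` car Q" using F(3) by simp
  then obtain x where x: "x:car Q" "q = N +>\<^bsub>Q\<^esub> x" by auto
  then obtain a where "a:car A" "x = v *[Q] a" using v by(auto simp: cyclic_gen_def)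
  thus "EX a:car A. q = (N +>\<^bsub>Q\<^esub> v) *[quot_mod Q N] a" using x act by auto
 next
  fix a assume a: "a:car A"
  thus "(N +>\<^bsub>Q\<^esub> v) *[quot_mod Q N] a = 0[quot_mod Q N] <-> a:{a:car A. v *[Q] a:N}"
   using act F(4)[OF Q.ract_closed[OF vc a]] by simp
 qed
qed

definition pmod :: "'a => ('a, 'a) right_mod" where
 "pmod u = sub_mod (regular A) (eset A u)"

lemma pmod_fg: "u:car A ==> fg_module A (pmod u)"
 unfolding pmod_def by(rule fg_sub[OF regular_fg right_idealD(8)[OF eset_right_ideal]])

lemma pmod_cyclic_gen:
 assumes u: "u:car A" "u**u = u"
 shows "cyclic_gen (pmod u) u {a:car A. u**a = \<zero>}"
 using u unfolding cyclic_gen_def pmod_def by(auto intro: image_eqI[of _ _ u])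

lemma pmod_submodule_iff:
 "u:car A ==> right_submodule A (pmod u) U <-> right_ideal A U & U <= eset A u"
 unfolding pmod_def right_ideal_def
 by(rule sub_mod_submodule_iff[OF rreg right_idealD(8)[OF eset_right_ideal]])

end

lemma proj_mod_eq: "proj_mod A e i = sub_mod (regular A) (eset A (e i))"
 by(simp add: proj_mod_def)

section \<open>The top of \<open>e A\<close>\<close>

context corner_alg
begin

text \<open>The radical of \<open>e A\<close> described by elements; \<open>rad_pmod\<close>
  identifies it with the intersection of the maximal submodules.\<close>

definition topker :: "'a set" where
 "topker = {x:eset A e. ALL a:car A. x**a**e:R}"

lemma eset_e: "w:eset A e <-> w:car A & e**w = w"
 using eset_iff e by simp

lemma topker_right_ideal: "right_ideal A topker" "topker <= eset A e" "e ~: topker"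
proof -
 show "right_ideal A topker"
 proof (rule right_idealI)
  note ED = right_idealD[OF eset_right_ideal[OF e(1)]]
  show "topker <= car A" by(auto simp: topker_def e)
  show "\<zero>:topker" using ED(2) R_zero e(1) by(simp add: topker_def)
  show "x+.y:topker" if "x:topker" "y:topker" for x y
   using that ED(1,3) R_add e(1) by(auto simp: topker_def A.l_distr subset_iff)
  show "x**a:topker" if x: "x:topker" and a: "a:car A" for x a
  proof -
   have xe: "x:eset A e" and xc: "x:car A" using x ED(1) by(auto simp: topker_def)
   have "x**a**b**e:R" if b: "b:car A" for b
   proof -
    have "x**(a**b)**e:R" using x a b unfolding topker_def by blast
    thus ?thesis using xc a b e(1) by(simp add: A.m_assoc)
   qed
   thus ?thesis using ED(4)[OF xe a] unfolding topker_def by blast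
  qed
 qed
 show "topker <= eset A e" by(auto simp: topker_def)
 have "e ~: R" using e by(auto simp: corner_rad_def corner_unit_def)
 thus "e ~: topker" using e by(auto simp: topker_def intro!: bexI[of _ e])
qed

text \<open>If some \<open>x a e\<close> were a unit of the corner, \<open>e\<close> itself would be
  a multiple of \<open>x\<close>.\<close>

lemma proper_sub_topker:
 assumes U: "right_ideal A U" "U <= eset A e" "e ~: U"
 shows "U <= topker"
proof
 note UD = right_idealD[OF U(1)]
 fix x assume x: "x:U"
 hence xe: "x:car A" "e**x = x" using U(2) eset_e by auto
 have "x**a**e:R" if a: "a:car A" for a
 proof (rule ccontr)
  assume n: "x**a**e ~: R"
  have "x**a**e = e**(x**a)**e" using xe a e(1) by(simp flip: A.m_assoc)
  hence g: "x**a**e:Gam" using G_corner[of "x**a"] xe a by simp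
  then obtain y where y: "y:Gam" "x**a**e**y = e"
   using unit_or_nilpotent[OF g n] by(auto simp: corner_unit_def)
  have "x**a**e**y:U"
   by(intro UD(4) x a e(1) G_carrier[OF y(1)])
  thus False using y(2) U(3) by simp
 qed
 thus "x:topker" using x U(2) by(auto simp: topker_def)
qed

lemma rad_pmod: "rad_mod A (pmod e) = topker"
proof -
 have car: "car (pmod e) = eset A e" by(simp add: pmod_def)
 have ee: "e:eset A e" using e eset_e by simp
 have ne: "topker ~= eset A e" using topker_right_ideal(3) ee by auto
 have full: "U = eset A e" if "right_ideal A U" "U <= eset A e" "e:U" for U
  using that right_idealD(4)[OF that(1,3)] by auto
 have "maximal_submodule A (pmod e) N <-> N = topker" for N
 proof
  assume N: "maximal_submodule A (pmod e) N"
  hence N1: "right_ideal A N" "N <= eset A e" "N ~= eset A e"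
   by(auto simp: maximal_submodule_def pmod_submodule_iff[OF e(1)] car)
  hence "e ~: N" using full by blast
  hence "N <= topker" using proper_sub_topker N1 by blast
  hence "topker = N \<or> topker = eset A e"
   using N topker_right_ideal unfolding maximal_submodule_def pmod_submodule_iff[OF e(1)] car by blast
  thus "N = topker" using ne by blast
 next
  assume N: "N = topker"
  show "maximal_submodule A (pmod e) N"
   unfolding maximal_submodule_def pmod_submodule_iff[OF e(1)] car N
  proof (intro conjI allI impI topker_right_ideal(1,2) ne)
   fix N' assume N': "right_ideal A N' & N' <= eset A e" "topker <= N'"
   show "N' = topker \<or> N' = eset A e" using full proper_sub_topker N' by blast
  qed
 qed
 hence "rad_mod A (pmod e) = car (pmod e) \<inter> topker" by(simp add: rad_mod_def)
 thus ?thesis using topker_right_ideal(2) car by auto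
qed

definition top :: "('a, 'a set) right_mod" where "top = top_mod A (pmod e)"

lemma top_facts:
 "right_module A top" "EX v. cyclic_gen top v {a:car A. e**a:topker}"
proof -
 have s: "right_submodule A (pmod e) topker" using topker_right_ideal pmod_submodule_iff[OF e(1)] by simp
 note rp = fg_right_module[OF pmod_fg[OF e(1)]]
 show "right_module A top" unfolding top_def top_mod_def rad_pmod by(rule quot_mod_facts(1)[OF rp s])
 show "EX v. cyclic_gen top v {a:car A. e**a:topker}"
  using cyclic_gen_quot[OF rp pmod_cyclic_gen[OF e(1,2)] s] unfolding top_def top_mod_def rad_pmod
  by(auto simp: pmod_def)
qed

text \<open>A nonzero \<open>t\<close> in \<open>T e\<close> gives an epimorphism from
  \<open>e A\<close> to \<open>T\<close>. Its kernel avoids \<open>e\<close> and so lies in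
  \<open>topker\<close>. Conversely \<open>topker\<close> is killed: from \<open>t x\<close> nonzero
  one obtains \<open>t = t r\<close> with \<open>r\<close> in \<open>R\<close>, although
  \<open>e - r\<close> is a unit.\<close>

lemma iso_top_iff:
 assumes T: "simple_module A T"
 shows "mod_iso A T top <-> (EX t:car T. t *[T] e ~= 0[T])"
proof
 have rT: "right_module A T" using T by(simp add: simple_module_def)
 interpret T: right_module A T by(rule rT)
 obtain v where v: "cyclic_gen top v {a:car A. e**a:topker}" using top_facts(2) by blast
 {
  assume "mod_iso A T top"
  then obtain w where w: "cyclic_gen T w {a:car A. e**a:topker}"
   using cyclic_gen_transfer[OF top_facts(1) rT mod_iso_sym[OF rT] v] by blast
  hence "w:car T" "w *[T] e ~= 0[T]" using topker_right_ideal(3) e by(auto simp: cyclic_gen_def)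
  thus "EX t:car T. t *[T] e ~= 0[T]" by blast
 }
 assume "EX t:car T. t *[T] e ~= 0[T]"
 then obtain t0 where t0: "t0:car T" "t0 *[T] e ~= 0[T]" by blast
 define t where "t = t0 *[T] e"
 have t: "t:car T" "t ~= 0[T]" "t *[T] e = t"
  using t0 e T.ract_closed by(auto simp: t_def simp flip: T.ract_assoc)
 have gen: "EX a:car A. q = s *[T] a" if s: "s:car T" "s ~= 0[T]" and q: "q:car T" for s q
 proof -
  have "right_submodule A T ((%a. s *[T] a) ` car (regular A))"
   by(rule submodule_image[OF rreg rT cyclic_gen_map[OF rT s(1)] submodule_carrier[OF rreg]])
  moreover have "s:(%a. s *[T] a) ` car (regular A)" using T.ract_one[OF s(1)] by(intro image_eqI[of _ _ "\<one>"]) auto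
  ultimately have "(%a. s *[T] a) ` car (regular A) = car T"
   using T s(2) unfolding simple_module_def by blast
  thus ?thesis using q by auto
 qed
 have te: "t *[T] a = t *[T] (e**a)" if "a:car A" for a using t that e(1) by(simp add: T.ract_assoc)
 define U where "U = {x:eset A e. t *[T] x = 0[T]}"
 have UI: "right_ideal A U"
 proof (rule right_idealI)
  note ED = right_idealD[OF eset_right_ideal[OF e(1)]]
  show "U <= car A" using ED(1) by(auto simp: U_def)
  show "\<zero>:U" using ED(2) t by(simp add: U_def)
  show "x+.y:U" if "x:U" "y:U" for x y
   using that ED(1,3) t by(auto simp: U_def T.ract_add_right subset_iff)
  show "x**a:U" if "x:U" "a:car A" for x a
   using that ED(1,4) t by(auto simp: U_def T.ract_assoc subset_iff)
 qed
 have "e ~: U" using t by(simp add: U_def)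
 hence "U <= topker" using proper_sub_topker[OF UI] by(auto simp: U_def)
 moreover have "t *[T] x = 0[T]" if x: "x:topker" for x
 proof (rule ccontr)
  assume n: "t *[T] x ~= 0[T]"
  have xc: "x:car A" using x topker_right_ideal(2) eset_e by auto
  obtain a where a: "a:car A" "t = t *[T] x *[T] a" using gen[OF T.ract_closed[OF t(1) xc] n t(1)] by blast
  define r where "r = x**a**e"
  have r: "r:R" using x a by(simp add: topker_def r_def)
  have rc: "r:car A" using xc a e by(simp add: r_def)
  have "t *[T] r = t *[T] x *[T] a *[T] e" using t xc a e by(simp add: r_def T.ract_assoc)
  hence tr: "t *[T] r = t" using a(2) t(3) by simp
  obtain u where u: "u:Gam" "(e-.r)**u = e" using one_minus_R[OF r] by(auto simp: corner_unit_def)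
  have "t *[T] (e-.r) = 0[T]" using t rc e(1) tr by(simp add: T.ract_diff_right T.M.diff_self)
  hence "t *[T] ((e-.r)**u) = 0[T]" using t rc e(1) G_carrier[OF u(1)] by(simp add: T.ract_assoc)
  thus False using u(2) t by simp
 qed
 ultimately have "cyclic_gen T t {a:car A. e**a:topker}"
  unfolding cyclic_gen_def using t(1) gen[OF t(1,2)] te by(auto simp: U_def)
 thus "mod_iso A T top" using cyclic_gen_iso[OF rT top_facts(1) _ v] by blast
qed

end

lemma subquotient_facts:
 assumes M: "right_module A M" and N: "right_submodule A M N" "right_submodule A M N'" "N <= N'"
 shows "right_module A (subquotient M N N')"
  "(%x. N +>\<^bsub>sub_mod M N'\<^esub> x):mod_hom A (sub_mod M N') (subquotient M N N')"
  "(%x. N +>\<^bsub>sub_mod M N'\<^esub> x) ` N' = car (subquotient M N N')"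
  "x:N' ==> N +>\<^bsub>sub_mod M N'\<^esub> x = 0[subquotient M N N'] <-> x:N"
proof -
 note r = sub_mod_right_module[OF M N(2)]
 have s: "right_submodule A (sub_mod M N') N" using sub_mod_submodule_iff[OF M N(2)] N(1,3) by blast
 note F = quot_mod_facts[OF r s]
 show "right_module A (subquotient M N N')"
  "(%x. N +>\<^bsub>sub_mod M N'\<^esub> x):mod_hom A (sub_mod M N') (subquotient M N N')"
  "(%x. N +>\<^bsub>sub_mod M N'\<^esub> x) ` N' = car (subquotient M N N')"
  "x:N' ==> N +>\<^bsub>sub_mod M N'\<^esub> x = 0[subquotient M N N'] <-> x:N"
  using F by(simp_all add: subquotient_def)
qed

lemma simple_subquotient:
 assumes M: "right_module A M" and N: "right_submodule A M N" "right_submodule A M N'" "N \<subset> N'"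
  and between: "!!U. right_submodule A M U ==> N \<subset> U ==> U <= N' ==> U = N'"
 shows "simple_module A (subquotient M N N')"
proof -
 have NN: "N <= N'" using N(3) by auto
 note F = subquotient_facts[OF M N(1,2) NN]
 let ?S = "subquotient M N N'" and ?p = "%x. N +>\<^bsub>sub_mod M N'\<^esub> x"
 have c: "car (sub_mod M N') = N'" by simp
 note rN' = sub_mod_right_module[OF M N(2)]
 show ?thesis
  unfolding simple_module_def
 proof (intro conjI allI impI F(1))
  obtain x where x: "x:N'" "x ~: N" using N(3) by auto
  hence "?p x ~= 0[?S]" "?p x:car ?S" using F(4)[of x] mod_homD(1)[OF F(2), of x] by auto
  thus "car ?S ~= {0[?S]}" by auto
  fix V assume V: "right_submodule A ?S V"
  let ?U = "{x:car (sub_mod M N'). ?p x:V}"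
  have "right_submodule A (sub_mod M N') ?U" by(rule submodule_vimage[OF rN' F(1,2) V])
  hence U: "right_submodule A M ?U" "?U <= N'" using sub_mod_submodule_iff[OF M N(2)] by auto
  have NU: "N <= ?U"
  proof
   fix x assume x: "x:N"
   hence "?p x = 0[?S]" using F(4) NN by blast
   thus "x:?U" using right_submoduleD(2)[OF F(1) V] x NN by(simp add: subset_iff)
  qed
  have VU: "V = ?p ` ?U"
  proof
   show "V <= ?p ` ?U"
   proof
    fix y assume y: "y:V"
    hence "y:?p ` N'" using right_submoduleD(1)[OF F(1) V] F(3) by auto
    thus "y:?p ` ?U" using y by auto
   qed
  qed auto
  show "V = {0[?S]} \<or> V = car ?S"
  proof (cases "?U = N")
   case True
   hence "V <= {0[?S]}" using VU F(4) NN by auto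
   thus ?thesis using right_submoduleD(2)[OF F(1) V] by auto
  next
   case False
   hence "?U = N'" using between[OF U(1) _ U(2)] NU by auto
   thus ?thesis using VU F(3) by simp
  qed
 qed
qed

lemma filtration_mono:
 assumes "filtration A M t N" "i <= j" "j <= t"
 shows "N i <= N j"
 using assms(2,3)
proof (induct j rule: dec_induct)
 case (step j)
 hence "N j <= N (Suc j)" using assms(1) by(simp add: filtration_def)
 thus ?case using step by auto
qed simp

context fd_alg
begin

lemma simple_generated:
 assumes T: "simple_module A T" and s: "s:car T" "s ~= 0[T]" and q: "q:car T"
 shows "EX a:car A. q = s *[T] a"
proof -
 have rT: "right_module A T" using T by(simp add: simple_module_def)
 interpret T: right_module A T by(rule rT)
 have "right_submodule A T ((%a. s *[T] a) ` car (regular A))"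
  by(rule submodule_image[OF rreg rT cyclic_gen_map[OF rT s(1)] submodule_carrier[OF rreg]])
 moreover have "s:(%a. s *[T] a) ` car (regular A)" using T.ract_one[OF s(1)] by(intro image_eqI[of _ _ "\<one>"]) auto
 ultimately have "(%a. s *[T] a) ` car (regular A) = car T"
  using T s(2) unfolding simple_module_def by blast
 thus ?thesis using q by auto
qed

text \<open>A submodule maximal among those with a composition series must be everything: otherwise
  a minimal submodule above it continues the series.\<close>

lemma composition_series_ex:
 assumes Q: "fg_module A Q"
 shows "EX t N. filtration A Q t N & (ALL j<t. simple_module A (subquotient Q (N j) (N (Suc j))))"
proof -
 note rQ = fg_right_module[OF Q]
 interpret V: vector_space_on K Q "kscale A Q" by(rule vs_module[OF rQ])
 have fQ: "V.fin_dim" using Q by(simp add: fg_module_iff)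
 define P where "P U <-> right_submodule A Q U & (EX (t::nat) N. N 0 = {0[Q]} & N t = U & (ALL j<=t. right_submodule A Q (N j)) &
  (ALL j<t. N j <= N (Suc j) & simple_module A (subquotient Q (N j) (N (Suc j)))))" for U
 have "P {0[Q]}" unfolding P_def using submodule_zero[OF rQ]
  by(intro conjI exI[of _ 0] exI[of _ "%_. {0[Q]}"]) auto
 moreover have "V.subspace U" if "P U" for U using that submodule_subspace[OF rQ] by(simp add: P_def)
 ultimately obtain U where U: "P U" "ALL W. P W --> ~ U \<subset> W"
  using V.maximal_subspace_ex[OF fQ, of P "{0[Q]}"] by auto
 obtain t :: nat and N where sU: "right_submodule A Q U" and N: "N 0 = {0[Q]}" "N t = U" "ALL j<=t. right_submodule A Q (N j)"
  "ALL j<t. N j <= N (Suc j) & simple_module A (subquotient Q (N j) (N (Suc j)))"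
  using U(1) unfolding P_def by blast
 have "U = car Q"
 proof (rule ccontr)
  assume n: "U ~= car Q"
  define S where "S W <-> right_submodule A Q W & U \<subset> W" for W
  have "S (car Q)" using n right_submoduleD(1)[OF rQ sU] submodule_carrier[OF rQ] by(auto simp: S_def)
  moreover have "V.subspace W" if "S W" for W using that submodule_subspace[OF rQ] by(simp add: S_def)
  ultimately obtain W where W: "S W" "ALL X. S X --> ~ X \<subset> W"
   using V.minimal_subspace_ex[OF fQ, of S "car Q"] by auto
  have sW: "right_submodule A Q W" and UW: "U \<subset> W" using W(1) by(auto simp: S_def)
  have simp: "simple_module A (subquotient Q U W)"
   by(rule simple_subquotient[OF rQ sU sW UW]) (use W(2) in \<open>auto simp: S_def\<close>)
  let ?N = "N(Suc t := W)"
  have "P W"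
   unfolding P_def
  proof (intro conjI exI[of _ "Suc t"] exI[of _ ?N] sW allI impI)
   fix j assume "j <= Suc t"
   thus "right_submodule A Q (?N j)" using N(3) sW by(auto simp: le_Suc_eq)
  next
   fix j assume "j < Suc t"
   thus "?N j <= ?N (Suc j)" "simple_module A (subquotient Q (?N j) (?N (Suc j)))"
    using N(2,4) UW simp by(auto simp: less_Suc_eq)
  qed (use N in auto)
  thus False using U(2) UW by blast
 qed
 thus ?thesis unfolding filtration_def using N by(intro exI[of _ t] exI[of _ N]) auto
qed

end

section \<open>Composition multiplicities and proper standard modules\<close>

context corner_alg
begin

text \<open>This expresses that \<open>Q e\<close> is a simple module over
  \<open>e A e\<close>.\<close>

definition transitive_at :: "('a, 'm) right_mod => bool" where
 "transitive_at Q <-> (EX x:car Q. x *[Q] e ~= 0[Q]) &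
   (ALL x:car Q. ALL z:car Q. x *[Q] e = x --> z *[Q] e = z --> x ~= 0[Q] --> (EX a:car A. z = x *[Q] a))"

text \<open>Passing from a module to its multiples by \<open>e\<close> sends the top of
  \<open>e A\<close> to a simple \<open>e A e\<close>-module and all other simple modules to zero,
  so the multiplicity is the length of \<open>Q e\<close>.\<close>

lemma comp_multiplicity_iff:
 assumes Q: "fg_module A Q"
 shows "comp_multiplicity A Q top 1 <-> transitive_at Q"
proof
 note rQ = fg_right_module[OF Q]
 interpret Q: right_module A Q by(rule rQ)
 have top_iff: "mod_iso A (subquotient Q (N j) (N (Suc j))) top <-> (EX y:N (Suc j). y *[Q] e ~: N j)"
  if F: "filtration A Q t N" and S: "ALL j<t. simple_module A (subquotient Q (N j) (N (Suc j)))" and j: "j < t" for t N j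
 proof -
  have NN: "right_submodule A Q (N j)" "right_submodule A Q (N (Suc j))" "N j <= N (Suc j)" using F j by(auto simp: filtration_def)
  note G = subquotient_facts[OF rQ NN]
  let ?S = "subquotient Q (N j) (N (Suc j))" and ?p = "%x. N j +>\<^bsub>sub_mod Q (N (Suc j))\<^esub> x"
  have pe: "?p y *[?S] e = 0[?S] <-> y *[Q] e:N j" if y: "y:N (Suc j)" for y
   using mod_homD(3)[OF G(2), of y e] G(4)[OF right_submoduleD(4)[OF rQ NN(2) y e(1)]] y e(1) by simp
  have "mod_iso A ?S top <-> (EX s:?p ` N (Suc j). s *[?S] e ~= 0[?S])"
   using iso_top_iff[OF S[rule_format, OF j]] G(3) by simp
  also have "\<dots> <-> (EX y:N (Suc j). y *[Q] e ~: N j)" using pe by auto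
  finally show ?thesis .
 qed
 have ee: "x *[Q] e *[Q] e = x *[Q] e" if "x:car Q" for x using that e by(simp flip: Q.ract_assoc)
 {
  assume "comp_multiplicity A Q top 1"
  then obtain t N where F: "filtration A Q t N" and S: "ALL j<t. simple_module A (subquotient Q (N j) (N (Suc j)))"
   and c: "card {j. j < t & mod_iso A (subquotient Q (N j) (N (Suc j))) top} = 1"
   unfolding comp_multiplicity_def by(elim exE conjE) (rule that)
  obtain j0 where j0: "{j. j < t & mod_iso A (subquotient Q (N j) (N (Suc j))) top} = {j0}"
   using c by(rule card_1_singletonE)
  have j0t: "j0 < t" and iso0: "mod_iso A (subquotient Q (N j0) (N (Suc j0))) top" using j0 by auto
  have sN: "right_submodule A Q (N j)" if "j <= t" for j using F that by(simp add: filtration_def)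
  note sD = right_submoduleD[OF rQ sN]
  have skip: "y *[Q] e:N j" if "j < t" "j ~= j0" "y:N (Suc j)" for j y
   using top_iff[OF F S that(1)] j0 that by blast
  \<comment> \<open>The factors below \<open>j0\<close> are killed by \<open>e\<close>; as
    \<open>e\<close> is idempotent, the submodule \<open>N j0\<close> is killed as well.\<close>
  have low: "x *[Q] e = 0[Q]" if "j <= j0" "x:N j" for j x using that
  proof (induct j arbitrary: x)
   case 0 thus ?case using F e(1) by(simp add: filtration_def)
  next
   case (Suc j)
   hence "x *[Q] e:N j" using skip[of j x] j0t by auto
   hence "x *[Q] e *[Q] e = 0[Q]" using Suc by simp
   moreover have "x:car Q" using sD(1)[of "Suc j"] Suc j0t by auto
   ultimately show ?case using ee by simp
  qed
  \<comment> \<open>For the same reason multiplication by \<open>e\<close> takes every higher member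
    back into \<open>N (Suc j0)\<close>.\<close>
  have high: "x *[Q] e:N (Suc j0)" if "Suc j0 <= j" "j <= t" "x:N j" for j x using that
  proof (induct j arbitrary: x rule: dec_induct)
   case base thus ?case using sD(4)[of "Suc j0" x e] j0t e(1) by simp
  next
   case (step j)
   hence "x *[Q] e:N j" using skip[of j x] by auto
   hence "x *[Q] e *[Q] e:N (Suc j0)" using step by simp
   moreover have "x:car Q" using sD(1)[of "Suc j"] step by auto
   ultimately show ?case using ee by simp
  qed
  have top: "x *[Q] e:N (Suc j0)" if "x:car Q" for x
   using high[of t x] j0t F that by(simp add: filtration_def)
  have NN: "right_submodule A Q (N j0)" "right_submodule A Q (N (Suc j0))" "N j0 <= N (Suc j0)" using F j0t by(auto simp: filtration_def)
  note G = subquotient_facts[OF rQ NN]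
  let ?S = "subquotient Q (N j0) (N (Suc j0))" and ?p = "%x. N j0 +>\<^bsub>sub_mod Q (N (Suc j0))\<^esub> x"
  show "transitive_at Q"
   unfolding transitive_at_def
  proof (intro conjI ballI impI)
   obtain y where y: "y:N (Suc j0)" "y *[Q] e ~: N j0" using top_iff[OF F S j0t] iso0 by blast
   hence "y *[Q] e ~= 0[Q]" using right_submoduleD(2)[OF rQ NN(1)] by metis
   thus "EX x:car Q. x *[Q] e ~= 0[Q]" using y right_submoduleD(1)[OF rQ NN(2)] by auto
  next
   fix x z assume x: "x:car Q" "x *[Q] e = x" "x ~= 0[Q]" and z: "z:car Q" "z *[Q] e = z"
   have xz: "x:N (Suc j0)" "z:N (Suc j0)" using top[OF x(1)] top[OF z(1)] x z by auto
   have "x ~: N j0" using low[of j0 x] x by auto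
   hence "?p x ~= 0[?S]" using G(4)[OF xz(1)] by simp
   moreover have "?p x:car ?S" "?p z:car ?S" using mod_homD(1)[OF G(2)] xz by auto
   ultimately obtain a where a: "a:car A" "?p z = ?p x *[?S] a"
    using simple_generated[OF S[rule_format, OF j0t], of "?p x" "?p z"] by blast
   have xa: "x *[Q] a:N (Suc j0)" using right_submoduleD(4)[OF rQ NN(2) xz(1) a(1)] .
   have d: "z \<ominus>\<^bsub>Q\<^esub> x *[Q] a:N (Suc j0)" using right_submoduleD(6)[OF rQ NN(2) xz(2) xa] .
   have zd: "z = (z \<ominus>\<^bsub>Q\<^esub> x *[Q] a) +[Q] x *[Q] a" using x z a Q.ract_closed by(simp add: Q.M.diff_add_cancel)
   interpret S: right_module A ?S by(rule G(1))
   have "?p z = ?p (z \<ominus>\<^bsub>Q\<^esub> x *[Q] a) +[?S] ?p (x *[Q] a)"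
    using mod_homD(2)[OF G(2), of "z \<ominus>\<^bsub>Q\<^esub> x *[Q] a" "x *[Q] a"] d xa zd by simp
   moreover have "?p (x *[Q] a) = ?p z" using mod_homD(3)[OF G(2), of x a] xz a by simp
   ultimately have "?p (z \<ominus>\<^bsub>Q\<^esub> x *[Q] a) = 0[?S]"
    using mod_homD(1)[OF G(2), of z] mod_homD(1)[OF G(2), of "z \<ominus>\<^bsub>Q\<^esub> x *[Q] a"] d xz
    by(simp add: S.M.add.r_cancel_one)
   hence "z \<ominus>\<^bsub>Q\<^esub> x *[Q] a:N j0" using G(4)[OF d] by simp
   from low[OF order.refl this] have "(z \<ominus>\<^bsub>Q\<^esub> x *[Q] a) *[Q] e = 0[Q]" .
   hence "z \<ominus>\<^bsub>Q\<^esub> x *[Q] a *[Q] e = 0[Q]" using z x a e(1) Q.ract_closed by(simp add: Q.ract_diff_left)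
   hence "z = x *[Q] (a**e)"
    using z x a e(1) Q.ract_closed by(simp add: Q.M.diff_eq_zero_iff Q.ract_assoc)
   thus "EX a:car A. z = x *[Q] a" using a(1) e(1) by(intro bexI[of _ "a**e"]) auto
  qed
 }
 assume T: "transitive_at Q"
 obtain x where x: "x:car Q" "x *[Q] e ~= 0[Q]" using T unfolding transitive_at_def by blast
 define x0 where "x0 = x *[Q] e"
 have x0: "x0:car Q" "x0 ~= 0[Q]" "x0 *[Q] e = x0" using x e(1) ee Q.ract_closed by(auto simp: x0_def)
 have tr: "EX a:car A. z = y *[Q] a"
  if "y:car Q" "z:car Q" "y *[Q] e = y" "z *[Q] e = z" "y ~= 0[Q]" for y z
  by(rule conjunct2[OF T[unfolded transitive_at_def], rule_format, OF that(1,2,3,4,5)])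
 obtain t N where F: "filtration A Q t N" and S: "ALL j<t. simple_module A (subquotient Q (N j) (N (Suc j)))"
  using composition_series_ex[OF Q] by(elim exE conjE) (rule that)
 have N0: "N 0 = {0[Q]}" and Nt: "N t = car Q" and sN: "!!j. j <= t ==> right_submodule A Q (N j)"
  using F unfolding filtration_def by simp_all
 note sD = right_submoduleD[OF rQ sN]
 \<comment> \<open>The first member that contains the nonzero element \<open>x0\<close> of
   \<open>Q e\<close>, and by transitivity then all of \<open>Q e\<close>; only the step that leads
   to it has the required factor.\<close>
 define l where "l = (LEAST j. x0:N j)"
 have xt: "x0:N t" using x0(1) Nt by simp
 have l: "x0:N l" "l <= t" "!!j. j < l ==> x0 ~: N j"
  unfolding l_def by(rule LeastI[of "%j. x0:N j", OF xt], rule Least_le[of "%j. x0:N j", OF xt],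
   erule not_less_Least)
 have "l ~= 0" using l(1) N0 x0(2) by(cases l) simp_all
 then obtain j0 where lj: "l = Suc j0" by(cases l) auto
 have j0: "j0 < t" "x0:N (Suc j0)" "x0 ~: N j0" using l lj by auto
 have "{j. j < t & mod_iso A (subquotient Q (N j) (N (Suc j))) top} = {j0}"
 proof (intro equalityI subsetI)
  fix j assume "j:{j0}"
  thus "j:{j. j < t & mod_iso A (subquotient Q (N j) (N (Suc j))) top}"
   using top_iff[OF F S j0(1)] j0 x0(3) by(auto intro!: bexI[of _ x0])
 next
  fix j assume "j:{j. j < t & mod_iso A (subquotient Q (N j) (N (Suc j))) top}"
  hence jt: "j < t" and "mod_iso A (subquotient Q (N j) (N (Suc j))) top" by auto
  then obtain y0 where y0: "y0:N (Suc j)" "y0 *[Q] e ~: N j" using top_iff[OF F S jt] by blast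
  define y where "y = y0 *[Q] e"
  have y0c: "y0:car Q" using y0 sD(1)[of "Suc j"] jt by auto
  have y: "y:N (Suc j)" "y ~: N j" "y:car Q" "y *[Q] e = y"
   using y0 sD(4)[of "Suc j" y0 e] jt e(1) ee[OF y0c] Q.ract_closed[OF y0c e(1)] by(auto simp: y_def)
  have y0': "y ~= 0[Q]" using y(2) sD(2)[of j] jt by auto
  have "~ j < j0"
  proof
   assume "j < j0"
   hence "y:N j0" using filtration_mono[OF F, of "Suc j" j0] y(1) j0(1) by auto
   moreover obtain a where "a:car A" "x0 = y *[Q] a" using tr[OF y(3) x0(1) y(4) x0(3) y0'] by blast
   ultimately show False using sD(4)[of j0 y a] j0 by simp
  qed
  moreover have "~ j0 < j"
  proof
   assume "j0 < j"
   hence "x0:N j" using filtration_mono[OF F, of "Suc j0" j] j0 jt by auto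
   moreover obtain a where "a:car A" "y = x0 *[Q] a" using tr[OF x0(1) y(3) x0(3) y(4) x0(2)] by blast
   ultimately show False using sD(4)[of j x0 a] jt y(2) by simp
  qed
  ultimately show "j:{j0}" by simp
 qed
 thus "comp_multiplicity A Q top 1"
  unfolding comp_multiplicity_def using F S by(intro exI[of _ t] exI[of _ N]) auto
qed

text \<open>Here \<open>Q e\<close> is a cyclic module over the local algebra \<open>e A e\<close>,
  hence simple precisely when the annihilator of its generator is the radical.\<close>

lemma transitive_at_cyclic:
 assumes Q: "right_module A Q" and v: "cyclic_gen Q v {a:car A. e**a:U}"
  and U: "right_ideal A U"
 shows "transitive_at Q <-> e ~: U & R <= U"
proof -
 interpret Q: right_module A Q by fact
 note UD = right_idealD[OF U]
 have vc: "v:car Q" and vz: "!!a. a:car A ==> v *[Q] a = 0[Q] <-> e**a:U"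
  and vg: "!!q. q:car Q ==> EX a:car A. q = v *[Q] a"
  using v by(auto simp: cyclic_gen_def)
 have veq: "v *[Q] a = v *[Q] b <-> e**(a-.b):U" if "a:car A" "b:car A" for a b
  using vz[of "a-.b"] that vc Q.ract_closed by(simp add: Q.ract_diff_right Q.M.diff_eq_zero_iff)
 have ve: "v *[Q] e = v"
 proof -
  have "e**(e-.\<one>) = \<zero>" using e by(simp add: a_minus_def A.r_distr A.r_minus A.r_neg)
  thus ?thesis using veq[of e "\<one>"] e UD(2) Q.ract_one[OF vc] by simp
 qed
 show ?thesis
 proof
  assume T: "transitive_at Q"
  obtain q where q: "q:car Q" "q *[Q] e ~= 0[Q]" using T unfolding transitive_at_def by blast
  have eU: "e ~: U"
  proof
   assume "e:U"
   hence v0: "v = 0[Q]" using vz[of e] e ve by simp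
   obtain a where "a:car A" "q = v *[Q] a" using vg[OF q(1)] by blast
   thus False using q v0 e(1) by simp
  qed
  have "x:U" if x: "x:R" for x
  proof (rule ccontr)
   assume n: "x ~: U"
   have xG: "x:Gam" using R_G[OF x] .
   note xc = G_carrier[OF xG]
   have "v *[Q] x ~= 0[Q]" using vz[OF xc] n G_e(1)[OF xG] by simp
   moreover have "v *[Q] x *[Q] e = v *[Q] x" using vc xc e(1) G_e(2)[OF xG] by(simp flip: Q.ract_assoc)
   ultimately obtain a where a: "a:car A" "v = v *[Q] x *[Q] a"
    using T vc ve Q.ract_closed[OF vc xc] unfolding transitive_at_def by blast
   define r where "r = x**(e**a**e)"
   have r: "r:R" unfolding r_def by(rule R_mult(1)[OF x G_corner[OF a(1)]])
   note rG = R_G[OF r]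
   have "r = x**a**e" unfolding r_def using xc a(1) e(1) G_e(2)[OF xG] by(simp flip: A.m_assoc)
   hence "v *[Q] r = v" using a vc xc e(1) ve by(simp add: Q.ract_assoc)
   hence "e**(e-.r):U" using veq[of e r] ve e(1) G_carrier[OF rG] by simp
   moreover have "e**(e-.r) = e-.r" using G_e(1)[OF G_diff[OF e(4) rG]] .
   moreover obtain u where u: "u:Gam" "(e-.r)**u = e" using one_minus_R[OF r] by(auto simp: corner_unit_def)
   ultimately show False using UD(4)[of "e-.r" u] G_carrier[OF u(1)] eU by simp
  qed
  thus "e ~: U & R <= U" using eU by blast
 next
  assume eU: "e ~: U & R <= U"
  show "transitive_at Q"
   unfolding transitive_at_def
  proof (intro conjI ballI impI)
   show "EX x:car Q. x *[Q] e ~= 0[Q]" using vz[of e] e eU by(intro bexI[of _ v] vc) auto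
   fix x z assume x: "x:car Q" "x *[Q] e = x" "x ~= 0[Q]" and z: "z:car Q"
   obtain a where a: "a:car A" "x = v *[Q] a" using vg[OF x(1)] by blast
   obtain b where b: "b:car A" "z = v *[Q] b" using vg[OF z] by blast
   define g where "g = e**a**e"
   have g: "g:Gam" unfolding g_def by(rule G_corner[OF a(1)])
   have vge: "v *[Q] g = x" using a x(2) vc ve e(1) by(simp add: g_def Q.ract_assoc)
   hence "g ~: U" using vz[OF G_carrier[OF g]] x(3) G_e(1)[OF g] by simp
   then obtain y where y: "y:Gam" "g**y = e" using eU unit_or_nilpotent[OF g] by(auto simp: corner_unit_def)
   have "x *[Q] (y**b) = v *[Q] (g**y) *[Q] b"
    using vge[symmetric] vc G_carrier[OF g] G_carrier[OF y(1)] b(1) by(simp add: Q.ract_assoc Q.ract_closed)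
   hence "z = x *[Q] (y**b)" using y(2) ve b(2) by simp
   thus "EX a:car A. z = x *[Q] a" using b(1) G_carrier[OF y(1)] by(intro bexI[of _ "y**b"]) auto
  qed
 qed
qed

text \<open>The right ideal generated by \<open>R\<close> and \<open>e I\<close>, the preimage of the kernel of the proper standard
  module.\<close>

definition properker :: "'a set => 'a set" where
 "properker I = \<Inter> {U. right_ideal A U & (%a. e**a) ` I <= U & R <= U}"

text \<open>That \<open>e\<close> stays outside is seen from the radical \<open>topker\<close> of
  \<open>e A\<close>, which contains both \<open>R\<close> and \<open>e I\<close>, the latter
  because \<open>e\<close> is not in \<open>I\<close>.\<close>

lemma properker_facts:
 assumes I: "ideal I A" "e ~: I"
 shows "right_ideal A (properker I)" "properker I <= eset A e" "(%a. e**a) ` I <= properker I" "R <= properker I"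
  "e ~: properker I" "!!U. right_ideal A U ==> (%a. e**a) ` I <= U ==> R <= U ==> properker I <= U"
proof -
 interpret I: ideal I A by(rule I)
 have Ic: "x:car A" if "x:I" for x using that I.a_Hcarr by blast
 have RG: "R <= topker"
 proof
  fix x assume x: "x:R"
  note xG = R_G[OF x]
  have "x**a**e:R" if a: "a:car A" for a
   using R_mult(1)[OF x G_corner[OF a]] G_carrier[OF xG] a e(1) G_e(2)[OF xG] by(simp flip: A.m_assoc)
  thus "x:topker" using eset_e G_e(1)[OF xG] G_carrier[OF xG] unfolding topker_def by blast
 qed
 have IT: "(%a. e**a) ` I <= topker"
 proof
  fix x assume "x:(%a. e**a) ` I"
  then obtain b where b: "b:I" "x = e**b" by auto
  have "x**a**e:R" if a: "a:car A" for a
  proof (rule ccontr)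
   assume n: "x**a**e ~: R"
   have "x**a**e = e**(b**a)**e" using b a e(1) Ic by(simp add: A.m_assoc)
   hence g: "x**a**e:Gam" using G_corner[of "b**a"] b a Ic by simp
   obtain y where y: "y:Gam" "x**a**e**y = e" using unit_or_nilpotent[OF g n] by(auto simp: corner_unit_def)
   have "x**a**e**y:I" using b a e(1) G_carrier[OF y(1)] by(simp add: I.I_l_closed I.I_r_closed)
   thus False using y(2) I(2) by simp
  qed
  thus "x:topker" using b Ic e(1) unfolding topker_def by blast
 qed
 show ri: "right_ideal A (properker I)"
 proof (rule right_idealI)
  show "properker I <= car A"
   unfolding properker_def using topker_right_ideal RG IT right_idealD(1)[OF topker_right_ideal(1)] by blast
 qed (auto simp: properker_def right_idealD(2-4))
 have T: "properker I <= topker" unfolding properker_def using topker_right_ideal(1) RG IT by blast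
 thus "properker I <= eset A e" "e ~: properker I" using topker_right_ideal(2,3) by auto
 show "(%a. e**a) ` I <= properker I" "R <= properker I" unfolding properker_def by blast+
 show "!!U. right_ideal A U ==> (%a. e**a) ` I <= U ==> R <= U ==> properker I <= U"
  unfolding properker_def by blast
qed

lemma standard_quot:
 assumes I: "ideal I A"
 shows "right_submodule A (pmod e) ((%a. e**a) ` I)"
  "fg_module A (quot_mod (pmod e) ((%a. e**a) ` I))"
  "cyclic_gen (quot_mod (pmod e) ((%a. e**a) ` I)) ((%a. e**a) ` I +>\<^bsub>pmod e\<^esub> e) {a:car A. e**a:I}"
proof -
 interpret I: ideal I A by(rule I)
 have Ic: "x:car A" if "x:I" for x using that I.a_Hcarr by blast
 have D: "(%a. e**a) ` I = I \<inter> eset A e"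
 proof
  show "(%a. e**a) ` I <= I \<inter> eset A e" using Ic e(1) I.I_l_closed by auto
  show "I \<inter> eset A e <= (%a. e**a) ` I"
  proof
   fix x assume "x:I \<inter> eset A e"
   thus "x:(%a. e**a) ` I" using eset_e[of x] by(intro image_eqI[of _ _ x]) auto
  qed
 qed
 have "right_ideal A I" by(rule right_idealI) (use Ic I.I_r_closed I.a_closed I.zero_closed in auto)
 hence "right_ideal A (I \<inter> eset A e)"
  using submodule_Int[OF rreg] eset_right_ideal[OF e(1)] unfolding right_ideal_def by blast
 thus s: "right_submodule A (pmod e) ((%a. e**a) ` I)"
  using pmod_submodule_iff[OF e(1)] D by simp
 show "fg_module A (quot_mod (pmod e) ((%a. e**a) ` I))" by(rule fg_quot[OF pmod_fg[OF e(1)] s])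
 have "{a:car A. e *[pmod e] a:(%a. e**a) ` I} = {a:car A. e**a:I}"
  unfolding D by(auto simp: pmod_def)
 thus "cyclic_gen (quot_mod (pmod e) ((%a. e**a) ` I)) ((%a. e**a) ` I +>\<^bsub>pmod e\<^esub> e) {a:car A. e**a:I}"
  using cyclic_gen_quot[OF fg_right_module[OF pmod_fg[OF e(1)]] pmod_cyclic_gen[OF e(1,2)] s] by simp
qed

text \<open>Submodules of the standard module correspond to right ideals between \<open>e I\<close>
  and \<open>e A\<close>. By the criterion for multiplicity one, the least admissible right ideal is
  \<open>properker I\<close>, so the \<open>LEAST\<close> of the definition is attained at its
  image.\<close>

lemma proper_standard_quot:
 assumes I: "ideal I A" "e ~: I"
 defines "D == quot_mod (pmod e) ((%a. e**a) ` I)"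
 defines "N0 == (LEAST N. right_submodule A D N & comp_multiplicity A (quot_mod D N) top 1)"
 shows "right_module A (quot_mod D N0)" "EX v. cyclic_gen (quot_mod D N0) v {a:car A. e**a:properker I}"
proof -
 let ?J = "(%a. e**a) ` I"
 note SQ = standard_quot[OF I(1), folded D_def]
 note PF = properker_facts[OF I]
 note rP = fg_right_module[OF pmod_fg[OF e(1)]] and rD = fg_right_module[OF SQ(2)]
 note QF = quot_mod_facts[OF rP SQ(1), folded D_def]
 let ?q = "%x. ?J +>\<^bsub>pmod e\<^esub> x"
 have cP: "car (pmod e) = eset A e" by(simp add: pmod_def)
 have actq: "?q e *[D] a = ?q (e**a)" if "a:car A" for a
  using mod_homD(3)[OF QF(2), of e a] that eset_e e by(simp add: pmod_def)
 define N1 where "N1 = ?q ` properker I"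
 have s1: "right_submodule A (pmod e) (properker I)" using PF(1,2) pmod_submodule_iff[OF e(1)] by simp
 have sN1: "right_submodule A D N1" unfolding N1_def by(rule submodule_image[OF rP rD QF(2) s1])
 have gen: "cyclic_gen (quot_mod D N) (N +>\<^bsub>D\<^esub> ?q e) {a:car A. e**a:{x:eset A e. ?q x:N}}"
  and Uri: "right_ideal A {x:eset A e. ?q x:N}" and fgN: "fg_module A (quot_mod D N)"
  if N: "right_submodule A D N" for N
 proof -
  have "{a:car A. ?q e *[D] a:N} = {a:car A. e**a:{x:eset A e. ?q x:N}}"
   using actq by auto
  thus "cyclic_gen (quot_mod D N) (N +>\<^bsub>D\<^esub> ?q e) {a:car A. e**a:{x:eset A e. ?q x:N}}"
   using cyclic_gen_quot[OF rD SQ(3) N] by simp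
  show "right_ideal A {x:eset A e. ?q x:N}"
   using submodule_vimage[OF rP rD QF(2) N] pmod_submodule_iff[OF e(1)] by(simp add: cP)
  show "fg_module A (quot_mod D N)" by(rule fg_quot[OF SQ(2) N])
 qed
 have cond: "comp_multiplicity A (quot_mod D N) top 1 <-> e ~: {x:eset A e. ?q x:N} & R <= {x:eset A e. ?q x:N}"
  if N: "right_submodule A D N" for N
  using comp_multiplicity_iff[OF fgN[OF N]] transitive_at_cyclic[OF fg_right_module[OF fgN[OF N]] gen[OF N] Uri[OF N]] by simp
 interpret P: right_module A "pmod e" by(rule rP)
 interpret D: right_module A D by(rule rD)
 have U1: "{x:eset A e. ?q x:N1} = properker I"
 proof
  show "properker I <= {x:eset A e. ?q x:N1}" using PF(2) by(auto simp: N1_def)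
  show "{x:eset A e. ?q x:N1} <= properker I"
  proof
   fix x assume "x:{x:eset A e. ?q x:N1}"
   then obtain y where x: "x:eset A e" and y: "y:properker I" "?q x = ?q y" by(auto simp: N1_def)
   have yc: "y:car (pmod e)" and xc: "x:car (pmod e)" using y PF(2) x cP by auto
   have "?q (x \<ominus>\<^bsub>pmod e\<^esub> y) = 0[D]"
    using mod_hom_diff[OF rP rD QF(2) xc yc] y(2) mod_homD(1)[OF QF(2) yc] by(simp add: D.M.diff_self)
   hence "x \<ominus>\<^bsub>pmod e\<^esub> y:properker I" using QF(4)[of "x \<ominus>\<^bsub>pmod e\<^esub> y"] xc yc PF(3) by auto
   hence "(x \<ominus>\<^bsub>pmod e\<^esub> y) +[pmod e] y:properker I"
    using right_submoduleD(3)[OF rP s1] y(1) by blast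
   thus "x:properker I" using xc yc by(simp add: P.M.diff_add_cancel)
  qed
 qed
 have "N0 = N1"
  unfolding N0_def
 proof (rule Least_equality)
  show "right_submodule A D N1 & comp_multiplicity A (quot_mod D N1) top 1"
   using sN1 cond[OF sN1] U1 PF(4,5) by simp
  fix N assume N: "right_submodule A D N & comp_multiplicity A (quot_mod D N) top 1"
  hence sN: "right_submodule A D N" by simp
  have "?J <= {x:eset A e. ?q x:N}"
  proof
   fix x assume x: "x:?J"
   hence xc: "x:car (pmod e)" using right_submoduleD(1)[OF rP SQ(1)] by auto
   hence "?q x = 0[D]" using QF(4) x by blast
   thus "x:{x:eset A e. ?q x:N}" using xc cP right_submoduleD(2)[OF rD sN] by simp
  qed
  hence "properker I <= {x:eset A e. ?q x:N}" using PF(6)[OF Uri[OF sN]] cond[OF sN] N by blast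
  thus "N1 <= N" by(auto simp: N1_def)
 qed
 thus "right_module A (quot_mod D N0)" "EX v. cyclic_gen (quot_mod D N0) v {a:car A. e**a:properker I}"
  using fg_right_module[OF fgN[OF sN1]] gen[OF sN1] unfolding U1 by auto
qed

lemma top_simple: "simple_module A top"
proof -
 have s: "right_submodule A (pmod e) topker" using topker_right_ideal pmod_submodule_iff[OF e(1)] by simp
 obtain v where v: "cyclic_gen top v {a:car A. e**a:topker}" using top_facts(2) by blast
 interpret T: right_module A top by(rule top_facts(1))
 have vc: "v:car top" and vz: "!!a. a:car A ==> v *[top] a = 0[top] <-> e**a:topker"
  and vg: "!!q. q:car top ==> EX a:car A. q = v *[top] a"
  using v by(auto simp: cyclic_gen_def)
 show ?thesis
  unfolding simple_module_def
 proof (intro conjI allI impI top_facts(1))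
  have "v *[top] e ~= 0[top]" using vz[OF e(1)] e(2) topker_right_ideal(3) by simp
  hence "v ~= 0[top]" using e(1) by auto
  thus "car top ~= {0[top]}" using vc by blast
  fix N assume N: "right_submodule A top N"
  note ND = right_submoduleD[OF top_facts(1) N]
  let ?U = "{x:eset A e. v *[top] x:N}"
  have UI: "right_ideal A ?U"
  proof (rule right_idealI)
   note ED = right_idealD[OF eset_right_ideal[OF e(1)]]
   show "?U <= car A" using ED(1) by auto
   show "\<zero>:?U" using ED(2) ND(2) vc by simp
   show "x+.y:?U" if "x:?U" "y:?U" for x y
    using that ED(1,3) ND(3) vc by(auto simp: T.ract_add_right subset_iff)
   show "x**a:?U" if "x:?U" "a:car A" for x a
    using that ED(1,4) ND(4) vc by(auto simp: T.ract_assoc subset_iff)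
  qed
  have ve: "v *[top] a = v *[top] (e**a)" if a: "a:car A" for a
  proof -
   have "e**(a-.e**a) = \<zero>"
    using a e by(simp add: a_minus_def A.r_distr A.r_minus A.r_neg flip: A.m_assoc)
   hence "v *[top] (a-.e**a) = 0[top]"
    using vz[of "a-.e**a"] a e(1) right_idealD(2)[OF topker_right_ideal(1)] by simp
   thus ?thesis using a e(1) vc T.ract_closed by(simp add: T.ract_diff_right T.M.diff_eq_zero_iff)
  qed
  show "N = {0[top]} \<or> N = car top"
  proof (cases "e:?U")
   case True
   hence "v *[top] e:N" by simp
   hence "v *[top] a:N" if "a:car A" for a
    using ND(4)[of "v *[top] e" a] that ve[OF that] vc e(1) by(simp add: T.ract_assoc)
   thus ?thesis using vg ND(1) by blast
  next
   case False
   hence "?U <= topker" using proper_sub_topker[OF UI] by auto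
   have "q = 0[top]" if q: "q:N" for q
   proof -
    obtain a where a: "a:car A" "q = v *[top] a" using vg q ND(1) by blast
    hence "e**a:?U" using q ve by simp
    thus ?thesis using \<open>?U <= topker\<close> vz a by auto
   qed
   thus ?thesis using ND(2) by blast
  qed
 qed
qed

end

section \<open>Filtrations of the regular module\<close>

context fd_alg
begin

lemma right_ideal_subspace: "right_ideal A N ==> vsA.subspace N"
proof (rule vsA.subspaceI)
 assume N: "right_ideal A N"
 note D = right_idealD[OF N]
 show "k \<odot> x:N" if "k:car K" "x:N" for k x
  using that D(1) D(4)[of x "k \<odot> \<one>"] smult_eq_mult(1)[of k x] by auto
qed (use right_idealD[of N] in auto)

lemma two_sided_idealI:
 assumes W: "W <= car A" "\<zero>:W" "!!x y. x:W ==> y:W ==> x+.y:W"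
  and l: "!!x a. x:W ==> a:car A ==> a**x:W"
  and r: "!!x a. x:W ==> a:car A ==> x**a:W"
 shows "ideal W A"
proof (rule idealI)
 show "subgroup W (add_monoid A)"
  using right_idealD(5)[OF right_idealI[OF W r]] by(simp add: additive_subgroup_def)
qed (use A.ring_axioms l r in auto)

lemma ideal_right_ideal: "ideal I A ==> right_ideal A I"
proof (rule right_idealI)
 assume "ideal I A"
 then interpret I: ideal I A .
 show "I <= car A" using I.a_Hcarr by blast
qed (auto intro: ideal.I_r_closed additive_subgroup.a_closed additive_subgroup.zero_closed ideal.axioms(1))

text \<open>Filtrations of the regular module in which each subquotient is cyclic, with annihilator of
  the generator prescribed up to the index \<open>kp j\<close>.\<close>

definition rchain ::
 "nat => (nat => 'a set) => nat => (nat => 'a set) => (nat => nat) => (nat => 'a) => bool" where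
 "rchain n L t N kp v <-> N 0 = {\<zero>} & N t = car A & (ALL j<=t. right_ideal A (N j)) &
   (ALL j<t. kp j:{1..n} & v j:car A & (ALL a:car A. v j**a:N j <-> a:L (kp j)) &
    N (Suc j) = {u+.v j**w | u w. u:N j & w:car A})"

lemma rchainD:
 assumes "rchain n L t N kp v"
 shows "N 0 = {\<zero>}" "N t = car A" "j <= t ==> right_ideal A (N j)" "j < t ==> kp j:{1..n}"
  "j < t ==> v j:car A" "j < t ==> a:car A ==> v j**a:N j <-> a:L (kp j)"
  "j < t ==> N (Suc j) = {u+.v j**w | u w. u:N j & w:car A}"
 using assms unfolding rchain_def by blast+

end

section \<open>Generators of \<open>e A\<close> over the corner algebra\<close>

context corner_alg
begin

text \<open>These are the left \<open>e A e\<close>-submodules of \<open>e A\<close>.\<close>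

definition left_stable :: "'a set => bool" where
 "left_stable W <-> W <= eset A e & \<zero>:W & (ALL x:W. ALL y:W. x+.y:W) & (ALL g:Gam. ALL w:W. g**w:W)"

lemma left_stableD:
 assumes "left_stable W"
 shows "W <= eset A e" "\<zero>:W" "x:W ==> y:W ==> x+.y:W" "g:Gam ==> x:W ==> g**x:W"
  "vsA.subspace W"
proof -
 show *: "W <= eset A e" "\<zero>:W" "!!x y. x:W ==> y:W ==> x+.y:W" "!!g x. g:Gam ==> x:W ==> g**x:W"
  using assms by(auto simp: left_stable_def)
 show "vsA.subspace W"
 proof (rule vsA.subspaceI)
  show "k \<odot> x:W" if k: "k:car K" and x: "x:W" for k x
  proof -
   have "x:car A" "e**x = x" using *(1) x eset_e by auto
   hence "(k \<odot> e)**x = k \<odot> x" using k e(1) by(simp add: smult_mult)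
   thus ?thesis using *(4)[OF G_smult[OF k e(4)] x] by simp
  qed
 qed (use * right_idealD(1)[OF eset_right_ideal[OF e(1)]] in auto)
qed

lemma left_stable_eset: "left_stable (eset A e)"
 unfolding left_stable_def
proof (intro conjI ballI subset_refl)
 note ED = right_idealD[OF eset_right_ideal[OF e(1)]]
 show "\<zero>:eset A e" by(rule ED(2))
 show "x+.y:eset A e" if "x:eset A e" "y:eset A e" for x y using ED(3) that .
 show "g**w:eset A e" if g: "g:Gam" and w: "w:eset A e" for g w
 proof -
  have wc: "w:car A" using w eset_e by blast
  have "e**(g**w) = g**w" using G_carrier[OF g] G_e(1)[OF g] wc e(1) by(simp flip: A.m_assoc)
  thus ?thesis unfolding eset_e using G_carrier[OF g] wc by simp
 qed
qed

lemma R_eset: "R <= eset A e"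
 using eset_e R_G G_carrier G_e(1) by blast

lemmas pz = properker_facts[OF A.zeroideal, simplified, OF e(3)]

text \<open>In other words, \<open>properker {\<zero>}\<close> is \<open>R e A\<close>. The
  intersection of all such \<open>W\<close> is a right ideal, since with \<open>W\<close> also the
  set of all \<open>w\<close> with \<open>w a\<close> in \<open>W\<close> qualifies.\<close>

lemma properker_zero_least:
 assumes W: "left_stable W" "!!r w. r:R ==> w:eset A e ==> r**w:W"
 shows "properker {\<zero>} <= W"
proof -
 define P where "P W <-> left_stable W & (ALL r:R. ALL w:eset A e. r**w:W)" for W
 define U where "U = {x:eset A e. ALL W. P W --> x:W}"
 note ED = right_idealD[OF eset_right_ideal[OF e(1)]]
 have PD: "P W ==> left_stable W" for W by(simp add: P_def)
 have "right_ideal A U"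
 proof (rule right_idealI)
  show "U <= car A" using ED(1) by(auto simp: U_def)
  show "\<zero>:U" using ED(2) left_stableD(2)[OF PD] by(simp add: U_def)
  show "x+.y:U" if "x:U" "y:U" for x y using that ED(3) left_stableD(3)[OF PD] by(simp add: U_def)
  show "x**a:U" if x: "x:U" and a: "a:car A" for x a
  proof -
   have "x**a:W" if W: "P W" for W
   proof -
    note WD = left_stableD[OF PD[OF W]]
    have c: "w:car A" if "w:eset A e" for w using ED(1) that by blast
    have "P {w:eset A e. w**a:W}"
     unfolding P_def left_stable_def
    proof (intro conjI ballI)
     show "{w:eset A e. w**a:W} <= eset A e" by blast
     show "\<zero>:{w:eset A e. w**a:W}" using ED(2) WD(2) a by simp
     show "w+.w':{w:eset A e. w**a:W}" if "w:{w:eset A e. w**a:W}" "w':{w:eset A e. w**a:W}" for w w'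
      using that ED(3)[of w w'] WD(3) a c by(simp add: A.l_distr)
     show "g**w:{w:eset A e. w**a:W}" if g: "g:Gam" and w: "w:{w:eset A e. w**a:W}" for g w
      using w left_stableD(4)[OF left_stable_eset g] WD(4)[OF g] G_carrier[OF g] a c by(simp add: A.m_assoc)
     show "r**w:{w:eset A e. w**a:W}" if r: "r:R" and w: "w:eset A e" for r w
     proof -
      have "r**(w**a):W" using W r ED(4)[OF w a] unfolding P_def by blast
      thus ?thesis
       using left_stableD(4)[OF left_stable_eset R_G[OF r] w] G_carrier[OF R_G[OF r]] c[OF w] a by(simp add: A.m_assoc)
     qed
    qed
    thus ?thesis using x by(auto simp: U_def)
   qed
   thus ?thesis using ED(4)[OF _ a] x by(simp add: U_def)
  qed
 qed
 moreover have "R <= U"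
 proof
  fix r assume r: "r:R"
  have "r**e:W" if "P W" for W using that r eset_e[of e] e unfolding P_def by blast
  thus "r:U" using G_e(2)[OF R_G[OF r]] R_eset r by(auto simp: U_def)
 qed
 ultimately have "properker {\<zero>} <= U" using pz(6) e(1) right_idealD(2) by simp
 thus ?thesis using W unfolding U_def P_def by blast
qed

text \<open>The elements that \<open>g\<close> multiplies into the ideal form a right ideal
  containing \<open>R\<close>, so minimality applies.\<close>

lemma left_stable_properker: "left_stable (properker {\<zero>})"
 unfolding left_stable_def
proof (intro conjI ballI)
 note PD = right_idealD[OF pz(1)] and ED = right_idealD[OF eset_right_ideal[OF e(1)]]
 show "g**x:properker {\<zero>}" if g: "g:Gam" and x: "x:properker {\<zero>}" for g x
 proof -
  have "right_ideal A {x:eset A e. g**x:properker {\<zero>}}"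
   using ED(1-4) PD(2-4) G_carrier[OF g]
   by(intro right_idealI) (auto simp: A.r_distr subset_iff simp flip: A.m_assoc)
  moreover have "R <= {x:eset A e. g**x:properker {\<zero>}}"
   using R_eset R_mult(2)[OF _ g] pz(4) by blast
  ultimately have "properker {\<zero>} <= {x:eset A e. g**x:properker {\<zero>}}"
   using pz(6) right_idealD(2) e(1) by simp
  thus ?thesis using x by blast
 qed
qed (use pz(2) right_idealD(2,3)[OF pz(1)] in auto)

abbreviation combs :: "(nat => 'a) => 'a set => nat => 'a set" where
 "combs y == lin_comb A (%z p. z**y p)"

lemma combs_subset:
 assumes "\<zero>:W" "!!x y. x:W ==> y:W ==> x+.y:W" "!!z p. z:S ==> p < q ==> z**y p:W"
 shows "combs y S q <= W"
 using assms(3) by(induct q) (auto simp: assms(1) intro!: assms(2))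

lemma combs_lmult:
 assumes "!!z. z:S ==> g**z:T" "g:car A" "S <= car A" "range y <= car A"
 shows "x:combs y S q ==> x:car A & g**x:combs y T q"
proof (induct q arbitrary: x)
 case (Suc q)
 then obtain u z where u: "x = u+.z**y q" "u:combs y S q" "z:S" by auto
 have c: "z:car A" "y q:car A" "u:car A" using u Suc(1) assms(3,4) by auto
 have "g**x = g**u+.(g**z)**y q" using u(1) c assms(2) by(simp add: A.r_distr A.m_assoc)
 thus ?case using Suc(1)[OF u(2)] assms(1)[OF u(3)] u(1) c by auto
qed (use assms(2) in auto)

lemma combs_add:
 assumes S: "S <= car A" "!!x y. x:S ==> y:S ==> x+.y:S" and y: "range y <= car A"
 shows "x:combs y S q ==> x':combs y S q ==> x+.x':combs y S q"
proof (induct q arbitrary: x x')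
 case (Suc q)
 obtain u z u' z' where u: "x = u+.z**y q" "u:combs y S q" "z:S"
  "x' = u'+.z'**y q" "u':combs y S q" "z':S" using Suc(2,3) by auto
 have cc: "v:car A" if "v:combs y S q" for v
  using combs_lmult[of S \<one> "car A" y, OF _ A.one_closed S(1) y that] S(1) by auto
 note cu = cc[OF u(2)] cc[OF u(5)]
 have c: "z:car A" "z':car A" "y q:car A"
  using u(3,6) S(1) y by auto
 have "x+.x' = (u+.u')+.(z+.z')**y q" using u(1,4) c cu by(simp add: A.l_distr A.a_ac)
 thus ?case using Suc(1)[OF u(2,5)] S(2)[OF u(3,6)] by(simp only: lin_comb.simps) blast
qed auto

lemma combs_zero: "\<zero>:S ==> range y <= car A ==> \<zero>:combs y S q"
proof (induct q)
 case (Suc q)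
 have "y q:car A" using Suc(3) by auto
 hence "\<zero> = \<zero> \<oplus> \<zero>**y q" by simp
 thus ?case using Suc by(simp only: lin_comb.simps) blast
qed simp

lemma left_stable_combs:
 assumes y: "range y <= eset A e"
 shows "left_stable (combs y Gam q)"
proof -
 have yc: "range y <= car A" using y right_idealD(1)[OF eset_right_ideal[OF e(1)]] by blast
 have "combs y Gam q <= eset A e"
  using y by(intro combs_subset left_stableD(2-4)[OF left_stable_eset]) auto
 moreover have "x+.x':combs y Gam q" if "x:combs y Gam q" "x':combs y Gam q" for x x'
  by(rule combs_add[OF _ _ yc that]) (auto simp: G_carrier G_add)
 moreover have "g**x:combs y Gam q" if g: "g:Gam" and x: "x:combs y Gam q" for g x
  using combs_lmult[OF _ G_carrier[OF g] _ yc x, of Gam] G_mult[OF g] G_carrier by blast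
 ultimately show ?thesis unfolding left_stable_def using combs_zero[OF G_zero yc] by blast
qed

lemma left_stable_sum:
 assumes W: "left_stable W" "left_stable V"
 shows "left_stable {x+.u | x u. x:W & u:V}" (is "left_stable ?S")
 unfolding left_stable_def
proof (intro conjI ballI)
 note D = left_stableD[OF W(1)] left_stableD[OF W(2)]
 have c: "x:W \<or> x:V ==> x:car A" for x using D(1,6) eset_e by blast
 show "?S <= eset A e" using D(1,6) left_stableD(3)[OF left_stable_eset] by blast
 have "\<zero> = \<zero> \<oplus> \<zero>" by simp
 thus "\<zero>:?S" using D(2,7) by blast
 fix p assume p: "p:?S"
 then obtain x u where x: "p = x+.u" "x:W" "u:V" by blast
 show "p+.p':?S" if p': "p':?S" for p'
 proof -
  obtain x' u' where x': "p' = x'+.u'" "x':W" "u':V" using p' by blast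
  have "p+.p' = (x+.x')+.(u+.u')" using x x' c by(simp add: A.a_ac)
  thus ?thesis using D(3)[OF x(2) x'(2)] D(8)[OF x(3) x'(3)] by blast
 qed
 show "g**p:?S" if g: "g:Gam" for g
 proof -
  have "g**p = g**x+.g**u" using x c G_carrier[OF g] by(simp add: A.r_distr)
  thus ?thesis using D(4)[OF g x(2)] D(9)[OF g x(3)] by blast
 qed
qed

text \<open>Nakayama's lemma for the left \<open>e A e\<close>-module \<open>e A\<close>.\<close>

lemma nakayama:
 assumes X: "left_stable X" and s: "eset A e = {x+.u | x u. x:X & u:properker {\<zero>}}"
 shows "X = eset A e"
proof (rule ccontr)
 assume n: "X ~= eset A e"
 obtain W where W: "left_stable W & X <= W & W ~= eset A e"
  and mx: "ALL V. left_stable V & X <= V & V ~= eset A e --> ~ W \<subset> V"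
  using vsA.maximal_subspace_ex[OF fin_dim_A, of "%W. left_stable W & X <= W & W ~= eset A e" X] X n left_stableD(5)
  by auto
 note WD = left_stableD[OF conjunct1[OF W]] and ED = left_stableD[OF left_stable_eset]
 have "r**w:W" if r: "r:R" and w: "w:eset A e" for r w
 proof (rule ccontr)
  assume nW: "r**w ~: W"
  define y where "y = (%p::nat. r**w)"
  note rG = R_G[OF r]
  have rc: "r:car A" "w:car A" "r**w:eset A e" using G_carrier[OF rG] w eset_e ED(4)[OF rG w] by auto
  \<comment> \<open>By maximality \<open>W\<close> and the left multiples of \<open>r w\<close>
    together give everything, so \<open>w = u + g r w\<close> with \<open>u\<close> in
    \<open>W\<close>; since \<open>e - g r\<close> is a unit, \<open>w\<close> lies in
    \<open>W\<close>.\<close>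
  let ?V = "{x+.u | x u. x:W & u:combs y Gam 1}"
  have V: "left_stable ?V" by(rule left_stable_sum[OF conjunct1[OF W] left_stable_combs]) (auto simp: y_def rc(3))
  have comb: "u:combs y Gam 1 <-> (EX g:Gam. u = g**(r**w))" for u
  proof -
   have "\<zero> \<oplus> g**(r**w) = g**(r**w)" if "g:Gam" for g using rc(1,2) G_carrier[OF that] by simp
   hence "(%g. \<zero> \<oplus> g**(r**w)) ` Gam = (%g. g**(r**w)) ` Gam" by(rule image_cong[OF refl])
   moreover have "combs y Gam 1 = (%g. \<zero> \<oplus> g**(r**w)) ` Gam" by(auto simp: y_def)
   ultimately show ?thesis by(simp add: image_iff)
  qed
  have WV: "W <= ?V"
  proof
   fix x assume x: "x:W"
   have "\<zero>:combs y Gam 1" using comb G_zero rc by(intro iffD2[OF comb] bexI[of _ \<zero>]) auto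
   moreover have "x = x+.\<zero>" using subsetD[OF WD(1) x] eset_e[of x] by simp
   ultimately show "x:?V" using x by blast
  qed
  have "r**w = \<zero> \<oplus> e**(r**w)" using rc(3)[unfolded eset_e] by simp
  hence "r**w:?V" using WD(2) comb e(4) by blast
  hence "?V = eset A e" using mx[rule_format, of ?V] V W WV nW by blast
  hence "w:?V" using w by simp
  then obtain u t where ut: "w = u+.t" "u:W" "t:combs y Gam 1" by blast
  then obtain g where "g:Gam" "t = g**(r**w)" using comb by blast
  hence u: "w = u+.g**(r**w)" "u:W" "g:Gam" using ut by auto
  have gr: "g**r:R" by(rule R_mult(2)[OF r u(3)])
  have c: "u:car A" "g:car A" "g**r:car A" using WD(1) u eset_e G_carrier R_G[OF gr] by auto
  obtain h where h: "h:Gam" "h**(e-.g**r) = e" using one_minus_R[OF gr] by(auto simp: corner_unit_def)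
  have "(e-.g**r)**w = w-.g**r**w"
   using c rc e(1) w eset_e by(simp add: a_minus_def A.l_distr A.l_minus)
  also have "\<dots> = u+.g**(r**w)-.g**(r**w)" using u(1) c rc by(simp add: A.m_assoc)
  also have "\<dots> = u" using c rc by(simp add: A.add_diff_cancel)
  finally have "(e-.g**r)**w = u" .
  hence "h**u = h**(e-.g**r)**w" using G_carrier[OF h(1)] c rc e(1) by(simp add: A.m_assoc)
  hence "w = h**u" using h(2) w eset_e by simp
  hence "w:W" using WD(4)[OF h(1) u(2)] by simp
  thus False using WD(4)[OF rG] nW by blast
 qed
 hence "properker {\<zero>} <= W" by(rule properker_zero_least[OF conjunct1[OF W]])
 hence "x+.u:W" if "x:X" "u:properker {\<zero>}" for x u using that W WD(3)[of x u] by auto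
 hence "{x+.u | x u. x:X & u:properker {\<zero>}} <= W" by blast
 thus False using W WD(1) s by simp
qed

text \<open>A lift of a basis of \<open>e A / R e A\<close> over the division ring
  \<open>e A e / R\<close>, built greedily: the family is prolonged while it misses an element
  modulo \<open>properker {\<zero>}\<close>, and then Nakayama's lemma shows that it generates.
  Independence is stated for the last coefficient, the form used by inductions over the
  index.\<close>

lemma left_basis_ex:
 obtains y m where "range y <= eset A e" "eset A e = combs y Gam m"
  "!!q g x. q < m ==> g:Gam ==> x:combs y Gam q ==> x+.g**y q:properker {\<zero>} ==> g:R"
proof -
 define F where "F y q = {x+.u | x u. x:combs y Gam q & u:properker {\<zero>}}" for y q
 define good where "good y q <-> range y <= eset A e & (ALL p<q. y p ~: F y p)" for y q
 have LF: "left_stable (F y q)" if "range y <= eset A e" for y q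
  unfolding F_def by(rule left_stable_sum[OF left_stable_combs[OF that] left_stable_properker])
 note pz0 = right_idealD(2)[OF pz(1)]
 have combF: "x:F y q" if "x:combs y Gam q" "range y <= eset A e" for x y q
 proof -
  have "x:car A" using subsetD[OF left_stableD(1)[OF left_stable_combs[OF that(2)]] that(1)] eset_e by blast
  hence "x = x+.\<zero>" by simp
  thus ?thesis unfolding F_def using that(1) pz0 by blast
 qed
 have Fsuc: "F y q <= F y (Suc q)" "y q:F y (Suc q)" if y: "range y <= eset A e" for y q
 proof -
  note C = left_stable_combs[OF y] and yq = subsetD[OF y rangeI[of y q]]
  have yc: "y q:car A" "e**y q = y q" using yq[unfolded eset_e] by auto
  have "x:combs y Gam (Suc q)" if "x:combs y Gam q" for x
  proof -
   have "x = x+.\<zero>**y q" using subsetD[OF left_stableD(1)[OF C[of q]] that, unfolded eset_e] yc by simp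
   thus ?thesis using that G_zero by auto
  qed
  thus "F y q <= F y (Suc q)" unfolding F_def by blast
  have "y q = \<zero> \<oplus> e**y q" using yc by simp
  hence "y q:combs y Gam (Suc q)" using left_stableD(2)[OF C[of q]] e(4) by auto
  thus "y q:F y (Suc q)" by(rule combF[OF _ y])
 qed
 obtain ht :: "'a set => nat" and d where ht: "ALL U. ht U <= d"
  "ALL U W. vsA.subspace U --> vsA.subspace W --> U \<subset> W --> ht U < ht W" using vsA.height_ex[OF fin_dim_A] by blast
 \<comment> \<open>Each new member enlarges \<open>F y q\<close>, so the height bounds the length of
   a good family.\<close>
 have bound: "q <= d" if "good y q" for y q
 proof -
  have "p <= ht (F y p)" if "p <= q" for p using that
  proof (induct p)
   case (Suc p)
   have y: "range y <= eset A e" "y p ~: F y p" using \<open>good y q\<close> Suc(2) by(auto simp: good_def)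
   hence "F y p \<subset> F y (Suc p)" using Fsuc[OF y(1), of p] by blast
   hence "ht (F y p) < ht (F y (Suc p))" using ht(2) left_stableD(5)[OF LF[OF y(1)]] by blast
   thus ?case using Suc by simp
  qed simp
  thus ?thesis using ht(1) order_trans by blast
 qed
 have "good (%_. \<zero>) 0" using left_stableD(2)[OF left_stable_eset] by(auto simp: good_def)
 then obtain m where m: "EX y. good y m" and mx: "ALL q. (EX y. good y q) --> q <= m"
  using ex_has_greatest_nat[of "%q. EX y. good y q" 0 "%q. q" "Suc d"] bound by(auto simp: less_Suc_eq_le)
 then obtain y where y: "good y m" by blast
 hence ye: "range y <= eset A e" by(simp add: good_def)
 have Fm: "F y m = eset A e"
 proof (rule ccontr)
  assume "F y m ~= eset A e"
  then obtain w where w: "w:eset A e" "w ~: F y m" using left_stableD(1)[OF LF[OF ye]] by blast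
  have "combs (y(m := w)) Gam p = combs y Gam p" if "p <= m" for p
   by(rule lin_comb_cong) (use that in auto)
  hence "F (y(m := w)) p = F y p" if "p <= m" for p using that by(simp add: F_def)
  hence "good (y(m := w)) (Suc m)" using y w by(auto simp: good_def less_Suc_eq)
  thus False using mx by force
 qed
 have full: "combs y Gam m = eset A e" 
  by(rule nakayama[OF left_stable_combs[OF ye] Fm[symmetric, unfolded F_def]])
 show ?thesis
 proof (rule that[OF ye full[symmetric]])
  fix q g x assume q: "q < m" and g: "g:Gam" and x: "x:combs y Gam q" and xg: "x+.g**y q:properker {\<zero>}"
  note yq = subsetD[OF ye rangeI[of y q]] and FD = left_stableD[OF LF[OF ye]] and CD = left_stableD[OF left_stable_combs[OF ye]]
  have c: "y q:car A" "e**y q = y q" "g:car A" "x:car A" using yq[unfolded eset_e] G_carrier[OF g] subsetD[OF CD(1) x, unfolded eset_e] by auto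
  show "g:R"
  proof (rule ccontr)
   assume "g ~: R"
   then obtain h where h: "h:Gam" "h**g = e" using unit_or_nilpotent[OF g] by(auto simp: corner_unit_def)
   have "g**y q = (\<ominus> x)+.(x+.g**y q)" using c by(simp add: A.r_neg1)
   moreover have "\<ominus> x:combs y Gam q" using vsA.subspaceD(5)[OF CD(5) x] .
   ultimately have "g**y q:F y q" unfolding F_def using xg by blast
   hence "h**(g**y q):F y q" by(rule FD(4)[OF h(1)])
   hence "y q:F y q" using h(2) c G_carrier[OF h(1)] by(simp flip: A.m_assoc)
   thus False using y q by(auto simp: good_def)
  qed
 qed
qed

end

section \<open>Coefficients along a filtration and the two filtrations of \<open>J\<close>\<close>

context corner_alg
begin

definition Ae :: "'a set" where "Ae = {z:car A. z**e = z}"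

lemma Ae_props:
 "Ae <= car A" "\<zero>:Ae" "x:Ae ==> y:Ae ==> x+.y:Ae" "x:Ae ==> \<ominus> x:Ae"
 "a:car A ==> x:Ae ==> a**x:Ae" "a:car A ==> a**e:Ae" "Gam <= Ae"
 using e by(auto simp: Ae_def A.l_distr A.l_minus A.m_assoc corner_def)

context
 fixes y m
 assumes y: "range y <= eset A e" and m: "eset A e = combs y Gam m"
begin

lemma yc: "range y <= car A" "y q:car A" "e**y q = y q"
proof -
 have "y q:eset A e" for q using y by blast
 thus "range y <= car A" "y q:car A" "e**y q = y q" unfolding eset_e by auto
qed

lemma combs_carrier: "S <= car A ==> combs y S q <= car A"
 by(rule combs_subset) (use yc in auto)

text \<open>The sums are stable under multiplication from the right because every
  \<open>y p a\<close> lies in \<open>e A\<close> and is therefore a combination of the generators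
  with coefficients in the corner.\<close>

lemma minimal_ideal_combs:
 assumes J: "ideal J A" "e:J" and least: "!!I. ideal I A ==> e:I ==> J <= I"
 shows "J = combs y Ae m"
proof
 interpret J: ideal J A by(rule J)
 have "z**y p:J" if "z:Ae" for z p
 proof -
  have zc: "z:car A" using that by(simp add: Ae_def)
  have "z**(e**y p):J" using J(2) yc(2) zc by(intro J.I_l_closed J.I_r_closed)
  thus ?thesis using yc(3) by simp
 qed
 thus "combs y Ae m <= J" by(intro combs_subset) auto
 have GA: "x:combs y Ae q" if "x:combs y Gam q" for x q
 proof -
  have "\<one>**x:combs y Ae q"
   by(rule conjunct2[OF combs_lmult[OF _ _ _ yc(1) that]]) (use Ae_props(7) G_carrier in auto)
  moreover have "x:car A" using that combs_carrier[of Gam q] G_carrier by blast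
  ultimately show ?thesis by simp
 qed
 have "ideal (combs y Ae m) A"
 proof (rule two_sided_idealI)
  show "combs y Ae m <= car A" by(rule combs_carrier[OF Ae_props(1)])
  show "\<zero>:combs y Ae m" by(rule combs_zero[OF Ae_props(2) yc(1)])
  show add: "x+.x':combs y Ae m" if "x:combs y Ae m" "x':combs y Ae m" for x x'
   by(rule combs_add[OF Ae_props(1,3) yc(1) that])
  show "a**x:combs y Ae m" if "x:combs y Ae m" "a:car A" for x a
   by(rule conjunct2[OF combs_lmult[OF Ae_props(5)[OF that(2)] that(2) Ae_props(1) yc(1) that(1)]])
  show "x**a:combs y Ae m" if x: "x:combs y Ae m" and a: "a:car A" for x a
  proof -
   have "combs y Ae m <= {x:car A. x**a:combs y Ae m}"
   proof (rule combs_subset)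
    show "\<zero>:{x:car A. x**a:combs y Ae m}" using a combs_zero[OF Ae_props(2) yc(1)] by simp
    show "u+.u':{x:car A. x**a:combs y Ae m}"
     if "u:{x:car A. x**a:combs y Ae m}" "u':{x:car A. x**a:combs y Ae m}" for u u'
     using that a add by(simp add: A.l_distr)
    show "z**y p:{x:car A. x**a:combs y Ae m}" if z: "z:Ae" for z p
    proof -
     have zc: "z:car A" using z by(simp add: Ae_def)
     have "y p**a:eset A e" using right_idealD(4)[OF eset_right_ideal[OF e(1)] _ a] y by blast
     hence yam: "y p**a:combs y Gam m" using m by simp
     have "z**(y p**a):combs y Ae m"
      by(rule conjunct2[OF combs_lmult[OF _ zc _ yc(1) yam]]) (use G_carrier Ae_props(5)[OF zc] Ae_props(7) in auto)
     thus ?thesis using zc yc(2) a by(simp add: A.m_assoc)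
    qed
   qed
   thus ?thesis using x by blast
  qed
 qed
 moreover have "e:combs y Gam m" using m eset_e e by blast
 ultimately show "J <= combs y Ae m" using GA by(intro least)
qed

text \<open>If \<open>e\<close> annihilates the subquotient \<open>N (j + 1) / N j\<close>, then no new multiples of \<open>e\<close> occur in
  \<open>N (j + 1)\<close>. Otherwise the linear independence of the \<open>y p\<close> modulo the annihilator allows to
  compare coefficients.\<close>

lemma chain_coefficients:
 assumes ch: "rchain n L t N kp v"
  and s1: "ALL j<t. kp j ~= s --> (ALL a:car A. a**e:L (kp j))"
  and s2: "ALL a:car A. a-.e**a:L s"
  and s3: "ALL q<m. ALL g:Gam. ALL x:combs y Gam q. x+.g**y q:L s --> g:L s"
 shows "j < t ==> kp j ~= s ==> z:N (Suc j) ==> z:Ae ==> z:N j"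
  and "i <= t ==> q < m ==> z:Ae ==> x:combs y Ae q ==> x+.z**y q:N i ==> z:N i"
  and "i <= t ==> q <= m ==> x:combs y Ae q ==> x:N i ==> x:combs y (N i \<inter> Ae) q"
proof -
 note C = rchainD[OF ch] and s = s1[rule_format] s2[rule_format] s3[rule_format]
 note ND = right_idealD[OF C(3)]
 show low: "z:N j" if j: "j < t" "kp j ~= s" and z: "z:N (Suc j)" "z:Ae" for j z
 proof -
  have jt: "j <= t" using j by simp
  obtain u w where u: "z = u+.v j**w" "u:N j" "w:car A" using z(1) C(7)[OF j(1)] by blast
  have uc: "u:car A" using u(2) ND(1)[OF jt] by blast
  have "z = z**e" using z(2) by(simp add: Ae_def)
  also have "\<dots> = u**e+.v j**(w**e)" using u uc C(5)[OF j(1)] e(1) by(simp add: A.l_distr A.m_assoc)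
  finally show ?thesis
   using ND(3)[OF jt ND(4)[OF jt u(2) e(1)], of "v j**(w**e)"] C(6)[OF j(1), of "w**e"] s(1)[OF j u(3)] u(3) e(1) by simp
 qed
 \<comment> \<open>Proved downwards from \<open>i = t\<close>, where \<open>N t\<close> is the whole
   algebra; at \<open>i = 0\<close> it becomes the linear independence of the generators over
   \<open>A e\<close>.\<close>
 define T where "T i <-> (ALL q<m. ALL z:Ae. ALL x:combs y Ae q. x+.z**y q:N i --> z:N i)" for i
 have low2: "x:combs y (N i \<inter> Ae) q" if T: "T i" and i: "i <= t" and "q <= m" "x:combs y Ae q" "x:N i" for i q x
  using that(3-5)
 proof (induct q arbitrary: x)
  case (Suc q)
  obtain u z where u: "x = u+.z**y q" "u:combs y Ae q" "z:Ae" using Suc(3) by auto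
  have z: "z:N i" using T[unfolded T_def, rule_format, of q z u] Suc(2,4) u by simp
  have c: "u:car A" "z:car A" using u(2) combs_carrier[OF Ae_props(1)] u(3) Ae_props(1) by auto
  have "u = x-.z**y q" using u(1) c yc(2) by(simp add: A.add_diff_cancel)
  hence "u:N i" using ND(7)[OF i Suc(4) ND(4)[OF i z yc(2)[of q]]] by simp
  hence "u:combs y (N i \<inter> Ae) q" using Suc(1)[OF _ u(2)] Suc(2) by simp
  thus ?case using z u by auto
 qed simp
 have T: "T i" if "i <= t" for i using that
 proof (induct rule: inc_induct)
  case base show ?case using C(2) Ae_props(1) by(auto simp: T_def)
 next
  case (step i)
  hence it: "i < t" "i <= t" "Suc i <= t" by auto
  have vc: "v i:car A" by(rule C(5)[OF it(1)])
  note Nc = subsetD[OF ND(1)[OF it(2)]]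
  have NN: "x:N (Suc i)" if "x:N i" for x
  proof -
   have "x = x+.v i**\<zero>" using Nc[OF that] vc by simp
   thus ?thesis using C(7)[OF it(1)] that by blast
  qed
  show ?case
   unfolding T_def
  proof (intro allI ballI impI)
   fix q z x assume q: "q < m" and z: "z:Ae" and x: "x:combs y Ae q" and xz: "x+.z**y q:N i"
   have c: "x:car A" "z:car A" using x combs_carrier[OF Ae_props(1)] z Ae_props(1) by auto
   have zS: "z:N (Suc i)" using step(3)[unfolded T_def, rule_format, OF q z x NN[OF xz]] .
   have "x = (x+.z**y q)-.z**y q" using c yc(2) by(simp add: A.add_diff_cancel)
   hence xS: "x:N (Suc i)" using ND(7)[OF it(3) NN[OF xz] ND(4)[OF it(3) zS yc(2)[of q]]] by simp
   show "z:N i"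
   proof (cases "kp i = s")
    case False show ?thesis by(rule low[OF it(1) False zS z])
   next
    case True
    \<comment> \<open>By \<open>s2\<close>, \<open>v i a\<close> and \<open>v i (e a)\<close> agree
      modulo \<open>N i\<close>, so the elements of \<open>A e\<close> in \<open>N (Suc i)\<close>
      become multiples of \<open>v i\<close> by elements of the corner.\<close>
    have split: "EX u:N i. EX g:Gam. z = u+.v i**g" if z: "z:N (Suc i) \<inter> Ae" for z
    proof -
     obtain u w where u: "z = u+.v i**w" "u:N i" "w:car A" using z C(7)[OF it(1)] by blast
     note uc = Nc[OF u(2)]
     define r where "r = v i**(w**e-.e**(w**e))"
     have r: "r:N i" unfolding r_def using C(6)[OF it(1)] s(2)[of "w**e"] u(3) e(1) True by simp
     have "z = z**e" using z by(simp add: Ae_def)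
     also have "\<dots> = u**e+.v i**(w**e)" using u uc vc e(1) by(simp add: A.l_distr A.m_assoc)
     also have "v i**(w**e) = r+.v i**(e**w**e)"
      unfolding r_def using vc u(3) e(1) by(simp add: A.diff_add_cancel A.m_assoc flip: A.r_distr)
     also have "u**e+.(r+.v i**(e**w**e)) = (u**e+.r)+.v i**(e**w**e)"
      using uc Nc[OF r] vc u(3) e(1) by(simp add: A.a_assoc)
     finally show ?thesis using ND(3)[OF it(2) ND(4)[OF it(2) u(2) e(1)] r] G_corner[OF u(3)] by blast
    qed
    have splits: "EX u:N i. EX g:combs y Gam q. x = u+.v i**g" if "x:combs y (N (Suc i) \<inter> Ae) q" for x q
     using that
    proof (induct q arbitrary: x)
     case 0
     have "x = \<zero> \<oplus> v i**\<zero>" using 0 vc by simp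
     thus ?case using ND(2)[OF it(2)] by auto
    next
     case (Suc q)
     obtain x' z' where x': "x = x'+.z'**y q" "x':combs y (N (Suc i) \<inter> Ae) q" "z':N (Suc i) \<inter> Ae"
      using Suc(2) by auto
     obtain u g where u: "u:N i" "g:combs y Gam q" "x' = u+.v i**g" using Suc(1)[OF x'(2)] by blast
     obtain u' g' where u': "u':N i" "g':Gam" "z' = u'+.v i**g'" using split[OF x'(3)] by blast
     have gc: "g:car A" "g':car A" using combs_carrier[of Gam q] u(2) G_carrier[OF u'(2)] G_carrier by auto
     have "x = (u+.u'**y q)+.v i**(g+.g'**y q)"
      using x'(1) u(3) u'(3) Nc[OF u(1)] Nc[OF u'(1)] vc gc yc(2)
      by(simp add: A.l_distr A.r_distr A.a_ac A.m_assoc)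
     moreover have "g+.g'**y q:combs y Gam (Suc q)" using u(2) u'(2) by auto
     ultimately show ?case using ND(3)[OF it(2) u(1) ND(4)[OF it(2) u'(1) yc(2)[of q]]] by blast
    qed
    have "x:combs y (N (Suc i) \<inter> Ae) q" using low2[OF step(3) it(3) _ x xS] q by simp
    then obtain u g where u: "u:N i" "g:combs y Gam q" "x = u+.v i**g" using splits by blast
    obtain u' g' where u': "u':N i" "g':Gam" "z = u'+.v i**g'" using split zS z by blast
    have gc: "g:car A" "g':car A" using combs_carrier[of Gam q] u(2) G_carrier[OF u'(2)] G_carrier by auto
    \<comment> \<open>The part of the relation over \<open>v i\<close>. It falls into
      \<open>N i\<close>, so the independence in \<open>s3\<close> puts the last coefficient into
      the annihilator.\<close>
    define w where "w = v i**(g+.g'**y q)"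
    have d: "u+.u'**y q:N i" by(rule ND(3)[OF it(2) u(1) ND(4)[OF it(2) u'(1) yc(2)[of q]]])
    have wc: "w:car A" using vc gc yc(2) by(simp add: w_def)
    have "x+.z**y q = w+.(u+.u'**y q)"
     using u(3) u'(3) Nc[OF u(1)] Nc[OF u'(1)] vc gc yc(2) unfolding w_def
     by(simp add: A.l_distr A.r_distr A.a_ac A.m_assoc)
    hence "w = (x+.z**y q)-.(u+.u'**y q)" using wc Nc[OF d] by(simp add: A.add_diff_cancel)
    hence "w:N i" using ND(7)[OF it(2) xz d] by simp
    hence "g+.g'**y q:L s" using C(6)[OF it(1), of "g+.g'**y q"] gc yc(2) True by(simp add: w_def)
    hence "g':L s" using s(3)[OF q u'(2) u(2)] by simp
    hence "v i**g':N i" using C(6)[OF it(1) gc(2)] True by simp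
    thus ?thesis using u'(3) ND(3)[OF it(2) u'(1)] by simp
   qed
  qed
 qed
 show "i <= t ==> q < m ==> z:Ae ==> x:combs y Ae q ==> x+.z**y q:N i ==> z:N i"
  using T unfolding T_def by blast
 show "i <= t ==> q <= m ==> x:combs y Ae q ==> x:N i ==> x:combs y (N i \<inter> Ae) q"
  by(rule low2[OF T])
qed

end

text \<open>The coefficient argument is applied twice to the same generators. Along the proper
  standard chain their independence modulo \<open>properker {\<zero>}\<close> descends to freeness
  over \<open>A e\<close>. This freeness is the independence required along the standard chain,
  where the annihilator belonging to \<open>s\<close> consists of the elements killed by
  \<open>e\<close> from the left. Intersecting that chain with \<open>J\<close> filters
  \<open>J\<close> by copies of \<open>e A\<close>, while the partial sums of the generators filter
  it by copies of \<open>A e\<close>.\<close>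

lemma stratifying_ideal:
 assumes J: "ideal J A" "e:J" and least: "!!I. ideal I A ==> e:I ==> J <= I"
  and P: "rchain n P t N kp v" and D: "rchain n D t' N' kp' v'"
  and s: "!!k. k:{1..n} ==> k ~= s ==> J <= P k & J <= D k"
   "P s = {a:car A. e**a:properker {\<zero>}}" "D s = {a:car A. e**a = \<zero>}"
 shows "proj_chain A e J" "proj_chain (op_algebra A) e J"
  "!!j. j < t ==> kp j ~= s ==> N (Suc j) \<inter> J <= N j" "!!j. j < t' ==> kp' j ~= s ==> N' (Suc j) \<inter> J <= N' j"
  "!!U. right_ideal A U ==> {x:J. x**e = x} <= U ==> J <= U"
  "!!U. right_ideal (op_algebra A) U ==> {x:J. e**x = x} <= U ==> J <= U"
proof -
 interpret J: ideal J A by(rule J)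
 note JR = ideal_right_ideal[OF J(1)]
 have Jc: "J <= car A" by(rule right_idealD(1)[OF JR])
 obtain y m where y: "range y <= eset A e" "eset A e = combs y Gam m"
  and indep: "!!q g x. q < m ==> g:Gam ==> x:combs y Gam q ==> x+.g**y q:properker {\<zero>} ==> g:R"
  by(rule left_basis_ex) (rule that; (assumption | blast))
 note yc = yc[OF y]
 have JC: "J = combs y Ae m" by(rule minimal_ideal_combs[OF y J least])
 have aeJ: "a**e:J" if "a:car A" for a using J(2) that by(rule J.I_l_closed)
 have AeJ: "Ae <= J" using aeJ by(force simp: Ae_def)
 have k1: "ALL j<t. kp j ~= s --> (ALL a:car A. a**e:P (kp j))"
  using s(1)[OF rchainD(4)[OF P]] aeJ by blast
 have k2: "ALL j<t'. kp' j ~= s --> (ALL a:car A. a**e:D (kp' j))"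
  using s(1)[OF rchainD(4)[OF D]] aeJ by blast
 have e0: "e**(a-.e**a) = \<zero>" if "a:car A" for a
  using that e by(simp add: a_minus_def A.r_distr A.r_minus A.r_neg flip: A.m_assoc)
 have e1: "a-.e**a:P s" "a-.e**a:D s" if "a:car A" for a
  using that e0[OF that] e(1) right_idealD(2)[OF pz(1)] unfolding s(2,3) by auto
 have comb_e: "x:car A & e**x = x" if "x:combs y Gam q" for x q
  using subsetD[OF left_stableD(1)[OF left_stable_combs[OF y(1)]] that] unfolding eset_e .
 have ge: "x+.g**y q:car A & e**(x+.g**y q) = x+.g**y q" if "g:Gam" "x:combs y Gam q" for q g x
  using comb_e[OF that(2)] G_carrier[OF that(1)] G_e(1)[OF that(1)] yc(2) e(1) by(simp add: A.r_distr flip: A.m_assoc)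
 have i1: "g:P s" if "q < m" "g:Gam" "x:combs y Gam q" "x+.g**y q:P s" for q g x
 proof -
  have "g:R" using indep[OF that(1-3)] that(4) ge[OF that(2,3)] unfolding s(2) by simp
  thus ?thesis unfolding s(2) using pz(4) G_carrier[OF that(2)] G_e(1)[OF that(2)] by auto
 qed
 have j1: "ALL a:car A. a-.e**a:P s" "ALL q<m. ALL g:Gam. ALL x:combs y Gam q. x+.g**y q:P s --> g:P s"
  using e1(1) i1 by blast+
 note CP = chain_coefficients[OF y P k1 j1]
 \<comment> \<open>The bottom case \<open>i = 0\<close> of the coefficient argument.\<close>
 have free: "z = \<zero>" if "q < m" "z:Ae" "x:combs y Ae q" "x+.z**y q = \<zero>" for q z x
  using CP(2)[where i = 0 and q = q and z = z and x = x] that rchainD(1)[OF P] by simp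
 have GA: "x:combs y Ae q" if "x:combs y Gam q" for x q
 proof -
  have "\<one>**x:combs y Ae q"
   by(rule conjunct2[OF combs_lmult[OF _ _ _ yc(1) that]]) (use Ae_props(7) G_carrier in auto)
  thus ?thesis using comb_e[OF that] by simp
 qed
 have i2: "g:D s" if "q < m" "g:Gam" "x:combs y Gam q" "x+.g**y q:D s" for q g x
 proof -
  have "x+.g**y q = \<zero>" using that(4) ge[OF that(2,3)] unfolding s(3) by simp
  hence "g = \<zero>" using free[OF that(1) _ GA[OF that(3)]] that(2) Ae_props(7) by blast
  thus ?thesis unfolding s(3) using e(1) by simp
 qed
 have j2: "ALL a:car A. a-.e**a:D s" "ALL q<m. ALL g:Gam. ALL x:combs y Gam q. x+.g**y q:D s --> g:D s"
  using e1(2) i2 by blast+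
 note CD = chain_coefficients[OF y D k2 j2]
 have low: "X (Suc j) \<inter> J <= X j"
  if ri: "right_ideal A (X j)" and X: "!!x. x:combs y Ae m ==> x:X (Suc j) ==> x:combs y (X (Suc j) \<inter> Ae) m"
   "!!z. z:X (Suc j) ==> z:Ae ==> z:X j" for X :: "nat => 'a set" and j
 proof
  fix x assume "x:X (Suc j) \<inter> J"
  hence "x:combs y (X (Suc j) \<inter> Ae) m" using X(1) JC by blast
  moreover have "combs y (X (Suc j) \<inter> Ae) m <= X j"
   using right_idealD(2-4)[OF ri] X(2) yc(2) by(intro combs_subset) auto
  ultimately show "x:X j" by blast
 qed
 show "N (Suc j) \<inter> J <= N j" if j: "j < t" "kp j ~= s" for j
  by(rule low[OF rchainD(3)[OF P]]) (use j CP(1)[OF j] CP(3)[where i = "Suc j" and q = m] in auto)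
 show lowD: "N' (Suc j) \<inter> J <= N' j" if j: "j < t'" "kp' j ~= s" for j
  by(rule low[OF rchainD(3)[OF D]]) (use j CD(1)[OF j] CD(3)[where i = "Suc j" and q = m] in auto)
 show "J <= U" if U: "right_ideal A U" "{x:J. x**e = x} <= U" for U
 proof -
  have "z:U" if "z:Ae" for z using U(2) AeJ that by(auto simp: Ae_def)
  thus ?thesis unfolding JC using right_idealD(2-4)[OF U(1)] yc(2) by(intro combs_subset) auto
 qed
 interpret L: corner_alg K "op_algebra A" e by(rule op_corner_alg)
 show "J <= U" if U: "right_ideal (op_algebra A) U" "{x:J. e**x = x} <= U" for U
 proof -
  have "e**y p:J" for p using J(2) yc(2) by(rule J.I_r_closed)
  hence "y p:U" for p using U(2) yc(3) by auto
  thus ?thesis unfolding JC using L.right_idealD(2-4)[OF U(1)] Ae_props(1) by(intro combs_subset) auto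
 qed
 \<comment> \<open>Steps with \<open>kp' j\<close> different from \<open>s\<close> add nothing to
   the intersection with \<open>J\<close>; each of the others adds one copy of
   \<open>e A\<close>.\<close>
 have "proj_chain A e (J \<inter> N' j)" if "j <= t'" for j using that
 proof (induct j)
  case 0
  thus ?case using proj_chain.zero[of A e] rchainD(1)[OF D] right_idealD(2)[OF JR] by(simp add: Int_absorb1)
 next
  case (Suc j)
  hence j: "j < t'" "j <= t'" by auto
  note C = rchainD(5-7)[OF D j(1)] and ND = right_idealD[OF rchainD(3)[OF D j(2)]]
  have sub: "N' j <= N' (Suc j)"
  proof
   fix x assume "x:N' j"
   moreover from this have "x = x+.v' j**\<zero>" using ND(1) C(1) by auto
   ultimately show "x:N' (Suc j)" unfolding C(3) by blast
  qed
  show ?case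
  proof (cases "kp' j = s")
   case False
   hence "J \<inter> N' (Suc j) = J \<inter> N' j" using lowD[OF j(1)] sub by blast
   thus ?thesis using Suc(1) j by simp
  next
   case True
   let ?v = "v' j**e"
   have step: "proj_chain A e {u+.?v**w | u w. u:J \<inter> N' j & w:eset A e}"
   proof (rule proj_chain.step[OF Suc(1)[OF j(2)]])
    show "?v:car A" "?v**e = ?v" using C(1) e by(simp_all add: A.m_assoc)
    fix w assume w: "w:eset A e" "?v**w:J \<inter> N' j"
    hence "w:car A" "e**w = w" unfolding eset_e by auto
    thus "w = \<zero>" using w(2) C(1) C(2)[of w] True e(1) by(simp add: A.m_assoc s(3))
   qed
   have "J \<inter> N' (Suc j) = {u+.?v**w | u w. u:J \<inter> N' j & w:eset A e}" (is "_ = ?S")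
   proof
    show "J \<inter> N' (Suc j) <= ?S"
    proof
     fix x assume x: "x:J \<inter> N' (Suc j)"
     obtain u w where u: "x = u+.v' j**w" "u:N' j" "w:car A" using x unfolding C(3) by blast
     \<comment> \<open>The part \<open>w - e w\<close> of the coefficient is absorbed into
       \<open>N' j\<close>, which leaves a multiple of \<open>v' j e\<close>, an element of
       \<open>J\<close>.\<close>
     define u' where "u' = u+.v' j**(w-.e**w)"
     have uc: "u:car A" using u(2) ND(1) by blast
     have dN: "v' j**(w-.e**w):N' j" using C(2)[of "w-.e**w"] e1(2)[OF u(3)] u(3) e(1) True by simp
     have u': "u':N' j" unfolding u'_def by(rule ND(3)[OF u(2) dN])
     hence u'c: "u':car A" using ND(1) by blast
     have "v' j**w = v' j**(w-.e**w)+.v' j**(e**w)"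
      using C(1) u(3) e(1) by(simp add: A.diff_add_cancel flip: A.r_distr)
     hence xu: "x = u'+.?v**(e**w)"
      using u(1,3) uc C(1) e unfolding u'_def by(simp add: A.a_assoc A.m_assoc flip: A.m_assoc[of e e w])
     have "?v:J" by(rule aeJ[OF C(1)])
     hence vJ: "?v**(e**w):J" by(rule J.I_r_closed[OF _ A.m_closed[OF e(1) u(3)]])
     have "u' = x-.?v**(e**w)" using xu u'c C(1) e(1) u(3) by(simp add: A.add_diff_cancel)
     hence "u':J" using right_idealD(7)[OF JR _ vJ] x by simp
     thus "x:?S" using xu u' u(3) by blast
    qed
    show "?S <= J \<inter> N' (Suc j)"
    proof
     fix x assume "x:?S"
     then obtain u w where u: "x = u+.?v**w" "u:J" "u:N' j" "w:eset A e" by blast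
     have w: "w:car A" "e**w = w" using u(4) unfolding eset_e by auto
     have "x = u+.v' j**w" using u(1) w C(1) e(1) by(simp add: A.m_assoc)
     hence "x:N' (Suc j)" unfolding C(3) using u(3) w(1) by blast
     moreover have "x:J"
      unfolding u(1) by(rule right_idealD(3)[OF JR u(2) right_idealD(4)[OF JR aeJ[OF C(1)] w(1)]])
     ultimately show "x:J \<inter> N' (Suc j)" by blast
    qed
   qed
   thus ?thesis using step by simp
  qed
 qed
 from this[of t'] show "proj_chain A e J" using rchainD(2)[OF D] Jc by(simp add: Int_absorb2)
 have Ae_op: "eset (op_algebra A) e = Ae" using e by(auto simp: Ae_def A.m_assoc intro: rev_image_eqI)
 \<comment> \<open>By freeness, \<open>w y q\<close> lies in the sum of the earlier terms only for
   \<open>w = 0\<close>; this is the condition on a step in the opposite algebra.\<close>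
 have "proj_chain (op_algebra A) e (combs y Ae q)" if "q <= m" for q using that
 proof (induct q)
  case 0 thus ?case using proj_chain.zero[of "op_algebra A" e] by simp
 next
  case (Suc q)
  have "proj_chain (op_algebra A) e
   {u +[op_algebra A] y q **[op_algebra A] w | u w. u:combs y Ae q & w:eset (op_algebra A) e}"
  proof (rule proj_chain.step)
   show "proj_chain (op_algebra A) e (combs y Ae q)" using Suc by simp
   show "y q:car (op_algebra A)" "y q **[op_algebra A] e = y q" using yc(2,3) by simp_all
   fix w assume "w:eset (op_algebra A) e" "y q **[op_algebra A] w:combs y Ae q"
   hence w: "w:Ae" "w**y q:combs y Ae q" unfolding Ae_op by simp_all
   have wc: "w:car A" using w(1) Ae_props(1) by blast
   have "(\<ominus> w)**y q+.w**y q = \<zero>" using wc yc(2) by(simp add: A.l_minus A.l_neg)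
   hence "w**y q+.(\<ominus> w)**y q = \<zero>" using wc yc(2) by(simp add: A.a_comm)
   hence "\<ominus> w = \<zero>" using free[of q "\<ominus> w" "w**y q"] Suc(2) Ae_props(4)[OF w(1)] w(2) by simp
   thus "w = 0[op_algebra A]" using wc by(metis A.minus_minus A.minus_zero op_simps(4))
  qed
  thus ?case unfolding Ae_op by simp
 qed
 thus "proj_chain (op_algebra A) e J" unfolding JC by blast
qed

end

section \<open>Passage to the quotients of a stratified algebra\<close>

text \<open>The counterpart of \<open>rchain\<close> without indices. Indexed chains serve
  descending inductions; this form tolerates that steps disappear when a chain is pushed to a
  quotient.\<close>

inductive cyc_filt :: "('k, 'a) module => nat => (nat => 'a set) => 'a set => bool" for A n L where
 zero: "cyc_filt A n L {0[A]}"
| step: "cyc_filt A n L N ==> k:{1..n} ==> v:car A ==>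
  ALL a:car A. v **[A] a:N <-> a:L k ==>
  cyc_filt A n L {u +[A] v **[A] w | u w. u:N & w:car A}"

context fd_alg
begin

lemma carrier_right_ideal: "right_ideal A (car A)"
 by(rule right_idealI) auto

text \<open>Isomorphisms with modules on another type are replaced by preimages in \<open>A\<close>
  of cyclic generators, after which only right ideals remain.\<close>

lemma filtered_rchain:
 fixes X :: "nat => ('a, 'm) right_mod"
 assumes X: "!!k. k:{1..n} ==> right_module A (X k)" "!!k. k:{1..n} ==> EX x. cyclic_gen (X k) x (L k)"
  and F: "filtered_by A (X ` {1..n}) (regular A)"
 shows "EX t N kp v. rchain n L t N kp v"
proof -
 obtain t N where fil: "filtration A (regular A) t N"
  and iso: "ALL j<t. EX Y:X ` {1..n}. mod_iso A (subquotient (regular A) (N j) (N (Suc j))) Y"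
  using F unfolding filtered_by_def by(elim conjE exE) (rule that)
 have N: "N 0 = {\<zero>}" "N t = car A" "!!j. j <= t ==> right_submodule A (regular A) (N j)"
  "!!j. j < t ==> N j <= N (Suc j)" using fil unfolding filtration_def by simp_all
 define P where "P j k v <-> k:{1..n} & v:car A & (ALL a:car A. v**a:N j <-> a:L k) &
  N (Suc j) = {u+.v**w | u w. u:N j & w:car A}" for j k v
 have ex: "EX k v. P j k v" if j: "j < t" for j
 proof -
  have s: "right_submodule A (regular A) (N j)" "right_submodule A (regular A) (N (Suc j))" using N(3) j by auto
  note G = subquotient_facts[OF rreg s N(4)[OF j]] and ND = right_submoduleD[OF rreg s(1), simplified]
   and ND' = right_submoduleD[OF rreg s(2), simplified]
  let ?S = "subquotient (regular A) (N j) (N (Suc j))" and ?p = "%x. N j +>\<^bsub>sub_mod (regular A) (N (Suc j))\<^esub> x"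
  obtain k where k: "k:{1..n}" "mod_iso A ?S (X k)" using iso j by blast
  obtain x where "cyclic_gen (X k) x (L k)" using X(2)[OF k(1)] by blast
  then obtain w where w: "cyclic_gen ?S w (L k)"
   using cyclic_gen_transfer[OF X(1)[OF k(1)] G(1) mod_iso_sym[OF G(1) k(2)]] by blast
  have wc: "w:?p ` N (Suc j)" using w G(3) unfolding cyclic_gen_def by simp
  then obtain v where v: "v:N (Suc j)" "w = ?p v" by blast
  have vc: "v:car A" using v(1) ND'(1) by blast
  have act: "w *[?S] a = ?p (v**a)" if "a:car A" for a
   using mod_homD(3)[OF G(2), of v a] v that by simp
  have va: "v**a:N (Suc j)" if "a:car A" for a by(rule ND'(4)[OF v(1) that])
  have "v**a:N j <-> a:L k" if a: "a:car A" for a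
  proof -
   have "w *[?S] a = 0[?S] <-> a:L k" using w a unfolding cyclic_gen_def by blast
   thus ?thesis unfolding act[OF a] G(4)[OF va[OF a]] .
  qed
  moreover have "N (Suc j) = {u+.v**w | u w. u:N j & w:car A}"
  proof
   show "{u+.v**w | u w. u:N j & w:car A} <= N (Suc j)" using N(4)[OF j] ND'(3) va by blast
   show "N (Suc j) <= {u+.v**w | u w. u:N j & w:car A}"
   proof
    fix x assume x: "x:N (Suc j)"
    have "?p x:car ?S" using x G(3) by blast
    then obtain a where a: "a:car A" "?p x = w *[?S] a" using w unfolding cyclic_gen_def by blast
    have c: "x:car A" "v**a:car A" using x ND'(1) vc a(1) by auto
    have u: "x+.\<ominus> (v**a):N (Suc j)"
     using right_idealD(7)[of "N (Suc j)" x "v**a"] s(2) x va[OF a(1)] by(simp add: right_ideal_def a_minus_def)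
    have eq: "x = (x+.\<ominus> (v**a))+.v**a" using c by(simp add: A.a_assoc A.l_neg)
    interpret S: right_module A ?S by(rule G(1))
    have "?p x = ?p (x+.\<ominus> (v**a)) +[?S] ?p (v**a)"
     using mod_homD(2)[OF G(2), of "x+.\<ominus> (v**a)" "v**a"] u va[OF a(1)] eq by simp
    hence "?p (x+.\<ominus> (v**a)) = 0[?S]"
     using a(2) act[OF a(1)] mod_homD(1)[OF G(2), of "x+.\<ominus> (v**a)"] mod_homD(1)[OF G(2), of "v**a"] u va[OF a(1)]
     by(simp add: S.M.add.r_cancel_one')
    hence "x+.\<ominus> (v**a):N j" using G(4)[OF u] by simp
    thus "x:{u+.v**w | u w. u:N j & w:car A}" using eq a(1) by blast
   qed
  qed
  ultimately have "P j k v" unfolding P_def using k(1) vc by blast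
  thus ?thesis by blast
 qed
 define kv where "kv j = (SOME p. P j (fst p) (snd p))" for j
 have "P j (fst (kv j)) (snd (kv j))" if jt: "j < t" for j
 proof -
  obtain k v where "P j k v" using ex[OF jt] by blast
  hence "P j (fst (k, v)) (snd (k, v))" by simp
  thus ?thesis unfolding kv_def by(rule someI)
 qed
 hence "rchain n L t N (%j. fst (kv j)) (%j. snd (kv j))"
  unfolding rchain_def P_def right_ideal_def using N(1-3) by blast
 thus ?thesis by blast
qed

lemma cyc_filt_right_ideal: "cyc_filt A n L N ==> right_ideal A N"
proof (induct rule: cyc_filt.induct)
 case zero show ?case by(rule right_idealI) auto
next
 case (step N k v) show ?case by(rule right_ideal_add_mult[OF step(2) carrier_right_ideal step(4)])
qed

text \<open>Each step is recognised up to isomorphism by its cyclic generator and the annihilator of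
  that generator.\<close>

lemma cyc_filt_filtered:
 fixes X :: "nat => ('a, 'm) right_mod"
 assumes X: "!!k. k:{1..n} ==> right_module A (X k)" "!!k. k:{1..n} ==> EX x. cyclic_gen (X k) x (L k)"
  and C: "cyc_filt A n L (car A)"
 shows "filtered_by A (X ` {1..n}) (regular A)"
proof -
 have "EX t F. F 0 = {\<zero>} & F t = N & (ALL j<=t. right_ideal A (F j)) &
  (ALL j<t. F j <= F (Suc j) & (EX Y:X ` {1..n}. mod_iso A (subquotient (regular A) (F j) (F (Suc j))) Y))"
  if "cyc_filt A n L N" for N using that
 proof (induct rule: cyc_filt.induct)
  case zero
  show ?case by(rule exI[of _ 0], rule exI[of _ "%_. {\<zero>}"]) (use cyc_filt_right_ideal[OF cyc_filt.zero] in simp)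
 next
  case (step N k v)
  let ?N = "{u+.v**w | u w. u:N & w:car A}"
  obtain t F where F: "F 0 = {\<zero>}" "F t = N" "ALL j<=t. right_ideal A (F j)"
   "ALL j<t. F j <= F (Suc j) & (EX Y:X ` {1..n}. mod_iso A (subquotient (regular A) (F j) (F (Suc j))) Y)"
   using step(2) by(elim exE conjE) (rule that)
  note NI = cyc_filt_right_ideal[OF step(1)] and NI' = cyc_filt_right_ideal[OF cyc_filt.step[OF step(1,3-5)]]
  note ND = right_idealD[OF NI]
  have sub: "N <= ?N"
  proof
   fix x assume x: "x:N"
   hence "x = x+.v**\<zero>" using ND(1) step(4) by auto
   thus "x:?N" using x by blast
  qed
  note G = subquotient_facts[OF rreg ND(8) right_idealD(8)[OF NI'] sub]
  let ?S = "subquotient (regular A) N ?N" and ?p = "%x. N +>\<^bsub>sub_mod (regular A) ?N\<^esub> x"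
  have va: "v**a:?N" if "a:car A" for a
  proof -
   have "v**a = \<zero> \<oplus> v**a" using that step(4) by simp
   thus ?thesis using ND(2) that by blast
  qed
  have vN: "v:?N" using va[of \<one>] step(4) by simp
  have act: "?p v *[?S] a = ?p (v**a)" if "a:car A" for a
   using mod_homD(3)[OF G(2), of v a] vN that by simp
  have "cyclic_gen ?S (?p v) (L k)"
   unfolding cyclic_gen_def
  proof (intro conjI ballI)
   show "?p v:car ?S" using G(3) vN by blast
   show "?p v *[?S] a = 0[?S] <-> a:L k" if a: "a:car A" for a
    using act[OF a] G(4)[OF va[OF a]] step(5) a by simp
   fix q assume "q:car ?S"
   hence "q:?p ` ?N" using G(3) by simp
   then obtain u w where u: "q = ?p (u+.v**w)" "u:N" "w:car A" by blast
   interpret S: right_module A ?S by(rule G(1))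
   have uN: "u:?N" using u(2) sub by blast
   have "?p (u+.v**w) = ?p u +[?S] ?p (v**w)" using mod_homD(2)[OF G(2), of u "v**w"] uN va[OF u(3)] by simp
   moreover have "?p u = 0[?S]" using G(4)[OF uN] u(2) by simp
   moreover have "?p (v**w):car ?S" using G(3) va[OF u(3)] by blast
   ultimately have "q = ?p v *[?S] w" using u(1) act[OF u(3)] by simp
   thus "EX a:car A. q = ?p v *[?S] a" using u(3) by blast
  qed
  moreover obtain x where "cyclic_gen (X k) x (L k)" using X(2)[OF step(3)] by blast
  ultimately have iso: "mod_iso A ?S (X k)" by(rule cyclic_gen_iso[OF G(1) X(1)[OF step(3)]])
  define F' where "F' j = (if j <= t then F j else ?N)" for j
  show ?case
  proof (rule exI[of _ "Suc t"], rule exI[of _ F'], intro conjI allI impI)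
   show "F' 0 = {\<zero>}" "F' (Suc t) = ?N" using F(1) by(simp_all add: F'_def)
   show "right_ideal A (F' j)" if "j <= Suc t" for j using F(3) NI' by(simp add: F'_def)
   fix j assume "j < Suc t"
   hence j: "j < t \<or> j = t" by linarith
   have "F' j <= F' (Suc j) & (EX Y:X ` {1..n}. mod_iso A (subquotient (regular A) (F' j) (F' (Suc j))) Y)"
   proof (cases "j < t")
    case True thus ?thesis using F(4) by(simp add: F'_def)
   next
    case False
    hence eq: "F' j = N" "F' (Suc j) = ?N" using F(2) j by(auto simp: F'_def)
    show ?thesis unfolding eq using sub iso by(intro conjI bexI[OF _ imageI[OF step(3)]])
   qed
   thus "F' j <= F' (Suc j)" "EX Y:X ` {1..n}. mod_iso A (subquotient (regular A) (F' j) (F' (Suc j))) Y"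
    by blast+
  qed
 qed
 from this[OF C] obtain t F where F: "F 0 = {\<zero>}" "F t = car A" "ALL j<=t. right_ideal A (F j)"
  "ALL j<t. F j <= F (Suc j) & (EX Y:X ` {1..n}. mod_iso A (subquotient (regular A) (F j) (F (Suc j))) Y)"
  by(elim exE conjE) (rule that)
 show ?thesis
  unfolding filtered_by_def
  by(intro conjI regular_fg exI[of _ t] exI[of _ F])
   (use F in \<open>simp_all add: filtration_def right_ideal_def\<close>)
qed

text \<open>In a local corner an idempotent is nilpotent, hence zero, or a unit, and then the
  complementary idempotent vanishes.\<close>

lemma local_primitive:
 assumes "local_idempotent A u"
 shows "primitive_idempotent A u"
proof -
 interpret U: corner_alg K A u by unfold_locales (rule assms)
 have key: "f = \<zero> \<or> g = \<zero>" if f: "f:car A" "f**f = f" and g: "g:car A" and fg: "f**g = \<zero>" "g**f = \<zero>"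
  and u: "u = f+.g" for f g
 proof -
  have fG: "f:corner A u" using f g fg u by(auto simp: corner_def A.l_distr A.r_distr)
  have pow: "f [^] Suc m = f" for m using f by(induct m) auto
  show ?thesis
  proof (cases "f:corner_rad A u")
   case True
   then obtain m :: nat where "f [^] m = \<zero>" using U.R_nilpotent by(auto simp: nilpotent_elt_def)
   hence "f [^] Suc m = \<zero>" using f(1) by simp
   thus ?thesis using pow[of m] by simp
  next
   case False
   then obtain h where h: "h:corner A u" "h**f = u" using U.unit_or_nilpotent[OF fG] by(auto simp: corner_unit_def)
   have hc: "h:car A" by(rule U.G_carrier[OF h(1)])
   have "f**u = f" using U.G_e(2)[OF fG] .
   have "u**g = h**(f**g)" using h(2) hc f(1) g by(simp flip: A.m_assoc)
   hence "u**g = \<zero>" using fg(1) hc by simp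
   hence "g**g = \<zero>" using u f(1) g fg(1) by(simp add: A.l_distr)
   have "u**u = u" by(rule U.e(2))
   hence "f+.g**g = f+.g" using u f g fg by(simp add: A.l_distr A.r_distr)
   hence "\<ominus> f+.(f+.g) = \<ominus> f+.f" using \<open>g**g = \<zero>\<close> f(1) by simp
   hence "g = \<zero>" using f(1) g by(simp add: A.r_neg1 A.l_neg)
   thus ?thesis ..
  qed
 qed
 show ?thesis unfolding primitive_idempotent_def using U.e(1-3) key by blast
qed

text \<open>A criterion by products in \<open>A\<close>, through which the tops over a quotient
  algebra are compared with those over \<open>A\<close>.\<close>

lemma tops_iso_iff:
 assumes u: "local_idempotent A u" and w: "local_idempotent A w"
 shows "mod_iso A (top_mod A (pmod u)) (top_mod A (pmod w)) <->
  (EX a:car A. EX b:car A. u**a**w**b**u ~: corner_rad A u)"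
proof -
 interpret U: corner_alg K A u by unfold_locales (rule u)
 interpret W: corner_alg K A w by unfold_locales (rule w)
 interpret T: right_module A U.top by(rule U.top_facts(1))
 obtain v where v: "cyclic_gen U.top v {a:car A. u**a:U.topker}" using U.top_facts(2) by blast
 have vc: "v:car U.top" using v by(simp add: cyclic_gen_def)
 have "mod_iso A U.top W.top <-> (EX t:car U.top. t *[U.top] w ~= 0[U.top])"
  by(rule W.iso_top_iff[OF U.top_simple])
 also have "\<dots> <-> (EX a:car A. v *[U.top] (a**w) ~= 0[U.top])"
 proof
  assume "EX t:car U.top. t *[U.top] w ~= 0[U.top]"
  then obtain t where t: "t:car U.top" "t *[U.top] w ~= 0[U.top]" by blast
  then obtain a where a: "a:car A" "t = v *[U.top] a" using v unfolding cyclic_gen_def by blast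
  hence "v *[U.top] (a**w) ~= 0[U.top]" using t(2) T.ract_assoc[OF vc a(1) W.e(1)] by simp
  thus "EX a:car A. v *[U.top] (a**w) ~= 0[U.top]" using a(1) by blast
 next
  assume "EX a:car A. v *[U.top] (a**w) ~= 0[U.top]"
  then obtain a where a: "a:car A" "v *[U.top] (a**w) ~= 0[U.top]" by blast
  thus "EX t:car U.top. t *[U.top] w ~= 0[U.top]"
   using T.ract_assoc[OF vc a(1) W.e(1)] T.ract_closed[OF vc a(1)] by(intro bexI[of _ "v *[U.top] a"]) auto
 qed
 also have "\<dots> <-> (EX a:car A. u**a**w ~: U.topker)"
 proof (rule bex_cong[OF refl])
  fix a assume a: "a:car A"
  hence "v *[U.top] (a**w) = 0[U.top] <-> u**(a**w):U.topker"
   using v W.e(1) unfolding cyclic_gen_def by simp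
  thus "v *[U.top] (a**w) ~= 0[U.top] <-> u**a**w ~: U.topker"
   using a U.e(1) W.e(1) by(simp add: A.m_assoc)
 qed
 also have "\<dots> <-> (EX a:car A. EX b:car A. u**a**w**b**u ~: corner_rad A u)"
 proof (rule bex_cong[OF refl])
  fix a assume a: "a:car A"
  have "u**a**w:eset A u" using a U.e(1) W.e(1) by(intro image_eqI[of _ _ "a**w"]) (auto simp: A.m_assoc)
  thus "u**a**w ~: U.topker <-> (EX b:car A. u**a**w**b**u ~: corner_rad A u)"
   unfolding U.topker_def by blast
 qed
 finally show ?thesis unfolding U.top_def W.top_def .
qed

end

section \<open>Ordered idempotent systems and their ideals\<close>

locale strat = fd_alg K A for K :: "'k ring" and A :: "('k, 'a) module" (structure) +
 fixes n :: nat and e :: "nat => 'a"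
 assumes sys: "idempotent_system A n e"
begin

abbreviation J :: "nat => 'a set" where "J == strat_ideal A n e"

lemma idem_local: "k:{1..n} ==> local_idempotent A (e k)"
 using primitive_local sys unfolding idempotent_system_def by blast

lemma idem: "k:{1..n} ==> e k:car A" "k:{1..n} ==> e k**e k = e k" "k:{1..n} ==> e k ~= \<zero>"
 using idem_local by(auto simp: local_idempotent_def)

lemma idem_corner: "k:{1..n} ==> corner_alg K A (e k)"
 by unfold_locales (rule idem_local)

lemma idem_orth: "k:{1..n} ==> j:{1..n} ==> k ~= j ==> e k**e j = \<zero>"
 and idem_sum: "(\<Oplus>i\<in>{1..n}. e i) = \<one>"
 using sys unfolding idempotent_system_def by blast+

lemma sum_closed: "(\<Oplus>i\<in>{k<..n}. e i):car A"
 by(rule A.finsum_closed) (auto simp: idem(1))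

lemma J_ideal: "ideal (J k) A"
 unfolding strat_ideal_def by(rule A.genideal_ideal) (use sum_closed in simp)

lemma J_mem: assumes j: "k < j" "j <= n" shows "e j:J k"
proof -
 interpret I: ideal "J k" A by(rule J_ideal)
 have jn: "j:{1..n}" using j by simp
 have "(\<Oplus>i\<in>{k<..n}. e i):J k" unfolding strat_ideal_def by(rule A.genideal_self'[OF sum_closed])
 hence "e j**(\<Oplus>i\<in>{k<..n}. e i):J k" by(rule I.I_l_closed[OF _ idem(1)[OF jn]])
 also have "e j**(\<Oplus>i\<in>{k<..n}. e i) = (\<Oplus>i\<in>{k<..n}. e j**e i)"
  by(rule A.finsum_rdistr) (use idem(1) jn in auto)
 also have "\<dots> = (\<Oplus>i\<in>{k<..n}. if j = i then e i else \<zero>)"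
  by(rule A.finsum_cong') (use idem idem_orth jn in auto)
 also have "\<dots> = e j" by(rule A.finsum_singleton) (use j idem(1) in auto)
 finally show ?thesis .
qed

lemma J_least: assumes "ideal I A" "!!j. k < j ==> j <= n ==> e j:I" shows "J k <= I"
proof -
 have "(\<Oplus>i\<in>{k<..n}. e i):I"
  by(rule vsA.subspace_finsum[OF right_ideal_subspace[OF ideal_right_ideal[OF assms(1)]]]) (use assms(2) in auto)
 thus ?thesis unfolding strat_ideal_def by(intro A.genideal_minimal[OF assms(1)]) simp
qed

lemma J_n: "J n = {\<zero>}"
 using J_least[OF A.zeroideal, of n] right_idealD(2)[OF ideal_right_ideal[OF J_ideal[of n]]] by auto

lemma J_anti: "k <= l ==> J l <= J k"
 by(rule J_least[OF J_ideal]) (use J_mem in auto)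

lemma simple_top_eq: "simple_top A e k = top_mod A (pmod (e k))"
 by(simp add: simple_top_def proj_mod_eq pmod_def)

lemma rad_of_distinct:
 assumes "k:{1..n}" "j:{1..n}" "k ~= j" "a:car A" "b:car A"
 shows "e k**a**e j**b**e k:corner_rad A (e k)"
 using sys assms tops_iso_iff[OF idem_local[OF assms(1)] idem_local[OF assms(2)]]
 unfolding idempotent_system_def simple_top_eq by blast

text \<open>The elements \<open>a\<close> for which \<open>e k A a A e k\<close> lies in the radical
  of the corner form an ideal. It contains every later \<open>e j\<close>, because the tops are not
  isomorphic, but not \<open>e k\<close>.\<close>

lemma idem_notin: assumes k: "k:{1..n}" shows "e k ~: J k"
proof -
 interpret E: corner_alg K A "e k" by(rule idem_corner[OF k])
 define M where "M = {a:car A. ALL x:car A. ALL y:car A. e k**x**a**y**e k:E.R}"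
 note c = idem(1)[OF k]
 have "ideal M A"
 proof (rule two_sided_idealI)
  show "M <= car A" "\<zero>:M" using c E.R_zero by(auto simp: M_def)
  show "x+.y:M" if "x:M" "y:M" for x y
   using that c E.R_add by(auto simp: M_def A.l_distr A.r_distr)
  show "a**x:M" if x: "x:M" and a: "a:car A" for x a
  proof -
   have xc: "x:car A" using x by(simp add: M_def)
   have "e k**u**(a**x)**v**e k:E.R" if "u:car A" "v:car A" for u v
   proof -
    have "e k**(u**a)**x**v**e k:E.R" using x a that unfolding M_def by blast
    thus ?thesis using c a that xc by(simp add: A.m_assoc)
   qed
   thus ?thesis using a xc unfolding M_def by blast
  qed
  show "x**a:M" if x: "x:M" and a: "a:car A" for x a
  proof -
   have xc: "x:car A" using x by(simp add: M_def)
   have "e k**u**(x**a)**v**e k:E.R" if "u:car A" "v:car A" for u v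
   proof -
    have "e k**u**x**(a**v)**e k:E.R" using x a that unfolding M_def by blast
    thus ?thesis using c a that xc by(simp add: A.m_assoc)
   qed
   thus ?thesis using a xc unfolding M_def by blast
  qed
 qed
 moreover have "e j:M" if "k < j" "j <= n" for j
  using rad_of_distinct[of k j] that k idem(1)[of j] by(auto simp: M_def)
 ultimately have "J k <= M" by(rule J_least)
 moreover have "e k ~: M"
 proof
  assume "e k:M"
  hence "e k**\<one>**e k**\<one>**e k:E.R" unfolding M_def using A.one_closed by blast
  hence "e k:E.R" using c idem(2)[OF k] by simp
  thus False using E.e by(auto simp: corner_rad_def corner_unit_def)
 qed
 ultimately show ?thesis by blast
qed

text \<open>The annihilator of the generator of a standard module; \<open>pstand\<close> plays the
  same part for proper standard modules.\<close>

definition stand :: "nat => 'a set" where "stand k = {a:car A. e k**a:J k}"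

definition pstand :: "nat => 'a set" where
 "pstand k = {a:car A. e k**a:corner_alg.properker A (e k) (J k)}"

lemma standard_gen:
 assumes k: "k:{1..n}"
 shows "right_module A (standard_mod A n e k)" "EX x. cyclic_gen (standard_mod A n e k) x (stand k)"
  "right_module A (proper_standard_mod A n e k)" "EX x. cyclic_gen (proper_standard_mod A n e k) x (pstand k)"
proof -
 interpret E: corner_alg K A "e k" by(rule idem_corner[OF k])
 have eq: "standard_mod A n e k = quot_mod (pmod (e k)) ((%a. e k**a) ` J k)"
  by(simp add: standard_mod_def proj_mod_eq pmod_def)
 note S = E.standard_quot[OF J_ideal[of k]] and P = E.proper_standard_quot[OF J_ideal idem_notin[OF k]]
 show "right_module A (standard_mod A n e k)" unfolding eq by(rule fg_right_module[OF S(2)])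
 show "EX x. cyclic_gen (standard_mod A n e k) x (stand k)" unfolding eq stand_def using S(3) by blast
 show "right_module A (proper_standard_mod A n e k)" "EX x. cyclic_gen (proper_standard_mod A n e k) x (pstand k)"
  unfolding proper_standard_mod_def eq simple_top_eq pstand_def using P unfolding E.top_def by blast+
qed

lemma properly_stratified_chains:
 assumes "properly_stratified K A n e"
 shows "EX t N kp v. rchain n stand t N kp v" "EX t N kp v. rchain n pstand t N kp v"
 using filtered_rchain[where n = n and X = "standard_mod A n e" and L = stand, OF standard_gen(1,2)]
  filtered_rchain[where n = n and X = "proper_standard_mod A n e" and L = pstand, OF standard_gen(3,4)] assms
 unfolding properly_stratified_def by blast+

lemma properly_stratifiedI:
 assumes "cyc_filt A n stand (car A)" "cyc_filt A n pstand (car A)"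
 shows "properly_stratified K A n e"
 unfolding properly_stratified_def
 using fd sys cyc_filt_filtered[where X = "standard_mod A n e", OF standard_gen(1,2) assms(1)] cyc_filt_filtered[where X = "proper_standard_mod A n e", OF standard_gen(3,4) assms(2)] by blast

end

lemma op_ideal: "ring A ==> ideal I A ==> ideal I (op_algebra A)"
proof -
 assume A: "ring A" and I: "ideal I A"
 interpret I: ideal I A by(rule I)
 have ab: "abelian_group (op_algebra A)"
  by(rule abelian_groupI) (auto simp: I.a_ac intro: bexI[of _ "\<ominus>\<^bsub>A\<^esub> _"] I.l_neg)
 have ri: "ring (op_algebra A)"
  by(rule ringI[OF ab monoidI]) (auto simp: I.m_assoc I.l_distr I.r_distr)
 have "add_monoid (op_algebra A) = add_monoid A" by(simp add: op_algebra_def)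
 hence "subgroup I (add_monoid (op_algebra A))" using I.a_subgroup by simp
 thus ?thesis by(rule idealI[OF ri]) (auto intro: I.I_l_closed I.I_r_closed)
qed

context strat
begin

text \<open>For the last index the stratifying ideal is zero, and for the earlier ones both
  annihilators contain \<open>J m\<close>, the ideal generated by \<open>e n\<close>; this is the
  situation of \<open>stratifying_ideal\<close>.\<close>

lemma last_idempotent:
 assumes ps: "properly_stratified K A n e" and n: "n = Suc m"
 shows "proj_chain A (e n) (J m)" "proj_chain (op_algebra A) (e n) (J m)"
  "EX t N kp v. rchain n pstand t N kp v & (ALL j<t. kp j ~= n --> N (Suc j) \<inter> J m <= N j)"
  "EX t N kp v. rchain n stand t N kp v & (ALL j<t. kp j ~= n --> N (Suc j) \<inter> J m <= N j)"
  "!!U. right_ideal A U ==> {x:J m. x**e n = x} <= U ==> J m <= U"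
  "!!U. right_ideal (op_algebra A) U ==> {x:J m. e n**x = x} <= U ==> J m <= U"
proof -
 have nn: "n:{1..n}" using n by simp
 interpret E: corner_alg K A "e n" by(rule idem_corner[OF nn])
 obtain t N kp v where P: "rchain n pstand t N kp v" using properly_stratified_chains(2)[OF ps] by blast
 obtain t' N' kp' v' where D: "rchain n stand t' N' kp' v'" using properly_stratified_chains(1)[OF ps] by blast
 have eJ: "e n:J m" using J_mem[of m n] n by simp
 have least: "J m <= I" if "ideal I A" "e n:I" for I
 proof (rule J_least[OF that(1)])
  fix j assume "m < j" "j <= n"
  hence "j = n" using n by simp
  thus "e j:I" using that(2) by simp
 qed
 have s1: "J m <= pstand k & J m <= stand k" if k: "k:{1..n}" "k ~= n" for k
 proof -
  interpret Ek: corner_alg K A "e k" by(rule idem_corner[OF k(1)])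
  have kJ: "J m <= J k" using J_anti[of k m] k n by simp
  note RD = right_idealD(1)[OF ideal_right_ideal[OF J_ideal[of m]]]
  have "e k**a:J k" "e k**a:Ek.properker (J k)" if "a:J m" for a
   using ideal.I_l_closed[OF J_ideal[of k] _ Ek.e(1), of a] Ek.properker_facts(3)[OF J_ideal idem_notin[OF k(1)]] kJ that
   by blast+
  thus ?thesis using RD unfolding pstand_def stand_def by blast
 qed
 have s2: "pstand n = {a:car A. e n**a:E.properker {\<zero>}}" by(simp add: pstand_def J_n)
 have s3: "stand n = {a:car A. e n**a = \<zero>}" by(simp add: stand_def J_n)
 note S = E.stratifying_ideal[OF J_ideal eJ least P D s1 s2 s3]
 show "proj_chain A (e n) (J m)" by(rule S(1))
 show "proj_chain (op_algebra A) (e n) (J m)" by(rule S(2))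
 show "EX t N kp v. rchain n pstand t N kp v & (ALL j<t. kp j ~= n --> N (Suc j) \<inter> J m <= N j)"
  by(intro exI[of _ t] exI[of _ N] exI[of _ kp] exI[of _ v] conjI P allI impI) (rule S(3))
 show "EX t N kp v. rchain n stand t N kp v & (ALL j<t. kp j ~= n --> N (Suc j) \<inter> J m <= N j)"
  by(intro exI[of _ t'] exI[of _ N'] exI[of _ kp'] exI[of _ v'] conjI D allI impI) (rule S(4))
 show "!!U. right_ideal A U ==> {x:J m. x**e n = x} <= U ==> J m <= U" by(rule S(5))
 show "!!U. right_ideal (op_algebra A) U ==> {x:J m. e n**x = x} <= U ==> J m <= U" by(rule S(6))
qed

text \<open>Right self-injectivity of the corner uses the chain for \<open>J m\<close> in the
  opposite algebra, left self-injectivity the chain in \<open>A\<close>.\<close>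

lemma last_corner_frobenius:
 assumes ps: "properly_stratified K A n e" and g: "gorenstein A" and n: "n >= 1"
 shows "EX l. corner_alg.frobenius_form K A (e n) l"
proof -
 obtain m where m: "n = Suc m" using n by(cases n) auto
 have nn: "n:{1..n}" using n by simp
 interpret E: corner_alg K A "e n" by(rule idem_corner[OF nn])
 interpret L: corner_alg K "op_algebra A" "e n" by(rule E.op_corner_alg)
 note S = last_idempotent[OF ps m]
 have eJ: "e n:J m" using J_mem[of m n] m by simp
 obtain r r' where r: "inj_dim_le A (regular A) r" "inj_dim_le (op_algebra A) (regular (op_algebra A)) r'"
  using g unfolding gorenstein_def by blast
 have P: "proj_chain (op_algebra (op_algebra A)) (e n) (J m)" using S(1) by simp
 show ?thesis
  by(rule E.frobenius_form_ex[OF E.regular_cinj[OF S(2) eJ ideal_right_ideal[OF J_ideal] r(1)]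
   L.regular_cinj[OF P eJ L.ideal_right_ideal[OF op_ideal[OF A.ring_axioms J_ideal]] r(2)]])
qed

end

section \<open>Idempotents, ideals and filtrations under a surjection\<close>

context fd_quot
begin

lemma phi_pow: "a:car A ==> phi (a [^] (m::nat)) = phi a [^]\<^bsub>B\<^esub> m"
 by(induct m) (simp_all add: phi_one phi_mult)

lemma phi_finsum: "finite I ==> f:I \<rightarrow> car A ==> phi (finsum A f I) = finsum B (%i. phi (f i)) I"
proof (induct I rule: finite_induct)
 case (insert i I)
 hence "f:I \<rightarrow> car A" "f i:car A" "(%i. phi (f i)):I \<rightarrow> car B" by auto
 thus ?case using insert by(simp add: phi_add)
qed (simp add: phi_zero)

lemma corner_push: "u:car A ==> x:corner A u ==> phi x:corner B (phi u)"
 by(auto simp: corner_def simp flip: phi_mult)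

lemma corner_push_surj:
 assumes u: "u:car A" "u**u = u" and y: "y:corner B (phi u)"
 shows "EX x:corner A u. y = phi x"
proof -
 have yB: "y:car B" "phi u **[B] y = y" "y **[B] phi u = y" using y by(auto simp: corner_def)
 note p = psi[OF yB(1)]
 have "u**psi y**u:corner A u" using u p(1) by(auto simp: corner_def A.A.m_assoc simp flip: A.A.m_assoc[of u u])
 moreover have "phi (u**psi y**u) = y" using u(1) p yB by(simp add: phi_mult)
 ultimately show ?thesis by metis
qed

text \<open>Nilpotent elements and units are preserved, so the dichotomy passes to the image. A
  radical element cannot become a unit, for then the nonzero idempotent \<open>phi u\<close> would
  be nilpotent.\<close>

lemma local_push:
 assumes u: "local_idempotent A u" and n: "phi u ~= 0[B]"
 shows "local_idempotent B (phi u)" "x:corner A u ==> phi x:corner_rad B (phi u) <-> x:corner_rad A u"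
proof -
 interpret U: corner_alg K A u by unfold_locales (rule u)
 have dich: "nilpotent_elt B (phi x)" if "x:corner_rad A u" for x
  using U.R_nilpotent[OF that] phi_pow[OF U.G_carrier[OF U.R_G[OF that]]] phi_zero
  by(auto simp: nilpotent_elt_def) metis
 have unit: "corner_unit B (phi u) (phi x)" if x: "x:corner A u" "x ~: corner_rad A u" for x
 proof -
  obtain y where y: "y:corner A u" "x**y = u" "y**x = u"
   using U.unit_or_nilpotent[OF x] by(auto simp: corner_unit_def)
  thus ?thesis using corner_push[OF U.e(1) y(1)] U.G_carrier[OF x(1)] U.G_carrier[OF y(1)]
   by(auto simp: corner_unit_def simp flip: phi_mult intro!: bexI[of _ "phi y"])
 qed
 show loc: "local_idempotent B (phi u)"
  unfolding local_idempotent_def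
 proof (intro conjI ballI n)
  show "phi u:car B" "phi u **[B] phi u = phi u" using U.e by(auto simp flip: phi_mult)
  fix y assume "y:corner B (phi u)"
  then obtain x where "x:corner A u" "y = phi x" using corner_push_surj[OF U.e(1,2)] by blast
  thus "nilpotent_elt B y \<or> corner_unit B (phi u) y" using dich unit by blast
 qed
 interpret V: corner_alg K B "phi u" by unfold_locales (rule loc)
 show "phi x:corner_rad B (phi u) <-> x:corner_rad A u" if x: "x:corner A u"
 proof
  assume "phi x:corner_rad B (phi u)"
  thus "x:corner_rad A u" using unit[OF x] by(auto simp: corner_rad_def)
 next
  assume xR: "x:corner_rad A u"
  show "phi x:corner_rad B (phi u)"
  proof (rule ccontr)
   assume nR: "phi x ~: corner_rad B (phi u)"
   have xG: "phi x:corner B (phi u)" by(rule corner_push[OF U.e(1) x])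
   obtain y where y: "y:corner B (phi u)" "phi x **[B] y = phi u"
    using V.unit_or_nilpotent[OF xG nR] by(auto simp: corner_unit_def)
   obtain z where z: "z:corner A u" "y = phi z" using corner_push_surj[OF U.e(1,2) y(1)] by blast
   have "x**z:corner_rad A u" by(rule U.R_mult(1)[OF xR z(1)])
   then obtain k :: nat where "phi (x**z) [^]\<^bsub>B\<^esub> k = 0[B]" using dich by(auto simp: nilpotent_elt_def)
   moreover have "phi (x**z) = phi u" using y(2) z U.G_carrier x by(simp add: phi_mult)
   moreover have "phi u [^]\<^bsub>B\<^esub> Suc k = phi u" using V.e by(induct k) auto
   moreover have "phi u [^]\<^bsub>B\<^esub> Suc k = phi u [^]\<^bsub>B\<^esub> k **[B] phi u" by simp
   ultimately show False using n V.e(1) by simp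
  qed
 qed
qed

lemma vimage_ideal: "ideal I B ==> ideal {a:car A. phi a:I} A"
proof (rule A.two_sided_idealI)
 assume "ideal I B"
 then interpret I: ideal I B .
 show "\<zero>:{a:car A. phi a:I}" using phi_zero I.zero_closed by simp
 show "x+.y:{a:car A. phi a:I}" if "x:{a:car A. phi a:I}" "y:{a:car A. phi a:I}" for x y
  using that I.a_closed by(auto simp: phi_add)
qed (auto simp: phi_mult intro: ideal.I_l_closed ideal.I_r_closed)

lemma image_ideal: "ideal I A ==> ideal (phi ` I) B"
proof -
 assume "ideal I A"
 then interpret I: ideal I A .
 have c: "x:I ==> x:car A" for x using I.a_Hcarr by blast
 show ?thesis
 proof (rule B.two_sided_idealI)
  show "phi ` I <= car B" using c by blast
  show "0[B]:phi ` I" using phi_zero I.zero_closed by(intro image_eqI[of _ _ \<zero>]) auto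
  show "x +[B] y:phi ` I" if xy: "x:phi ` I" "y:phi ` I" for x y
  proof -
   obtain a b where "a:I" "b:I" "x = phi a" "y = phi b" using xy by blast
   thus ?thesis using I.a_closed c by(intro image_eqI[of _ _ "a+.b"]) (auto simp: phi_add)
  qed
  fix x b assume x: "x:phi ` I" and b: "b:car B"
  obtain a where a: "a:I" "x = phi a" using x by blast
  have "b **[B] x = phi (psi b**a)" "x **[B] b = phi (a**psi b)" using a c psi[OF b] by(simp_all add: phi_mult)
  thus "b **[B] x:phi ` I" "x **[B] b:phi ` I" using I.I_l_closed[OF a(1)] I.I_r_closed[OF a(1)] psi[OF b] by auto
 qed
qed

lemma image_right_ideal:
 assumes U: "right_ideal A U" shows "right_ideal B (phi ` U)"
proof (rule B.right_idealI)
 note D = A.right_idealD[OF U]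
 show "phi ` U <= car B" using D(1) by blast
 show "0[B]:phi ` U" using phi_zero D(2) by(intro image_eqI[of _ _ \<zero>]) auto
 show "x +[B] y:phi ` U" if xy: "x:phi ` U" "y:phi ` U" for x y
 proof -
  obtain a b where "a:U" "b:U" "x = phi a" "y = phi b" using xy by blast
  thus ?thesis using D(1,3) by(intro image_eqI[of _ _ "a+.b"]) (auto simp: phi_add subset_iff)
 qed
 show "x **[B] b:phi ` U" if x: "x:phi ` U" and b: "b:car B" for x b
 proof -
  obtain a where a: "a:U" "x = phi a" using x by blast
  thus ?thesis using D(1) D(4)[OF a(1) psi(1)[OF b]] psi[OF b]
   by(intro image_eqI[of _ _ "a**psi b"]) (auto simp: phi_mult subset_iff)
 qed
qed

text \<open>A step survives with the same annihilator if it adds nothing to the intersection with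
  \<open>ker\<close>, and it disappears if its generator is congruent modulo \<open>ker\<close> to
  an element of the previous member.\<close>

lemma chain_push:
 assumes ch: "A.rchain M L t N kp v"
  and st: "!!j. j < t ==> (kp j:{1..n} & N (Suc j) \<inter> ker <= N j) \<or> (EX x:N j. v j-.x:ker)"
  and L: "!!k a. k:{1..n} ==> a:car A ==> phi a:L' k <-> a:L k"
 shows "cyc_filt B n L' (car B)"
proof -
 note C = A.rchainD[OF ch]
 have "cyc_filt B n L' (phi ` N j)" if "j <= t" for j using that
 proof (induct j)
  case 0 thus ?case using C(1) cyc_filt.zero[of B] by(simp add: phi_zero)
 next
  case (Suc j)
  hence j: "j < t" "j <= t" by auto
  note ND = A.right_idealD[OF C(3)[OF j(2)]] and vc = C(5)[OF j(1)]
  have Nc: "x:car A" if "x:N j" for x using ND(1) that by blast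
  have sub: "x:N (Suc j)" if "x:N j" for x
  proof -
   have "x = x+.v j**\<zero>" using Nc[OF that] vc by simp
   thus ?thesis unfolding C(7)[OF j(1)] using that by blast
  qed
  have IH: "cyc_filt B n L' (phi ` N j)" using Suc(1) j by simp
  from st[OF j(1)] show ?case
  proof
   assume k: "kp j:{1..n} & N (Suc j) \<inter> ker <= N j"
   have "ALL b:car B. phi (v j) **[B] b:phi ` N j <-> b:L' (kp j)"
   proof
    fix b assume "b:car B"
    then obtain a where a: "a:car A" "b = phi a" using psi by metis
    have va: "v j**a:car A" "v j**a:N (Suc j)"
    proof -
     show "v j**a:car A" using vc a by simp
     hence "v j**a = \<zero> \<oplus> v j**a" by simp
     thus "v j**a:N (Suc j)" unfolding C(7)[OF j(1)] using ND(2) a(1) by blast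
    qed
    have "phi (v j**a):phi ` N j <-> v j**a:N j"
    proof
     assume "phi (v j**a):phi ` N j"
     then obtain x where x: "x:N j" "phi (v j**a) = phi x" by blast
     have "v j**a-.x:ker" using phi_eq_iff[OF va(1) Nc[OF x(1)]] x(2) by simp
     moreover have "Suc j <= t" using j by simp
     hence "v j**a-.x:N (Suc j)" by(rule A.right_idealD(7)[OF C(3) va(2) sub[OF x(1)]])
     ultimately have "v j**a-.x:N j" using k by blast
     hence "(v j**a-.x)+.x:N j" by(rule ND(3)[OF _ x(1)])
     thus "v j**a:N j" using va(1) Nc[OF x(1)] by(simp add: A.A.diff_add_cancel)
    qed blast
    thus "phi (v j) **[B] b:phi ` N j <-> b:L' (kp j)"
     using C(6)[OF j(1) a(1)] L[OF conjunct1[OF k] a(1)] vc a by(simp add: phi_mult)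
   qed
   hence "cyc_filt B n L' {u +[B] phi (v j) **[B] w | u w. u:phi ` N j & w:car B}"
    by(rule cyc_filt.step[OF IH conjunct1[OF k] phi_closed[OF vc]])
   also have "{u +[B] phi (v j) **[B] w | u w. u:phi ` N j & w:car B} = phi ` N (Suc j)"
   proof
    show "{u +[B] phi (v j) **[B] w | u w. u:phi ` N j & w:car B} <= phi ` N (Suc j)"
    proof
     fix y assume "y:{u +[B] phi (v j) **[B] w | u w. u:phi ` N j & w:car B}"
     then obtain u w where u: "y = phi u +[B] phi (v j) **[B] w" "u:N j" "w:car B" by blast
     have "y = phi (u+.v j**psi w)" using u(1) Nc[OF u(2)] vc psi[OF u(3)] by(simp add: phi_add phi_mult)
     moreover have "u+.v j**psi w:N (Suc j)" unfolding C(7)[OF j(1)] using u(2) psi[OF u(3)] by blast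
     ultimately show "y:phi ` N (Suc j)" by blast
    qed
    show "phi ` N (Suc j) <= {u +[B] phi (v j) **[B] w | u w. u:phi ` N j & w:car B}"
    proof
     fix y assume "y:phi ` N (Suc j)"
     then obtain u w where u: "y = phi (u+.v j**w)" "u:N j" "w:car A" unfolding C(7)[OF j(1)] by blast
     have "y = phi u +[B] phi (v j) **[B] phi w" using u Nc[OF u(2)] vc by(simp add: phi_add phi_mult)
     thus "y:{u +[B] phi (v j) **[B] w | u w. u:phi ` N j & w:car B}" using u(2,3) by blast
    qed
   qed
   finally show ?thesis .
  next
   assume "EX x:N j. v j-.x:ker"
   then obtain x where x: "x:N j" "phi (v j) = phi x" using phi_eq_iff[OF vc Nc] by blast
   have "phi ` N (Suc j) = phi ` N j"
   proof
    show "phi ` N (Suc j) <= phi ` N j"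
    proof
     fix y assume "y:phi ` N (Suc j)"
     then obtain u w where u: "y = phi (u+.v j**w)" "u:N j" "w:car A" unfolding C(7)[OF j(1)] by blast
     have "y = phi (u+.x**w)" using u x Nc vc by(simp add: phi_add phi_mult)
     thus "y:phi ` N j" using ND(3)[OF u(2) ND(4)[OF x(1) u(3)]] by blast
    qed
   qed (use sub in blast)
   thus ?thesis using IH by simp
  qed
 qed
 from this[of t] show ?thesis using C(2) surj by simp
qed

lemma op_fd_quot: "fd_quot K (op_algebra A) (op_algebra B) phi"
proof -
 interpret A': fd_alg K "op_algebra A" by(rule fd_algI[OF op_fd_algebra[OF A.fd]])
 interpret B': fd_alg K "op_algebra B" by(rule fd_algI[OF op_fd_algebra[OF B.fd]])
 show ?thesis
  by unfold_locales (use surj klin in \<open>auto simp: ring_hom_def phi_mult phi_add phi_one\<close>)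
qed

end

text \<open>The case of arbitrary \<open>n <= m\<close> serves to compare ideals; the stratification
  itself is pushed down for \<open>m = n\<close> and for \<open>m = Suc n\<close>.\<close>

locale strat_quot = fd_quot K A B phi + S: strat K A m e
 for K :: "'k ring" and A :: "('k, 'a) module" (structure) and B :: "('k, 'b) module" and phi m e +
 fixes n :: nat and e' :: "nat => 'b"
 assumes nm: "n <= m" and kerJ: "ker = S.J n" and e': "!!j. j:{1..n} ==> e' j = phi (e j)"
begin

lemma sub_index: "j:{1..n} ==> j:{1..m}"
 using nm by simp

lemma idem_notin_ker: "k:{1..n} ==> e k ~: ker"
 using S.idem_notin[of k] S.J_anti[of k n] sub_index unfolding kerJ by auto

lemma phi_idem: "k:{1..n} ==> phi (e k) ~= 0[B]"
 using idem_notin_ker S.idem(1) sub_index by(auto simp: ker_def)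

lemmas loc_push = local_push[OF S.idem_local[OF sub_index] phi_idem]

lemma push_sys: "idempotent_system B n e'"
 unfolding idempotent_system_def
proof (intro conjI ballI impI)
 fix k assume k: "k:{1..n}"
 show "primitive_idempotent B (e' k)" unfolding e'[OF k] by(rule B.local_primitive[OF loc_push(1)[OF k k]])
 fix j assume j: "j:{1..n}" "k ~= j"
 note kj = sub_index[OF k] sub_index[OF j(1)]
 show "e' k **[B] e' j = 0[B]"
  using S.idem_orth[OF kj j(2)] S.idem(1)[OF kj(1)] S.idem(1)[OF kj(2)] phi_zero e'[OF k] e'[OF j(1)] by(simp flip: phi_mult)
 have st: "simple_top B e' l = top_mod B (B.pmod (e' l))" for l
  by(simp add: simple_top_def proj_mod_eq B.pmod_def)
 show "~ mod_iso B (simple_top B e' k) (simple_top B e' j)"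
 proof
  assume "mod_iso B (simple_top B e' k) (simple_top B e' j)"
  then obtain b c where bc: "b:car B" "c:car B"
   "phi (e k) **[B] b **[B] phi (e j) **[B] c **[B] phi (e k) ~: corner_rad B (phi (e k))"
   using B.tops_iso_iff[OF loc_push(1)[OF k k] loc_push(1)[OF j(1) j(1)]] unfolding st e'[OF k] e'[OF j(1)] by blast
  let ?x = "e k**psi b**e j**psi c**e k"
  have x: "?x:corner_rad A (e k)" by(rule S.rad_of_distinct[OF kj j(2) psi(1)[OF bc(1)] psi(1)[OF bc(2)]])
  hence "phi ?x:corner_rad B (phi (e k))" using loc_push(2)[OF k k, of ?x] by(simp add: corner_rad_def)
  thus False using bc psi S.idem(1)[OF kj(1)] S.idem(1)[OF kj(2)] by(simp add: phi_mult)
 qed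
next
 have ec: "e j:car A" if "j:{1..m}" for j by(rule S.idem(1)[OF that])
 have "(\<Oplus>\<^bsub>B\<^esub>i\<in>{1..n}. e' i) = (\<Oplus>\<^bsub>B\<^esub>i\<in>{1..m}. phi (e i))"
 proof (rule B.A.add.finprod_mono_neutral_cong_left)
  show "{1..n} <= {1..m}" using nm by auto
  show "phi (e i) = 0[B]" if "i:{1..m} - {1..n}" for i
  proof -
   have "e i:ker" unfolding kerJ using S.J_mem[of n i] that by auto
   thus ?thesis by(simp add: ker_def)
  qed
 qed (use e' ec in auto)
 also have "\<dots> = phi (\<Oplus>i\<in>{1..m}. e i)" by(rule phi_finsum[symmetric]) (use ec in auto)
 finally show "(\<Oplus>\<^bsub>B\<^esub>i\<in>{1..n}. e' i) = 1[B]" using S.idem_sum phi_one by simp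
qed

sublocale T: strat K B n e'
 by unfold_locales (rule push_sys)

text \<open>One direction holds because preimages of ideals are ideals, the other because images are
  ideals and \<open>ker\<close> lies in \<open>S.J k\<close>.\<close>

lemma J_push:
 assumes k: "k <= n" and a: "a:car A"
 shows "phi a:T.J k <-> a:S.J k"
proof
 have "S.J k <= {a:car A. phi a:T.J k}"
 proof (rule S.J_least[OF vimage_ideal[OF T.J_ideal]])
  fix j assume j: "k < j" "j <= m"
  hence jm: "e j:car A" by(intro S.idem(1)) auto
  show "e j:{a:car A. phi a:T.J k}"
  proof (cases "j <= n")
   case True
   thus ?thesis using T.J_mem[OF j(1) True] e'[of j] j jm by simp
  next
   case False
   hence "e j:ker" unfolding kerJ using S.J_mem[of n j] j by simp
   thus ?thesis using B.right_idealD(2)[OF B.ideal_right_ideal[OF T.J_ideal]] jm by(simp add: ker_def)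
  qed
 qed
 thus "a:S.J k ==> phi a:T.J k" by blast
 assume pa: "phi a:T.J k"
 have "T.J k <= phi ` S.J k"
 proof (rule T.J_least[OF image_ideal[OF S.J_ideal]])
  fix j assume "k < j" "j <= n"
  thus "e' j:phi ` S.J k" using S.J_mem[of k j] nm e'[of j] by simp
 qed
 then obtain x where x: "x:S.J k" "phi a = phi x" using pa by blast
 note D = A.right_idealD[OF A.ideal_right_ideal[OF S.J_ideal[of k]]]
 have xc: "x:car A" using x(1) D(1) by blast
 have "a-.x:S.J k" using phi_eq_iff[OF a xc] x(2) S.J_anti[OF k] unfolding kerJ by blast
 hence "(a-.x)+.x:S.J k" by(rule D(3)[OF _ x(1)])
 thus "a:S.J k" using a xc by(simp add: A.A.diff_add_cancel)
qed

lemma stand_push: "k:{1..n} ==> a:car A ==> phi a:T.stand k <-> a:S.stand k"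
 using J_push[of k "e k**a"] S.idem(1)[OF sub_index] by(simp add: T.stand_def S.stand_def e' phi_mult)

text \<open>Preimage and image of the two right ideals contain the required generators, so the
  minimality of \<open>properker\<close> gives both inclusions; the remaining difference of two
  representatives lies in \<open>ker\<close> and hence in \<open>S.J k\<close>.\<close>

lemma pstand_push:
 assumes k: "k:{1..n}" and a: "a:car A"
 shows "phi a:T.pstand k <-> a:S.pstand k"
proof -
 note km = sub_index[OF k]
 interpret E: corner_alg K A "e k" by(rule S.idem_corner[OF km])
 interpret F: corner_alg K B "e' k" by(rule T.idem_corner[OF k])
 note PE = E.properker_facts[OF S.J_ideal S.idem_notin[OF km]] and PF = F.properker_facts[OF T.J_ideal T.idem_notin[OF k]]
 note DE = A.right_idealD[OF PE(1)] and DF = B.right_idealD[OF PF(1)]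
 have kn: "k <= n" using k by simp
 have Jc: "x:car A" if "x:S.J k" for x using A.right_idealD(1)[OF A.ideal_right_ideal[OF S.J_ideal]] that by blast
 have rad: "phi x:F.R <-> x:E.R" if "x:E.Gam" for x using loc_push(2)[OF k k that] by(simp add: e'[OF k])
 have fwd: "E.properker (S.J k) <= {x:car A. phi x:F.properker (T.J k)}"
 proof (rule PE(6))
  show "right_ideal A {x:car A. phi x:F.properker (T.J k)}"
   by(rule A.right_idealI) (use DF(2-4) in \<open>auto simp: phi_zero phi_add phi_mult\<close>)
  show "E.R <= {x:car A. phi x:F.properker (T.J k)}"
   using rad E.R_G E.G_carrier PF(4) by blast
  show "(%a. e k**a) ` S.J k <= {x:car A. phi x:F.properker (T.J k)}"
  proof
   fix x assume "x:(%a. e k**a) ` S.J k"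
   then obtain y where y: "y:S.J k" "x = e k**y" by blast
   have "phi y:T.J k" using J_push[OF kn Jc[OF y(1)]] y(1) by simp
   hence "e' k **[B] phi y:F.properker (T.J k)" using PF(3) by blast
   thus "x:{x:car A. phi x:F.properker (T.J k)}"
    using y Jc E.e(1) by(simp add: phi_mult e'[OF k])
  qed
 qed
 have bwd: "F.properker (T.J k) <= phi ` E.properker (S.J k)"
 proof (rule PF(6)[OF image_right_ideal[OF PE(1)]])
  show "F.R <= phi ` E.properker (S.J k)"
  proof
   fix y assume y: "y:F.R"
   hence "y:corner B (phi (e k))" using F.R_G e'[OF k] by simp
   then obtain x where x: "x:E.Gam" "y = phi x" using corner_push_surj[OF E.e(1,2)] by blast
   thus "y:phi ` E.properker (S.J k)" using rad[OF x(1)] y PE(4) by blast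
  qed
  show "(%a. e' k **[B] a) ` T.J k <= phi ` E.properker (S.J k)"
  proof
   fix x assume "x:(%a. e' k **[B] a) ` T.J k"
   then obtain y where y: "y:T.J k" "x = e' k **[B] y" by blast
   have yc: "y:car B" using B.right_idealD(1)[OF B.ideal_right_ideal[OF T.J_ideal]] y(1) by blast
   note p = psi[OF yc]
   have "psi y:S.J k" using J_push[OF kn p(1)] p(2) y(1) by simp
   hence "e k**psi y:E.properker (S.J k)" using PE(3) by blast
   moreover have "x = phi (e k**psi y)" using y(2) p E.e(1) by(simp add: phi_mult e'[OF k])
   ultimately show "x:phi ` E.properker (S.J k)" by blast
  qed
 qed
 have ea: "e k**a:car A" using E.e(1) a by simp
 have "phi (e k**a):F.properker (T.J k) <-> e k**a:E.properker (S.J k)"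
 proof
  assume "phi (e k**a):F.properker (T.J k)"
  then obtain x where x: "x:E.properker (S.J k)" "phi (e k**a) = phi x" using bwd by blast
  have xc: "x:car A" "e k**x = x" using x(1) PE(2) E.eset_e by auto
  have kr: "e k**a-.x:ker" using phi_eq_iff[OF ea xc(1)] x(2) by simp
  hence "e k**(e k**a-.x):E.properker (S.J k)" using PE(3) S.J_anti[OF kn] unfolding kerJ by blast
  moreover have "e k**(e k**a-.x) = e k**a-.x"
   using E.e xc a by(simp add: a_minus_def A.A.r_distr A.A.r_minus flip: A.A.m_assoc)
  ultimately have "(e k**a-.x)+.x:E.properker (S.J k)" using DE(3)[OF _ x(1)] by simp
  thus "e k**a:E.properker (S.J k)" using ea xc(1) by(simp add: A.A.diff_add_cancel)
 qed (use fwd in blast)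
 thus ?thesis using a E.e(1) by(simp add: T.pstand_def S.pstand_def phi_mult e'[OF k])
qed

lemma cyc_filt_push:
 assumes N: "m = n \<or> m = Suc n" and ch: "A.rchain m L t N kp v"
  and low: "m = Suc n ==> ALL j<t. kp j ~= m --> N (Suc j) \<inter> ker <= N j"
  and Lm: "m = Suc n ==> \<one> \<ominus> e m:L m"
  and L: "!!k a. k:{1..n} ==> a:car A ==> phi a:L' k <-> a:L k"
 shows "cyc_filt B n L' (car B)"
proof (rule chain_push[OF ch _ L])
 note C = A.rchainD[OF ch]
 fix j assume j: "j < t"
 note ND = A.right_idealD[OF C(3)[OF less_imp_le[OF j]]]
 show "(kp j:{1..n} & N (Suc j) \<inter> ker <= N j) \<or> (EX x:N j. v j-.x:ker)"
 proof (cases "kp j:{1..n}")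
  case True
  have "N (Suc j) \<inter> ker <= N j"
  proof (cases "m = n")
   case True
   hence "ker = {\<zero>}" using S.J_n kerJ by simp
   thus ?thesis using ND(2) by auto
  next
   case False
   hence mn: "m = Suc n" using N by simp
   hence "kp j ~= m" using True by auto
   thus ?thesis using low[OF mn] j by blast
  qed
  thus ?thesis using True by blast
 next
  case False
  hence mn: "m = Suc n" "kp j = m" using C(4)[OF j] N by auto
  have em: "e m:car A" by(rule S.idem(1)) (use mn in simp)
  have vc: "v j:car A" by(rule C(5)[OF j])
  \<comment> \<open>Modulo \<open>N j\<close> the generator equals \<open>v j e m\<close>, which
    lies in \<open>ker\<close>; so this step collapses in the quotient.\<close>
  have "v j**(\<one> \<ominus> e m):N j" using C(6)[OF j, of "\<one> \<ominus> e m"] Lm[OF mn(1)] mn(2) em by simp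
  moreover have "v j-.v j**(\<one> \<ominus> e m):ker"
  proof -
   have "v j-.v j**(\<one> \<ominus> e m) = v j**e m"
    using vc em by(simp add: a_minus_def A.A.r_distr A.A.r_minus A.A.minus_add A.A.r_neg A.A.r_neg2 A.A.a_ac)
   moreover have "e m:ker" unfolding kerJ by(rule S.J_mem) (use mn in auto)
   ultimately show ?thesis using ker_props(3)[OF vc] by simp
  qed
  ultimately show ?thesis by blast
 qed
qed

lemma stratified_push:
 assumes N: "m = n \<or> m = Suc n" and ps: "properly_stratified K A m e" and g: "gorenstein A"
 shows "properly_stratified K B n e'" "gorenstein B"
proof -
 interpret O: fd_quot K "op_algebra A" "op_algebra B" phi by(rule op_fd_quot)
 have Oker: "O.ker = ker" by(simp add: O.ker_def ker_def)
 obtain r r' where r: "inj_dim_le A (regular A) r" "inj_dim_le (op_algebra A) (regular (op_algebra A)) r'"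
  using g unfolding gorenstein_def by blast
 have "properly_stratified K B n e' & gorenstein B"
 proof (cases "m = n")
  case True
  hence k0: "ker = {\<zero>}" using S.J_n kerJ by simp
  obtain t N kp v where P: "A.rchain m S.pstand t N kp v" using S.properly_stratified_chains(2)[OF ps] by blast
  obtain t' N' kp' v' where D: "A.rchain m S.stand t' N' kp' v'" using S.properly_stratified_chains(1)[OF ps] by blast
  have "cyc_filt B n T.stand (car B)" by(rule cyc_filt_push[OF N D _ _ stand_push]) (use True in auto)
  moreover have "cyc_filt B n T.pstand (car B)" by(rule cyc_filt_push[OF N P _ _ pstand_push]) (use True in auto)
  \<comment> \<open>For a zero kernel the idempotent 0 can be taken: the kernel is then the empty
    chain.\<close>
  moreover have "inj_dim_le B (regular B) r"
   by(rule quotient_inj_dim[where e = \<zero>, OF _ _ _ _ _ r(1)])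
    (use proj_chain.zero[of A \<zero>] k0 A.right_idealD(2) in auto)
  moreover have "inj_dim_le (op_algebra B) (regular (op_algebra B)) r'"
   by(rule O.quotient_inj_dim[where e = \<zero>, OF _ _ _ _ _ r(2)])
    (use proj_chain.zero[of "op_algebra A" \<zero>] k0 O.A.right_idealD(2) in \<open>auto simp: Oker\<close>)
  ultimately show ?thesis using T.properly_stratifiedI unfolding gorenstein_def by blast
 next
  case False
  hence mn: "m = Suc n" using N by simp
  hence mm: "m:{1..m}" by simp
  note em = S.idem[OF mm]
  interpret E: corner_alg K A "e m" by(rule S.idem_corner[OF mm])
  note L = S.last_idempotent[OF ps mn, folded kerJ]
  have emk: "e m:ker" unfolding kerJ by(rule S.J_mem) (use mn in auto)
  have e1: "e m**(\<one> \<ominus> e m) = \<zero>" using em by(simp add: a_minus_def A.A.r_distr A.A.r_minus A.A.r_neg)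
  have l1: "\<one> \<ominus> e m:S.stand m" "\<one> \<ominus> e m:S.pstand m"
   using e1 em(1) A.right_idealD(2)[OF A.ideal_right_ideal[OF S.J_ideal]]
    A.right_idealD(2)[OF E.properker_facts(1)[OF S.J_ideal S.idem_notin[OF mm]]]
   by(auto simp: S.stand_def S.pstand_def)
  obtain t N kp v where P: "A.rchain m S.pstand t N kp v" "ALL j<t. kp j ~= m --> N (Suc j) \<inter> ker <= N j" using L(3) by blast
  obtain t' N' kp' v' where D: "A.rchain m S.stand t' N' kp' v'" "ALL j<t'. kp' j ~= m --> N' (Suc j) \<inter> ker <= N' j"
   using L(4) by blast
  have "cyc_filt B n T.stand (car B)" by(rule cyc_filt_push[OF N D(1) D(2) l1(1) stand_push])
  moreover have "cyc_filt B n T.pstand (car B)" by(rule cyc_filt_push[OF N P(1) P(2) l1(2) pstand_push])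
  moreover have "inj_dim_le B (regular B) r"
   by(rule quotient_inj_dim[OF em(1,2) L(1) L(5) emk r(1)])
  moreover have "inj_dim_le (op_algebra B) (regular (op_algebra B)) r'"
   by(rule O.quotient_inj_dim[where e = "e m", OF _ _ _ _ _ r(2)])
    (use em(1,2) L(2) L(6) emk in \<open>simp_all add: Oker\<close>)
  ultimately show ?thesis using T.properly_stratifiedI unfolding gorenstein_def by blast
 qed
 thus "properly_stratified K B n e'" "gorenstein B" by blast+
qed

end

section \<open>Endomorphism algebras\<close>

lemma lin_comb_image:
 assumes "!!z i. z:S ==> f z i:C" "0[M]:C" "!!x y. x:C ==> y:C ==> x +[M] y:C"
  and "!!x y. x:C ==> y:C ==> th (x +[M] y) = th x +[N] th y" "th 0[M] = 0[N]"
 shows "lin_comb M f S q <= C & th ` lin_comb M f S q = lin_comb N (%z i. th (f z i)) S q"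
proof (induct q)
 case (Suc q)
 hence c: "!!u. u:lin_comb M f S q ==> u:C" and eq: "th ` lin_comb M f S q = lin_comb N (%z i. th (f z i)) S q" by auto
 have "th ` lin_comb M f S (Suc q) = {th u +[N] th (f z q) | u z. u:lin_comb M f S q & z:S}"
  using assms(1,4) c by(auto simp: image_iff) metis+
 also have "\<dots> = lin_comb N (%z i. th (f z i)) S (Suc q)" unfolding lin_comb.simps eq[symmetric] by blast
 finally show ?case using assms(1,3) c by auto
qed (use assms in auto)

context fd_alg
begin

text \<open>The axioms are checked on preimages in a subspace with its own identity
  \<open>u\<close>. With a corner as the subspace this yields endomorphism algebras, with the whole
  algebra it yields quotients.\<close>

lemma image_fd_algebra:
 fixes E :: "('k, 'b) module"
 assumes C: "vsA.subspace C" "u:C" "!!x y. x:C ==> y:C ==> x**y:C"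
   "!!x. x:C ==> u**x = x" "!!x. x:C ==> x**u = x"
  and th: "th ` C = car E" "!!x y. x:C ==> y:C ==> th (x+.y) = th x +[E] th y"
   "!!x y. x:C ==> y:C ==> th (x**y) = th x **[E] th y"
   "!!k x. k:car K ==> x:C ==> th (k \<odot> x) = k \<odot>\<^bsub>E\<^esub> th x" "th u = 1[E]" "th \<zero> = 0[E]"
 shows "fd_algebra K E"
proof -
 note D = vsA.subspaceD[OF C(1)]
 have c: "x:car A" if "x:C" for x using D(1) that by blast
 note ops = th(2-4)[symmetric]
 have ab: "abelian_group E"
 proof (rule abelian_groupI)
  show "EX y:car E. y +[E] x = 0[E]" if "x:car E" for x
  proof -
   obtain a where a: "a:C" "x = th a" using \<open>x:car E\<close> th(1) by blast
   have "th (\<ominus> a) +[E] x = 0[E]" using a D(5)[OF a(1)] c by(simp add: ops A.l_neg th(6))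
   thus ?thesis using D(5)[OF a(1)] th(1) by blast
  qed
 qed (use D(2,3) c in \<open>auto simp: th(1)[symmetric] ops th(6)[symmetric] A.a_ac\<close>)
 have ri: "ring E"
  by(rule ringI[OF ab monoidI])
   (use C D(2,3) c in \<open>auto simp: th(1)[symmetric] ops th(5)[symmetric] A.m_assoc A.l_distr A.r_distr\<close>)
 have mo: "module K E"
  by(rule moduleI[OF F.cring_axioms ab])
   (use D(2-4) c in \<open>auto simp: th(1)[symmetric] ops smult_l_distr smult_r_distr smult_assoc1\<close>)
 have vs: "vector_space_on K E (smult E)"
 proof -
  interpret M: module K E by(rule mo)
  show ?thesis
   by unfold_locales (auto simp: M.smult_l_distr M.smult_r_distr M.smult_assoc1)
 qed
 interpret V: vector_space_on K E "smult E" by(rule vs)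
 obtain b d where b: "range b <= C" "C = vsA.span b d" using vsA.subspace_span_ex[OF fin_dim_A C(1)] by blast
 have "b i:C" for i using b(1) by blast
 hence kb: "k \<odot> b i:C" if "k:car K" for k i using D(4) that by blast
 have "th ` vsA.span b d = lin_comb E (%k i. th (k \<odot> b i)) (car K) d"
  by(rule conjunct2[OF lin_comb_image[of _ _ C]]) (use kb D(2,3) th(2,6) in auto)
 also have "\<dots> = V.span (%i. th (b i)) d" by(rule lin_comb_cong) (use b(1) th(4) in auto)
 finally have "V.fin_dim" unfolding V.fin_dim_def
  using b th(1) by(intro exI[of _ "%i. th (b i)"] exI[of _ d]) auto
 note fin = V.fin_dim_combination[OF this]
 show ?thesis
  unfolding fd_algebra_def fd_algebra_axioms_def
  using mo F.field_axioms ri fin D(4) c C(3) by(auto simp: th(1)[symmetric] ops smult_mult)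
qed

text \<open>The map sending \<open>b\<close> to the functional with values \<open>l (b x)\<close> is
  injective by the first nondegeneracy. By the second, the functionals obtained from a spanning
  family of \<open>A\<close> have only 0 as a common zero, so the map is onto the dual.\<close>

lemma frobenius_algebraI:
 assumes l: "vsA.functional l"
  and r: "!!b. b:car A ==> ALL x:car A. l (b**x) = 0[K] ==> b = \<zero>"
  and s: "!!b. b:car A ==> ALL x:car A. l (x**b) = 0[K] ==> b = \<zero>"
 shows "frobenius_algebra K A"
proof -
 let ?D = "dual K A (regular (op_algebra A))"
 define w where "w b = (\<lambda>x\<in>car A. l (b**x))" for b
 have lD: "!!x. x:car A ==> l x:car K"
  "!!x y. x:car A ==> y:car A ==> l (x+.y) = l x +[K] l y"
  "!!k x. k:car K ==> x:car A ==> l (k \<odot> x) = k **[K] l x"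
  using l unfolding vsA.functional_def by auto
 have l0: "l \<zero> = 0[K]" using lD(3)[of "0[K]" \<zero>] lD(1)[of \<zero>] by simp
 have ks: "kscale A (regular (op_algebra A)) k x = k \<odot> x" if "k:car K" "x:car A" for k x
  using that by(simp add: kscale_def smult_mult)
 have Dc: "f:car ?D <-> f:extensional (car A) & vsA.functional f" for f
  unfolding vsA.functional_def by(auto simp: dual_def ks PiE_def)
 have wf: "vsA.functional (w b)" if "b:car A" for b
  unfolding vsA.functional_def using that lD by(auto simp: w_def A.r_distr smult_mult)
 have W: "w:mod_hom A (regular A) ?D"
 proof (rule mod_homI)
  fix x assume "x:car (regular A)"
  thus "w x:car ?D" unfolding Dc using wf by(simp add: w_def)
 next
  fix x y assume "x:car (regular A)" "y:car (regular A)"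
  thus "w (x +[regular A] y) = w x +[?D] w y"
   by(auto simp: w_def dual_def A.l_distr lD intro!: restrict_ext)
 next
  fix x a assume "x:car (regular A)" "a:car A"
  thus "w (x *[regular A] a) = w x *[?D] a"
   by(auto simp: w_def dual_def A.m_assoc intro!: restrict_ext)
 qed
 have inj: "inj_on w (car A)"
 proof (rule inj_onI)
  fix b c assume bc: "b:car A" "c:car A" "w b = w c"
  have "l ((b-.c)**x) = 0[K]" if x: "x:car A" for x
  proof -
   have "l (b**x) = l (c**x)" using fun_cong[OF bc(3), of x] x by(simp add: w_def)
   moreover have "l (b**x) = l ((b-.c)**x) +[K] l (c**x)"
    using bc x lD(2)[of "(b-.c)**x" "c**x"] by(simp add: A.diff_add_cancel flip: A.l_distr)
   ultimately show ?thesis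
    using lD(1)[of "(b-.c)**x"] lD(1)[of "c**x"] bc x by(simp add: F.add.r_cancel_one')
  qed
  hence "b-.c = \<zero>" using r[of "b-.c"] bc by simp
  thus "b = c" using bc by(simp add: A.diff_eq_zero_iff)
 qed
 have "w ` car A = car ?D"
 proof
  show "w ` car A <= car ?D" using mod_homD(1)[OF W] by auto
  obtain b d where b: "range b <= car A" "car A = vsA.span b d" using fin_dim_A unfolding vsA.fin_dim_def by blast
  show "car ?D <= w ` car A"
  proof
   fix f assume f: "f:car ?D"
   have bc: "b i:car A" for i using b(1) by blast
   have "EX v:w ` car A. ALL x:car A. f x = v x"
   proof (rule vsA.functional_in_dual_span[where f = "%i. w (b i)" and q = d])
    show "vsA.functional v" if "v:w ` car A" for v using that wf by blast
    show "EX u:w ` car A. ALL x:car A. u x = v x +[K] v' x" if vv: "v:w ` car A" "v':w ` car A" for v v'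
    proof -
     obtain p q where "p:car A" "q:car A" "v = w p" "v' = w q" using vv by blast
     thus ?thesis by(intro bexI[of _ "w (p+.q)"]) (auto simp: w_def A.l_distr lD)
    qed
    show "EX u:w ` car A. ALL x:car A. u x = k **[K] v x" if kv: "k:car K" "v:w ` car A" for k v
    proof -
     obtain p where "p:car A" "v = w p" using kv by blast
     thus ?thesis using kv(1) by(intro bexI[of _ "w (k \<odot> p)"]) (auto simp: w_def smult_mult lD)
    qed
    show "EX u:w ` car A. ALL x:car A. u x = 0[K]" by(intro bexI[of _ "w \<zero>"]) (auto simp: w_def l0)
    show "w (b i):w ` car A" for i using bc by blast
    show "vsA.functional f" using f Dc by blast
    fix x assume x: "x:car A" and z: "!!i. i < d ==> w (b i) x = 0[K]"
    have "vsA.span b d <= {y:car A. l (y**x) = 0[K]}"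
    proof -
     have "vsA.span b q <= {y:car A. l (y**x) = 0[K]}" if "q <= d" for q using that
     proof (induct q)
      case (Suc q)
      have "l (b q**x) = 0[K]" using z[of q] Suc(2) x by(simp add: w_def)
      thus ?case using Suc bc x by(auto simp: A.l_distr smult_mult lD)
     qed (use l0 x in auto)
     thus ?thesis by blast
    qed
    hence "x = \<zero>" using s[OF x] b(2) by blast
    moreover have "f \<zero> = 0[K]"
    proof -
     have "vsA.functional f" using f Dc by blast
     hence fk: "f:car A \<rightarrow> car K" "ALL k:car K. ALL x:car A. f (k \<odot> x) = k **[K] f x"
      unfolding vsA.functional_def by blast+
     have "f (0[K] \<odot> \<zero>) = 0[K] **[K] f \<zero>" by(rule fk(2)[rule_format]) simp_all
     moreover have "f \<zero>:car K" using fk(1) by auto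
     ultimately show ?thesis by simp
    qed
    ultimately show "f x = 0[K]" by simp
   qed
   then obtain p where p: "p:car A" "ALL x:car A. f x = w p x" by blast
   have "f = w p"
   proof
    fix x show "f x = w p x" using p f Dc[of f] by(cases "x:car A") (auto simp: w_def extensional_def)
   qed
   thus "f:w ` car A" using p(1) by blast
  qed
 qed
 hence "mod_iso A (regular A) ?D" unfolding mod_iso_def bij_betw_def using W inj by auto
 thus ?thesis unfolding frobenius_algebra_def using fd mod_iso_sym[OF rreg] by blast
qed

lemma dual_functional:
 assumes M: "right_module (op_algebra A) M"
 shows "f:car (dual K A M) <-> f:extensional (car M) &
  vector_space_on.functional K M (kscale A M) f"
proof -
 interpret O: fd_alg K "op_algebra A" by(rule fd_algI[OF op_fd_algebra[OF fd]])
 have "kscale (op_algebra A) M = kscale A M" by(simp add: kscale_def fun_eq_iff)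
 then interpret V: vector_space_on K M "kscale A M" using O.vs_module[OF M] by simp
 show ?thesis unfolding V.functional_def by(auto simp: dual_def PiE_def)
qed

text \<open>The scalar action is written out pointwise, which makes
  \<open>functional_in_dual_span\<close> applicable to functionals on the dual.\<close>

lemma dual_vector_space:
 assumes M: "right_module (op_algebra A) M"
 shows "vector_space_on K (dual K A M) (%k f. \<lambda>x\<in>car M. k **[K] f x)"
proof -
 interpret O: fd_alg K "op_algebra A" by(rule fd_algI[OF op_fd_algebra[OF fd]])
 have "kscale (op_algebra A) M = kscale A M" by(simp add: kscale_def fun_eq_iff)
 then interpret V: vector_space_on K M "kscale A M" using O.vs_module[OF M] by simp
 have fD: "f x:car K" if "f:car (dual K A M)" "x:car M" for f x
  using that by(auto simp: dual_def)
 have fe: "(\<lambda>x\<in>car M. f x) = f" if "f:car (dual K A M)" for f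
  using that by(auto simp: dual_def intro: PiE_restrict)
 have di: "(\<lambda>x\<in>car M. g x):car (dual K A M)" if "V.functional g" for g
  using that unfolding dual_functional[OF M] V.functional_def by auto
 have func: "V.functional f" if "f:car (dual K A M)" for f using that dual_functional[OF M] by blast
 have fa: "V.functional (%x. f x +[K] g x)" if "f:car (dual K A M)" "g:car (dual K A M)" for f g
  using func[OF that(1)] func[OF that(2)] unfolding V.functional_def by(auto simp: F.a_ac F.r_distr Pi_iff)
 have fs: "V.functional (%x. k **[K] f x)" if "k:car K" "f:car (dual K A M)" for k f
  using func[OF that(2)] that(1) unfolding V.functional_def by(auto simp: F.m_ac F.r_distr Pi_iff)
 have f0: "V.functional (%x. 0[K])" unfolding V.functional_def by auto
 have add: "f +[dual K A M] g = (\<lambda>x\<in>car M. f x +[K] g x)" for f g by(simp add: dual_def)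
 have zero: "0[dual K A M] = (\<lambda>x\<in>car M. 0[K])" by(simp add: dual_def)
 have ab: "abelian_group (dual K A M)"
 proof (rule abelian_groupI)
  fix f assume f: "f:car (dual K A M)"
  show "0[dual K A M] \<oplus>\<^bsub>dual K A M\<^esub> f = f"
   unfolding add zero by(subst (2) fe[OF f, symmetric], rule restrict_ext) (use fD[OF f] in simp)
  have "(\<lambda>x\<in>car M. (\<ominus>\<^bsub>K\<^esub> 1[K]) **[K] f x) +[dual K A M] f = 0[dual K A M]"
   unfolding add zero by(rule restrict_ext) (use fD[OF f] in \<open>simp add: F.l_minus F.l_neg\<close>)
  moreover have "(\<lambda>x\<in>car M. (\<ominus>\<^bsub>K\<^esub> 1[K]) **[K] f x):car (dual K A M)" by(rule di[OF fs[OF _ f]]) simp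
  ultimately show "EX g:car (dual K A M). g +[dual K A M] f = 0[dual K A M]" by blast
  fix g assume g: "g:car (dual K A M)"
  show "f +[dual K A M] g:car (dual K A M)" unfolding add by(rule di[OF fa[OF f g]])
  show "f +[dual K A M] g = g +[dual K A M] f"
   unfolding add by(rule restrict_ext) (use fD[OF f] fD[OF g] in \<open>simp add: F.a_comm\<close>)
  fix h assume h: "h:car (dual K A M)"
  show "f +[dual K A M] g +[dual K A M] h = f +[dual K A M] (g +[dual K A M] h)"
   unfolding add by(rule restrict_ext) (use fD[OF f] fD[OF g] fD[OF h] in \<open>simp add: F.a_assoc\<close>)
 qed (simp add: zero di[OF f0])
 show ?thesis
 proof (intro vector_space_on.intro vector_space_on_axioms.intro F.field_axioms ab)
  fix k f assume k: "k:car K" and f: "f:car (dual K A M)"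
  show "(\<lambda>x\<in>car M. k **[K] f x):car (dual K A M)" by(rule di[OF fs[OF k f]])
  show "(\<lambda>x\<in>car M. (k **[K] l) **[K] f x) = (\<lambda>x\<in>car M. k **[K] (\<lambda>x\<in>car M. l **[K] f x) x)" if "l:car K" for l
   by(rule restrict_ext) (use k that fD[OF f] in \<open>simp add: F.m_assoc\<close>)
  show "(\<lambda>x\<in>car M. (k +[K] l) **[K] f x) =
   (\<lambda>x\<in>car M. k **[K] f x) +[dual K A M] (\<lambda>x\<in>car M. l **[K] f x)" if "l:car K" for l
   unfolding add by(rule restrict_ext) (use k that fD[OF f] in \<open>simp add: F.l_distr\<close>)
  show "(\<lambda>x\<in>car M. k **[K] (f +[dual K A M] g) x) =
   (\<lambda>x\<in>car M. k **[K] f x) +[dual K A M] (\<lambda>x\<in>car M. k **[K] g x)" if g: "g:car (dual K A M)" for g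
   unfolding add by(rule restrict_ext) (use k fD[OF f] fD[OF g] in \<open>simp add: F.r_distr\<close>)
 next
  fix f assume f: "f:car (dual K A M)"
  show "(\<lambda>x\<in>car M. 1[K] **[K] f x) = f"
   by(subst (2) fe[OF f, symmetric], rule restrict_ext) (use fD[OF f] in simp)
 qed
qed

end

section \<open>Transfer of Frobenius forms to endomorphism algebras\<close>

context fd_quot
begin

text \<open>\<open>E\<close> and the corner of \<open>B\<close> at \<open>phi u\<close> are images
  of \<open>u A u\<close> with the same kernel; the form is transferred through common preimages
  instead of an explicit isomorphism.\<close>

lemma frobenius_of_corner_image:
 fixes E :: "('k, 'c) module"
 assumes u: "corner_alg K A u" and V: "corner_alg K B (phi u)" and l: "corner_alg.frobenius_form K B (phi u) l"
  and th: "th ` corner A u = car E"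
   "!!x y. x:corner A u ==> y:corner A u ==> th (x+.y) = th x +[E] th y"
   "!!x y. x:corner A u ==> y:corner A u ==> th (x**y) = th x **[E] th y"
   "!!k x. k:car K ==> x:corner A u ==> th (k \<odot> x) = k \<odot>\<^bsub>E\<^esub> th x"
   "th u = 1[E]" "th \<zero> = 0[E]"
  and ker: "!!x. x:corner A u ==> th x = 0[E] <-> x:ker"
 shows "frobenius_algebra K E"
proof -
 interpret U: corner_alg K A u by(rule u)
 interpret V: corner_alg K B "phi u" by(rule V)
 have fdE: "fd_algebra K E"
  by(rule A.image_fd_algebra[OF U.G_subspace U.e(4) U.G_mult U.G_e th])
 interpret E: fd_alg K E by(rule fd_algI[OF fdE])
 have lf: "B.vsA.functional l" and nr: "!!b. b:V.Gam ==> ALL x:V.Gam. l (b **[B] x) = 0[K] ==> b = 0[B]"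
  and nl: "!!b. b:V.Gam ==> ALL x:V.Gam. l (x **[B] b) = 0[K] ==> b = 0[B]"
  using l unfolding V.frobenius_form_def by blast+
 note Gc = U.G_carrier
 have thc: "th x:car E" if "x:U.Gam" for x using th(1) that by blast
 define pre where "pre = inv_into U.Gam th"
 have pre: "pre h:U.Gam" "th (pre h) = h" if "h:car E" for h
 proof -
  have "h:th ` U.Gam" using that th(1) by simp
  thus "pre h:U.Gam" "th (pre h) = h" unfolding pre_def by(rule inv_into_into, rule f_inv_into_f)
 qed
 define l' where "l' h = l (phi (pre h))" for h
 \<comment> \<open>The preimage chosen by \<open>pre\<close> does not matter, since it differs from
   \<open>x\<close> by an element of \<open>ker\<close>.\<close>
 have key: "l' (th x) = l (phi x)" if x: "x:U.Gam" for x
 proof -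
  note p = pre[OF thc[OF x]]
  have d: "pre (th x)-.x:U.Gam" by(rule U.G_diff[OF p(1) x])
  have "th ((pre (th x)-.x)+.x) = th (pre (th x)-.x) +[E] th x" by(rule th(2)[OF d x])
  hence "th x = th (pre (th x)-.x) +[E] th x" using p Gc[OF p(1)] Gc[OF x] by(simp add: A.A.diff_add_cancel)
  hence "th (pre (th x)-.x) = 0[E]" using thc[OF d] thc[OF x] by(simp add: E.A.add.r_cancel_one)
  hence "pre (th x)-.x:ker" using ker[OF d] by simp
  thus ?thesis using phi_eq_iff[OF Gc[OF p(1)] Gc[OF x]] by(simp add: l'_def)
 qed
 have surjE: "EX x:U.Gam. h = th x" if "h:car E" for h using pre[OF that] by metis
 have lfD: "l x:car K" "l (x +[B] y) = l x +[K] l y" "k:car K ==> l (k \<odot>\<^bsub>B\<^esub> x) = k **[K] l x"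
  if "x:car B" "y:car B" for x y k using lf that unfolding B.vsA.functional_def by auto
 have "E.vsA.functional l'"
  unfolding E.vsA.functional_def
 proof (intro conjI ballI)
  show "l':car E \<rightarrow> car K" 
  proof (rule Pi_I)
   fix h assume "h:car E"
   then obtain x where x: "x:U.Gam" "h = th x" using surjE by blast
   have "phi x:car B" using Gc[OF x(1)] by simp
   thus "l' h:car K" using lfD(1)[of "phi x" "phi x"] key[OF x(1)] x(2) by simp
  qed
  fix h assume "h:car E"
  then obtain x where x: "x:U.Gam" "h = th x" using surjE by blast
  show "l' (h +[E] h') = l' h +[K] l' h'" if "h':car E" for h'
  proof -
   obtain y where y: "y:U.Gam" "h' = th y" using surjE \<open>h':car E\<close> by blast
   have "l' (h +[E] h') = l (phi (x+.y))" using x y th(2)[OF x(1) y(1)] key[OF U.G_add[OF x(1) y(1)]] by simp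
   thus ?thesis using x(2) y(2) key[OF x(1)] key[OF y(1)] Gc[OF x(1)] Gc[OF y(1)] lfD(2)[of "phi x" "phi y"] by(simp add: phi_add)
  qed
  show "l' (k \<odot>\<^bsub>E\<^esub> h) = k **[K] l' h" if k: "k:car K" for k
   using x k th(4)[OF k x(1)] key[OF U.G_smult[OF k x(1)]] key[OF x(1)] lfD(3)[of "phi x" "phi x" k] Gc[OF x(1)] by(simp add: klin)
 qed
 moreover have "b = 0[E]" if b: "b:car E" and z: "ALL x:car E. l' (b **[E] x) = 0[K]" for b
 proof -
  obtain p where p: "p:U.Gam" "b = th p" using surjE[OF b] by blast
  have "l (phi p **[B] y) = 0[K]" if yV: "y:V.Gam" for y
  proof -
   obtain q where q: "q:U.Gam" "y = phi q" using corner_push_surj[OF U.e(1,2) yV] by blast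
   have "l (phi p **[B] y) = l' (b **[E] th q)"
    using key[OF U.G_mult[OF p(1) q(1)]] th(3)[OF p(1) q(1)] p q Gc by(simp add: phi_mult)
   thus ?thesis using z thc[OF q(1)] by simp
  qed
  hence "phi p = 0[B]" by(intro nr[OF corner_push[OF U.e(1) p(1)]]) blast
  thus ?thesis using ker[OF p(1)] p Gc[OF p(1)] by(simp add: ker_def)
 qed
 moreover have "b = 0[E]" if b: "b:car E" and z: "ALL x:car E. l' (x **[E] b) = 0[K]" for b
 proof -
  obtain p where p: "p:U.Gam" "b = th p" using surjE[OF b] by blast
  have "l (y **[B] phi p) = 0[K]" if yV: "y:V.Gam" for y
  proof -
   obtain q where q: "q:U.Gam" "y = phi q" using corner_push_surj[OF U.e(1,2) yV] by blast
   have "l (y **[B] phi p) = l' (th q **[E] b)"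
    using key[OF U.G_mult[OF q(1) p(1)]] th(3)[OF q(1) p(1)] p q Gc by(simp add: phi_mult)
   thus ?thesis using z thc[OF q(1)] by simp
  qed
  hence "phi p = 0[B]" by(intro nl[OF corner_push[OF U.e(1) p(1)]]) blast
  thus ?thesis using ker[OF p(1)] p Gc[OF p(1)] by(simp add: ker_def)
 qed
 ultimately show ?thesis by(rule E.frobenius_algebraI)
qed

end

context corner_alg
begin

text \<open>An endomorphism is determined by the image of \<open>v = v e\<close>. This lies in
  \<open>M e\<close>, so it is \<open>v g\<close> for some \<open>g\<close> in the corner, unique
  modulo \<open>I\<close>.\<close>

lemma cyclic_end:
 assumes M: "right_module A M" and v: "cyclic_gen M v {a:car A. e**a:I}" and I: "ideal I A"
 obtains th where "th ` Gam = car (end_algebra A M)"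
  "!!g a. g:Gam ==> a:car A ==> th g (v *[M] a) = v *[M] (g**a)"
  "!!g. g:Gam ==> v *[M] g = 0[M] <-> g:I"
  "!!w. w:car M ==> EX g:Gam. w *[M] e = v *[M] g"
  "!!a. a:car A ==> v *[M] (e**a) = v *[M] a"
proof -
 interpret M: right_module A M by(rule M)
 interpret I: ideal I A by(rule I)
 have vc: "v:car M" and vz: "!!a. a:car A ==> v *[M] a = 0[M] <-> e**a:I"
  and vg: "!!q. q:car M ==> EX a:car A. q = v *[M] a"
  using v unfolding cyclic_gen_def by auto
 have ve: "v *[M] (e**a) = v *[M] a" if a: "a:car A" for a
 proof -
  have "e**(a-.e**a) = \<zero>"
   using a e by(simp add: a_minus_def A.r_distr A.r_minus A.r_neg flip: A.m_assoc)
  hence "v *[M] (a-.e**a) = 0[M]" using vz[of "a-.e**a"] a e(1) I.zero_closed by simp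
  thus ?thesis using a e(1) vc M.ract_closed by(simp add: M.ract_diff_right M.M.diff_eq_zero_iff)
 qed
 have ex: "EX h:mod_hom A M M. ALL a:car A. h (v *[M] a) = v *[M] (g**a)" if g: "g:Gam" for g
 proof -
  have gc: "g:car A" "e**g = g" "g**e = g" using G_carrier[OF g] G_e[OF g] by auto
  have "EX h:mod_hom A M M. ALL a:car (regular A). h (v *[M] a) = (v *[M] g) *[M] a"
  proof (rule mod_hom_factor[OF rreg M M cyclic_gen_map[OF M vc] _ cyclic_gen_map[OF M M.ract_closed[OF vc gc(1)]]])
   show "(%a. v *[M] a) ` car (regular A) = car M" using vg M.ract_closed[OF vc] by auto
   fix a assume "a:car (regular A)" "v *[M] a = 0[M]"
   hence a: "a:car A" "e**a:I" using vz by auto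
   have "g**(e**a):I" by(rule I.I_l_closed[OF a(2) gc(1)])
   hence "e**(g**a):I" using gc a(1) e(1) by(simp flip: A.m_assoc)
   hence "v *[M] (g**a) = 0[M]" using vz[of "g**a"] gc a by simp
   thus "(v *[M] g) *[M] a = 0[M]" using M.ract_assoc[OF vc gc(1) a(1)] by simp
  qed
  thus ?thesis using M.ract_assoc[OF vc gc(1)] by auto
 qed
 define Q where "Q g h <-> h:mod_hom A M M & (ALL a:car A. h (v *[M] a) = v *[M] (g**a))" for g h
 define th where "th g = restrict (SOME h. Q g h) (car M)" for g
 have th: "th g:car (end_algebra A M)" "ALL a:car A. th g (v *[M] a) = v *[M] (g**a)" if g: "g:Gam" for g
 proof -
  let ?h = "SOME h. Q g h"
  have "EX h. Q g h" using ex[OF g] unfolding Q_def by blast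
  hence "Q g ?h" by(rule someI_ex)
  hence h: "?h:mod_hom A M M & (ALL a:car A. ?h (v *[M] a) = v *[M] (g**a))"
   unfolding Q_def .
  note hD = mod_homD[OF conjunct1[OF h]]
  have "restrict ?h (car M):mod_hom A M M"
   by(rule mod_homI) (use hD M.ract_closed in auto)
  thus "th g:car (end_algebra A M)" by(simp add: th_def end_algebra_def)
  show "ALL a:car A. th g (v *[M] a) = v *[M] (g**a)" using h M.ract_closed[OF vc] by(simp add: th_def)
 qed
 have part4: "EX g:Gam. w *[M] e = v *[M] g" if w: "w:car M" for w
 proof -
  obtain b where b: "b:car A" "w = v *[M] b" using vg[OF w] by blast
  have "w *[M] e = v *[M] (e**(b**e))" using b ve[of "b**e"] M.ract_assoc[OF vc b(1) e(1)] e(1) by simp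
  also have "e**(b**e) = e**b**e" using b(1) e(1) by(simp add: A.m_assoc)
  finally show ?thesis using G_corner[OF b(1)] by blast
 qed
 show ?thesis
 proof (rule that[of th])
  show "th ` Gam = car (end_algebra A M)"
  proof
   show "th ` Gam <= car (end_algebra A M)" using th(1) by blast
   show "car (end_algebra A M) <= th ` Gam"
   proof
    fix h assume h: "h:car (end_algebra A M)"
    hence hm: "h:mod_hom A M M" and he: "h:extensional (car M)" by(auto simp: end_algebra_def)
    have v1: "v *[M] e = v" using ve[of \<one>] e(1) M.ract_one[OF vc] by simp
    have "h v *[M] e = h v" using mod_homD(3)[OF hm vc e(1)] v1 by simp
    then obtain g where g: "g:Gam" "h v = v *[M] g" using part4[OF mod_homD(1)[OF hm vc]] by auto
    have "h x = th g x" for x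
    proof (cases "x:car M")
     case True
     then obtain a where a: "a:car A" "x = v *[M] a" using vg by blast
     have "h x = v *[M] g *[M] a" using mod_homD(3)[OF hm vc a(1)] a(2) g(2) by simp
     thus ?thesis using th(2)[OF g(1)] a M.ract_assoc[OF vc G_carrier[OF g(1)] a(1)] by simp
    next
     case False
     thus ?thesis using he th(1)[OF g(1)] by(simp add: end_algebra_def extensional_def)
    qed
    hence "h = th g" by(rule ext)
    thus "h:th ` Gam" using g(1) by blast
   qed
  qed
  show "th g (v *[M] a) = v *[M] (g**a)" if "g:Gam" "a:car A" for g a using th(2)[OF that(1)] that(2) by blast
  show "v *[M] g = 0[M] <-> g:I" if "g:Gam" for g using vz[OF G_carrier[OF that]] G_e(1)[OF that] by simp
 qed (rule part4 ve; assumption)+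
qed

end

context fd_quot
begin

text \<open>By \<open>cyclic_end\<close> the endomorphism algebra is the corner \<open>u A u\<close>
  modulo \<open>ker\<close>, that is, the corner of \<open>B\<close>.\<close>

lemma frobenius_end:
 assumes u: "corner_alg K A u" and V: "corner_alg K B (phi u)" and l: "corner_alg.frobenius_form K B (phi u) l"
  and M: "right_module A M" and v: "A.cyclic_gen M v {a:car A. u**a:ker}" and I: "ideal ker A"
 shows "frobenius_algebra K (end_algebra A M)"
proof -
 interpret U: corner_alg K A u by(rule u)
 interpret M: right_module A M by(rule M)
 obtain th where th: "th ` U.Gam = car (end_algebra A M)"
  "!!g a. g:U.Gam ==> a:car A ==> th g (v *[M] a) = v *[M] (g**a)"
  "!!g. g:U.Gam ==> v *[M] g = 0[M] <-> g:ker"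
  "!!a. a:car A ==> v *[M] (u**a) = v *[M] a"
  using U.cyclic_end[OF M v I] by metis
 have vc: "v:car M" and vg: "!!q. q:car M ==> EX a:car A. q = v *[M] a"
  using v unfolding A.cyclic_gen_def by auto
 have the: "th g:extensional (car M)" if "g:U.Gam" for g
 proof -
  have "th g:car (end_algebra A M)" using th(1) that by blast
  thus ?thesis by(simp add: end_algebra_def)
 qed
 have eqI: "h = h'" if "h:extensional (car M)" "h':extensional (car M)"
  "!!a. a:car A ==> h (v *[M] a) = h' (v *[M] a)" for h h' :: "'c => 'c"
  by(rule extensionalityI[OF that(1,2)]) (use that(3) vg in blast)
 note vcl = M.ract_closed[OF vc]
 note Gc = U.G_carrier
 show ?thesis
 proof (rule frobenius_of_corner_image[OF u V l th(1)])
  fix x y assume x: "x:U.Gam" and y: "y:U.Gam"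
  show "th (x+.y) = th x +[end_algebra A M] th y"
   by(rule eqI[OF the[OF U.G_add[OF x y]]])
    (use vc vcl Gc[OF x] Gc[OF y] th(2)[OF U.G_add[OF x y]] th(2)[OF x] th(2)[OF y] in
     \<open>simp_all add: end_algebra_def A.A.l_distr M.ract_add_right\<close>)
  show "th (x**y) = th x **[end_algebra A M] th y"
   by(rule eqI[OF the[OF U.G_mult[OF x y]]])
    (use vcl Gc[OF x] Gc[OF y] th(2)[OF U.G_mult[OF x y]] th(2)[OF x] th(2)[OF y] in
     \<open>simp_all add: end_algebra_def compose_def A.A.m_assoc\<close>)
 next
  fix k x assume k: "k:car K" and x: "x:U.Gam"
  show "th (k \<odot> x) = k \<odot>\<^bsub>end_algebra A M\<^esub> th x"
   by(rule eqI[OF the[OF U.G_smult[OF k x]]])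
    (use vc vcl k Gc[OF x] th(2)[OF U.G_smult[OF k x]] th(2)[OF x] in
     \<open>simp_all add: end_algebra_def A.smult_mult A.kscale_ract(2)[OF M]\<close>)
 next
  show "th u = 1[end_algebra A M]"
  proof (rule eqI[OF the[OF U.e(4)]])
   fix a assume a: "a:car A"
   show "th u (v *[M] a) = 1[end_algebra A M] (v *[M] a)"
    using th(2)[OF U.e(4) a] th(4)[OF a] vcl[OF a] by(simp add: end_algebra_def)
  qed (simp add: end_algebra_def)
  show z: "th \<zero> = 0[end_algebra A M]"
   by(rule eqI[OF the[OF U.G_zero]]) (use vc vcl th(2)[OF U.G_zero] in \<open>simp_all add: end_algebra_def\<close>)
  fix x assume x: "x:U.Gam"
  show "th x = 0[end_algebra A M] <-> x:ker"
  proof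
   assume "th x = 0[end_algebra A M]"
   hence "th x (v *[M] u) = 0[M]" using vcl[OF U.e(1)] by(simp add: end_algebra_def)
   thus "x:ker" using th(2)[OF x U.e(1)] U.G_e(2)[OF x] th(3)[OF x] by simp
  next
   assume xk: "x:ker"
   show "th x = 0[end_algebra A M]"
   proof (rule eqI[OF the[OF x]])
    fix a assume a: "a:car A"
    have "v *[M] (x**a) = 0[M] *[M] a" using th(3)[OF x] xk M.ract_assoc[OF vc Gc[OF x] a] by simp
    thus "th x (v *[M] a) = 0[end_algebra A M] (v *[M] a)"
     using th(2)[OF x a] vcl[OF a] a by(simp add: end_algebra_def)
   qed (simp add: end_algebra_def)
  qed
 qed
qed

end

section \<open>Endomorphisms of dual modules\<close>

context fd_quot
begin

text \<open>Precomposition with an endomorphism of the left module \<open>M\<close> is an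
  endomorphism of its dual. Both \<open>h\<close> and precomposition reverse products, so
  \<open>th\<close> preserves them; it is onto because a finite dimensional space is its own double
  dual.\<close>

lemma frobenius_end_dual:
 assumes u: "corner_alg K A u" and V: "corner_alg K B (phi u)" and l: "corner_alg.frobenius_form K B (phi u) l"
  and M: "fg_module (op_algebra A) M" and v: "fd_alg.cyclic_gen (op_algebra A) M v {a:car A. a**u:ker}"
  and I: "ideal ker A"
 shows "frobenius_algebra K (end_algebra A (dual K A M))"
proof -
 interpret U: corner_alg K A u by(rule u)
 interpret L: corner_alg K "op_algebra A" u by(rule U.op_corner_alg)
 have rM: "right_module (op_algebra A) M" by(rule L.fg_right_module[OF M])
 interpret M: right_module "op_algebra A" M by(rule rM)
 let ?D = "dual K A M" and ?E = "end_algebra A (dual K A M)"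
 have ks: "kscale (op_algebra A) M = kscale A M" by(simp add: kscale_def fun_eq_iff)
 interpret VM: vector_space_on K M "kscale A M" using L.vs_module[OF rM] ks by simp
 interpret VD: vector_space_on K ?D "%k f. \<lambda>x\<in>car M. k **[K] f x" by(rule A.dual_vector_space[OF rM])
 have fin: "VM.fin_dim" using M ks unfolding L.fg_module_iff by simp
 have v': "L.cyclic_gen M v {a:car (op_algebra A). u **[op_algebra A] a:ker}" using v by simp
 have vc: "v:car M" and vg: "!!q. q:car M ==> EX a:car A. q = v *[M] a"
  using v unfolding L.cyclic_gen_def by auto
 obtain h where hE: "h ` U.Gam = car (end_algebra (op_algebra A) M)"
  and hv: "!!g a. g:U.Gam ==> a:car A ==> h g (v *[M] a) = v *[M] (a**g)"
  and hk: "!!g. g:U.Gam ==> v *[M] g = 0[M] <-> g:ker"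
  and hw: "!!w. w:car M ==> EX g:U.Gam. w *[M] u = v *[M] g"
  and hu: "!!a. a:car A ==> v *[M] (a**u) = v *[M] a"
  by(rule L.cyclic_end[OF rM v' op_ideal[OF A.A.ring_axioms I]]) (rule that; simp)
 note act = M.ract_closed[simplified] and assoc = M.ract_assoc[simplified]
 note vcl = act[OF vc] and Gc = U.G_carrier
 have hm: "h g:mod_hom (op_algebra A) M M" if "g:U.Gam" for g
 proof -
  have "h g:car (end_algebra (op_algebra A) M)" using hE that by blast
  thus ?thesis by(simp add: end_algebra_def)
 qed
 note hD = mod_homD[OF hm, simplified]
 have hs: "h g (kscale A M k x) = kscale A M k (h g x)" if "g:U.Gam" "k:car K" "x:car M" for g k x
  using hD(3)[OF that(1,3), of "k \<odot> \<one>"] that(2) by(simp add: kscale_def)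
 have Dc: "f:car ?D <-> f:extensional (car M) & VM.functional f" for f by(rule A.dual_functional[OF rM])
 have Dres: "(\<lambda>x\<in>car M. f x):car ?D" if "VM.functional f" for f
  using that unfolding Dc VM.functional_def by auto
 have DD: "x:car M ==> f x:car K" "x:car M ==> y:car M ==> f (x +[M] y) = f x +[K] f y"
  "k:car K ==> x:car M ==> f (kscale A M k x) = k **[K] f x" if "f:car ?D" for f x y k
  using that unfolding Dc VM.functional_def by auto
 have Dex: "(\<lambda>x\<in>car M. f x) = f" if "f:car ?D" for f using that Dc by(simp add: extensional_restrict)
 have D0: "f 0[M] = 0[K]" if f: "f:car ?D" for f
  using DD(3)[OF f, of "0[K]" "0[M]"] DD(1)[OF f, of "0[M]"] by simp
 have Dh: "(\<lambda>x\<in>car M. f (h g x)):car ?D" if f: "f:car ?D" and g: "g:U.Gam" for f g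
  by(rule Dres) (use DD[OF f] hD[OF g] hs[OF g] in \<open>auto simp: VM.functional_def\<close>)
 have ksa: "kscale A M k (x *[M] a) = kscale A M k x *[M] a" "kscale A M k (x *[M] a) = x *[M] (k \<odot> a)"
  if "k:car K" "x:car M" "a:car A" for k x a
  using L.kscale_ract[OF rM that(1,2)] that(3) ks by simp_all
 have Da: "(\<lambda>x\<in>car M. f (x *[M] a)):car ?D" if f: "f:car ?D" and a: "a:car A" for f a
  by(rule Dres) (use DD[OF f] a act M.ract_add_left ksa(1)[symmetric] in \<open>auto simp: VM.functional_def\<close>)
 have Dact: "f *[?D] a = (\<lambda>x\<in>car M. f (x *[M] a))" for f a by(simp add: dual_def)
 have Dadd: "f +[?D] f' = (\<lambda>x\<in>car M. f x +[K] f' x)" for f f' by(simp add: dual_def)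
 have Dzero: "0[?D] = (\<lambda>x\<in>car M. 0[K])" by(simp add: dual_def)
 have Dks: "kscale A ?D k f = (\<lambda>x\<in>car M. k **[K] f x)" if "f:car ?D" "k:car K" for f k
  unfolding kscale_def Dact by(rule restrict_ext) (use DD(3)[OF that(1,2)] in \<open>simp add: kscale_def\<close>)
 have hmc: "h g x:car M" if "g:U.Gam" "x:car M" for g x using hD(1) that .
 have hadd: "h (x+.y) m = h x m +[M] h y m" and hmul: "h (x**y) m = h y (h x m)"
  if x: "x:U.Gam" and y: "y:U.Gam" and m: "m:car M" for x y m
 proof -
  obtain a where a: "a:car A" "m = v *[M] a" using vg[OF m] by blast
  show "h (x+.y) m = h x m +[M] h y m"
   using hv[OF U.G_add[OF x y] a(1)] hv[OF x a(1)] hv[OF y a(1)] a Gc[OF x] Gc[OF y] M.ract_add_right[of v "a**x" "a**y"] vc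
   by(simp add: A.A.r_distr)
  show "h (x**y) m = h y (h x m)"
   using hv[OF U.G_mult[OF x y] a(1)] hv[OF x a(1)] hv[OF y, of "a**x"] a Gc[OF x] Gc[OF y] by(simp add: A.A.m_assoc)
 qed
 have hsm: "h (k \<odot> x) m = kscale A M k (h x m)" if k: "k:car K" and x: "x:U.Gam" and m: "m:car M" for k x m
 proof -
  obtain a where a: "a:car A" "m = v *[M] a" using vg[OF m] by blast
  thus ?thesis
   using hv[OF U.G_smult[OF k x] a(1)] hv[OF x a(1)] ksa(2)[OF k vc, of "a**x"] Gc[OF x] k by(simp add: A.smult_mult)
 qed
 define th where "th g = (\<lambda>f\<in>car ?D. \<lambda>x\<in>car M. f (h g x))" for g
 have thE: "th g:car ?E" if g: "g:U.Gam" for g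
 proof -
  have "th g:mod_hom A ?D ?D"
  proof (rule mod_homI)
   fix f f' assume f: "f:car ?D" "f':car ?D"
   have "f +[?D] f':car ?D" using VD.V.a_closed[OF f] .
   thus "th g (f +[?D] f') = th g f +[?D] th g f'"
    unfolding th_def using f hmc[OF g] by(auto simp: Dadd intro!: restrict_ext)
  next
   fix f a assume f: "f:car ?D" and a: "a:car A"
   show "th g (f *[?D] a) = th g f *[?D] a"
    unfolding th_def Dact using f Da[OF f a] a hmc[OF g] act hD(3)[OF g] by(auto intro!: restrict_ext)
  qed (use Dh[OF _ g] in \<open>simp add: th_def\<close>)
  thus ?thesis by(simp add: end_algebra_def th_def)
 qed
 have surj: "EX g:U.Gam. th g = F" if F: "F:car ?E" for F
 proof -
  have Fm: "F:mod_hom A ?D ?D" and Fe: "F:extensional (car ?D)" using F by(auto simp: end_algebra_def)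
  note FD = mod_homD[OF Fm]
  obtain b d where b: "range b <= car M" "car M = VM.span b d" using fin unfolding VM.fin_dim_def by blast
  have bc: "b i:car M" for i using b(1) by blast
  have Fs: "F (\<lambda>x\<in>car M. k **[K] f x) = (\<lambda>x\<in>car M. k **[K] F f x)" if k: "k:car K" and f: "f:car ?D" for k f
   using FD(3)[OF f, of "k \<odot> \<one>"] Dks[OF f k] Dks[OF FD(1)[OF f] k] k by(simp add: kscale_def)
  \<comment> \<open>Taking \<open>F f\<close> at the generator is a functional on the dual, hence
    evaluation at some \<open>w\<close> in \<open>M\<close>; the product \<open>w u\<close> then has
    the form \<open>v g\<close>.\<close>
  have gF: "VD.functional (%f. F f v)"
   unfolding VD.functional_def using FD(1,2) DD(1) vc Fs by(auto simp: Dadd)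
  have "EX w:(%w f. f w) ` car M. ALL f:car ?D. F f v = w f"
  proof (rule VD.functional_in_dual_span[where f = "%i f. f (b i)" and q = d, OF _ _ _ _ _ gF])
   show "VD.functional w" if "w:(%w f. f w) ` car M" for w
    using that DD(1) unfolding VD.functional_def by(auto simp: Dadd)
   show "EX t:(%w f. f w) ` car M. ALL f:car ?D. t f = p f +[K] q f"
    if pq: "p:(%w f. f w) ` car M" "q:(%w f. f w) ` car M" for p q
   proof -
    obtain x y where "x:car M" "y:car M" "p = (%f. f x)" "q = (%f. f y)" using pq by blast
    thus ?thesis using DD(2) by(intro bexI[OF _ imageI[of "x +[M] y"]]) auto
   qed
   show "EX t:(%w f. f w) ` car M. ALL f:car ?D. t f = k **[K] p f"
    if kp: "k:car K" "p:(%w f. f w) ` car M" for k p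
   proof -
    obtain x where "x:car M" "p = (%f. f x)" using kp by blast
    thus ?thesis using DD(3) kp(1) by(intro bexI[OF _ imageI[of "kscale A M k x"]]) auto
   qed
   show "EX t:(%w f. f w) ` car M. ALL f:car ?D. t f = 0[K]"
    using D0 by(intro bexI[OF _ imageI[of "0[M]"]]) auto
   show "(%f. f (b i)):(%w f. f w) ` car M" for i by(rule imageI[OF bc])
   fix f assume f: "f:car ?D" and z: "!!i. i < d ==> f (b i) = 0[K]"
   have "VM.span b q <= {y:car M. f y = 0[K]}" if "q <= d" for q using that
   proof (induct q)
    case (Suc q)
    thus ?case using z[of q] bc DD(2,3)[OF f] by auto
   qed (use D0[OF f] in auto)
   hence "VM.span b d <= {y:car M. f y = 0[K]}" by blast
   \<comment> \<open>Zero is written as a scalar multiple of \<open>f\<close> so that the linearity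
     \<open>Fs\<close> of \<open>F\<close> applies.\<close>
   hence "f x = 0[K] **[K] f x" if "x:car M" for x using b(2) that by auto
   hence "(\<lambda>x\<in>car M. 0[K] **[K] f x) = f" using Dex[OF f] by(metis (no_types, lifting) restrict_ext)
   hence "F f = (\<lambda>x\<in>car M. 0[K] **[K] F f x)" using Fs[OF A.F.zero_closed f] by simp
   hence "F f v = 0[K] **[K] F f v" using vc by(metis (no_types, lifting) restrict_apply')
   thus "F f v = 0[K]" using DD(1)[OF FD(1)[OF f] vc] by simp
  qed
  then obtain w where w: "w:car M" "!!f. f:car ?D ==> F f v = f w" by blast
  obtain g where g: "g:U.Gam" "w *[M] u = v *[M] g" using hw[OF w(1)] by blast
  have Fv: "F f (v *[M] a) = f (w *[M] a)" if f: "f:car ?D" and a: "a:car A" for f a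
   using FD(3)[OF f a] w(2)[OF Da[OF f a]] w(1) vc by(simp add: Dact)
  have eq: "F f x = f (h g x)" if f: "f:car ?D" and x: "x:car M" for f x
  proof -
   obtain a where a: "a:car A" "x = v *[M] a" using vg[OF x] by blast
   have au: "a**u:car A" using a(1) U.e(1) by simp
   have "F f x = F f (v *[M] (a**u))" using hu[OF a(1)] a(2) by simp
   also have "\<dots> = f (w *[M] (a**u))" by(rule Fv[OF f au])
   also have "w *[M] (a**u) = v *[M] (a**g)"
    using assoc[OF w(1) U.e(1) a(1)] assoc[OF vc Gc[OF g(1)] a(1)] g(2) by simp
   finally show ?thesis using hv[OF g(1) a(1)] a(2) by simp
  qed
  have "th g f = F f" for f
  proof (cases "f:car ?D")
   case True
   have "th g f = (\<lambda>x\<in>car M. F f x)" unfolding th_def using True eq[OF True] by(auto intro!: restrict_ext)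
   thus ?thesis using Dex[OF FD(1)[OF True]] by simp
  next
   case False thus ?thesis using Fe by(simp add: th_def extensional_def)
  qed
  thus ?thesis using g(1) by blast
 qed
 show ?thesis
 proof (rule frobenius_of_corner_image[OF u V l, of th])
  show "th ` U.Gam = car ?E" using thE surj by blast
  fix x y assume x: "x:U.Gam" and y: "y:U.Gam"
  have "th (x+.y) f = (th x +[?E] th y) f" for f
   using DD(2) hmc[OF x] hmc[OF y] hadd[OF x y]
   by(cases "f:car ?D") (auto simp: th_def end_algebra_def Dadd intro!: restrict_ext)
  thus "th (x+.y) = th x +[?E] th y" by(rule ext)
  have "th (x**y) f = (th x **[?E] th y) f" for f
   using hmc[OF x] hmul[OF x y] Dh[OF _ y, of f]
   by(cases "f:car ?D") (auto simp: th_def end_algebra_def compose_def intro!: restrict_ext)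
  thus "th (x**y) = th x **[?E] th y" by(rule ext)
 next
  fix k x assume k: "k:car K" and x: "x:U.Gam"
  have "th (k \<odot> x) f = (k \<odot>\<^bsub>?E\<^esub> th x) f" for f
  proof (cases "f:car ?D")
   case True
   thus ?thesis using Dks[OF Dh[OF True x] k] hsm[OF k x] DD(3)[OF True k] hmc[OF x]
    by(auto simp: th_def end_algebra_def intro!: restrict_ext)
  qed (simp add: th_def end_algebra_def)
  thus "th (k \<odot> x) = k \<odot>\<^bsub>?E\<^esub> th x" by(rule ext)
 next
  have h1: "h u m = m" if "m:car M" for m
  proof -
   obtain a where "a:car A" "m = v *[M] a" using vg[OF \<open>m:car M\<close>] by blast
   thus ?thesis using hv[OF U.e(4)] hu by simp
  qed
  have "th u f = 1[?E] f" for f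
  proof (cases "f:car ?D")
   case True
   have "(\<lambda>x\<in>car M. f (h u x)) = (\<lambda>x\<in>car M. f x)" by(rule restrict_ext) (simp add: h1)
   thus ?thesis using True Dex[OF True] by(simp add: th_def end_algebra_def)
  qed (simp add: th_def end_algebra_def)
  thus "th u = 1[?E]" by(rule ext)
  have zz: "th x = 0[?E]" if x: "x:U.Gam" "x:ker" for x
  proof -
   have h0: "h x m = 0[M]" if "m:car M" for m
   proof -
    obtain a where a: "a:car A" "m = v *[M] a" using vg[OF \<open>m:car M\<close>] by blast
    hence "h x m = v *[M] x *[M] a" using hv[OF x(1) a(1)] assoc[OF vc Gc[OF x(1)] a(1)] by simp
    thus ?thesis using hk[OF x(1)] x(2) a(1) by simp
   qed
   have "th x f = 0[?E] f" for f
    using h0 D0 by(cases "f:car ?D") (auto simp: th_def end_algebra_def Dzero intro!: restrict_ext)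
   thus ?thesis by(rule ext)
  qed
  show "th \<zero> = 0[?E]" by(rule zz[OF U.G_zero A.right_idealD(2)[OF ker_props(2)]])
  fix x assume x: "x:U.Gam"
  show "th x = 0[?E] <-> x:ker"
  proof
   assume z: "th x = 0[?E]"
   have "v *[M] x = 0[M]"
   proof (rule ccontr)
    assume n: "v *[M] x ~= 0[M]"
    then obtain f where f: "VM.functional f" "f (v *[M] x) ~= 0[K]"
     using VM.functional_separates[OF fin VM.subspace_zero vcl[OF Gc[OF x]]] by blast
    have "th x (\<lambda>m\<in>car M. f m) v = f (h x v)"
     using Dres[OF f(1)] vc hmc[OF x vc] by(simp add: th_def)
    moreover have "h x v = v *[M] x" using hv[OF x A.A.one_closed] M.ract_one[OF vc] Gc[OF x] by simp
    moreover have "th x (\<lambda>m\<in>car M. f m) v = 0[K]"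
     using z Dres[OF f(1)] vc by(simp add: end_algebra_def Dzero)
    ultimately show False using f(2) by simp
   qed
   thus "x:ker" using hk[OF x] by blast
  qed (rule zz[OF x])
 qed
qed

text \<open>Provides the surjection from one quotient of \<open>A\<close> onto a smaller one, along
  which the induction proceeds.\<close>

lemma fd_quot_factor:
 assumes C: "fd_quot K A C \<rho>" and k: "ker <= fd_quot.ker A C \<rho>"
 shows "EX \<tau>. fd_quot K B C \<tau> & (ALL a:car A. \<tau> (phi a) = \<rho> a)"
proof -
 interpret C: fd_quot K A C \<rho> by(rule C)
 define \<tau> where "\<tau> b = \<rho> (psi b)" for b
 have \<tau>: "\<tau> (phi a) = \<rho> a" if a: "a:car A" for a
 proof -
  note p = psi[OF phi_closed[OF a]]
  have "psi (phi a)-.a:C.ker" using phi_eq_iff[OF p(1) a] p(2) k by blast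
  thus ?thesis using C.phi_eq_iff[OF p(1) a] by(simp add: \<tau>_def)
 qed
 have "fd_quot K B C \<tau>"
 proof (intro fd_quot.intro fd_quot_axioms.intro B.fd_alg_axioms C.B.fd_alg_axioms)
  have rep: "EX a:car A. x = phi a" if "x:car B" for x using psi[OF that] by metis
  show "\<tau>:ring_hom B C"
  proof (rule ring_hom_memI)
   show "\<tau> 1[B] = 1[C]" using \<tau>[of \<one>] by(simp add: phi_one C.phi_one)
   fix x assume "x:car B"
   then obtain a where a: "a:car A" "x = phi a" using rep by blast
   thus "\<tau> x:car C" using \<tau> by simp
   fix y assume "y:car B"
   then obtain b where b: "b:car A" "y = phi b" using rep by blast
   show "\<tau> (x **[B] y) = \<tau> x **[C] \<tau> y" "\<tau> (x +[B] y) = \<tau> x +[C] \<tau> y"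
    using \<tau>[of "a**b"] \<tau>[of "a+.b"] \<tau>[of a] \<tau>[of b] a b by(simp_all add: phi_mult phi_add C.phi_mult C.phi_add)
  qed
  show "\<tau> ` car B = car C" using C.surj \<tau> unfolding surj[symmetric] by(simp add: image_image)
  show "\<tau> (k \<odot>\<^bsub>B\<^esub> x) = k \<odot>\<^bsub>C\<^esub> \<tau> x" if k: "k:car K" and x: "x:car B" for k x
  proof -
   obtain a where a: "a:car A" "x = phi a" using rep[OF x] by blast
   thus ?thesis using \<tau>[of "k \<odot> a"] \<tau>[of a] k by(simp add: klin C.klin)
  qed
 qed
 thus ?thesis using \<tau> by blast
qed

end

section \<open>Descent through the quotients of a stratified algebra\<close>

lemma (in fd_alg) quot_fd_quot:
 assumes I: "ideal I A"
 shows "fd_quot K A (quot_algebra A I) (%a. I +> a)" "fd_quot.ker A (quot_algebra A I) (%a. I +> a) = I"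
proof -
 interpret I: ideal I A by(rule I)
 let ?B = "quot_algebra A I" and ?p = "%a. I +> a"
 have rep: "I +> x = I +> y" if "x:I +> y" "y:car A" for x y
  by(rule I.a_repr_independence'[symmetric]) (use that in auto)
 have surj: "?p ` car A = car ?B" by(auto simp: quot_algebra_def FactRing_def A_RCOSETS_def')
 note rh = I.rcos_ring_hom
 have hom: "?p:ring_hom A ?B"
 proof (rule ring_hom_memI)
  fix x y assume "x:car A" "y:car A"
  thus "?p (x**y) = ?p x **[?B] ?p y" "?p (x+.y) = ?p x +[?B] ?p y"
   using ring_hom_mult[OF rh] ring_hom_add[OF rh] by(simp_all only: quot_algebra_def ring.simps monoid.simps partial_object.simps)
 qed (use surj in \<open>auto simp: quot_algebra_def FactRing_def\<close>)
 have klin: "?p (k \<odot> x) = k \<odot>\<^bsub>?B\<^esub> ?p x" if k: "k:car K" and x: "x:car A" for k x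
 proof -
  have "I +> (k \<odot> y) = I +> (k \<odot> x)" if y: "y:I +> x" for y
  proof -
   obtain i where i: "i:I" "y = i+.x" using y by(auto simp: a_r_coset_def')
   have "k \<odot> i:I" by(rule vsA.subspaceD(4)[OF right_ideal_subspace[OF ideal_right_ideal[OF I]] k i(1)])
   moreover have "k \<odot> y = k \<odot> i+.k \<odot> x" using i k x I.a_Hcarr by(simp add: smult_r_distr)
   ultimately have "k \<odot> y:I +> (k \<odot> x)" by(auto simp: a_r_coset_def')
   thus ?thesis using rep k x by simp
  qed
  moreover have "x:I +> x" using x by(rule I.a_rcos_self)
  ultimately have "(\<Union>y\<in>I +> x. I +> (k \<odot> y)) = I +> (k \<odot> x)" by blast
  thus ?thesis unfolding quot_algebra_def module.simps by(rule sym)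
 qed
 have z: "0[?B] = I" by(simp add: quot_algebra_def FactRing_def)
 hence zero: "?p \<zero> = 0[?B]" using I.a_rcos_const[of \<zero>] by simp
 have "fd_algebra K ?B"
  by(rule image_fd_algebra[OF vsA.subspace_carrier _ _ _ _ surj ring_hom_add[OF hom] ring_hom_mult[OF hom] klin
   ring_hom_one[OF hom] zero]) auto
 then interpret B: fd_alg K ?B by(rule fd_algI)
 show q: "fd_quot K A ?B ?p" by(intro fd_quot.intro fd_quot_axioms.intro fd_alg_axioms B.fd_alg_axioms hom surj klin)
 interpret Q: fd_quot K A ?B ?p by(rule q)
 have "I +> a = I <-> a:I" if a: "a:car A" for a using I.a_rcos_const[of a] I.a_rcos_self[OF a] by blast
 moreover have "a:car A" if "a:I" for a using I.a_Hcarr[OF that] .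
 ultimately show "Q.ker = I" unfolding Q.ker_def z by blast
qed

text \<open>The descent starts at \<open>i = n\<close>, where the ideal is zero. In the step, the
  kernel of the map between successive quotients is the ideal generated by the last idempotent of
  the larger one.\<close>

lemma (in strat) quotients_stratified:
 assumes ps: "properly_stratified K A n e" and g: "gorenstein A" and i: "i <= n"
 shows "properly_stratified K (quot_algebra A (J i)) i (%j. J i +> e j) & gorenstein (quot_algebra A (J i))"
 using i
proof (induct rule: inc_induct)
 note Q = quot_fd_quot[OF J_ideal]
 case base
 interpret fd_quot K A "quot_algebra A (J n)" "%a. J n +> a" by(rule Q(1))
 interpret strat_quot K A "quot_algebra A (J n)" "%a. J n +> a" n e n "%j. J n +> e j"
  by unfold_locales (simp_all add: Q(2))
 show ?case using stratified_push[OF _ ps g] by blast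
next
 note Q = quot_fd_quot[OF J_ideal]
 case (step i)
 let ?B = "quot_algebra A (J (Suc i))" and ?C = "quot_algebra A (J i)"
 interpret P: fd_quot K A ?B "%a. J (Suc i) +> a" by(rule Q(1))
 interpret PS: strat_quot K A ?B "%a. J (Suc i) +> a" n e "Suc i" "%j. J (Suc i) +> e j"
  by unfold_locales (use step(2) in \<open>simp_all add: Q(2)\<close>)
 have "P.ker <= fd_quot.ker A ?C (%a. J i +> a)" unfolding Q(2) by(rule J_anti) simp
 then obtain \<tau> where \<tau>: "fd_quot K ?B ?C \<tau>" "ALL a:car A. \<tau> (J (Suc i) +> a) = J i +> a"
  using P.fd_quot_factor[OF Q(1)] by blast
 interpret T: fd_quot K ?B ?C \<tau> by(rule \<tau>(1))
 have "T.ker = PS.T.J i"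
 proof (rule Set.set_eqI)
  fix b
  have "b:T.ker <-> b:PS.T.J i" if b: "b:car ?B"
  proof -
   obtain a where a: "a:car A" "b = J (Suc i) +> a" using b unfolding P.surj[symmetric] by blast
   have "b:T.ker <-> a:fd_quot.ker A ?C (%a. J i +> a)"
    using a \<tau>(2) b unfolding T.ker_def fd_quot.ker_def[OF Q(1)] by simp
   thus ?thesis unfolding Q(2) a(2) using PS.J_push[of i a] a(1) by simp
  qed
  thus "b:T.ker <-> b:PS.T.J i"
   using T.ker_props(1) P.B.right_idealD(1)[OF P.B.ideal_right_ideal[OF PS.T.J_ideal[of i]]] by blast
 qed
 then interpret TS: strat_quot K ?B ?C \<tau> "Suc i" "%j. J (Suc i) +> e j" i "%j. J i +> e j"
  by unfold_locales (use step(2) \<tau>(2) idem(1) in auto)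
 show ?case using TS.stratified_push step(3) by blast
qed

theorem theorem2p5:
  fixes K :: "'k ring" and A :: "('k, 'a) module" and e :: "nat \<Rightarrow> 'a" and n :: nat
  assumes "properly_stratified K A n e"
    and "gorenstein A"
  shows "\<forall>i\<in>{1..n}.
    frobenius_algebra K (end_algebra A (standard_mod A n e i)) \<and>
    frobenius_algebra K (end_algebra A (costandard_mod K A n e i)) \<and>
    (let I = strat_ideal A n e i; B = quot_algebra A I
     in properly_stratified K B i (\<lambda>j. I +>\<^bsub>A\<^esub> e j) \<and> gorenstein B)"
proof
 fix i assume i: "i:{1..n}"
 interpret fd_alg K A using assms(1) by(intro fd_algI) (simp add: properly_stratified_def)
 interpret strat K A n e by unfold_locales (use assms(1) in \<open>simp add: properly_stratified_def\<close>)
 interpret E: corner_alg K A "e i" by(rule idem_corner[OF i])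
 interpret L: corner_alg K "op_algebra A" "e i" by(rule E.op_corner_alg)
 let ?B = "quot_algebra A (J i)" and ?e = "%j. J i +>\<^bsub>A\<^esub> e j"
 note Q = quot_fd_quot[OF J_ideal[of i]]
 interpret P: fd_quot K A ?B "%a. J i +>\<^bsub>A\<^esub> a" by(rule Q(1))
 have B: "properly_stratified K ?B i ?e" "gorenstein ?B"
  using quotients_stratified[OF assms] i by auto
 interpret T: strat K ?B i ?e by unfold_locales (use B(1) in \<open>simp add: properly_stratified_def\<close>)
 \<comment> \<open>In the quotient \<open>?B\<close> the index \<open>i\<close> is the last one, so
   its corner is the one treated by \<open>last_corner_frobenius\<close>.\<close>
 obtain l where l: "corner_alg.frobenius_form K ?B (?e i) l" using T.last_corner_frobenius[OF B] i by auto
 have V: "corner_alg K ?B (?e i)" by(rule T.idem_corner) (use i in simp)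
 have kI: "ideal P.ker A" unfolding Q(2) by(rule J_ideal)
 obtain v where v: "cyclic_gen (standard_mod A n e i) v {a:car A. e i **[A] a:P.ker}"
  using standard_gen(2)[OF i] unfolding stand_def Q(2) by blast
 have "frobenius_algebra K (end_algebra A (standard_mod A n e i))"
  by(rule P.frobenius_end[OF E.corner_alg_axioms V l standard_gen(1)[OF i] v kI])
 moreover have "frobenius_algebra K (end_algebra A (costandard_mod K A n e i))"
 proof -
  let ?M = "standard_mod (op_algebra A) n e i"
  have id: "ideal I (op_algebra A) <-> ideal I A" for I
   using op_ideal[OF A.ring_axioms, of I] op_ideal[OF L.A.ring_axioms, of I] by auto
  \<comment> \<open>Sums and two-sided ideals are the same in the opposite algebra.\<close>
  have "strat_ideal (op_algebra A) n e i = J i"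
  proof -
   have "finsum (op_algebra A) f S = finsum A f S" for f :: "nat => 'a" and S by(simp add: finsum_def op_algebra_def)
   thus ?thesis by(simp add: strat_ideal_def genideal_def id)
  qed
  hence eq: "?M = quot_mod (L.pmod (e i)) ((%a. e i **[op_algebra A] a) ` J i)"
   by(simp add: standard_mod_def proj_mod_eq L.pmod_def)
  have oi: "ideal (J i) (op_algebra A)" using J_ideal id by blast
  have fg: "fg_module (op_algebra A) ?M" unfolding eq by(rule L.standard_quot(2)[OF oi])
  obtain w where "L.cyclic_gen ?M w {a:car (op_algebra A). e i **[op_algebra A] a:J i}"
   unfolding eq using L.standard_quot(3)[OF oi] by blast
  hence w: "L.cyclic_gen ?M w {a:car A. a **[A] e i:P.ker}" by(simp add: Q(2))
  show ?thesis unfolding costandard_mod_def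
   by(rule P.frobenius_end_dual[OF E.corner_alg_axioms V l fg w kI])
 qed
 ultimately show "frobenius_algebra K (end_algebra A (standard_mod A n e i)) &
  frobenius_algebra K (end_algebra A (costandard_mod K A n e i)) &
  (let I = strat_ideal A n e i; B = quot_algebra A I
   in properly_stratified K B i (%j. I +>\<^bsub>A\<^esub> e j) & gorenstein B)"
  using B unfolding Let_def by blast
qed

end
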